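(* Let $d\ge 1$ and let $\mathcal{N}\subseteq \mathbb{S}^{d-1}\times\Lambda$ be an open nonempty neighbourhood of some fixed pair $(\omega,\lambda)$ with $\omega\in\mathbb{S}^{d-1}$, $\lambda\in\Lambda$. Let $f:\mathbb{Z}^d\to\mathbb{C}$ have compact (i.e. finite) support. Then the far-field amplitude $a^-=a^-(\omega,\lambda)$ of $f$, given on $\mathcal{N}$, uniquely determines $f$; likewise, the far-field amplitude $a^+=a^+(\omega,\lambda)$ of $f$, given on $\mathcal{N}$, uniquely determines $f$. That is, for each choice of sign $\pm$: if $f_1,f_2:\mathbb{Z}^d\to\mathbb{C}$ are compactly supported and their far-field amplitudes satisfy $a^\pm_1=a^\pm_2$ on $\mathcal{N}$, then $f_1=f_2$.
   Context: Discrete Laplacian: $\Delta\psi(x)=\sum_{x'\in\mathbb{Z}^d,\,|x'-x|=1}\psi(x')$, $x\in\mathbb{Z}^d$. The discrete Helmholtz equation is $\Delta\psi-\lambda\psi=f$ on $\mathbb{Z}^d$. Let $\Lambda=\{\zeta\in\mathbb{R}:\ 2d-4<|\zeta|<2d\}$, $T^d=\mathbb{R}^d/2\pi\mathbb{Z}^d$, $\phi(k)=2\sum_{i=1}^d\cos k_i$, and $\Gamma(\lambda)=\{k\in T^d:\phi(k)=\lambda\}$. For $\lambda\in\Lambda$ and $\omega\in\mathbb{S}^{d-1}$, $\kappa(\omega,\lambda)$ denotes the unique point of $\Gamma(\lambda)$ with $\nabla\phi(\kappa)/|\nabla\phi(\kappa)|=\omega$, and $\mu(\omega,\lambda)=\kappa(\omega,\lambda)\cdot\omega$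 (for $x\in\mathbb{Z}^d\setminus\{0\}$ and $\omega=x/|x|$ one has $e^{\pm i\mu(\omega,\lambda)|x|}=e^{\pm i\kappa(\omega,\lambda)\cdot x}$, which is well defined for $\kappa\in T^d$). For compactly supported $f$ and $\lambda\in\Lambda$ let $\psi^\pm(x)=\lim_{\nu\to\lambda\pm i0}\big((\Delta-\nu)^{-1}f\big)(x)$, $x\in\mathbb{Z}^d$, where $(\Delta-\nu)^{-1}:\ell^2(\mathbb{Z}^d)\to\ell^2(\mathbb{Z}^d)$ for $\operatorname{Im}\nu\ne0$. The far-field amplitudes $a^\pm(\omega,\lambda)$ of $f$ are the functions, continuous (indeed smooth) in $\omega\in\mathbb{S}^{d-1}$, determined by the asymptotic formula $$\psi^\pm(x)=\frac{e^{\pm i\mu(\omega,\lambda)|x|}}{|x|^{(d-1)/2}}\,a^\pm(\omega,\lambda)+O\big(|x|^{-(d+1)/2}\big),\qquad \omega=x/|x|,\ |x|\to\infty,\ x\in\mathbb{Z}^d,$$ with remainder uniform in $\omega$. (The directions $x/|x|$, $x\in\mathbb{Z}^d\setminus\{0\}$, are dense in $\mathbb{S}^{d-1}$, and $a^\pm$ is extended to all of $\mathbb{S}^{d-1}$ by continuity.) *)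

theory Defs
  imports "HOL-Analysis.Analysis" "HOL-Library.Landau_Symbols"
begin

text \<open>The lattice \<open>\<int>\<^sup>d\<close> is the type \<open>int ^ 'n\<close> with \<open>d = CARD('n) \<ge> 1\<close>; as \<open>int ^ 'n\<close> carries no
  norm, Euclidean lengths are taken after embedding it into \<open>real ^ 'n\<close>.\<close>

definition lat :: "int ^ 'n \<Rightarrow> real ^ 'n" where
  "lat x = (\<chi> i. real_of_int (x $ i))"

definition discrete_laplacian :: "(int ^ 'n \<Rightarrow> complex) \<Rightarrow> int ^ 'n \<Rightarrow> complex" where
  "discrete_laplacian \<psi> x = (\<Sum>x' | norm (lat (x' - x)) = 1. \<psi> x')"

definition ell2 :: "(int ^ 'n \<Rightarrow> complex) set" where
  "ell2 = {\<psi>. (\<lambda>x. (norm (\<psi> x))\<^sup>2) summable_on UNIV}"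

definition resolvent :: "complex \<Rightarrow> (int ^ 'n \<Rightarrow> complex) \<Rightarrow> int ^ 'n \<Rightarrow> complex" where
  "resolvent \<nu> = inv_into ell2 (\<lambda>\<psi> x. discrete_laplacian \<psi> x - \<nu> * \<psi> x)"

text \<open>In the following, the sign \<open>\<plusminus>\<close> is a parameter \<open>s\<close> with value \<open>1\<close> or \<open>-1\<close>, and
  \<open>\<nu> \<rightarrow> \<lambda> \<plusminus> i0\<close> means \<open>\<nu> = \<lambda> \<plusminus> i\<epsilon>\<close> with \<open>\<epsilon>\<close> tending to \<open>0\<close> from above.\<close>

definition limit_solution ::
  "real \<Rightarrow> real \<Rightarrow> (int ^ 'n \<Rightarrow> complex) \<Rightarrow> int ^ 'n \<Rightarrow> complex" where
  "limit_solution s lam f x = Lim (at_right 0) (\<lambda>\<epsilon>. resolvent (Complex lam (s * \<epsilon>)) f x)"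

definition Lambda :: "'n::finite itself \<Rightarrow> real set" where
  "Lambda _ = {\<zeta>. 2 * real CARD('n) - 4 < \<bar>\<zeta>\<bar> \<and> \<bar>\<zeta>\<bar> < 2 * real CARD('n)}"

definition phi :: "real ^ 'n \<Rightarrow> real" where
  "phi k = 2 * (\<Sum>i\<in>UNIV. cos (k $ i))"

definition gradient :: "(real ^ 'n \<Rightarrow> real) \<Rightarrow> real ^ 'n \<Rightarrow> real ^ 'n" where
  "gradient g k = (THE D. GDERIV g k :> D)"

text \<open>The torus \<open>\<real>\<^sup>d / 2\<pi>\<int>\<^sup>d\<close> is represented by a fundamental domain. Another choice of
  representatives changes \<open>\<kappa>\<close> by an element of \<open>2\<pi>\<int>\<^sup>d\<close> and \<open>\<mu>\<close> accordingly, but not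
  \<open>exp (\<plusminus> i \<mu> |x|)\<close> for \<open>x \<in> \<int>\<^sup>d - {0}\<close> with \<open>x / |x| = \<omega>\<close>.\<close>

definition torus :: "(real ^ 'n) set" where
  "torus = {k. \<forall>i. - pi < k $ i \<and> k $ i \<le> pi}"

definition level_surface :: "real \<Rightarrow> (real ^ 'n) set" where
  "level_surface lam = {k \<in> torus. phi k = lam}"

definition kappa :: "real ^ 'n \<Rightarrow> real \<Rightarrow> real ^ 'n" where
  "kappa \<omega> lam =
    (THE k. k \<in> level_surface lam \<and> gradient phi k /\<^sub>R norm (gradient phi k) = \<omega>)"

definition mu :: "real ^ 'n \<Rightarrow> real \<Rightarrow> real" where
  "mu \<omega> lam = kappa \<omega> lam \<bullet> \<omega>"

text \<open>The amplitude is specified by its properties: \<open>far_field_amplitude s f a\<close> fixes the values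
  \<open>a \<omega> lam\<close> for \<open>\<omega>\<close> in the unit sphere and \<open>lam\<close> in \<open>\<Lambda>\<close>, and no others. Since
  \<open>\<omega> = x / |x|\<close> is a function of \<open>x\<close>, a bound in \<open>x\<close> is automatically uniform in \<open>\<omega>\<close>.\<close>

definition far_field_amplitude ::
  "real \<Rightarrow> (int ^ 'n \<Rightarrow> complex) \<Rightarrow> (real ^ 'n \<Rightarrow> real \<Rightarrow> complex) \<Rightarrow> bool" where
  "far_field_amplitude s f a \<longleftrightarrow>
    (\<forall>lam \<in> Lambda TYPE('n).
      continuous_on (sphere 0 1) (\<lambda>\<omega>. a \<omega> lam) \<and>
      (\<lambda>x. norm (limit_solution s lam f x -
          (let r = norm (lat x); \<omega> = lat x /\<^sub>R r in
            exp (\<i> * complex_of_real (s * mu \<omega> lam * r)) /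
              complex_of_real (r powr ((real CARD('n) - 1) / 2)) * a \<omega> lam)))
        \<in> O[filtercomap lat at_infinity](\<lambda>x. norm (lat x) powr (- (real CARD('n) + 1) / 2)))"

end

theory Submission
  imports Defs "HOL-Probability.Probability"
begin

text \<open>
  Let \<open>f\<close> be the difference of two sources with equal amplitudes on \<open>N\<close>, and take the sign \<open>+\<close>; the other sign follows by
  complex conjugation. The solution \<open>\<psi>\<close> with source \<open>f\<close> decays like \<open>|x|\<^bsup>-(d+1)/2\<^esup>\<close> in the
  directions covered by \<open>N\<close> and like \<open>|x|\<^bsup>-(d-1)/2\<^esup>\<close> in all others. A stationary phase argument would
  identify the amplitude with a nonvanishing multiple of the Fourier transform \<open>fhat f\<close> at the point of the level surface
  \<open>Phi = \<lambda>\<close> whose normal is \<open>\<omega>\<close>. The proof here obtains the one consequence that matters, that \<open>fhat f\<close>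
  vanishes at these points, by a time-dependent argument that uses only non-stationary phase.

  Consider a wave packet \<open>e\<^bsup>-\<i>t\<Delta>\<^esup> g\<close> whose initial Fourier transform is a window around a point \<open>\<kappa>\<close> of the torus. It travels
  with velocity \<open>\<nabla>Phi \<kappa>\<close>. If the direction of this velocity is covered by \<open>N\<close>, the packet enters a cone in which \<open>\<psi>\<close>
  decays one power better than a wave of finite energy flux, and the pairing of \<open>\<psi>\<close> with the packet tends to \<open>0\<close> as
  \<open>t \<rightarrow> \<infinity>\<close> (\<open>outgoing_pairing_bound\<close>). On the Fourier side, this pairing is the integral
  of \<open>fhat f * window * cis (t * (Phi - \<lambda>)) / (Phi - \<lambda> - \<i>0)\<close>, up to a phase. The same integral with
  \<open>+ \<i>0\<close> tends to \<open>0\<close> as \<open>t \<rightarrow> \<infinity>\<close> for any source. The difference of the two is the jump of the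
  resolvent, which is concentrated on the level surface and hence does not depend on \<open>t\<close>; so it vanishes
  (\<open>resolvent_pairing_jump_tendsto_0\<close>). Integration over \<open>\<lambda>\<close>, Stone's formula, gives \<open>\<integral> fhat f * window = 0\<close>
  (\<open>spectral_uniqueness\<close>). Thus \<open>fhat f\<close> vanishes on an open subset of the torus (\<open>fhat_vanishes\<close>), which exists because
  every direction is a direction of propagation on every level in \<open>\<Lambda>\<close> (\<open>velocity_surjective\<close>). A trigonometric polynomial that
  vanishes on an open set is \<open>0\<close> (\<open>fhat_injective\<close>).

  The argument needs the boundary values of the resolvent with a rate of convergence that is
  summable against a packet. This is the limiting absorption principle (\<open>limiting_absorption\<close>), where \<open>\<lambda> \<in> \<Lambda>\<close> enters: no
  critical value of \<open>Phi\<close> lies in \<open>\<Lambda>\<close>, and so one integration by parts along \<open>\<nabla>Phi\<close> bounds the derivative of the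
  kernel in the spectral parameter.
\<close>

section \<open>Fourier analysis on the torus\<close>

text \<open>Fourier analysis takes place on the torus \<open>[-\<pi>, \<pi>]\<^sup>d\<close> with the uniform probability measure, built
  as a product so that integrals of products factor. A quasimomentum is a function \<open>'n \<Rightarrow> real\<close>; this
  makes \<open>k(j := \<theta>)\<close> available for varying a single coordinate.\<close>

definition circ :: "real measure" where
  "circ = uniform_measure lborel {- pi..pi}"

definition tor :: "('n::finite \<Rightarrow> real) measure" where
  "tor = PiM UNIV (\<lambda>_. circ)"

definition chi :: "int ^ 'n \<Rightarrow> ('n::finite \<Rightarrow> real) \<Rightarrow> complex" where
  "chi x k = (\<Prod>j\<in>UNIV. cis (real_of_int (x $ j) * k j))"

definition Phi :: "('n::finite \<Rightarrow> real) \<Rightarrow> real" where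
  "Phi k = 2 * (\<Sum>j\<in>UNIV. cos (k j))"

definition fhat :: "(int ^ 'n \<Rightarrow> complex) \<Rightarrow> ('n::finite \<Rightarrow> real) \<Rightarrow> complex" where
  "fhat f k = (\<Sum>y | f y \<noteq> 0. f y * cnj (chi y k))"

text \<open>The resolvent kernel: \<open>\<Delta>\<close> acts on the character \<open>x \<mapsto> chi x k\<close> as multiplication by \<open>Phi k\<close>.\<close>

definition green :: "complex \<Rightarrow> int ^ 'n::finite \<Rightarrow> complex" where
  "green z x = (\<integral>k. chi x k / (complex_of_real (Phi k) - z) \<partial>tor)"

lemma prob_space_circ: "prob_space circ"
  unfolding circ_def by (rule prob_space_uniform_measure) auto

lemma sets_circ [simp, measurable_cong]: "sets circ = sets borel"
  by (simp add: circ_def)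

lemma space_circ [simp]: "space circ = UNIV"
  by (simp add: circ_def)

interpretation circ: prob_space circ
  by (rule prob_space_circ)

interpretation tor: prob_space tor
  unfolding tor_def by (rule prob_space_PiM) (rule prob_space_circ)

lemma prob_circ_UNIV [simp]: "measure circ UNIV = 1"
  using circ.prob_space by simp

interpretation circs: product_sigma_finite "\<lambda>_. circ"
  by standard

lemma space_tor [simp]: "space tor = UNIV"
  by (simp add: tor_def space_PiM PiE_def)

lemma prob_tor_UNIV [simp]: "measure tor UNIV = 1"
  using tor.prob_space by simp

lemma sets_tor [measurable_cong]: "sets tor = sets (PiM UNIV (\<lambda>_. borel))"
  unfolding tor_def by (rule sets_PiM_cong) auto

lemma measurable_coord [measurable]: "(\<lambda>k. k j) \<in> borel_measurable tor"
proof -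
  have "(\<lambda>k. k j) \<in> measurable tor circ"
    unfolding tor_def by (rule measurable_component_singleton) simp
  then show ?thesis
    by (simp only: measurable_cong_sets[OF refl sets_circ])
qed

lemma borel_measurable_circ [simp]: "borel_measurable circ = borel_measurable borel"
  by (rule measurable_cong_sets) auto

lemma measurable_cnj [measurable]: "cnj \<in> borel_measurable borel"
  by (intro borel_measurable_continuous_onI continuous_intros)

lemma measurable_cis [measurable]: "cis \<in> borel_measurable borel"
  by (intro borel_measurable_continuous_onI continuous_intros)

lemma measurable_chi [measurable]: "chi x \<in> borel_measurable tor"
  unfolding chi_def[abs_def] by measurable

lemma measurable_Phi [measurable]: "Phi \<in> borel_measurable tor"
  unfolding Phi_def[abs_def] by measurable

lemma measurable_fhat [measurable]: "fhat f \<in> borel_measurable tor"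
proof -
  have [measurable]: "(\<lambda>k. cnj (chi y k)) \<in> borel_measurable tor" for y :: "int ^ 'n"
    by (rule measurable_compose[OF measurable_chi measurable_cnj])
  show ?thesis unfolding fhat_def[abs_def] by measurable
qed

lemma norm_fhat_le: "norm (fhat f k) \<le> (\<Sum>y | f y \<noteq> 0. norm (f y))"
  unfolding fhat_def by (rule order_trans[OF norm_sum]) (simp add: chi_def norm_mult prod_norm[symmetric])

lemma prod_cis: "(\<Prod>j\<in>UNIV. cis (c j)) = cis (\<Sum>j\<in>(UNIV :: 'n::finite set). c j)"
proof -
  have "(\<Prod>j\<in>I. cis (c j)) = cis (\<Sum>j\<in>I. c j)" if "finite I" for I
    using that by induction (auto simp: cis_mult)
  then show ?thesis by simp
qed

lemma integral_circ:
  fixes f :: "real \<Rightarrow> 'b::{banach, second_countable_topology}"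
  assumes [measurable]: "f \<in> borel_measurable borel"
  shows "(\<integral>k. f k \<partial>circ) = (1 / (2 * pi)) *\<^sub>R (LBINT k:{- pi..pi}. f k)"
proof -
  have eq: "circ = density lborel (\<lambda>x. ennreal (indicator {- pi..pi} x / (2 * pi)))"
    unfolding circ_def uniform_measure_def
    by (rule density_cong)
       (auto simp: indicator_def ennreal_divide_numeral divide_ennreal[symmetric] simp flip: ennreal_1 split: if_splits)
  have "(\<integral>k. f k \<partial>circ) = (\<integral>k. (indicator {- pi..pi} k / (2 * pi)) *\<^sub>R f k \<partial>lborel)"
    unfolding eq by (rule integral_density) auto
  also have "\<dots> = (\<integral>k. (1 / (2 * pi)) *\<^sub>R (indicator {- pi..pi} k *\<^sub>R f k) \<partial>lborel)"
    by (rule Bochner_Integration.integral_cong) auto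
  finally show ?thesis
    unfolding set_lebesgue_integral_def by (simp only: integral_scaleR_right)
qed

lemma integral_circ_FTC:
  fixes F f :: "real \<Rightarrow> 'b::euclidean_space"
  assumes "f \<in> borel_measurable borel"
    and "\<And>k. - pi \<le> k \<Longrightarrow> k \<le> pi \<Longrightarrow> (F has_vector_derivative f k) (at k within {- pi..pi})"
    and "continuous_on {- pi..pi} f"
  shows "(\<integral>k. f k \<partial>circ) = (1 / (2 * pi)) *\<^sub>R (F pi - F (- pi))"
  using integral_FTC_Icc[of "-pi" pi F f] assms
  by (simp add: integral_circ set_lebesgue_integral_def)

lemma AE_circ: "AE k in circ. - pi < k \<and> k < pi"
proof -
  have "AE k in lborel. k \<noteq> - pi \<and> k \<noteq> (pi::real)"
    by (simp add: AE_lborel_singleton)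
  then have "AE k in lborel. k \<in> {- pi..pi} \<longrightarrow> - pi < k \<and> k < pi"
    by eventually_elim auto
  then show ?thesis
    unfolding circ_def by (intro AE_uniform_measureI) auto
qed

lemma AE_tor: "AE k in (tor :: ('n::finite \<Rightarrow> real) measure). \<forall>j. - pi < k j \<and> k j < pi"
proof -
  have "AE k in (tor :: ('n \<Rightarrow> real) measure). - pi < k j \<and> k j < pi" for j
    unfolding tor_def by (rule AE_PiM_component[OF prob_space_circ _ AE_circ]) auto
  then show ?thesis
    by (simp add: AE_all_countable)
qed

lemma integrable_tor_bounded:
  fixes F :: "('n::finite \<Rightarrow> real) \<Rightarrow> 'b::{banach, second_countable_topology}"
  assumes "F \<in> borel_measurable tor" "\<And>k. norm (F k) \<le> B"
  shows "integrable tor F"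
  using assms by (intro tor.integrable_const_bound[where B=B]) auto

lemma norm_integral_tor_le:
  fixes F :: "('n::finite \<Rightarrow> real) \<Rightarrow> 'b::{banach, second_countable_topology}"
  assumes "F \<in> borel_measurable tor" "\<And>k. norm (F k) \<le> B"
  shows "norm (\<integral>k. F k \<partial>tor) \<le> B"
proof -
  have "B \<ge> 0" using order_trans[OF norm_ge_zero assms(2)] .
  have "norm (\<integral>k. F k \<partial>tor) \<le> (\<integral>k. norm (F k) \<partial>tor)"
    by simp
  also have "\<dots> \<le> (\<integral>k. B \<partial>(tor :: ('n \<Rightarrow> real) measure))"
    by (intro integral_mono integrable_norm integrable_tor_bounded[OF assms]) (use assms in auto)
  finally show ?thesis by simp
qed

lemma integral_tor_prod:
  fixes h :: "'n::finite \<Rightarrow> real \<Rightarrow> complex"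
  assumes "\<And>j. integrable circ (h j)"
  shows "(\<integral>k. (\<Prod>j\<in>UNIV. h j (k j)) \<partial>tor) = (\<Prod>j\<in>UNIV. \<integral>k. h j k \<partial>circ)"
  unfolding tor_def using assms by (intro circs.product_integral_prod) auto

lemma integral_tor_coordinate:
  fixes F :: "('n::finite \<Rightarrow> real) \<Rightarrow> 'b::{banach, second_countable_topology}"
  assumes "integrable tor F"
  shows "(\<integral>k. F k \<partial>tor) = (\<integral>k. (\<integral>y. F (k(j := y)) \<partial>circ) \<partial>PiM (UNIV - {j}) (\<lambda>_. circ))"
  using circs.product_integral_insert[of "UNIV - {j}" j F] assms
  by (simp add: tor_def insert_absorb)

lemma norm_chi [simp]: "norm (chi x k) = 1"
  by (simp add: chi_def prod_norm[symmetric])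

lemma chi_add: "chi (x + y) k = chi x k * chi y k"
  by (simp add: chi_def cis_mult prod.distrib[symmetric] algebra_simps)

lemma chi_minus: "chi (- x) k = cnj (chi x k)"
  by (simp add: chi_def cis_cnj)

lemma chi_diff: "chi (x - y) k = chi x k * cnj (chi y k)"
  using chi_add[of x "- y" k] by (simp add: chi_minus)

lemma integral_circ_cis: "(\<integral>k. cis (real_of_int n * k) \<partial>circ) = (if n = 0 then 1 else 0)"
proof (cases "n = 0")
  case False
  have "(\<integral>k. cis (real_of_int n * k) \<partial>circ) =
      (1 / (2 * pi)) *\<^sub>R (cis (n * pi) / (\<i> * n) - cis (n * (- pi)) / (\<i> * n))"
    using False
    by (intro integral_circ_FTC[where F="\<lambda>k. cis (n * k) / (\<i> * n)"])
       (auto intro!: derivative_eq_intros continuous_intros ext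
             simp: has_vector_derivative_def field_simps scaleR_conv_of_real)
  also have "cis (n * (- pi)) = cis (n * pi)"
    by (auto simp: complex_eq_iff sin_zero_iff_int2)
  finally show ?thesis using False by simp
qed simp

lemma integrable_circ_bounded:
  fixes F :: "real \<Rightarrow> 'b::{banach, second_countable_topology}"
  assumes "F \<in> borel_measurable borel" "\<And>k. norm (F k) \<le> B"
  shows "integrable circ F"
  using assms by (intro circ.integrable_const_bound[where B=B]) auto

lemma integral_chi: "(\<integral>k. chi x k \<partial>tor) = (if x = 0 then 1 else 0)"
proof -
  have "(\<integral>k. chi x k \<partial>tor) = (\<Prod>j\<in>UNIV. \<integral>k. cis (real_of_int (x $ j) * k) \<partial>circ)"
    unfolding chi_def by (rule integral_tor_prod, rule integrable_circ_bounded[where B=1]) auto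
  then show ?thesis
    by (auto simp: integral_circ_cis vec_eq_iff)
qed

lemma integral_cnj_bochner:
  fixes f :: "'a \<Rightarrow> complex"
  shows "(\<integral>x. cnj (f x) \<partial>M) = cnj (\<integral>x. f x \<partial>M)"
  by (rule Bochner_Integration.integral_bounded_linear'[OF bounded_linear_cnj bounded_linear_cnj]) auto

lemma integrable_mult_bounded:
  fixes u v :: "'a \<Rightarrow> complex"
  assumes "finite_measure M" "u \<in> borel_measurable M" "v \<in> borel_measurable M"
    "\<And>k. norm (u k) \<le> BU" "\<And>k. norm (v k) \<le> BV"
  shows "integrable M (\<lambda>k. u k * v k)"
  using assms(2-)
  by (intro finite_measure.integrable_const_bound[OF assms(1), where B="BU * BV"])
     (auto simp: norm_mult intro!: mult_mono order_trans[OF norm_ge_zero])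

text \<open>Bounded functions are square integrable on a probability space, and the distance of \<open>F\<close> to its
  projection is nonnegative. Summability of Fourier coefficients enters below only through this
  bound for finite sums.\<close>

lemma bessel_inequality:
  fixes F :: "'a \<Rightarrow> complex" and e :: "'i \<Rightarrow> 'a \<Rightarrow> complex"
  assumes "prob_space M" "finite S"
    and F[measurable]: "F \<in> borel_measurable M" and FB: "\<And>k. norm (F k) \<le> B"
    and e[measurable]: "\<And>i. e i \<in> borel_measurable M" and eB: "\<And>i k. norm (e i k) \<le> 1"
    and ortho: "\<And>i j. (\<integral>k. e i k * cnj (e j k) \<partial>M) = (if i = j then 1 else 0)"
  shows "(\<Sum>i\<in>S. (norm (\<integral>k. F k * e i k \<partial>M))\<^sup>2) \<le> B\<^sup>2"
proof -
  interpret prob_space M by fact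
  have B0: "B \<ge> 0" using order_trans[OF norm_ge_zero FB] .
  define c where "c i = (\<integral>k. F k * e i k \<partial>M)" for i
  define G where "G k = (\<Sum>i\<in>S. c i * cnj (e i k))" for k
  define CC where "CC = (\<Sum>i\<in>S. norm (c i))"
  have [measurable]: "(\<lambda>k. cnj (e i k)) \<in> borel_measurable M" for i
    by (rule measurable_compose[OF e measurable_cnj])
  have [measurable]: "(\<lambda>k. cnj (F k)) \<in> borel_measurable M"
    by (rule measurable_compose[OF F measurable_cnj])
  have [measurable]: "G \<in> borel_measurable M" unfolding G_def[abs_def] by measurable
  have [measurable]: "(\<lambda>k. cnj (G k)) \<in> borel_measurable M"
    by (rule measurable_compose[OF _ measurable_cnj]) measurable
  have GB: "norm (G k) \<le> CC" for k
    unfolding G_def CC_def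
    by (rule order_trans[OF norm_sum] sum_mono)+ (auto simp: norm_mult intro!: mult_left_le eB)
  have CC0: "CC \<ge> 0" unfolding CC_def by (simp add: sum_nonneg)
  note integr = integrable_mult_bounded[OF finite_measure_axioms]
  have FG: "(\<integral>k. F k * cnj (G k) \<partial>M) = (\<Sum>i\<in>S. (norm (c i))\<^sup>2)"
  proof -
    have "(\<integral>k. F k * cnj (G k) \<partial>M) = (\<integral>k. (\<Sum>i\<in>S. cnj (c i) * (F k * e i k)) \<partial>M)"
      by (simp add: G_def sum_distrib_left algebra_simps)
    also have "\<dots> = (\<Sum>i\<in>S. cnj (c i) * c i)"
      unfolding c_def
      by (subst Bochner_Integration.integral_sum) (auto intro!: integrable_mult_right integr[OF _ _ FB eB])
    finally show ?thesis by (simp add: complex_norm_square mult.commute del: of_real_power)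
  qed
  have GF: "(\<integral>k. G k * cnj (F k) \<partial>M) = (\<Sum>i\<in>S. (norm (c i))\<^sup>2)"
  proof -
    have "(\<integral>k. G k * cnj (F k) \<partial>M) = (\<integral>k. cnj (F k * cnj (G k)) \<partial>M)" by (simp add: mult.commute)
    also have "\<dots> = cnj (\<integral>k. F k * cnj (G k) \<partial>M)" by (rule integral_cnj_bochner)
    finally show ?thesis by (simp only: FG) simp
  qed
  have iee: "integrable M (\<lambda>k. e i k * cnj (e j k))" for i j
    by (rule integr[where BU=1 and BV=1]) (use eB in auto)
  have GG: "(\<integral>k. G k * cnj (G k) \<partial>M) = (\<Sum>i\<in>S. (norm (c i))\<^sup>2)"
  proof -
    have "(\<integral>k. G k * cnj (G k) \<partial>M) =
        (\<integral>k. (\<Sum>i\<in>S. \<Sum>j\<in>S. c j * cnj (c i) * (e i k * cnj (e j k))) \<partial>M)"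
      by (simp add: G_def sum_distrib_left sum_distrib_right algebra_simps)
    also have "\<dots> = (\<Sum>i\<in>S. \<Sum>j\<in>S. c j * cnj (c i) * (if i = j then 1 else 0))"
      by (simp add: Bochner_Integration.integral_sum Bochner_Integration.integrable_sum iee ortho)
    also have "\<dots> = (\<Sum>i\<in>S. cnj (c i) * c i)"
      using \<open>finite S\<close> by (simp add: if_distrib sum.delta mult.commute cong: if_cong)
    finally show ?thesis by (simp add: complex_norm_square mult.commute del: of_real_power)
  qed
  have iFF: "integrable M (\<lambda>k. F k * cnj (F k))" by (rule integr[where BU=B and BV=B]) (use FB in auto)
  have iFG: "integrable M (\<lambda>k. F k * cnj (G k))" by (rule integr[where BU=B and BV=CC]) (use FB GB in auto)
  have iGF: "integrable M (\<lambda>k. G k * cnj (F k))" by (rule integr[where BU=CC and BV=B]) (use FB GB in auto)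
  have iGG: "integrable M (\<lambda>k. G k * cnj (G k))" by (rule integr[where BU=CC and BV=CC]) (use FB GB in auto)
  have "(\<integral>k. F k * cnj (F k) - (F k - G k) * cnj (F k - G k) \<partial>M) =
      (\<integral>k. F k * cnj (G k) + G k * cnj (F k) - G k * cnj (G k) \<partial>M)"
    by (simp add: algebra_simps)
  also have "\<dots> = (\<Sum>i\<in>S. (norm (c i))\<^sup>2)"
    using iFG iGF iGG by (simp add: FG GF GG)
  finally have "(\<integral>k. F k * cnj (F k) - (F k - G k) * cnj (F k - G k) \<partial>M) = complex_of_real (\<Sum>i\<in>S. (norm (c i))\<^sup>2)" by simp
  moreover have "(\<integral>k. F k * cnj (F k) - (F k - G k) * cnj (F k - G k) \<partial>M) =
     (\<integral>k. complex_of_real ((norm (F k))\<^sup>2 - (norm (F k - G k))\<^sup>2) \<partial>M)"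
    by (simp only: complex_norm_square of_real_diff)
  ultimately have "(\<Sum>i\<in>S. (norm (c i))\<^sup>2) = (\<integral>k. (norm (F k))\<^sup>2 - (norm (F k - G k))\<^sup>2 \<partial>M)"
    by (simp only: integral_complex_of_real of_real_eq_iff)
  also have "\<dots> \<le> (\<integral>k. B\<^sup>2 \<partial>M)"
  proof (rule integral_mono)
    have "norm ((norm (F k))\<^sup>2 - (norm (F k - G k))\<^sup>2) \<le> B\<^sup>2 + (B + CC)\<^sup>2" for k
    proof -
      have "(norm (F k))\<^sup>2 \<le> B\<^sup>2" "(norm (F k - G k))\<^sup>2 \<le> (B + CC)\<^sup>2"
        using FB[of k] GB[of k] norm_triangle_ineq4[of "F k" "G k"] by (auto intro!: power_mono)
      then show ?thesis by (smt (verit) real_norm_def zero_le_power2)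
    qed
    then show "integrable M (\<lambda>k. (norm (F k))\<^sup>2 - (norm (F k - G k))\<^sup>2)"
      by (intro integrable_const_bound[where B="B\<^sup>2 + (B + CC)\<^sup>2"]) auto
    fix k show "(norm (F k))\<^sup>2 - (norm (F k - G k))\<^sup>2 \<le> B\<^sup>2"
      using FB[of k] power_mono[of "norm (F k)" B 2] zero_le_power2[of "norm (F k - G k)"] by (smt (verit) norm_ge_zero)
  qed simp
  also have "\<dots> = B\<^sup>2" by (simp add: prob_space)
  finally show ?thesis by (simp add: c_def)
qed

lemma bessel_circ:
  assumes "F \<in> borel_measurable borel" "\<And>k. norm (F k) \<le> B" "finite S"
  shows "(\<Sum>n\<in>S. (norm (\<integral>k. F k * cis (real_of_int n * k) \<partial>circ))\<^sup>2) \<le> B\<^sup>2"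
proof (rule bessel_inequality[OF prob_space_circ])
  fix i j :: int
  have "(\<integral>k. cis (i * k) * cnj (cis (j * k)) \<partial>circ) = (\<integral>k. cis (real_of_int (i - j) * k) \<partial>circ)"
    by (simp add: cis_cnj cis_mult algebra_simps)
  then show "(\<integral>k. cis (i * k) * cnj (cis (j * k)) \<partial>circ) = (if i = j then 1 else 0)"
    unfolding integral_circ_cis by simp
qed (use assms in auto)

lemma bessel_tor:
  fixes F :: "('n::finite \<Rightarrow> real) \<Rightarrow> complex"
  assumes "F \<in> borel_measurable tor" "\<And>k. norm (F k) \<le> B" "finite S"
  shows "(\<Sum>x\<in>S. (norm (\<integral>k. F k * chi x k \<partial>tor))\<^sup>2) \<le> B\<^sup>2"
  by (rule bessel_inequality[OF tor.prob_space_axioms])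
     (use assms in \<open>auto simp: integral_chi simp flip: chi_diff\<close>)

section \<open>The resolvent of the discrete Laplacian\<close>

lemma norm_lat_eq: "norm (lat x) = sqrt (real_of_int (\<Sum>i\<in>UNIV. (x $ i)\<^sup>2))"
  by (simp add: norm_vec_def L2_set_def lat_def)

lemma norm_lat_eq_1_iff:
  "norm (lat (y :: int ^ 'n::finite)) = 1 \<longleftrightarrow> (\<exists>j. y = axis j 1 \<or> y = axis j (- 1))"
proof
  assume "norm (lat y) = 1"
  then have s: "(\<Sum>i\<in>UNIV. (y $ i)\<^sup>2) = 1"
    unfolding norm_lat_eq by (metis of_int_eq_1_iff real_sqrt_eq_1_iff)
  then obtain j where j: "y $ j \<noteq> 0"
    by (metis (mono_tags, lifting) power_zero_numeral sum.neutral zero_neq_one)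
  have "(\<Sum>i\<in>UNIV. (y $ i)\<^sup>2) = (y $ j)\<^sup>2 + (\<Sum>i\<in>UNIV - {j}. (y $ i)\<^sup>2)"
    by (simp add: sum.remove)
  moreover have "(y $ j)\<^sup>2 \<ge> 1"
    using j by (simp add: int_one_le_iff_zero_less)
  moreover have "(\<Sum>i\<in>UNIV - {j}. (y $ i)\<^sup>2) \<ge> 0"
    by (simp add: sum_nonneg)
  ultimately have *: "(y $ j)\<^sup>2 = 1" "(\<Sum>i\<in>UNIV - {j}. (y $ i)\<^sup>2) = 0"
    using s by linarith+
  then have "\<forall>i. i \<noteq> j \<longrightarrow> y $ i = 0"
    by (subst (asm) sum_nonneg_eq_0_iff) auto
  moreover have "y $ j = 1 \<or> y $ j = - 1"
    using * by (simp add: power2_eq_1_iff)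
  ultimately show "\<exists>j. y = axis j 1 \<or> y = axis j (- 1)"
    by (intro exI[of _ j]) (auto simp: vec_eq_iff axis_def)
next
  have "(\<Sum>i\<in>UNIV. (axis j c $ i)\<^sup>2) = c\<^sup>2" for j :: 'n and c :: int
    by (simp add: axis_def if_distrib[of "\<lambda>x. x\<^sup>2"] sum.delta cong: if_cong)
  then show "norm (lat y) = 1" if "\<exists>j. y = axis j 1 \<or> y = axis j (- 1)"
    using that by (auto simp: norm_lat_eq simp del: of_int_sum of_int_power)
qed

lemma discrete_laplacian_eq:
  fixes \<psi> :: "int ^ 'n::finite \<Rightarrow> complex"
  shows "discrete_laplacian \<psi> x = (\<Sum>j\<in>UNIV. \<psi> (x + axis j 1) + \<psi> (x - axis j 1))"
proof -
  have neg: "axis j (- 1) = - axis j (1::int)" for j :: 'n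
    by (simp add: vec_eq_iff axis_def)
  have "{x'. norm (lat (x' - x)) = 1} = (\<lambda>j. x + axis j 1) ` UNIV \<union> (\<lambda>j. x - axis j 1) ` UNIV"
    unfolding norm_lat_eq_1_iff neg by (auto simp: algebra_simps)
  moreover have "inj (\<lambda>j::'n. x + axis j 1)" "inj (\<lambda>j::'n. x - axis j 1)"
    by (auto simp: inj_def axis_eq_axis)
  moreover have "(\<lambda>j::'n. x + axis j 1) ` UNIV \<inter> (\<lambda>j. x - axis j 1) ` UNIV = {}"
  proof -
    have "axis i (1::int) \<noteq> - axis j 1" for i j :: 'n
      by (subst neg[symmetric]) (auto simp: axis_eq_axis)
    then show ?thesis by (auto simp: diff_conv_add_uminus simp del: add_uminus_conv_diff)
  qed
  ultimately show ?thesis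
    unfolding discrete_laplacian_def
    by (simp add: sum.union_disjoint sum.reindex sum.distrib)
qed

lemma chi_axis: "chi (axis j 1) k = cis (k j)"
proof -
  have "chi (axis j 1) k = (\<Prod>i\<in>UNIV. if i = j then cis (k j) else 1)"
    unfolding chi_def by (rule prod.cong) (auto simp: axis_def)
  then show ?thesis by simp
qed

text \<open>Characters diagonalise \<open>\<Delta>\<close>, with symbol \<open>Phi\<close>.\<close>

lemma discrete_laplacian_chi: "discrete_laplacian (\<lambda>x. chi x k) x = complex_of_real (Phi k) * chi x k"
proof -
  have "cis t + cnj (cis t) = complex_of_real (2 * cos t)" for t
    by (simp add: complex_eq_iff)
  then have "(\<Sum>j\<in>UNIV. cis (k j) + cnj (cis (k j))) = complex_of_real (Phi k)"
    by (simp add: Phi_def sum_distrib_left)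
  moreover have "discrete_laplacian (\<lambda>x. chi x k) x = (\<Sum>j\<in>UNIV. cis (k j) + cnj (cis (k j))) * chi x k"
    unfolding discrete_laplacian_eq chi_diff chi_add chi_axis sum_distrib_right
    by (simp add: algebra_simps)
  ultimately show ?thesis by simp
qed

lemma bij_shift: "bij (\<lambda>x :: 'a::group_add. x + a)"
  by (rule bij_betw_byWitness[where f'="\<lambda>x. x - a"]) auto

lemma infsum_finite_sum:
  fixes g :: "'i::finite \<Rightarrow> 'a \<Rightarrow> complex"
  assumes "\<And>i. g i summable_on A"
  shows "infsum (\<lambda>x. \<Sum>i\<in>UNIV. g i x) A = (\<Sum>i\<in>UNIV. infsum (g i) A)"
proof -
  have "((\<lambda>x. \<Sum>i\<in>I. g i x) has_sum (\<Sum>i\<in>I. infsum (g i) A)) A" if "finite I" for I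
    using that
  proof induction
    case (insert i I)
    then show ?case
      using has_sum_add[OF has_sum_infsum[OF assms[of i]] insert.IH] by simp
  qed simp
  from infsumI[OF this[OF finite]] show ?thesis .
qed

text \<open>\<open>\<Delta>\<close> is symmetric on \<open>\<ell>\<^sup>2\<close>, because \<open>T\<close> below, the autocorrelation of \<open>\<psi>\<close>, satisfies
  \<open>cnj (T a) = T (- a)\<close>. Hence it has no nonreal eigenvalue, and \<open>\<Delta> - z\<close> is injective on \<open>\<ell>\<^sup>2\<close>.\<close>

lemma ell2_eigenvector_trivial:
  fixes \<psi> :: "int ^ 'n::finite \<Rightarrow> complex"
  assumes "\<psi> \<in> ell2" "Im z \<noteq> 0" and eq: "\<And>x. discrete_laplacian \<psi> x = z * \<psi> x"
  shows "\<psi> = (\<lambda>_. 0)"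
proof -
  have sq: "(\<lambda>x. (norm (\<psi> x))\<^sup>2) summable_on UNIV"
    using assms(1) by (simp add: ell2_def)
  have sh: "(\<lambda>x. (norm (\<psi> (x + a)))\<^sup>2) summable_on UNIV" for a
    using sq summable_on_reindex_bij_betw[OF bij_shift[of a], where f="\<lambda>x. (norm (\<psi> x))\<^sup>2"]
    by blast
  have pr: "(\<lambda>x. cnj (\<psi> (x + b)) * \<psi> (x + a)) summable_on UNIV" for a b
  proof (rule abs_summable_summable)
    have "(\<lambda>x. (norm (\<psi> (x + b)))\<^sup>2 + (norm (\<psi> (x + a)))\<^sup>2) summable_on UNIV"
      by (intro summable_on_add sh)
    then show "(\<lambda>x. norm (cnj (\<psi> (x + b)) * \<psi> (x + a))) summable_on UNIV"
    proof (rule Infinite_Sum.abs_summable_on_comparison_test')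
      fix x
      have "p * q \<le> p\<^sup>2 + q\<^sup>2" if "p \<ge> 0" "q \<ge> 0" for p q :: real
        using sum_squares_bound[of p q] mult_nonneg_nonneg[OF that] by linarith
      from this[of "norm (\<psi> (x + b))" "norm (\<psi> (x + a))"]
      show "norm (cnj (\<psi> (x + b)) * \<psi> (x + a)) \<le> (norm (\<psi> (x + b)))\<^sup>2 + (norm (\<psi> (x + a)))\<^sup>2"
        by (simp add: norm_mult)
    qed
  qed
  define T where "T a = (\<Sum>\<^sub>\<infinity>x. cnj (\<psi> x) * \<psi> (x + a))" for a
  have Tcnj: "cnj (T a) = T (- a)" for a
  proof -
    have "cnj (T a) = (\<Sum>\<^sub>\<infinity>x. cnj (\<psi> (x + a)) * \<psi> x)"
      unfolding T_def by (subst infsum_cnj[symmetric]) (simp add: mult.commute)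
    also have "\<dots> = (\<Sum>\<^sub>\<infinity>x. cnj (\<psi> (x - a + a)) * \<psi> (x - a))"
      using infsum_reindex_bij_betw[OF bij_shift[of "- a"], of "\<lambda>x. cnj (\<psi> (x + a)) * \<psi> x"] by simp
    finally show ?thesis by (simp add: T_def)
  qed
  have prn: "(\<lambda>x. cnj (\<psi> x) * \<psi> (x + a)) summable_on UNIV" for a
    using pr[of 0 a] by simp
  have "z * T 0 = (\<Sum>\<^sub>\<infinity>x. cnj (\<psi> x) * discrete_laplacian \<psi> x)"
    unfolding T_def eq by (subst infsum_cmult_right[symmetric]) (auto simp: algebra_simps intro: prn[of 0, simplified])
  also have "\<dots> = (\<Sum>\<^sub>\<infinity>x. \<Sum>j\<in>UNIV. (cnj (\<psi> x) * \<psi> (x + axis j 1) + cnj (\<psi> x) * \<psi> (x + (- axis j 1))))"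
    unfolding discrete_laplacian_eq by (simp add: sum_distrib_left algebra_simps)
  also have "\<dots> = (\<Sum>j\<in>UNIV. T (axis j 1) + T (- axis j 1))"
    unfolding T_def infsum_add[OF prn prn, symmetric]
    by (rule infsum_finite_sum) (intro summable_on_add prn)
  finally have *: "z * T 0 = (\<Sum>j\<in>UNIV. T (axis j 1) + T (- axis j 1))" .
  then have "cnj (z * T 0) = z * T 0"
    by (simp add: Tcnj add.commute)
  moreover have T0: "T 0 = complex_of_real (\<Sum>\<^sub>\<infinity>x. (norm (\<psi> x))\<^sup>2)"
    proof -
    have "T 0 = (\<Sum>\<^sub>\<infinity>x. complex_of_real ((norm (\<psi> x))\<^sup>2))"
      unfolding T_def complex_norm_square by (simp add: mult.commute)
    also have "\<dots> = complex_of_real (\<Sum>\<^sub>\<infinity>x. (norm (\<psi> x))\<^sup>2)"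
      by (rule infsumI) (rule has_sum_of_real[OF has_sum_infsum[OF sq]])
    finally show ?thesis .
  qed
  ultimately have "Im z * (\<Sum>\<^sub>\<infinity>x. (norm (\<psi> x))\<^sup>2) = 0"
    by (simp add: complex_eq_iff)
  then have "(\<Sum>\<^sub>\<infinity>x. (norm (\<psi> x))\<^sup>2) = 0"
    using assms(2) by simp
  then have "(norm (\<psi> x))\<^sup>2 = 0" for x
    using sq by (intro nonneg_infsum_le_0D[of "\<lambda>x. (norm (\<psi> x))\<^sup>2" UNIV]) auto
  then show ?thesis by auto
qed

lemma norm_Phi_minus_ge: "\<bar>Im z\<bar> \<le> norm (complex_of_real a - z)"
  using abs_Im_le_cmod[of "complex_of_real a - z"] by simp

lemma abs_Phi_le: "\<bar>Phi (k :: 'n::finite \<Rightarrow> real)\<bar> \<le> 2 * real CARD('n)"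
  unfolding Phi_def using sum_norm_bound[of UNIV "\<lambda>j. cos (k j)" 1] by simp

lemma resolvent_unique:
  fixes \<psi> f :: "int ^ 'n::finite \<Rightarrow> complex"
  assumes "Im z \<noteq> 0" "\<psi> \<in> ell2" "\<And>x. discrete_laplacian \<psi> x - z * \<psi> x = f x"
  shows "resolvent z f = \<psi>"
proof -
  let ?T = "\<lambda>\<psi> x. discrete_laplacian \<psi> x - z * \<psi> x"
  have "inj_on ?T ell2"
  proof (rule inj_onI)
    fix u v assume uv: "u \<in> ell2" "v \<in> ell2" "?T u = ?T v"
    have "(\<lambda>x. u x - v x) \<in> ell2"
    proof -
      have "(\<lambda>x. 2 * (norm (u x))\<^sup>2 + 2 * (norm (v x))\<^sup>2) summable_on UNIV"
        using uv by (intro summable_on_add summable_on_cmult_right) (auto simp: ell2_def)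
      then have "(\<lambda>x. (norm (u x - v x))\<^sup>2) summable_on UNIV"
      proof (rule summable_on_comparison_test)
        fix x
        have "(norm (u x - v x))\<^sup>2 \<le> (norm (u x) + norm (v x))\<^sup>2"
          by (intro power_mono norm_triangle_ineq4) auto
        also have "\<dots> \<le> 2 * (norm (u x))\<^sup>2 + 2 * (norm (v x))\<^sup>2"
          using sum_squares_bound[of "norm (u x)" "norm (v x)"] by (simp add: power2_sum)
        finally show "(norm (u x - v x))\<^sup>2 \<le> 2 * (norm (u x))\<^sup>2 + 2 * (norm (v x))\<^sup>2" .
      qed auto
      then show ?thesis by (simp add: ell2_def)
    qed
    moreover have "discrete_laplacian (\<lambda>x. u x - v x) x = z * (u x - v x)" for x
      using fun_cong[OF uv(3), of x] by (simp add: discrete_laplacian_eq sum.distrib sum_subtractf algebra_simps)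
    ultimately have "(\<lambda>x. u x - v x) = (\<lambda>_. 0)"
      using ell2_eigenvector_trivial assms(1) by blast
    then show "u = v" by (simp add: fun_eq_iff)
  qed
  moreover have "?T \<psi> = f" using assms(3) by auto
  ultimately show ?thesis
    unfolding resolvent_def using assms(2) inv_into_f_f[of ?T ell2 \<psi>] by auto
qed

text \<open>The Fourier coefficients of the bounded function \<open>fhat f k / (Phi k - z)\<close> are square summable
  by Bessel's inequality, and applying \<open>\<Delta> - z\<close> under the integral cancels the denominator.\<close>

lemma green_solution:
  fixes f :: "int ^ 'n::finite \<Rightarrow> complex"
  assumes "Im z \<noteq> 0" and fin: "finite {y. f y \<noteq> 0}"
  defines "\<phi> \<equiv> \<lambda>x. \<Sum>y | f y \<noteq> 0. f y * green z (x - y)"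
  shows "\<phi> \<in> ell2" "discrete_laplacian \<phi> x - z * \<phi> x = f x"
proof -
  let ?p = "\<lambda>k. 1 / (complex_of_real (Phi k) - z)"
  let ?T = "\<lambda>\<psi> x. discrete_laplacian \<psi> x - z * \<psi> x"
  define B where "B = 1 / \<bar>Im z\<bar>"
  have [simp]: "complex_of_real (Phi k) - z \<noteq> 0" for k :: "'n \<Rightarrow> real"
    using norm_Phi_minus_ge[of z "Phi k"] assms(1) by auto
  have pB: "norm (?p k) \<le> B" for k :: "'n \<Rightarrow> real"
    using norm_Phi_minus_ge[of z "Phi k"] assms(1) unfolding B_def norm_divide by (auto intro!: divide_left_mono mult_pos_pos)
  define F where "F k = fhat f k * ?p k" for k
  define C where "C = (\<Sum>y | f y \<noteq> 0. norm (f y))"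
  have fB: "norm (fhat f k) \<le> C" for k
    unfolding C_def by (rule norm_fhat_le)
  have [measurable]: "F \<in> borel_measurable tor" unfolding F_def by measurable
  have FB: "norm (F k) \<le> C * B" for k
    unfolding F_def norm_mult by (rule mult_mono[OF fB pB order_trans[OF norm_ge_zero fB]]) simp
  define \<psi> where "\<psi> x = (\<integral>k. F k * chi x k \<partial>tor)" for x
  have int: "integrable tor (\<lambda>k. F k * chi x k)" for x
    by (rule integrable_tor_bounded[where B="C * B"]) (auto simp: norm_mult FB)
  have ell: "\<psi> \<in> ell2"
  proof -
    have "bdd_above (sum (\<lambda>x. (norm (\<psi> x))\<^sup>2) ` {S. S \<subseteq> UNIV \<and> finite S})"
      unfolding \<psi>_def by (rule bdd_aboveI[of _ "(C * B)\<^sup>2"]) (auto intro!: bessel_tor FB)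
    then show ?thesis
      unfolding ell2_def by (auto intro!: nonneg_bdd_above_summable_on)
  qed
  have \<psi>_eq: "\<psi> x = (\<Sum>y | f y \<noteq> 0. f y * green z (x - y))" for x
  proof -
    have ip: "integrable tor (\<lambda>k. chi (x - y) k * ?p k)" for y
      by (rule integrable_tor_bounded[where B=B]) (use pB in \<open>auto simp: norm_divide\<close>)
    have "\<psi> x = (\<integral>k. (\<Sum>y | f y \<noteq> 0. f y * (chi (x - y) k * ?p k)) \<partial>tor)"
      unfolding \<psi>_def F_def fhat_def chi_diff by (simp add: sum_distrib_left sum_distrib_right algebra_simps)
    also have "\<dots> = (\<Sum>y | f y \<noteq> 0. f y * (\<integral>k. chi (x - y) k * ?p k \<partial>tor))"
      using pB
      by (simp only: ip Bochner_Integration.integral_sum integrable_mult_right integral_mult_right_zero)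
    finally show ?thesis by (simp add: green_def)
  qed
  have solve: "?T \<psi> = f"
  proof
    fix x
    have ic: "integrable tor (\<lambda>k. chi y k)" for y :: "int ^ 'n"
      by (rule integrable_tor_bounded[where B=1]) auto
    have "discrete_laplacian \<psi> x = (\<integral>k. (\<Sum>j\<in>UNIV. F k * chi (x + axis j 1) k + F k * chi (x - axis j 1) k) \<partial>tor)"
      unfolding discrete_laplacian_eq \<psi>_def
      by (simp only: Bochner_Integration.integral_sum Bochner_Integration.integral_add Bochner_Integration.integrable_add int)
    also have "\<dots> = (\<integral>k. F k * (Phi k * chi x k) \<partial>tor)"
      by (rule Bochner_Integration.integral_cong)
         (simp_all only: discrete_laplacian_chi[symmetric] discrete_laplacian_eq sum_distrib_left distrib_left)
    finally have "?T \<psi> x = (\<integral>k. F k * (Phi k * chi x k) \<partial>tor) - (\<integral>k. z * (F k * chi x k) \<partial>tor)"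
      by (simp add: \<psi>_def)
    also have "\<dots> = (\<integral>k. F k * (Phi k * chi x k) - z * (F k * chi x k) \<partial>tor)"
    proof (rule Bochner_Integration.integral_diff[symmetric])
      have "norm (complex_of_real (Phi k)) \<le> 2 * real CARD('n)" for k :: "'n \<Rightarrow> real"
        using abs_Phi_le[of k] by (simp only: norm_of_real)
      then show "integrable tor (\<lambda>k. F k * (Phi k * chi x k))"
        by (intro integrable_tor_bounded[where B="(C * B) * (2 * real CARD('n))"])
           (auto simp: norm_mult intro!: mult_mono FB order_trans[OF norm_ge_zero FB])
    qed (intro integrable_mult_right int)
    also have "\<dots> = (\<integral>k. fhat f k * chi x k \<partial>tor)"
    proof (rule Bochner_Integration.integral_cong[OF refl])
      fix k :: "'n \<Rightarrow> real"
      have "complex_of_real (Phi k) \<noteq> z" using norm_Phi_minus_ge[of z "Phi k"] assms(1) by auto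
      then have "F k * (Phi k - z) = fhat f k" by (simp add: F_def)
      then show "F k * (Phi k * chi x k) - z * (F k * chi x k) = fhat f k * chi x k"
        by (metis (no_types, opaque_lifting) left_diff_distrib mult.assoc mult.left_commute)
    qed
    also have "\<dots> = (\<integral>k. (\<Sum>y | f y \<noteq> 0. f y * chi (x - y) k) \<partial>tor)"
      unfolding fhat_def chi_diff by (simp add: sum_distrib_left sum_distrib_right algebra_simps)
    also have "\<dots> = (\<Sum>y | f y \<noteq> 0. f y * (if x - y = 0 then 1 else 0))"
      by (simp add: Bochner_Integration.integral_sum ic integral_chi)
    also have "\<dots> = f x"
      using fin by (simp add: if_distrib sum.delta cong: if_cong)
    finally show "?T \<psi> x = f x" .
  qed
  have "\<phi> = \<psi>" by (simp add: fun_eq_iff \<phi>_def \<psi>_eq)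
  then show "\<phi> \<in> ell2" "discrete_laplacian \<phi> x - z * \<phi> x = f x"
    using ell fun_cong[OF solve, of x] by auto
qed

lemma resolvent_eq_green:
  fixes f :: "int ^ 'n::finite \<Rightarrow> complex"
  assumes "Im z \<noteq> 0" "finite {y. f y \<noteq> 0}"
  shows "resolvent z f x = (\<Sum>y | f y \<noteq> 0. f y * green z (x - y))"
  using resolvent_unique[OF assms(1) green_solution[OF assms]] by (rule fun_cong)

text \<open>\<open>\<Delta>\<close> has real coefficients; this is what exchanges the two signs of the imaginary part.\<close>

lemma resolvent_cnj:
  fixes f :: "int ^ 'n::finite \<Rightarrow> complex"
  assumes "Im z \<noteq> 0" "finite {y. f y \<noteq> 0}"
  shows "resolvent (cnj z) (\<lambda>y. cnj (f y)) x = cnj (resolvent z f x)"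
proof -
  define \<psi> where "\<psi> = resolvent z f"
  have "\<psi> = (\<lambda>x. \<Sum>y | f y \<noteq> 0. f y * green z (x - y))"
    unfolding \<psi>_def using resolvent_eq_green[OF assms] by (rule ext)
  then have \<psi>: "\<psi> \<in> ell2" "\<And>x. discrete_laplacian \<psi> x - z * \<psi> x = f x"
    using green_solution[OF assms] by auto
  have "resolvent (cnj z) (\<lambda>y. cnj (f y)) = (\<lambda>x. cnj (\<psi> x))"
  proof (rule resolvent_unique)
    show "(\<lambda>x. cnj (\<psi> x)) \<in> ell2" using \<psi>(1) by (simp add: ell2_def)
    show "discrete_laplacian (\<lambda>x. cnj (\<psi> x)) x - cnj z * cnj (\<psi> x) = cnj (f x)" for x
      unfolding \<psi>(2)[of x, symmetric] by (simp add: discrete_laplacian_def)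
  qed (use assms in auto)
  then show ?thesis by (simp add: \<psi>_def fun_eq_iff)
qed

section \<open>Averages of the resolvent symbol\<close>

lemma sin_ge_third:
  assumes "0 \<le> x" "x \<le> pi / 2"
  shows "x / 3 \<le> sin x"
proof -
  have x2: "x < 2" using assms pi_half_less_two by linarith
  have "\<bar>sin x - x\<bar> \<le> \<bar>x\<bar> ^ 3 / 6"
    using Maclaurin_sin_bound[of x 3] by (simp add: numeral_3_eq_3 sin_coeff_def fact_numeral field_simps)
  also have "\<bar>x\<bar> ^ 3 / 6 \<le> x * (2 / 3)"
  proof -
    have "x ^ 2 \<le> 2 ^ 2" using x2 assms by (intro power_mono) auto
    then have "x * x ^ 2 \<le> x * 4" using assms by (intro mult_left_mono) auto
    then show ?thesis using assms by (simp add: power3_eq_cube power2_eq_square)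
  qed
  finally show ?thesis by linarith
qed

text \<open>At worst, near \<open>0\<close> and \<open>\<pi>\<close>, the cosine separates points quadratically.\<close>

lemma cos_diff_ge:
  assumes "0 \<le> a" "a \<le> pi" "0 \<le> b" "b \<le> pi"
  shows "(a - b)\<^sup>2 / 9 \<le> \<bar>2 * cos a - 2 * cos b\<bar>"
proof -
  have main: "(b - a)\<^sup>2 / 9 \<le> \<bar>2 * cos a - 2 * cos b\<bar>"
    if "0 \<le> a" "a \<le> b" "b \<le> pi" for a b
  proof -
    have 1: "(b - a) / 6 \<le> sin ((b - a) / 2)"
      using sin_ge_third[of "(b - a) / 2"] that by simp
    have 2: "sin ((b - a) / 2) \<le> sin ((a + b) / 2)"
    proof -
      have mono: "sin u \<le> sin v" if "0 \<le> u" "u \<le> v" "u + v \<le> pi" for u v :: real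
      proof (cases "v \<le> pi / 2")
        case True
        then show ?thesis using that by (intro sin_monotone_2pi_le) auto
      next
        case False
        then have "sin u \<le> sin (pi - v)"
          using that by (intro sin_monotone_2pi_le) auto
        then show ?thesis by simp
      qed
      show ?thesis by (rule mono) (use that in \<open>auto simp: field_simps\<close>)
    qed
    have "((b - a) / 6) * ((b - a) / 6) \<le> sin ((a + b) / 2) * sin ((b - a) / 2)"
      using 1 2 that by (intro mult_mono) auto
    then have "(b - a)\<^sup>2 / 36 \<le> sin ((a + b) / 2) * sin ((b - a) / 2)"
      by (simp add: power2_eq_square)
    moreover have "2 * cos a - 2 * cos b = 4 * (sin ((a + b) / 2) * sin ((b - a) / 2))"
      using cos_diff_cos[of a b] by simp
    ultimately show ?thesis by linarith
  qed
  show ?thesis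
  proof (cases "a \<le> b")
    case True
    then show ?thesis using main[of a b] assms by (simp add: power2_commute)
  next
    case False
    then show ?thesis using main[of b a] assms by (simp add: abs_minus_commute)
  qed
qed

text \<open>If \<open>c\<close> is outside the range of \<open>2 cos\<close>, the nearest value in the range takes its place.\<close>

lemma cos_level_distance:
  fixes c :: real
  obtains \<theta>\<^sub>0 where "\<And>\<theta>. - pi \<le> \<theta> \<Longrightarrow> \<theta> \<le> pi \<Longrightarrow> (\<bar>\<theta>\<bar> - \<theta>\<^sub>0)\<^sup>2 / 9 \<le> \<bar>2 * cos \<theta> - c\<bar>"
proof
  define c' where "c' = max (- 1) (min 1 (c / 2))"
  fix \<theta> :: real assume th: "- pi \<le> \<theta>" "\<theta> \<le> pi"
  have c': "- 1 \<le> c'" "c' \<le> 1" by (auto simp: c'_def)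
  have "(\<bar>\<theta>\<bar> - arccos c')\<^sup>2 / 9 \<le> \<bar>2 * cos \<bar>\<theta>\<bar> - 2 * cos (arccos c')\<bar>"
    using th c' by (intro cos_diff_ge arccos_lbound arccos_ubound) auto
  also have "\<dots> = \<bar>2 * cos \<theta> - 2 * c'\<bar>" using c' by (simp add: abs_if)
  also have "\<dots> \<le> \<bar>2 * cos \<theta> - c\<bar>"
  proof -
    have "\<bar>2 * x - 2 * max (- 1) (min 1 (c / 2))\<bar> \<le> \<bar>2 * x - c\<bar>" if "- 1 \<le> x" "x \<le> 1" for x :: real
      using that by linarith
    then show ?thesis by (simp add: c'_def)
  qed
  finally show "(\<bar>\<theta>\<bar> - arccos c')\<^sup>2 / 9 \<le> \<bar>2 * cos \<theta> - c\<bar>" .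
qed

text \<open>With \<open>\<epsilon> = |Im z|\<close>, the integrand is dominated by the two Lorentzians
  \<open>18 / ((\<theta> \<mp> \<theta>\<^sub>0)\<^sup>2 + \<epsilon>)\<close>, whose integrals are of order \<open>\<epsilon>\<^bsup>-1/2\<^esup>\<close>. The bound is uniform in the
  constant \<open>c\<close>, which absorbs all other coordinates of the torus.\<close>

lemma circ_resolvent_bound:
  assumes "Im z \<noteq> 0"
  shows "(\<integral>\<theta>. 1 / norm (complex_of_real (2 * cos \<theta> + c) - z) \<partial>circ) \<le> 18 / sqrt \<bar>Im z\<bar>"
proof -
  define \<epsilon> where "\<epsilon> = \<bar>Im z\<bar>"
  define q where "q = sqrt \<epsilon>"
  have \<epsilon>: "\<epsilon> > 0" "q > 0" "q\<^sup>2 = \<epsilon>" using assms by (auto simp: \<epsilon>_def q_def)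
  obtain \<theta>\<^sub>0 where th0: "\<And>\<theta>. - pi \<le> \<theta> \<Longrightarrow> \<theta> \<le> pi \<Longrightarrow> (\<bar>\<theta>\<bar> - \<theta>\<^sub>0)\<^sup>2 / 9 \<le> \<bar>2 * cos \<theta> - (Re z - c)\<bar>"
    using cos_level_distance[of "Re z - c"] by blast
  define h where "h \<theta> = 18 / ((\<theta> - \<theta>\<^sub>0)\<^sup>2 + \<epsilon>) + 18 / ((\<theta> + \<theta>\<^sub>0)\<^sup>2 + \<epsilon>)" for \<theta>
  have pos: "(\<theta> - \<theta>\<^sub>0)\<^sup>2 + \<epsilon> > 0" "(\<theta> + \<theta>\<^sub>0)\<^sup>2 + \<epsilon> > 0" for \<theta>
    using \<epsilon> by (simp_all add: add_nonneg_pos)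
  have le: "1 / norm (complex_of_real (2 * cos \<theta> + c) - z) \<le> h \<theta>" if "- pi < \<theta> \<and> \<theta> < pi" for \<theta>
  proof -
    define w where "w = 2 * cos \<theta> - (Re z - c)"
    have "\<bar>w\<bar> \<le> norm (complex_of_real (2 * cos \<theta> + c) - z)" "\<epsilon> \<le> norm (complex_of_real (2 * cos \<theta> + c) - z)"
      using abs_Re_le_cmod[of "complex_of_real (2 * cos \<theta> + c) - z"]
        abs_Im_le_cmod[of "complex_of_real (2 * cos \<theta> + c) - z"]
      by (simp_all add: w_def \<epsilon>_def algebra_simps)
    moreover have "(\<bar>\<theta>\<bar> - \<theta>\<^sub>0)\<^sup>2 / 9 \<le> \<bar>w\<bar>"
      using th0[of \<theta>] that by (simp add: w_def)
    ultimately have ge: "((\<bar>\<theta>\<bar> - \<theta>\<^sub>0)\<^sup>2 + \<epsilon>) / 18 \<le> norm (complex_of_real (2 * cos \<theta> + c) - z)"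
      using \<epsilon> by (simp add: add_divide_distrib)
    have p: "(\<bar>\<theta>\<bar> - \<theta>\<^sub>0)\<^sup>2 + \<epsilon> > 0" using \<epsilon> by (simp add: add_nonneg_pos)
    have "1 / norm (complex_of_real (2 * cos \<theta> + c) - z) \<le> 1 / (((\<bar>\<theta>\<bar> - \<theta>\<^sub>0)\<^sup>2 + \<epsilon>) / 18)"
      using p by (intro divide_left_mono ge mult_pos_pos less_le_trans[OF _ ge]) auto
    also have "\<dots> = 18 / ((\<bar>\<theta>\<bar> - \<theta>\<^sub>0)\<^sup>2 + \<epsilon>)" by simp
    also have "\<dots> \<le> h \<theta>"
    proof (cases "\<theta> \<ge> 0")
      case True
      then show ?thesis using pos(2)[of \<theta>] by (simp add: h_def)
    next
      case False
      then have "(\<bar>\<theta>\<bar> - \<theta>\<^sub>0)\<^sup>2 = (\<theta> + \<theta>\<^sub>0)\<^sup>2" by (simp add: power2_eq_square algebra_simps)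
      then show ?thesis using pos(1)[of \<theta>] by (simp add: h_def)
    qed
    finally show ?thesis .
  qed
  have cont: "continuous_on UNIV h"
    unfolding h_def using pos by (intro continuous_intros) (auto simp: less_imp_neq[symmetric] dest: less_imp_neq)
  then have [measurable]: "h \<in> borel_measurable borel" by (rule borel_measurable_continuous_onI)
  define F where "F \<theta> = (18 / q) * (arctan ((\<theta> - \<theta>\<^sub>0) / q) + arctan ((\<theta> + \<theta>\<^sub>0) / q))" for \<theta>
  have FD: "(F has_vector_derivative h \<theta>) (at \<theta>)" for \<theta>
  proof -
    have 1: "18 / q * (inverse (1 + (a / q)\<^sup>2) * (1 / q)) = 18 / (a\<^sup>2 + \<epsilon>)" for a
    proof -
      have "1 + (a / q)\<^sup>2 = (a\<^sup>2 + \<epsilon>) / q\<^sup>2"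
        using \<epsilon>(2) unfolding \<epsilon>(3)[symmetric] by (simp add: power_divide add_divide_distrib)
      then show ?thesis
        using \<epsilon>(2) by (simp add: power2_eq_square)
    qed
    have "(F has_real_derivative 18 / q * (inverse (1 + ((\<theta> - \<theta>\<^sub>0) / q)\<^sup>2) * (1 / q) + inverse (1 + ((\<theta> + \<theta>\<^sub>0) / q)\<^sup>2) * (1 / q))) (at \<theta>)"
      unfolding F_def using \<epsilon> by (auto intro!: derivative_eq_intros simp: algebra_simps)
    then show ?thesis
      unfolding distrib_left 1 h_def by (simp add: has_real_derivative_iff_has_vector_derivative)
  qed
  have "(\<integral>\<theta>. 1 / norm (complex_of_real (2 * cos \<theta> + c) - z) \<partial>circ) \<le> (\<integral>\<theta>. h \<theta> \<partial>circ)"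
  proof (rule integral_mono_AE')
    have "norm (h \<theta>) \<le> 36 / \<epsilon>" for \<theta>
    proof -
      have "18 / ((\<theta> - \<theta>\<^sub>0)\<^sup>2 + \<epsilon>) \<le> 18 / \<epsilon>" "18 / ((\<theta> + \<theta>\<^sub>0)\<^sup>2 + \<epsilon>) \<le> 18 / \<epsilon>"
        using \<epsilon> pos by (auto intro!: divide_left_mono mult_pos_pos)
      moreover have "h \<theta> \<ge> 0" using pos[of \<theta>] unfolding h_def by (intro add_nonneg_nonneg divide_nonneg_pos) auto
      ultimately show ?thesis by (simp add: h_def)
    qed
    then show "integrable circ h" by (intro integrable_circ_bounded) auto
    show "AE \<theta> in circ. 1 / norm (complex_of_real (2 * cos \<theta> + c) - z) \<le> h \<theta>"
      using AE_circ by eventually_elim (rule le)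
    have "h \<theta> \<ge> 0" for \<theta>
      using pos[of \<theta>] unfolding h_def by (intro add_nonneg_nonneg divide_nonneg_pos) auto
    then show "AE \<theta> in circ. 0 \<le> h \<theta>" by simp
  qed
  also have "(\<integral>\<theta>. h \<theta> \<partial>circ) = (1 / (2 * pi)) *\<^sub>R (F pi - F (- pi))"
  proof (rule integral_circ_FTC[where F=F])
    show "h \<in> borel_measurable borel" by measurable
    show "(F has_vector_derivative h k) (at k within {- pi..pi})" for k
      using FD[of k] by (rule has_vector_derivative_at_within)
    show "continuous_on {- pi..pi} h" by (rule continuous_on_subset[OF cont]) simp
  qed
  also have "\<dots> \<le> (1 / (2 * pi)) *\<^sub>R ((18 / q) * (2 * pi))"
  proof -
    have b: "\<bar>arctan x\<bar> \<le> pi / 2" for x using arctan_bounded[of x] by auto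
    have "F pi - F (- pi) = (18 / q) * ((arctan ((pi - \<theta>\<^sub>0) / q) + arctan ((pi + \<theta>\<^sub>0) / q)) -
      (arctan ((- pi - \<theta>\<^sub>0) / q) + arctan ((- pi + \<theta>\<^sub>0) / q)))"
      by (simp only: F_def right_diff_distrib)
    also have "\<dots> \<le> (18 / q) * (2 * pi)"
      using \<epsilon> b[of "(pi - \<theta>\<^sub>0) / q"] b[of "(pi + \<theta>\<^sub>0) / q"] b[of "(- pi - \<theta>\<^sub>0) / q"] b[of "(- pi + \<theta>\<^sub>0) / q"]
      by (intro mult_left_mono) (auto simp: abs_le_iff)
    finally show ?thesis by (intro scaleR_left_mono) auto
  qed
  also have "\<dots> = 18 / q" by simp
  finally show ?thesis by (simp add: q_def \<epsilon>_def)
qed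

lemma Phi_upd: "Phi (k(j := y)) = 2 * cos y + 2 * (\<Sum>i\<in>UNIV - {j}. cos (k i))"
proof -
  have "(\<Sum>i\<in>UNIV. cos ((k(j := y)) i)) = cos y + (\<Sum>i\<in>UNIV - {j}. cos ((k(j := y)) i))"
    by (subst sum.remove[of _ j]) auto
  also have "(\<Sum>i\<in>UNIV - {j}. cos ((k(j := y)) i)) = (\<Sum>i\<in>UNIV - {j}. cos (k i))"
    by (rule sum.cong) auto
  finally show ?thesis by (simp add: Phi_def)
qed

lemma inverse_resolvent_bound:
  assumes "Im z \<noteq> 0"
  shows "1 / norm (complex_of_real a - z) \<le> 1 / \<bar>Im z\<bar>"
  by (rule frac_le) (use norm_Phi_minus_ge[of z a] assms in simp_all)

lemma integrable_inverse_resolvent: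
  assumes "Im z \<noteq> 0"
  shows "integrable tor (\<lambda>k. 1 / norm (complex_of_real (Phi k) - z))"
proof (rule integrable_tor_bounded)
  show "(\<lambda>k. 1 / norm (complex_of_real (Phi k) - z)) \<in> borel_measurable tor" by measurable
  show "norm (1 / norm (complex_of_real (Phi k) - z)) \<le> 1 / \<bar>Im z\<bar>" for k :: "'a \<Rightarrow> real"
    using inverse_resolvent_bound[OF assms, of "Phi k"] by simp
qed

lemma tor_resolvent_bound:
  assumes "Im z \<noteq> 0"
  shows "(\<integral>k. 1 / norm (complex_of_real (Phi (k :: 'n::finite \<Rightarrow> real)) - z) \<partial>tor) \<le> 18 / sqrt \<bar>Im z\<bar>"
proof -
  fix j :: 'n
  interpret P: prob_space "PiM (UNIV - {j}) (\<lambda>_. circ)"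
    by (rule prob_space_PiM) (rule prob_space_circ)
  have "(\<integral>k. 1 / norm (complex_of_real (Phi (k :: 'n \<Rightarrow> real)) - z) \<partial>tor) =
     (\<integral>k. (\<integral>y. 1 / norm (complex_of_real (Phi (k(j := y))) - z) \<partial>circ) \<partial>PiM (UNIV - {j}) (\<lambda>_. circ))"
    by (rule integral_tor_coordinate[OF integrable_inverse_resolvent[OF assms]])
  also have "\<dots> \<le> (\<integral>k. 18 / sqrt \<bar>Im z\<bar> \<partial>PiM (UNIV - {j}) (\<lambda>_. circ))"
    by (intro integral_mono') (simp_all only: Phi_upd circ_resolvent_bound[OF assms] P.integrable_const, simp)
  also have "\<dots> = 18 / sqrt \<bar>Im z\<bar>" by (simp add: P.prob_space)
  finally show ?thesis .
qed

section \<open>Integration by parts and parameter integrals\<close>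

text \<open>The boundary terms of an integration by parts in one coordinate cancel by periodicity.\<close>

lemma tor_integral_by_parts:
  fixes W W' :: "('n::finite \<Rightarrow> real) \<Rightarrow> complex"
  assumes W: "\<And>k \<theta>. ((\<lambda>\<theta>. W (k(j := \<theta>))) has_vector_derivative W' (k(j := \<theta>))) (at \<theta>)"
    and per: "\<And>k. W (k(j := pi)) = W (k(j := - pi))"
    and "W' \<in> borel_measurable tor" "\<And>k. norm (W' k) \<le> B"
    and cont: "\<And>k. continuous_on UNIV (\<lambda>\<theta>. W' (k(j := \<theta>)))"
  shows "(\<integral>k. W' k \<partial>tor) = 0"
proof -
  have "(\<integral>y. W' (k(j := y)) \<partial>circ) = (1 / (2 * pi)) *\<^sub>R (W (k(j := pi)) - W (k(j := - pi)))" for k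
  proof (rule integral_circ_FTC[where F="\<lambda>\<theta>. W (k(j := \<theta>))"])
    show "(\<lambda>y. W' (k(j := y))) \<in> borel_measurable borel"
      by (rule borel_measurable_continuous_onI) (rule cont)
    show "((\<lambda>\<theta>. W (k(j := \<theta>))) has_vector_derivative W' (k(j := \<theta>))) (at \<theta> within {- pi..pi})" for \<theta>
      by (rule has_vector_derivative_at_within[OF W])
    show "continuous_on {- pi..pi} (\<lambda>y. W' (k(j := y)))"
      by (rule continuous_on_subset[OF cont]) simp
  qed
  then have "(\<integral>y. W' (k(j := y)) \<partial>circ) = 0" for k
    by (simp only: per diff_self scaleR_zero_right)
  then show ?thesis
    unfolding integral_tor_coordinate[OF integrable_tor_bounded[OF assms(3,4)], of j]
    by simp
qed

text \<open>Differentiation under the integral sign by dominated convergence: the difference quotients are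
  bounded by twice the bound on the derivative.\<close>

lemma has_vector_derivative_integral:
  fixes f f' :: "real \<Rightarrow> 'a \<Rightarrow> complex"
  assumes "prob_space M" and t: "a < t" "t < b"
    and f: "\<And>s. f s \<in> borel_measurable M" "\<And>s k. a < s \<Longrightarrow> s < b \<Longrightarrow> norm (f s k) \<le> A"
    and f': "f' t \<in> borel_measurable M" "\<And>s k. a < s \<Longrightarrow> s < b \<Longrightarrow> norm (f' s k) \<le> B"
    and deriv: "\<And>s k. a < s \<Longrightarrow> s < b \<Longrightarrow> ((\<lambda>s. f s k) has_vector_derivative f' s k) (at s)"
  shows "((\<lambda>s. \<integral>k. f s k \<partial>M) has_vector_derivative (\<integral>k. f' t k \<partial>M)) (at t)"
proof -
  interpret prob_space M by fact
  let ?I = "{a<..<b}"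
  let ?q = "\<lambda>s k. (f s k - f t k - (s - t) *\<^sub>R f' t k) /\<^sub>R norm (s - t)"
  have lip: "norm (f s k - f t k) \<le> B * norm (s - t)" if "s \<in> ?I" for s k
  proof (rule differentiable_bound[of ?I "\<lambda>s. f s k" "\<lambda>s h. h *\<^sub>R f' s k"])
    show "((\<lambda>s. f s k) has_derivative (\<lambda>h. h *\<^sub>R f' u k)) (at u within ?I)" if "u \<in> ?I" for u
      using deriv[of u k] that by (auto simp: has_vector_derivative_def intro: has_derivative_at_withinI)
    show "onorm (\<lambda>h. h *\<^sub>R f' u k) \<le> B" if "u \<in> ?I" for u
      using f'(2)[of u k] that by (simp add: onorm_scaleR_left onorm_id)
  qed (use t that in auto)
  have int: "integrable M (f s)" if "s \<in> ?I" for s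
    using that by (intro integrable_const_bound[where B=A] f) (auto intro!: f)
  have int': "integrable M (f' t)"
    using t by (intro integrable_const_bound[where B=B] f') (auto intro!: f')
  have "((\<lambda>s. norm (((\<integral>k. f s k \<partial>M) - (\<integral>k. f t k \<partial>M)) - (s - t) *\<^sub>R (\<integral>k. f' t k \<partial>M)) / norm (s - t)) \<longlongrightarrow> 0) (at t within ?I)"
    unfolding tendsto_at_iff_sequentially comp_def
  proof (intro allI impI)
    fix X :: "nat \<Rightarrow> real" assume X: "\<forall>i. X i \<in> ?I - {t}" "X \<longlonglongrightarrow> t"
    have lim: "(\<lambda>n. \<integral>k. ?q (X n) k \<partial>M) \<longlonglongrightarrow> (\<integral>k. 0 \<partial>M)"
    proof (rule integral_dominated_convergence)
      show "(\<lambda>k. 0) \<in> borel_measurable M" by simp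
      show "?q (X n) \<in> borel_measurable M" for n
        using f(1) f'(1) by measurable
      show "integrable M (\<lambda>_. 2 * B)" by simp
      show "AE k in M. (\<lambda>n. ?q (X n) k) \<longlonglongrightarrow> 0"
      proof (rule AE_I2)
        fix k
        have "((\<lambda>s. norm (f s k - f t k - (s - t) *\<^sub>R f' t k) / norm (s - t)) \<longlongrightarrow> 0) (at t within ?I)"
          using deriv[OF t, of k] unfolding has_vector_derivative_def has_derivative_iff_norm
          by (auto intro: tendsto_within_subset)
        then have "(\<lambda>n. norm (f (X n) k - f t k - (X n - t) *\<^sub>R f' t k) / norm (X n - t)) \<longlonglongrightarrow> 0"
          using X unfolding tendsto_at_iff_sequentially comp_def by blast
        then show "(\<lambda>n. ?q (X n) k) \<longlonglongrightarrow> 0"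
          by (intro tendsto_norm_zero_cancel[of "\<lambda>n. ?q (X n) k"]) (simp add: divide_inverse mult.commute)
      qed
      show "AE k in M. norm (?q (X n) k) \<le> 2 * B" for n
      proof (rule AE_I2)
        fix k
        have Xn: "X n \<in> ?I" "norm (X n - t) > 0" using X by auto
        have "norm (f (X n) k - f t k - (X n - t) *\<^sub>R f' t k) \<le> B * norm (X n - t) + norm (X n - t) * B"
        proof (rule order_trans[OF norm_triangle_ineq4 add_mono])
          show "norm (f (X n) k - f t k) \<le> B * norm (X n - t)" by (rule lip[OF Xn(1)])
          show "norm ((X n - t) *\<^sub>R f' t k) \<le> norm (X n - t) * B"
            using f'(2)[OF t, of k] by (simp add: mult_left_mono)
        qed
        then show "norm (?q (X n) k) \<le> 2 * B"
        proof -
          have "norm (?q (X n) k) = norm (f (X n) k - f t k - (X n - t) *\<^sub>R f' t k) / norm (X n - t)"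
            by (simp only: norm_scaleR norm_inverse abs_norm_cancel divide_inverse mult.commute abs_inverse)
          also have "\<dots> \<le> (2 * B * norm (X n - t)) / norm (X n - t)"
            using \<open>norm (f (X n) k - f t k - (X n - t) *\<^sub>R f' t k) \<le> _\<close> by (intro divide_right_mono) auto
          finally show ?thesis using Xn(2) by simp
        qed
      qed
    qed
    have "norm (\<integral>k. ?q (X n) k \<partial>M) =
        norm (((\<integral>k. f (X n) k \<partial>M) - (\<integral>k. f t k \<partial>M)) - (X n - t) *\<^sub>R (\<integral>k. f' t k \<partial>M)) / norm (X n - t)" for n
    proof -
      have "integrable M (f (X n))" "integrable M (f t)" using X t by (auto intro!: int)
      then show ?thesis using int' by (simp add: divide_inverse mult.commute)
    qed
    then show "(\<lambda>n. norm (((\<integral>k. f (X n) k \<partial>M) - (\<integral>k. f t k \<partial>M)) - (X n - t) *\<^sub>R (\<integral>k. f' t k \<partial>M)) / norm (X n - t)) \<longlonglongrightarrow> 0"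
      using tendsto_norm[OF lim] by simp
  qed
  then have "((\<lambda>s. \<integral>k. f s k \<partial>M) has_vector_derivative (\<integral>k. f' t k \<partial>M)) (at t within ?I)"
    by (simp add: has_vector_derivative_def has_derivative_iff_norm bounded_linear_scaleR_left)
  then show ?thesis
    by (subst (asm) has_vector_derivative_within_open) (use t in auto)
qed

section \<open>The limiting absorption principle\<close>

text \<open>This is \<open>|\<nabla>Phi|\<^sup>2\<close>, as \<open>\<partial>\<^sub>j Phi k = - 2 sin (k j)\<close>.\<close>

definition grad_sq :: "('n::finite \<Rightarrow> real) \<Rightarrow> real" where
  "grad_sq k = (\<Sum>j\<in>UNIV. (2 * sin (k j))\<^sup>2)"

text \<open>The weight \<open>|\<nabla>Phi|\<^sup>4 + (Phi - \<lambda>)\<^sup>2\<close> vanishes only at critical points of \<open>Phi\<close> on the level \<open>\<lambda>\<close>. Dividing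
  by it gives the decomposition
  \<open>1 = \<Sum>\<^sub>j ibp_field j lam k * \<partial>\<^sub>j Phi k + (Phi k - lam)\<^sup>2 / ibp_denom lam k\<close>, smooth on the whole torus, and so no
  cutoff near the level surface is needed. In the first part one can integrate by parts, the second
  cancels the singularity of the resolvent.\<close>

definition ibp_denom :: "real \<Rightarrow> ('n::finite \<Rightarrow> real) \<Rightarrow> real" where
  "ibp_denom lam k = (grad_sq k)\<^sup>2 + (Phi k - lam)\<^sup>2"

definition ibp_field :: "'n::finite \<Rightarrow> real \<Rightarrow> ('n \<Rightarrow> real) \<Rightarrow> real" where
  "ibp_field j lam k = grad_sq k * (- 2 * sin (k j)) / ibp_denom lam k"

text \<open>The derivative of \<open>ibp_field j lam\<close> in the coordinate \<open>j\<close>, by the quotient rule.\<close>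

definition ibp_field_deriv :: "'n::finite \<Rightarrow> real \<Rightarrow> ('n \<Rightarrow> real) \<Rightarrow> real" where
  "ibp_field_deriv j lam k =
    ((8 * sin (k j) * cos (k j) * (- 2 * sin (k j)) + grad_sq k * (- 2 * cos (k j))) * ibp_denom lam k
      - grad_sq k * (- 2 * sin (k j)) *
        (2 * grad_sq k * (8 * sin (k j) * cos (k j)) + 2 * (Phi k - lam) * (- 2 * sin (k j))))
    / (ibp_denom lam k)\<^sup>2"

text \<open>The critical values of \<open>Phi\<close> are the numbers \<open>2 \<Sum>\<^sub>j \<plusminus>1\<close>, and \<open>\<Lambda>\<close> contains none of them: either all
  signs agree and the value is \<open>\<plusminus>2d\<close>, or its modulus is at most \<open>2d - 4\<close>. Quantitatively,
  \<open>|cos \<theta> \<mp> 1| \<le> sin\<^sup>2 \<theta>\<close> for the sign of \<open>cos \<theta>\<close>, so that \<open>Phi k\<close> lies within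
  \<open>grad_sq k / 2\<close> of a critical value, whereas \<open>\<lambda>\<close> keeps a fixed distance \<open>\<eta>\<close> from all of them.\<close>

lemma ibp_denom_bounded_below:
  assumes "lam \<in> Lambda TYPE('n::finite)"
  obtains q where "q > 0" "\<And>k :: 'n \<Rightarrow> real. q \<le> ibp_denom lam k"
proof -
  define \<eta> where "\<eta> = min (2 * real CARD('n) - \<bar>lam\<bar>) (\<bar>lam\<bar> - (2 * real CARD('n) - 4))"
  have \<eta>: "\<eta> > 0" using assms by (auto simp: \<eta>_def Lambda_def)
  have "\<eta>\<^sup>2 / 2 \<le> ibp_denom lam k" for k :: "'n \<Rightarrow> real"
  proof -
    define \<sigma> where "\<sigma> j = (if cos (k j) \<ge> 0 then 1 else - 1 :: real)" for j
    define N where "N = 2 * (\<Sum>j\<in>UNIV. \<sigma> j)"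
    have "\<bar>cos (k j) - \<sigma> j\<bar> \<le> (sin (k j))\<^sup>2" for j
    proof -
      have s: "(sin (k j))\<^sup>2 = 1 - (cos (k j))\<^sup>2" by (simp add: sin_squared_eq)
      have c: "cos (k j) \<le> 1" "- 1 \<le> cos (k j)" by auto
      show ?thesis
      proof (cases "cos (k j) \<ge> 0")
        case True
        then have "(cos (k j))\<^sup>2 \<le> cos (k j)" using c by (simp add: power2_eq_square mult_left_le)
        then show ?thesis using True c by (simp add: \<sigma>_def s)
      next
        case False
        then have "(- cos (k j)) * (- cos (k j)) \<le> - cos (k j)" using c by (intro mult_left_le) auto
        then have "(cos (k j))\<^sup>2 \<le> - cos (k j)" by (simp add: power2_eq_square)
        moreover have "\<sigma> j = - 1" using False by (simp add: \<sigma>_def)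
        ultimately show ?thesis unfolding s using c by linarith
      qed
    qed
    then have "\<bar>\<Sum>j\<in>UNIV. cos (k j) - \<sigma> j\<bar> \<le> (\<Sum>j\<in>UNIV. (sin (k j))\<^sup>2)"
      by (intro order_trans[OF sum_abs] sum_mono)
    moreover have "grad_sq k = 4 * (\<Sum>j\<in>UNIV. (sin (k j))\<^sup>2)"
      by (simp add: grad_sq_def power_mult_distrib sum_distrib_left)
    moreover have "Phi k - N = 2 * (\<Sum>j\<in>UNIV. cos (k j) - \<sigma> j)"
      by (simp add: Phi_def N_def sum_subtractf)
    ultimately have close: "\<bar>Phi k - N\<bar> \<le> grad_sq k / 2" by simp
    have far: "\<eta> \<le> \<bar>lam - N\<bar>"
    proof (cases "\<exists>a b. \<sigma> a \<noteq> \<sigma> b")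
      case True
      then obtain a b where ab: "\<sigma> a = 1" "\<sigma> b = - 1"
        unfolding \<sigma>_def by (metis (no_types))
      then have "a \<noteq> b" by auto
      then have "(\<Sum>j\<in>UNIV. \<sigma> j) = \<sigma> a + (\<sigma> b + (\<Sum>j\<in>UNIV - {a} - {b}. \<sigma> j))"
        by (simp add: sum.remove[of UNIV a] sum.remove[of "UNIV - {a}" b])
      then have "(\<Sum>j\<in>UNIV. \<sigma> j) = (\<Sum>j\<in>UNIV - {a} - {b}. \<sigma> j)" using ab by simp
      moreover have "\<bar>\<Sum>j\<in>UNIV - {a} - {b}. \<sigma> j\<bar> \<le> real (card (UNIV - {a} - {b})) * 1"
        using sum_norm_bound[of "UNIV - {a} - {b}" \<sigma> 1] by (simp add: \<sigma>_def)
      moreover have "real (card (UNIV - {a} - {b})) = real CARD('n) - 2"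
      proof -
        have "card (UNIV - {a} - {b}) = CARD('n) - 2" using \<open>a \<noteq> b\<close> by (simp add: card_Diff_singleton_if)
        moreover have "card {a, b} \<le> CARD('n)" by (rule card_mono) auto
        ultimately show ?thesis using \<open>a \<noteq> b\<close> by simp
      qed
      ultimately have "\<bar>N\<bar> \<le> 2 * real CARD('n) - 4" by (simp add: N_def)
      then show ?thesis unfolding \<eta>_def by linarith
    next
      case False
      then have "(\<Sum>j\<in>UNIV. \<sigma> j) = (\<Sum>j\<in>(UNIV :: 'n set). \<sigma> undefined)" by (metis (no_types))
      then have "\<bar>N\<bar> = 2 * real CARD('n)" by (simp add: N_def \<sigma>_def abs_mult)
      then show ?thesis unfolding \<eta>_def by linarith
    qed
    have "\<eta> \<le> grad_sq k / 2 + \<bar>Phi k - lam\<bar>" using close far by linarith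
    then have "\<eta>\<^sup>2 \<le> (grad_sq k / 2 + \<bar>Phi k - lam\<bar>)\<^sup>2" using \<eta> by (intro power_mono) auto
    also have "\<dots> \<le> 2 * ((grad_sq k / 2)\<^sup>2 + (Phi k - lam)\<^sup>2)"
      using sum_squares_bound[of "grad_sq k / 2" "\<bar>Phi k - lam\<bar>"] by (simp add: power2_sum)
    also have "\<dots> \<le> 2 * ibp_denom lam k" by (simp add: ibp_denom_def power_divide)
    finally show ?thesis by simp
  qed
  then show ?thesis using \<eta> by (intro that[of "\<eta>\<^sup>2 / 2"]) auto
qed

lemma measurable_grad_sq [measurable]: "grad_sq \<in> borel_measurable tor"
  unfolding grad_sq_def[abs_def] by measurable

lemma measurable_ibp_denom [measurable]: "ibp_denom lam \<in> borel_measurable tor"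
  unfolding ibp_denom_def[abs_def] by measurable

lemma measurable_ibp_field [measurable]: "ibp_field j lam \<in> borel_measurable tor"
  unfolding ibp_field_def[abs_def] by measurable

lemma measurable_ibp_field_deriv [measurable]: "ibp_field_deriv j lam \<in> borel_measurable tor"
  unfolding ibp_field_deriv_def[abs_def] by measurable

lemma grad_sq_upd: "grad_sq (k(j := y)) = (2 * sin y)\<^sup>2 + (\<Sum>i\<in>UNIV - {j}. (2 * sin (k i))\<^sup>2)"
proof -
  have "(\<Sum>i\<in>UNIV. (2 * sin ((k(j := y)) i))\<^sup>2) = (2 * sin y)\<^sup>2 + (\<Sum>i\<in>UNIV - {j}. (2 * sin ((k(j := y)) i))\<^sup>2)"
    by (subst sum.remove[of _ j]) auto
  also have "(\<Sum>i\<in>UNIV - {j}. (2 * sin ((k(j := y)) i))\<^sup>2) = (\<Sum>i\<in>UNIV - {j}. (2 * sin (k i))\<^sup>2)"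
    by (rule sum.cong) auto
  finally show ?thesis by (simp add: grad_sq_def)
qed

lemma chi_upd: "chi x (k(j := y)) = cis (real_of_int (x $ j) * y) * (\<Prod>i\<in>UNIV - {j}. cis (real_of_int (x $ i) * k i))"
proof -
  have "(\<Prod>i\<in>UNIV. cis (real_of_int (x $ i) * (k(j := y)) i)) =
      cis (real_of_int (x $ j) * y) * (\<Prod>i\<in>UNIV - {j}. cis (real_of_int (x $ i) * (k(j := y)) i))"
    by (subst prod.remove[of _ j]) auto
  also have "(\<Prod>i\<in>UNIV - {j}. cis (real_of_int (x $ i) * (k(j := y)) i)) = (\<Prod>i\<in>UNIV - {j}. cis (real_of_int (x $ i) * k i))"
    by (rule prod.cong) auto
  finally show ?thesis by (simp add: chi_def)
qed

lemma chi_upd_deriv: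
  "((\<lambda>\<theta>. chi x (k(j := \<theta>))) has_vector_derivative \<i> * real_of_int (x $ j) * chi x (k(j := \<theta>))) (at \<theta>)"
  unfolding chi_upd has_vector_derivative_def
  by (auto intro!: derivative_eq_intros ext simp: scaleR_conv_of_real algebra_simps)

lemma Phi_upd_deriv:
  "((\<lambda>\<theta>. Phi (k(j := \<theta>))) has_real_derivative - 2 * sin \<theta>) (at \<theta>)"
  unfolding Phi_upd by (auto intro!: derivative_eq_intros)

lemma grad_sq_upd_deriv:
  "((\<lambda>\<theta>. grad_sq (k(j := \<theta>))) has_real_derivative 8 * sin \<theta> * cos \<theta>) (at \<theta>)"
  unfolding grad_sq_upd by (auto intro!: derivative_eq_intros)

lemma ibp_field_upd_deriv:
  assumes "ibp_denom lam (k(j := \<theta>)) \<noteq> 0"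
  shows "((\<lambda>\<theta>. ibp_field j lam (k(j := \<theta>))) has_real_derivative ibp_field_deriv j lam (k(j := \<theta>))) (at \<theta>)"
proof -
  have "((\<lambda>\<theta>. ibp_denom lam (k(j := \<theta>))) has_real_derivative
      2 * grad_sq (k(j := \<theta>)) * (8 * sin \<theta> * cos \<theta>) + 2 * (Phi (k(j := \<theta>)) - lam) * (- 2 * sin \<theta>)) (at \<theta>)"
    unfolding ibp_denom_def by (auto intro!: derivative_eq_intros grad_sq_upd_deriv Phi_upd_deriv)
  note D = this
  have "((\<lambda>\<theta>. grad_sq (k(j := \<theta>)) * (- 2 * sin \<theta>)) has_real_derivative
     8 * sin \<theta> * cos \<theta> * (- 2 * sin \<theta>) + grad_sq (k(j := \<theta>)) * (- 2 * cos \<theta>)) (at \<theta>)"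
    by (auto intro!: derivative_eq_intros grad_sq_upd_deriv)
  from DERIV_divide[OF this D assms] show ?thesis
    unfolding ibp_field_def ibp_field_deriv_def by (simp only: power2_eq_square fun_upd_same)
qed

lemma ibp_field_bounds:
  assumes "lam \<in> Lambda TYPE('n::finite)"
  obtains C where "C \<ge> 0" "\<And>k j. \<bar>ibp_field j lam (k :: 'n \<Rightarrow> real)\<bar> \<le> C"
    "\<And>k j. \<bar>ibp_field_deriv j lam (k :: 'n \<Rightarrow> real)\<bar> \<le> C"
    "\<And>k :: 'n \<Rightarrow> real. \<bar>Phi k - lam\<bar> / ibp_denom lam k \<le> C"
proof -
  obtain q where q: "q > 0" "\<And>k :: 'n \<Rightarrow> real. q \<le> ibp_denom lam k"
    using ibp_denom_bounded_below[OF assms] by blast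
  define n where "n = real CARD('n)"
  have g: "0 \<le> grad_sq k" "grad_sq k \<le> 4 * n" for k :: "'n \<Rightarrow> real"
  proof -
    show "0 \<le> grad_sq k" by (simp add: grad_sq_def sum_nonneg)
    have "(2 * sin (k j))\<^sup>2 \<le> 4" for j
      using sin_squared_eq[of "k j"] by (simp add: power_mult_distrib)
    then show "grad_sq k \<le> 4 * n"
      unfolding grad_sq_def n_def using sum_bounded_above[of UNIV "\<lambda>j. (2 * sin (k j))\<^sup>2" 4] by simp
  qed
  have w: "\<bar>Phi k - lam\<bar> \<le> 4 * n" for k :: "'n \<Rightarrow> real"
    using abs_Phi_le[of k] assms unfolding Lambda_def n_def by (auto simp: abs_le_iff)
  have s: "\<bar>sin t\<bar> \<le> 1" "\<bar>cos t\<bar> \<le> 1" for t :: real by auto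
  have n0: "n \<ge> 0" by (simp add: n_def)
  define M where "M = (4 * n)\<^sup>2 + (4 * n)\<^sup>2"
  have Q: "ibp_denom lam k \<le> M" for k :: "'n \<Rightarrow> real"
  proof -
    have "(grad_sq k)\<^sup>2 \<le> (4 * n)\<^sup>2" using g[of k] by (intro power_mono) auto
    moreover have "(Phi k - lam)\<^sup>2 \<le> (4 * n)\<^sup>2"
      using w[of k] n0 by (subst power2_le_iff_abs_le) auto
    ultimately show ?thesis unfolding ibp_denom_def M_def by linarith
  qed
  define K1 where "K1 = 4 * n * 2 / q"
  define K2 where "K2 = ((16 + 4 * n * 2) * M + 4 * n * 2 * (2 * (4 * n) * 8 + 2 * (4 * n) * 2)) / q\<^sup>2"
  define K3 where "K3 = 4 * n / q"
  have M0: "M \<ge> 0" by (simp add: M_def)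
  have K: "K1 \<ge> 0" "K2 \<ge> 0" "K3 \<ge> 0"
    using q n0 M0 by (auto simp: K1_def K2_def K3_def)
  show thesis
  proof (rule that[of "K1 + K2 + K3"])
    show "K1 + K2 + K3 \<ge> 0" using K by simp
    fix k :: "'n \<Rightarrow> real" and j
    have qk: "q \<le> ibp_denom lam k" "0 < ibp_denom lam k" using q less_le_trans by auto
    have "\<bar>ibp_field j lam k\<bar> \<le> K1"
      unfolding ibp_field_def K1_def abs_divide
    proof (rule frac_le)
      show "\<bar>grad_sq k * (- 2 * sin (k j))\<bar> \<le> 4 * n * 2"
        unfolding abs_mult using g[of k] s by (intro mult_mono) auto
    qed (use q qk n0 in auto)
    then show "\<bar>ibp_field j lam k\<bar> \<le> K1 + K2 + K3" using K by linarith
    have "\<bar>Phi k - lam\<bar> / ibp_denom lam k \<le> K3"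
      unfolding K3_def by (rule frac_le) (use w q qk n0 in auto)
    then show "\<bar>Phi k - lam\<bar> / ibp_denom lam k \<le> K1 + K2 + K3" using K by linarith
    define S where "S = sin (k j)"
    define C where "C = cos (k j)"
    have SC: "\<bar>S\<bar> \<le> 1" "\<bar>C\<bar> \<le> 1" by (simp_all add: S_def C_def)
    have ab: "\<bar>grad_sq k\<bar> \<le> 4 * n" "\<bar>ibp_denom lam k\<bar> \<le> M" using g[of k] Q[of k] qk by auto
    have e1: "\<bar>8 * S * C * (- 2 * S)\<bar> \<le> 16"
    proof -
      have "\<bar>S\<bar> * \<bar>C\<bar> * \<bar>S\<bar> \<le> 1 * 1 * 1" using SC by (intro mult_mono) auto
      then show ?thesis by (simp add: abs_mult)
    qed
    have e2: "\<bar>grad_sq k * (- 2 * C)\<bar> \<le> 4 * n * 2"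
      unfolding abs_mult using ab SC n0 by (intro mult_mono) auto
    have e3: "\<bar>grad_sq k * (- 2 * S)\<bar> \<le> 4 * n * 2"
      unfolding abs_mult using ab SC n0 by (intro mult_mono) auto
    have e4: "\<bar>2 * grad_sq k * (8 * S * C)\<bar> \<le> 2 * (4 * n) * 8"
    proof -
      have "\<bar>8 * S * C\<bar> \<le> 8 * 1 * 1" unfolding abs_mult using SC by (intro mult_mono) auto
      then show ?thesis unfolding abs_mult using ab SC n0 by (intro mult_mono) auto
    qed
    have e5: "\<bar>2 * (Phi k - lam) * (- 2 * S)\<bar> \<le> 2 * (4 * n) * 2"
      unfolding abs_mult using w[of k] SC n0 by (intro mult_mono) auto
    have t1: "\<bar>(8 * S * C * (- 2 * S) + grad_sq k * (- 2 * C)) * ibp_denom lam k\<bar> \<le> (16 + 4 * n * 2) * M"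
      unfolding abs_mult[of _ "ibp_denom lam k"] using ab n0 e1 e2
      by (intro mult_mono order_trans[OF abs_triangle_ineq] add_mono) auto
    have t2: "\<bar>grad_sq k * (- 2 * S) * (2 * grad_sq k * (8 * S * C) + 2 * (Phi k - lam) * (- 2 * S))\<bar>
        \<le> 4 * n * 2 * (2 * (4 * n) * 8 + 2 * (4 * n) * 2)"
      unfolding abs_mult[of "grad_sq k * (- 2 * S)"] using e3 e4 e5 n0
      by (intro mult_mono order_trans[OF abs_triangle_ineq] add_mono) auto
    have "\<bar>ibp_field_deriv j lam k\<bar> \<le> K2"
      unfolding ibp_field_deriv_def K2_def abs_divide S_def[symmetric] C_def[symmetric]
    proof (rule frac_le)
      show "q\<^sup>2 \<le> \<bar>(ibp_denom lam k)\<^sup>2\<bar>" using q qk by (simp add: power_mono)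
      show "\<bar>(8 * S * C * (- 2 * S) + grad_sq k * (- 2 * C)) * ibp_denom lam k
          - grad_sq k * (- 2 * S) * (2 * grad_sq k * (8 * S * C) + 2 * (Phi k - lam) * (- 2 * S))\<bar>
        \<le> (16 + 4 * n * 2) * M + 4 * n * 2 * (2 * (4 * n) * 8 + 2 * (4 * n) * 2)"
        by (rule order_trans[OF abs_triangle_ineq4 add_mono[OF t1 t2]])
    qed (use q n0 M0 in auto)
    then show "\<bar>ibp_field_deriv j lam k\<bar> \<le> K1 + K2 + K3" using K by linarith
  qed
qed

lemma continuous_on_upd: "continuous_on UNIV (\<lambda>\<theta>::real. (k(j := \<theta>)) i)"
  by (cases "i = j") auto

lemma continuous_on_chi_upd: "continuous_on UNIV (\<lambda>\<theta>. chi x (k(j := \<theta>)))"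
  unfolding chi_def by (intro continuous_intros continuous_on_upd)

lemma continuous_on_Phi_upd: "continuous_on UNIV (\<lambda>\<theta>. Phi (k(j := \<theta>)))"
  unfolding Phi_def by (intro continuous_intros continuous_on_upd)

lemma continuous_on_grad_sq_upd: "continuous_on UNIV (\<lambda>\<theta>. grad_sq (k(j := \<theta>)))"
  unfolding grad_sq_def by (intro continuous_intros continuous_on_upd)

lemma sum_weight_bounds:
  "0 \<le> (\<Sum>j\<in>UNIV. \<bar>real_of_int (x $ j)\<bar>)" "0 < 1 + (\<Sum>j\<in>UNIV. \<bar>real_of_int (x $ j)\<bar>)"
  by (auto intro!: sum_nonneg add_pos_nonneg)

text \<open>The integral is, up to a factor \<open>\<i>\<close>, the derivative of \<open>green (Complex lam \<tau>) x\<close> in \<open>\<tau>\<close>.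
  As \<open>\<partial>\<^sub>j Phi / (Phi - z)\<^sup>2 = - \<partial>\<^sub>j (1 / (Phi - z))\<close>, integration by parts against \<open>ibp_field\<close> lowers
  the power of the resolvent from two to one; the derivative of the character costs a factor
  \<open>|x\<^sub>j|\<close>. The remaining first power has average of order \<open>\<tau>\<^bsup>-1/2\<^esup>\<close>.\<close>

lemma green_derivative_bound:
  assumes "lam \<in> Lambda TYPE('n::finite)"
  obtains K where "K \<ge> 0" "\<And>(x :: int ^ 'n) \<tau>. \<tau> > 0 \<Longrightarrow>
    norm (\<integral>k. chi x k / (complex_of_real (Phi k) - Complex lam \<tau>)\<^sup>2 \<partial>tor)
      \<le> K * (1 + (\<Sum>j\<in>UNIV. \<bar>real_of_int (x $ j)\<bar>)) / sqrt \<tau>"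
proof -
  obtain q where q: "q > 0" "\<And>k :: 'n \<Rightarrow> real. q \<le> ibp_denom lam k"
    using ibp_denom_bounded_below[OF assms] by blast
  have qpos: "ibp_denom lam k > 0" for k :: "'n \<Rightarrow> real" using q less_le_trans by blast
  obtain C where C: "C \<ge> 0" "\<And>k j. \<bar>ibp_field j lam (k :: 'n \<Rightarrow> real)\<bar> \<le> C"
    "\<And>k j. \<bar>ibp_field_deriv j lam (k :: 'n \<Rightarrow> real)\<bar> \<le> C"
    "\<And>k :: 'n \<Rightarrow> real. \<bar>Phi k - lam\<bar> / ibp_denom lam k \<le> C"
    using ibp_field_bounds[OF assms] by blast
  define K where "K = C * (real CARD('n) + 2) * 18"
  have "norm (\<integral>k. chi x k / (complex_of_real (Phi k) - Complex lam \<tau>)\<^sup>2 \<partial>tor)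
      \<le> K * (1 + (\<Sum>j\<in>UNIV. \<bar>real_of_int (x $ j)\<bar>)) / sqrt \<tau>" if \<tau>: "\<tau> > 0" for x :: "int ^ 'n" and \<tau>
  proof -
    define w where "w k = complex_of_real (Phi k) - Complex lam \<tau>" for k :: "'n \<Rightarrow> real"
    define \<sigma> where "\<sigma> = (\<Sum>j\<in>UNIV. \<bar>real_of_int (x $ j)\<bar>)"
    have w\<tau>: "norm (w k) \<ge> \<tau>" for k
      using norm_Phi_minus_ge[of "Complex lam \<tau>" "Phi k"] \<tau> by (simp add: w_def)
    have wn: "norm (w k) > 0" for k using w\<tau>[of k] \<tau> by linarith
    have w0: "w k \<noteq> 0" for k using wn[of k] by auto
    have wR: "\<bar>Phi k - lam\<bar> \<le> norm (w k)" for k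
      using abs_Re_le_cmod[of "w k"] by (simp add: w_def)
    have [measurable]: "w \<in> borel_measurable tor" unfolding w_def by measurable
    define N where "N j k = \<i> * real_of_int (x $ j) * chi x k * ibp_field j lam k + chi x k * ibp_field_deriv j lam k" for j k
    define W where "W j k = chi x k * ibp_field j lam k / w k" for j k
    define W' where "W' j k = N j k / w k - chi x k * ibp_field j lam k * (- 2 * sin (k j)) / (w k)\<^sup>2" for j k
    have [measurable]: "W' j \<in> borel_measurable tor" for j
      unfolding W'_def[abs_def] N_def by measurable
    have NB: "norm (N j k) \<le> C * (\<bar>real_of_int (x $ j)\<bar> + 1)" for j k
    proof -
      have "norm (N j k) \<le> \<bar>real_of_int (x $ j)\<bar> * \<bar>ibp_field j lam k\<bar> + \<bar>ibp_field_deriv j lam k\<bar>"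
        unfolding N_def by (rule order_trans[OF norm_triangle_ineq]) (simp add: norm_mult)
      also have "\<dots> \<le> \<bar>real_of_int (x $ j)\<bar> * C + C"
        using C by (intro add_mono mult_left_mono) auto
      finally show ?thesis by (simp add: algebra_simps)
    qed
    have W'B: "norm (W' j k) \<le> C * (\<bar>real_of_int (x $ j)\<bar> + 1) / \<tau> + C * 2 / \<tau>\<^sup>2" for j k
    proof -
      have "norm (W' j k) \<le> norm (N j k) / norm (w k) + (\<bar>ibp_field j lam k\<bar> * \<bar>2 * sin (k j)\<bar>) / (norm (w k))\<^sup>2"
        unfolding W'_def by (rule order_trans[OF norm_triangle_ineq4]) (simp add: norm_mult norm_divide norm_power)
      also have "\<dots> \<le> C * (\<bar>real_of_int (x $ j)\<bar> + 1) / \<tau> + C * 2 / \<tau>\<^sup>2"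
      proof (intro add_mono frac_le)
        show "\<bar>ibp_field j lam k\<bar> * \<bar>2 * sin (k j)\<bar> \<le> C * 2"
          using C by (intro mult_mono) (auto simp: abs_mult)
      qed (use NB C w\<tau> \<tau> in \<open>auto intro: power_mono\<close>)
      finally show ?thesis .
    qed
    have int0: "(\<integral>k. W' j k \<partial>tor) = 0" for j
    proof (rule tor_integral_by_parts)
      fix k :: "'n \<Rightarrow> real" and \<theta> :: real
      define u where "u = k(j := \<theta>)"
      have rd: "((\<lambda>\<theta>. complex_of_real (ibp_field j lam (k(j := \<theta>)))) has_vector_derivative complex_of_real (ibp_field_deriv j lam (k(j := \<theta>)))) (at \<theta>)"
        using qpos[of "k(j := \<theta>)"]
        by (intro has_vector_derivative_of_real ibp_field_upd_deriv) simp
      have wd: "((\<lambda>\<theta>. w (k(j := \<theta>))) has_vector_derivative complex_of_real (- 2 * sin \<theta>)) (at \<theta>)"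
        unfolding w_def diff_conv_add_uminus has_vector_derivative_add_const
        by (intro has_vector_derivative_of_real Phi_upd_deriv)
      have "((\<lambda>\<theta>. W j (k(j := \<theta>))) has_vector_derivative
          ((\<i> * real_of_int (x $ j) * chi x (k(j := \<theta>)) * ibp_field j lam (k(j := \<theta>)) + chi x (k(j := \<theta>)) * ibp_field_deriv j lam (k(j := \<theta>))) * w (k(j := \<theta>))
            - chi x (k(j := \<theta>)) * ibp_field j lam (k(j := \<theta>)) * complex_of_real (- 2 * sin \<theta>)) / (w (k(j := \<theta>)) * w (k(j := \<theta>)))) (at \<theta>)"
        unfolding W_def has_vector_derivative_def
        by (rule has_derivative_eq_rhs[OF has_derivative_divide'[OF has_derivative_mult[OF chi_upd_deriv[unfolded has_vector_derivative_def] rd[unfolded has_vector_derivative_def]] wd[unfolded has_vector_derivative_def] w0]])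
           (rule ext, simp add: u_def[symmetric] scaleR_conv_of_real field_simps w0)
      also have "((\<i> * real_of_int (x $ j) * chi x (k(j := \<theta>)) * ibp_field j lam (k(j := \<theta>)) + chi x (k(j := \<theta>)) * ibp_field_deriv j lam (k(j := \<theta>))) * w (k(j := \<theta>))
            - chi x (k(j := \<theta>)) * ibp_field j lam (k(j := \<theta>)) * complex_of_real (- 2 * sin \<theta>)) / (w (k(j := \<theta>)) * w (k(j := \<theta>))) = W' j (k(j := \<theta>))"
        using w0[of "k(j := \<theta>)"] by (simp add: W'_def N_def diff_divide_distrib add_divide_distrib power2_eq_square)
      finally show "((\<lambda>\<theta>. W j (k(j := \<theta>))) has_vector_derivative W' j (k(j := \<theta>))) (at \<theta>)" .
    next
      fix k :: "'n \<Rightarrow> real"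
      show "W j (k(j := pi)) = W j (k(j := - pi))" by (simp add: W_def ibp_field_def)
      show "continuous_on UNIV (\<lambda>\<theta>. W' j (k(j := \<theta>)))"
      proof -
        have cq: "continuous_on UNIV (\<lambda>\<theta>. ibp_denom lam (k(j := \<theta>)))"
          unfolding ibp_denom_def by (intro continuous_intros continuous_on_Phi_upd continuous_on_grad_sq_upd)
        have cw: "continuous_on UNIV (\<lambda>\<theta>. w (k(j := \<theta>)))"
          unfolding w_def by (intro continuous_intros continuous_on_Phi_upd)
        have q0: "ibp_denom lam (k(j := \<theta>)) \<noteq> 0" for \<theta> using qpos[of "k(j := \<theta>)"] by linarith
        have cr: "continuous_on UNIV (\<lambda>\<theta>. ibp_field j lam (k(j := \<theta>)))"
          unfolding ibp_field_def fun_upd_same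
          by (intro continuous_on_divide cq ballI q0 continuous_intros continuous_on_grad_sq_upd)
        have cd: "continuous_on UNIV (\<lambda>\<theta>. ibp_field_deriv j lam (k(j := \<theta>)))"
          unfolding ibp_field_deriv_def fun_upd_same
          by (intro continuous_on_divide cq ballI power_not_zero q0 continuous_intros continuous_on_grad_sq_upd continuous_on_Phi_upd)
        have "continuous_on UNIV (\<lambda>\<theta>. N j (k(j := \<theta>)))"
          unfolding N_def by (intro continuous_intros continuous_on_chi_upd cr cd)
        then show ?thesis
          unfolding W'_def fun_upd_same
          by (intro continuous_on_diff continuous_on_divide cw ballI power_not_zero w0 continuous_on_mult
              continuous_on_chi_upd continuous_on_of_real cr continuous_on_power continuous_intros)
      qed
    qed (use W'B in auto)
    \<comment> \<open>\<open>rest\<close> collects what is left of \<open>chi x k / (w k)\<^sup>2\<close> after the exact derivatives \<open>W' j\<close> are removed.\<close>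
    define rest where "rest k = (\<Sum>j\<in>UNIV. N j k / w k) + chi x k * complex_of_real ((Phi k - lam)\<^sup>2 / ibp_denom lam k) / (w k)\<^sup>2" for k
    have rest_eq: "chi x k / (w k)\<^sup>2 = rest k - (\<Sum>j\<in>UNIV. W' j k)" for k
    proof -
      have "(\<Sum>j\<in>UNIV. ibp_field j lam k * (- 2 * sin (k j))) = (grad_sq k)\<^sup>2 / ibp_denom lam k"
        unfolding ibp_field_def by (simp add: sum_divide_distrib[symmetric] grad_sq_def power2_eq_square sum_distrib_left algebra_simps)
      then have "(\<Sum>j\<in>UNIV. ibp_field j lam k * (- 2 * sin (k j))) + (Phi k - lam)\<^sup>2 / ibp_denom lam k = 1"
        using qpos[of k] by (simp add: add_divide_distrib[symmetric]) (simp add: ibp_denom_def)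
      then have 1: "(\<Sum>j\<in>UNIV. complex_of_real (ibp_field j lam k * (- 2 * sin (k j)))) + complex_of_real ((Phi k - lam)\<^sup>2 / ibp_denom lam k) = 1"
        using arg_cong[where f=complex_of_real] unfolding of_real_sum[symmetric] of_real_add[symmetric] by fastforce
      have "rest k - (\<Sum>j\<in>UNIV. W' j k) = chi x k / (w k)\<^sup>2 *
         ((\<Sum>j\<in>UNIV. complex_of_real (ibp_field j lam k * (- 2 * sin (k j)))) + complex_of_real ((Phi k - lam)\<^sup>2 / ibp_denom lam k))"
      proof -
        have "W' j k = N j k / w k - chi x k / (w k)\<^sup>2 * complex_of_real (ibp_field j lam k * (- 2 * sin (k j)))" for j
          by (simp add: W'_def)
        then have "(\<Sum>j\<in>UNIV. W' j k) = (\<Sum>j\<in>UNIV. N j k / w k) -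
            chi x k / (w k)\<^sup>2 * (\<Sum>j\<in>UNIV. complex_of_real (ibp_field j lam k * (- 2 * sin (k j))))"
          by (simp only: sum_subtractf sum_distrib_left)
        moreover have "rest k = (\<Sum>j\<in>UNIV. N j k / w k) + chi x k / (w k)\<^sup>2 * complex_of_real ((Phi k - lam)\<^sup>2 / ibp_denom lam k)"
          by (simp add: rest_def)
        ultimately show ?thesis by (simp only: distrib_left) simp
      qed
      then show ?thesis by (simp only: 1 mult_1_right)
    qed
    have restB: "norm (rest k) \<le> (C * (\<sigma> + real CARD('n) + 1)) * (1 / norm (w k))" for k
    proof -
      have "norm (rest k) \<le> (\<Sum>j\<in>UNIV. norm (N j k) / norm (w k)) + norm (chi x k * complex_of_real ((Phi k - lam)\<^sup>2 / ibp_denom lam k) / (w k)\<^sup>2)"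
        unfolding rest_def by (rule order_trans[OF norm_triangle_ineq add_right_mono[OF order_trans[OF norm_sum]]]) (simp add: norm_divide)
      also have "(\<Sum>j\<in>UNIV. norm (N j k) / norm (w k)) \<le> (\<Sum>j\<in>UNIV. C * (\<bar>real_of_int (x $ j)\<bar> + 1) / norm (w k))"
        by (intro sum_mono divide_right_mono NB) simp
      also have "\<dots> = C * (\<sigma> + real CARD('n)) * (1 / norm (w k))"
        by (simp add: \<sigma>_def sum.distrib sum_divide_distrib[symmetric] sum_distrib_left[symmetric])
      also have "norm (chi x k * complex_of_real ((Phi k - lam)\<^sup>2 / ibp_denom lam k) / (w k)\<^sup>2)
          = \<bar>Phi k - lam\<bar> / ibp_denom lam k * (\<bar>Phi k - lam\<bar> / norm (w k)) * (1 / norm (w k))"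
      proof -
        have "\<bar>(Phi k - lam)\<^sup>2 / ibp_denom lam k\<bar> = \<bar>Phi k - lam\<bar> / ibp_denom lam k * \<bar>Phi k - lam\<bar>"
          using qpos[of k] by (simp add: abs_mult power2_eq_square)
        then show ?thesis
          by (simp only: norm_mult norm_divide norm_of_real norm_power norm_chi) (simp add: power2_eq_square)
      qed
      also have "\<dots> \<le> C * 1 * (1 / norm (w k))"
        using C(1) C(4)[of k] wR[of k] wn[of k] qpos[of k] by (intro mult_right_mono mult_mono) auto
      finally show ?thesis by (simp add: algebra_simps)
    qed
    have [measurable]: "rest \<in> borel_measurable tor" unfolding rest_def N_def by measurable
    have iw: "integrable tor (\<lambda>k. 1 / norm (w k))"
      unfolding w_def using \<tau> by (intro integrable_inverse_resolvent) simp
    have irest: "integrable tor rest"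
      by (rule Bochner_Integration.integrable_bound[OF integrable_mult_right[OF iw, of "C * (\<sigma> + real CARD('n) + 1)"]])
         (measurable, intro AE_I2, unfold real_norm_def, rule order_trans[OF restB abs_ge_self])
    have iW: "integrable tor (W' j)" for j by (rule integrable_tor_bounded[OF _ W'B]) measurable
    have "(\<integral>k. chi x k / (w k)\<^sup>2 \<partial>tor) = (\<integral>k. rest k \<partial>tor)"
      unfolding rest_eq using irest iW by (simp add: int0)
    also have "norm \<dots> \<le> (\<integral>k. norm (rest k) \<partial>tor)" by simp
    also have "\<dots> \<le> (\<integral>k. (C * (\<sigma> + real CARD('n) + 1)) * (1 / norm (w k)) \<partial>tor)"
      by (intro integral_mono integrable_norm irest integrable_mult_right iw restB)
    also have "\<dots> = (C * (\<sigma> + real CARD('n) + 1)) * (\<integral>k. 1 / norm (w k) \<partial>tor)" by (simp del: times_divide_eq_right)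
    also have "\<dots> \<le> (C * (\<sigma> + real CARD('n) + 1)) * (18 / sqrt \<tau>)"
      using tor_resolvent_bound[where 'n='n, of "Complex lam \<tau>"] \<tau> C(1) sum_weight_bounds(1)[of x]
      by (intro mult_left_mono mult_nonneg_nonneg) (auto simp: w_def \<sigma>_def)
    also have "\<dots> \<le> (C * ((real CARD('n) + 2) * (1 + \<sigma>))) * (18 / sqrt \<tau>)"
      using C(1) \<tau> sum_weight_bounds(1)[of x]
      by (intro mult_right_mono mult_left_mono) (auto simp: \<sigma>_def algebra_simps)
    also have "\<dots> = K * (1 + \<sigma>) / sqrt \<tau>" by (simp add: K_def)
    finally show ?thesis by (simp only: w_def \<sigma>_def)
  qed
  then show thesis using C(1) by (intro that[of K]) (auto simp: K_def)
qed

text \<open>A product over the coordinates, so that weighted sums over boxes factor into one-dimensional ones.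
  The exponent \<open>3/4\<close> is that of the interpolation below.\<close>

definition rho :: "int ^ 'n::finite \<Rightarrow> real" where
  "rho x = (\<Prod>j\<in>UNIV. (1 + \<bar>real_of_int (x $ j)\<bar>) powr (3 / 4))"

lemma one_plus_sum_le_prod:
  fixes a :: "'a \<Rightarrow> real"
  assumes "finite I" "\<And>i. i \<in> I \<Longrightarrow> a i \<ge> 0"
  shows "1 + (\<Sum>i\<in>I. a i) \<le> (\<Prod>i\<in>I. 1 + a i)"
  using assms
proof (induction rule: finite_induct)
  case (insert i I)
  have "(\<Sum>i\<in>I. a i) \<ge> 0" using insert by (intro sum_nonneg) auto
  then have "1 + (\<Sum>j\<in>insert i I. a j) \<le> (1 + a i) * (1 + (\<Sum>j\<in>I. a j))"
    using insert by (simp add: algebra_simps)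
  also have "\<dots> \<le> (1 + a i) * (\<Prod>i\<in>I. 1 + a i)"
    using insert by (intro mult_left_mono) auto
  finally show ?case using insert by simp
qed simp

lemma rho_ge: "(1 + (\<Sum>j\<in>UNIV. \<bar>real_of_int (x $ j)\<bar>)) powr (3 / 4) \<le> rho x"
proof -
  have "rho x = (\<Prod>j\<in>UNIV. 1 + \<bar>real_of_int (x $ j)\<bar>) powr (3 / 4)"
    unfolding rho_def by (rule prod_powr_distrib[symmetric])
  then show ?thesis
    using one_plus_sum_le_prod[of UNIV "\<lambda>j. \<bar>real_of_int (x $ j)\<bar>"] sum_weight_bounds(2)[of x]
    by (auto intro!: powr_mono2)
qed

lemma rho_ge_1: "1 \<le> rho x"
  unfolding rho_def by (intro prod_ge_1 ge_one_powr_ge_zero) auto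

lemma rho_diff: "rho (x - y) \<le> rho x * rho y"
  unfolding rho_def prod.distrib[symmetric]
proof (intro prod_mono conjI)
  fix j
  have "1 + \<bar>real_of_int ((x - y) $ j)\<bar> \<le> (1 + \<bar>real_of_int (x $ j)\<bar>) * (1 + \<bar>real_of_int (y $ j)\<bar>)"
    by (simp add: algebra_simps) (smt (verit) mult_nonneg_nonneg)
  then have "(1 + \<bar>real_of_int ((x - y) $ j)\<bar>) powr (3 / 4)
      \<le> ((1 + \<bar>real_of_int (x $ j)\<bar>) * (1 + \<bar>real_of_int (y $ j)\<bar>)) powr (3 / 4)"
    by (intro powr_mono2) auto
  then show "(1 + \<bar>real_of_int ((x - y) $ j)\<bar>) powr (3 / 4)
      \<le> (1 + \<bar>real_of_int (x $ j)\<bar>) powr (3 / 4) * (1 + \<bar>real_of_int (y $ j)\<bar>) powr (3 / 4)"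
    by (simp add: powr_mult)
qed auto

lemma green_derivative_trivial_bound:
  assumes "\<tau> > 0"
  shows "norm (\<integral>k. chi x k / (complex_of_real (Phi k) - Complex lam \<tau>)\<^sup>2 \<partial>tor) \<le> 18 / (\<tau> * sqrt \<tau>)"
proof -
  define w where "w k = complex_of_real (Phi k) - Complex lam \<tau>" for k :: "'a \<Rightarrow> real"
  have w\<tau>: "norm (w k) \<ge> \<tau>" for k
    using norm_Phi_minus_ge[of "Complex lam \<tau>" "Phi k"] assms by (simp add: w_def)
  have wn: "norm (w k) > 0" for k using w\<tau>[of k] assms by linarith
  have [measurable]: "w \<in> borel_measurable tor" unfolding w_def by measurable
  have le: "norm (chi x k / (w k)\<^sup>2) \<le> (1 / \<tau>) * (1 / norm (w k))" for k
  proof -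
    have "norm (chi x k / (w k)\<^sup>2) = (1 / norm (w k)) * (1 / norm (w k))"
      by (simp add: norm_divide norm_mult power2_eq_square)
    also have "\<dots> \<le> (1 / \<tau>) * (1 / norm (w k))"
      using w\<tau>[of k] wn[of k] assms by (intro mult_right_mono frac_le) auto
    finally show ?thesis .
  qed
  have iw: "integrable tor (\<lambda>k. 1 / norm (w k))"
    unfolding w_def using assms by (intro integrable_inverse_resolvent) simp
  have i1: "integrable tor (\<lambda>k. chi x k / (w k)\<^sup>2)"
    by (rule Bochner_Integration.integrable_bound[OF integrable_mult_right[OF iw, of "1 / \<tau>"]])
       (measurable, intro AE_I2, unfold real_norm_def, rule order_trans[OF le abs_ge_self])
  have "norm (\<integral>k. chi x k / (w k)\<^sup>2 \<partial>tor) \<le> (\<integral>k. norm (chi x k / (w k)\<^sup>2) \<partial>tor)" by simp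
  also have "\<dots> \<le> (\<integral>k. (1 / \<tau>) * (1 / norm (w k)) \<partial>tor)"
    by (intro integral_mono integrable_norm i1 integrable_mult_right iw le)
  also have "\<dots> = (1 / \<tau>) * (\<integral>k. 1 / norm (w k) \<partial>tor)" by (simp only: integral_mult_right_zero)
  also have "\<dots> \<le> (1 / \<tau>) * (18 / sqrt \<tau>)"
    using tor_resolvent_bound[where 'n='a, of "Complex lam \<tau>"] assms
    by (intro mult_left_mono) (auto simp: w_def)
  finally show ?thesis by (simp add: w_def)
qed

lemma green_has_vector_derivative:
  assumes "\<tau> > 0"
  shows "((\<lambda>\<tau>. green (Complex lam \<tau>) x) has_vector_derivative
    \<i> * (\<integral>k. chi x k / (complex_of_real (Phi k) - Complex lam \<tau>)\<^sup>2 \<partial>tor)) (at \<tau>)"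
proof -
  let ?w = "\<lambda>s k. complex_of_real (Phi (k :: 'a \<Rightarrow> real)) - Complex lam s"
  have wge: "s \<le> norm (?w s k)" if "s > 0" for s k
    using norm_Phi_minus_ge[of "Complex lam s" "Phi k"] that by simp
  have "((\<lambda>\<tau>. \<integral>k. chi x k / ?w \<tau> k \<partial>tor) has_vector_derivative (\<integral>k. \<i> * (chi x k / (?w \<tau> k)\<^sup>2) \<partial>tor)) (at \<tau>)"
  proof (rule has_vector_derivative_integral[OF tor.prob_space_axioms, where a="\<tau> / 2" and b="2 * \<tau>" and
        f="\<lambda>s k. chi x k / ?w s k" and f'="\<lambda>s k. \<i> * (chi x k / (?w s k)\<^sup>2)"])
    fix s k assume s: "\<tau> / 2 < s" "s < 2 * \<tau>"
    have s0: "s > 0" and wn: "norm (?w s k) > 0" "\<tau> / 2 \<le> norm (?w s k)"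
      using s assms wge[of s k] by linarith+
    show "norm (chi x k / ?w s k) \<le> 1 / (\<tau> / 2)"
      unfolding norm_divide norm_chi using wn assms by (intro frac_le) auto
    show "norm (\<i> * (chi x k / (?w s k)\<^sup>2)) \<le> 1 / (\<tau> / 2)\<^sup>2"
      unfolding norm_divide norm_mult norm_power norm_chi norm_ii mult_1_left using wn assms by (intro frac_le power_mono) auto
    have eq: "?w s k = complex_of_real (Phi k - lam) - \<i> * s" for s k
      by (simp add: Complex_eq)
    have "?w s k \<noteq> 0" using wn by auto
    then have "((\<lambda>s. chi x k / (complex_of_real (Phi k - lam) - \<i> * s)) has_derivative
        (\<lambda>h. h *\<^sub>R (\<i> * (chi x k / (complex_of_real (Phi k - lam) - \<i> * s)\<^sup>2)))) (at s)"
      unfolding eq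
      by (auto intro!: derivative_eq_intros ext simp: scaleR_conv_of_real power2_eq_square field_simps)
    then show "((\<lambda>s. chi x k / ?w s k) has_vector_derivative \<i> * (chi x k / (?w s k)\<^sup>2)) (at s)"
      unfolding eq has_vector_derivative_def .
  qed (use assms in auto)
  then show ?thesis by (simp only: green_def integral_mult_right_zero)
qed

text \<open>The interpolation step: of the two bounds of order \<open>|x| \<tau>\<^bsup>-1/2\<^esup>\<close> and \<open>\<tau>\<^bsup>-3/2\<^esup>\<close> for the
  derivative of the kernel neither suffices. The second is not integrable at \<open>\<tau> = 0\<close>, and the growth
  in \<open>x\<close> of the first is too strong for the decay of packets established later. The weights \<open>3/4\<close>
  and \<open>1/4\<close> give \<open>|x|\<^bsup>3/4\<^esup> \<tau>\<^bsup>-3/4\<^esup>\<close>, which does both.\<close>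

lemma powr_three_quarters:
  fixes X a b :: real
  assumes "0 \<le> X" "X \<le> a" "X \<le> b"
  shows "X \<le> a powr (3 / 4) * b powr (1 / 4)"
proof -
  have "X = X powr (3 / 4) * X powr (1 / 4)"
    using assms by (simp add: powr_add[symmetric])
  also have "\<dots> \<le> a powr (3 / 4) * b powr (1 / 4)"
    using assms by (intro mult_mono powr_mono2) auto
  finally show ?thesis .
qed

lemma green_increment_bound:
  assumes "lam \<in> Lambda TYPE('n::finite)"
  obtains K where "K \<ge> 0" "\<And>(x :: int ^ 'n) a b. 0 < a \<Longrightarrow> a < b \<Longrightarrow>
    norm (green (Complex lam b) x - green (Complex lam a) x) \<le> K * rho x * (b powr (1 / 4) - a powr (1 / 4))"
proof -
  obtain K0 where K0: "K0 \<ge> 0" "\<And>(x :: int ^ 'n) \<tau>. \<tau> > 0 \<Longrightarrow>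
    norm (\<integral>k. chi x k / (complex_of_real (Phi k) - Complex lam \<tau>)\<^sup>2 \<partial>tor)
      \<le> K0 * (1 + (\<Sum>j\<in>UNIV. \<bar>real_of_int (x $ j)\<bar>)) / sqrt \<tau>"
    using green_derivative_bound[OF assms] by blast
  define K1 where "K1 = K0 powr (3 / 4) * 18 powr (1 / 4)"
  have K1: "K1 \<ge> 0" by (simp add: K1_def)
  have bound: "norm (\<i> * (\<integral>k. chi x k / (complex_of_real (Phi k) - Complex lam \<tau>)\<^sup>2 \<partial>tor))
      \<le> K1 * rho x * \<tau> powr (- (3 / 4))" if \<tau>: "\<tau> > 0" for x :: "int ^ 'n" and \<tau>
  proof -
    define \<sigma> where "\<sigma> = 1 + (\<Sum>j\<in>UNIV. \<bar>real_of_int (x $ j)\<bar>)"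
    have \<sigma>: "\<sigma> > 0" using sum_weight_bounds(2)[of x] by (simp add: \<sigma>_def)
    let ?X = "norm (\<integral>k. chi x k / (complex_of_real (Phi k) - Complex lam \<tau>)\<^sup>2 \<partial>tor)"
    have "?X \<le> K0 * \<sigma> / sqrt \<tau>" using K0(2)[OF \<tau>, of x] by (simp add: \<sigma>_def)
    also have "\<dots> = K0 * \<sigma> * \<tau> powr (- (1 / 2))"
    proof -
      have "\<tau> powr (- (1 / 2)) = inverse (sqrt \<tau>)"
        unfolding powr_minus using \<tau> by (simp only: powr_half_sqrt less_imp_le)
      then show ?thesis by (simp only: divide_inverse[of "K0 * \<sigma>"])
    qed
    finally have a: "?X \<le> K0 * \<sigma> * \<tau> powr (- (1 / 2))" .
    have "?X \<le> 18 / (\<tau> * sqrt \<tau>)" by (rule green_derivative_trivial_bound[OF \<tau>])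
    also have "\<dots> = 18 * \<tau> powr (- (3 / 2))"
    proof -
      have "\<tau> powr (3 / 2) = \<tau> powr (1 + 1 / 2)" by simp
      also have "\<dots> = \<tau> * sqrt \<tau>" unfolding powr_add using \<tau> by (simp add: powr_half_sqrt)
      finally have "\<tau> powr (- (3 / 2)) = inverse (\<tau> * sqrt \<tau>)"
        unfolding powr_minus by (rule arg_cong)
      then show ?thesis by (simp only: divide_inverse[of 18])
    qed
    finally have b: "?X \<le> 18 * \<tau> powr (- (3 / 2))" .
    have "?X \<le> (K0 * \<sigma> * \<tau> powr (- (1 / 2))) powr (3 / 4) * (18 * \<tau> powr (- (3 / 2))) powr (1 / 4)"
      by (rule powr_three_quarters[OF _ a b]) simp
    also have "\<dots> = K1 * \<sigma> powr (3 / 4) * (\<tau> powr (- (3 / 8)) * \<tau> powr (- (3 / 8)))"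
    proof -
      have "(K0 * \<sigma> * \<tau> powr (- (1 / 2))) powr (3 / 4) = K0 powr (3 / 4) * \<sigma> powr (3 / 4) * \<tau> powr (- (1 / 2) * (3 / 4))"
        by (simp only: powr_mult powr_powr)
      moreover have "(18 * \<tau> powr (- (3 / 2))) powr (1 / 4) = 18 powr (1 / 4) * \<tau> powr (- (3 / 2) * (1 / 4))"
        by (simp only: powr_mult powr_powr)
      moreover have "- (1 / 2) * (3 / 4) = (- (3 / 8) :: real)" "- (3 / 2) * (1 / 4) = (- (3 / 8) :: real)" by simp_all
      ultimately show ?thesis by (simp only: K1_def ac_simps)
    qed
    also have "\<tau> powr (- (3 / 8)) * \<tau> powr (- (3 / 8)) = \<tau> powr (- (3 / 4))"
      by (simp add: powr_add[symmetric])
    also have "K1 * \<sigma> powr (3 / 4) * \<tau> powr (- (3 / 4)) \<le> K1 * rho x * \<tau> powr (- (3 / 4))"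
      using rho_ge[of x] K1 by (intro mult_right_mono mult_left_mono) (auto simp: \<sigma>_def)
    finally show ?thesis by (simp add: norm_mult)
  qed
  have "norm (green (Complex lam b) x - green (Complex lam a) x) \<le> 4 * K1 * rho x * (b powr (1 / 4) - a powr (1 / 4))"
    if ab: "0 < a" "a < b" for x :: "int ^ 'n" and a b
  proof -
    let ?\<phi> = "\<lambda>\<tau>. 4 * K1 * rho x * \<tau> powr (1 / 4)"
    have "norm (green (Complex lam b) x - green (Complex lam a) x) \<le> ?\<phi> b - ?\<phi> a"
    proof (rule differentiable_bound_general[OF ab(2)])
      have g: "((\<lambda>\<tau>. green (Complex lam \<tau>) x) has_vector_derivative
        \<i> * (\<integral>k. chi x k / (complex_of_real (Phi k) - Complex lam \<tau>)\<^sup>2 \<partial>tor)) (at \<tau>)" if "a \<le> \<tau>" for \<tau>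
        using that ab by (intro green_has_vector_derivative) simp
      then show "continuous_on {a..b} (\<lambda>\<tau>. green (Complex lam \<tau>) x)"
        by (intro continuous_at_imp_continuous_on ballI has_vector_derivative_continuous) auto
      show "continuous_on {a..b} ?\<phi>" using ab by (intro continuous_intros) auto
      fix \<tau> assume \<tau>: "a < \<tau>" "\<tau> < b"
      show "((\<lambda>\<tau>. green (Complex lam \<tau>) x) has_vector_derivative
        \<i> * (\<integral>k. chi x k / (complex_of_real (Phi k) - Complex lam \<tau>)\<^sup>2 \<partial>tor)) (at \<tau>)"
        using g \<tau> by simp
      have "(?\<phi> has_real_derivative 4 * K1 * rho x * ((1 / 4) * \<tau> powr (1 / 4 - 1))) (at \<tau>)"
        using \<tau> ab by (intro DERIV_cmult has_real_derivative_powr) simp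
      then show "(?\<phi> has_vector_derivative K1 * rho x * \<tau> powr (- (3 / 4))) (at \<tau>)"
        by (simp add: has_real_derivative_iff_has_vector_derivative mult.assoc)
      show "norm (\<i> * (\<integral>k. chi x k / (complex_of_real (Phi k) - Complex lam \<tau>)\<^sup>2 \<partial>tor))
          \<le> K1 * rho x * \<tau> powr (- (3 / 4))"
        using \<tau> ab by (intro bound) simp
    qed
    then show ?thesis by (simp add: algebra_simps)
  qed
  then show thesis using K1 by (intro that[of "4 * K1"]) auto
qed

text \<open>The kernel is Hoelder continuous of order \<open>1/4\<close> in \<open>\<epsilon>\<close> down to \<open>0\<close>, so the boundary values
  exist. The explicit rate, with its mild growth in \<open>x\<close>, allows the limit to be exchanged with infinite
  sums over the lattice.\<close>

lemma limiting_absorption: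
  assumes "lam \<in> Lambda TYPE('n::finite)"
  obtains K G where "K \<ge> 0" "\<And>(x :: int ^ 'n) \<epsilon>. 0 < \<epsilon> \<Longrightarrow>
    norm (green (Complex lam \<epsilon>) x - G x) \<le> K * rho x * \<epsilon> powr (1 / 4)"
proof -
  obtain K where K: "K \<ge> 0" "\<And>(x :: int ^ 'n) a b. 0 < a \<Longrightarrow> a < b \<Longrightarrow>
    norm (green (Complex lam b) x - green (Complex lam a) x) \<le> K * rho x * (b powr (1 / 4) - a powr (1 / 4))"
    using green_increment_bound[OF assms] by blast
  have inc: "norm (green (Complex lam b) x - green (Complex lam a) x) \<le> K * rho x * b powr (1 / 4)"
    if "0 < a" "a \<le> b" for x :: "int ^ 'n" and a b
  proof (cases "a = b")
    case True
    then show ?thesis using K(1) rho_ge_1[of x] by simp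
  next
    case False
    then have "norm (green (Complex lam b) x - green (Complex lam a) x) \<le> K * rho x * (b powr (1 / 4) - a powr (1 / 4))"
      using that by (intro K(2)) auto
    also have "\<dots> \<le> K * rho x * b powr (1 / 4)"
      using K(1) rho_ge_1[of x] by (intro mult_left_mono) auto
    finally show ?thesis .
  qed
  define e where "e n = inverse (real (Suc n))" for n
  have e: "e n > 0" "e \<longlonglongrightarrow> 0" for n
    unfolding e_def by (simp, rule LIMSEQ_inverse_real_of_nat)
  have ep: "(\<lambda>n. K * rho x * e n powr (1 / 4)) \<longlonglongrightarrow> 0" for x :: "int ^ 'n"
    using tendsto_powr'[OF e(2) tendsto_const[of "1 / 4"]] e(1) by (auto intro!: tendsto_mult_right_zero simp: less_imp_le)
  have "\<exists>g. (\<lambda>n. green (Complex lam (e n)) x) \<longlonglongrightarrow> g" for x :: "int ^ 'n"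
  proof -
    have "Cauchy (\<lambda>n. green (Complex lam (e n)) x)"
    proof (rule CauchyI')
      fix r :: real assume "r > 0"
      then obtain M where M: "\<And>n. n \<ge> M \<Longrightarrow> norm (K * rho x * e n powr (1 / 4)) < r"
        using LIMSEQ_D[OF ep[of x]] by auto
      have "norm (green (Complex lam (e m)) x - green (Complex lam (e n)) x) < r" if "m \<ge> M" "n > m" for m n
      proof -
        have "e n \<le> e m" using that by (simp add: e_def le_imp_inverse_le)
        then have "norm (green (Complex lam (e m)) x - green (Complex lam (e n)) x) \<le> K * rho x * e m powr (1 / 4)"
          by (intro inc e)
        also have "\<dots> < r" using M[OF that(1)] by (auto simp: abs_less_iff)
        finally show ?thesis .
      qed
      then show "\<exists>M. \<forall>m\<ge>M. \<forall>n>m. dist (green (Complex lam (e m)) x) (green (Complex lam (e n)) x) < r"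
        by (auto simp: dist_norm)
    qed
    then show ?thesis by (simp add: Cauchy_convergent_iff convergent_def)
  qed
  then obtain G where G: "\<And>x :: int ^ 'n. (\<lambda>n. green (Complex lam (e n)) x) \<longlonglongrightarrow> G x" by metis
  have "norm (green (Complex lam \<epsilon>) x - G x) \<le> K * rho x * \<epsilon> powr (1 / 4)" if "0 < \<epsilon>" for x :: "int ^ 'n" and \<epsilon>
  proof (rule tendsto_upperbound)
    show "(\<lambda>n. norm (green (Complex lam \<epsilon>) x - green (Complex lam (e n)) x)) \<longlonglongrightarrow> norm (green (Complex lam \<epsilon>) x - G x)"
      by (intro tendsto_intros G)
    have "eventually (\<lambda>n. e n < \<epsilon>) sequentially"
      using e(2) that by (rule order_tendstoD(2))
    then show "eventually (\<lambda>n. norm (green (Complex lam \<epsilon>) x - green (Complex lam (e n)) x) \<le> K * rho x * \<epsilon> powr (1 / 4)) sequentially"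
      by eventually_elim (auto intro!: inc e)
  qed simp
  then show thesis using K(1) by (intro that[of K G])
qed

section \<open>One-dimensional wave packets\<close>

text \<open>A window that is only twice continuously differentiable: two integrations by parts are all that
  is needed, and its derivatives have closed forms.\<close>

definition bump :: "real \<Rightarrow> real \<Rightarrow> real \<Rightarrow> real" where
  "bump \<kappa> r k = max 0 (r\<^sup>2 - (k - \<kappa>)\<^sup>2) ^ 3"

definition bump' :: "real \<Rightarrow> real \<Rightarrow> real \<Rightarrow> real" where
  "bump' \<kappa> r k = - 6 * max 0 (r\<^sup>2 - (k - \<kappa>)\<^sup>2) ^ 2 * (k - \<kappa>)"

definition bump'' :: "real \<Rightarrow> real \<Rightarrow> real \<Rightarrow> real" where
  "bump'' \<kappa> r k = 24 * max 0 (r\<^sup>2 - (k - \<kappa>)\<^sup>2) * (k - \<kappa>)\<^sup>2 - 6 * max 0 (r\<^sup>2 - (k - \<kappa>)\<^sup>2) ^ 2"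

text \<open>The solution of \<open>\<i> \<partial>\<^sub>t u = \<Delta> u\<close> on \<open>\<int>\<close> whose initial Fourier transform is \<open>bump \<kappa> r\<close>. Its phase
  is stationary where \<open>n = - 2 t sin k\<close>, so it travels with velocity about \<open>- 2 sin \<kappa>\<close>.\<close>

definition packet1 :: "real \<Rightarrow> real \<Rightarrow> int \<Rightarrow> real \<Rightarrow> complex" where
  "packet1 \<kappa> r n t = (\<integral>k. complex_of_real (bump \<kappa> r k) * cis (real_of_int n * k - 2 * t * cos k) \<partial>circ)"

lemma DERIV_max_0_power:
  fixes y :: real
  assumes "n \<ge> 1"
  shows "((\<lambda>y. max 0 y ^ Suc n) has_real_derivative real (Suc n) * max 0 y ^ n) (at y)"
proof (cases "y = 0")
  case True
  have "(\<lambda>h::real. max 0 h ^ Suc n / h) \<midarrow>0\<rightarrow> 0"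
  proof (rule Lim_null_comparison)
    show "eventually (\<lambda>h::real. norm (max 0 h ^ Suc n / h) \<le> \<bar>h\<bar> ^ n) (at 0)"
      by (intro always_eventually allI) (auto simp: max_def)
    have "\<bar>0::real\<bar> ^ n = 0" using assms by simp
    moreover have "(\<lambda>h::real. \<bar>h\<bar> ^ n) \<midarrow>0\<rightarrow> \<bar>0\<bar> ^ n" by (intro tendsto_intros)
    ultimately show "(\<lambda>h::real. \<bar>h\<bar> ^ n) \<midarrow>0\<rightarrow> 0" by (simp only:)
  qed
  then show ?thesis using True assms by (simp add: DERIV_def power_0_left)
next
  case False
  show ?thesis
  proof (cases "y > 0")
    case True
    have "((\<lambda>y. y ^ Suc n) has_real_derivative real (Suc n) * y ^ n) (at y)"
      by (rule DERIV_cong[OF DERIV_pow]) simp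
    then have "((\<lambda>y. max 0 y ^ Suc n) has_real_derivative real (Suc n) * y ^ n) (at y)"
      by (rule has_field_derivative_transform_within_open[of _ _ _ "{0<..}"]) (use True in auto)
    then show ?thesis using True by simp
  next
    case F: False
    have "((\<lambda>y. 0) has_real_derivative 0) (at y)" by simp
    then have "((\<lambda>y. max 0 y ^ Suc n) has_real_derivative 0) (at y)"
      by (rule has_field_derivative_transform_within_open[of _ _ _ "{..<0}"]) (use F False in auto)
    then show ?thesis using F assms by (simp add: power_0_left)
  qed
qed

lemma bump_deriv: "(bump \<kappa> r has_real_derivative bump' \<kappa> r k) (at k)"
proof -
  have "((\<lambda>k. max 0 (r\<^sup>2 - (k - \<kappa>)\<^sup>2) ^ Suc 2) has_real_derivative
      real (Suc 2) * max 0 (r\<^sup>2 - (k - \<kappa>)\<^sup>2) ^ 2 * (- (2 * (k - \<kappa>)))) (at k)"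
    by (rule DERIV_chain2[OF DERIV_max_0_power]) (auto intro!: derivative_eq_intros)
  moreover have "real (Suc 2) * max 0 (r\<^sup>2 - (k - \<kappa>)\<^sup>2) ^ 2 * (- (2 * (k - \<kappa>))) = bump' \<kappa> r k"
    by (simp add: bump'_def algebra_simps)
  moreover have "(\<lambda>k. max 0 (r\<^sup>2 - (k - \<kappa>)\<^sup>2) ^ Suc 2) = bump \<kappa> r"
    by (simp add: bump_def[abs_def])
  ultimately show ?thesis by (simp only:)
qed

lemma bump'_deriv: "(bump' \<kappa> r has_real_derivative bump'' \<kappa> r k) (at k)"
proof -
  have "((\<lambda>k. max 0 (r\<^sup>2 - (k - \<kappa>)\<^sup>2) ^ Suc 1) has_real_derivative
      real (Suc 1) * max 0 (r\<^sup>2 - (k - \<kappa>)\<^sup>2) ^ 1 * (- (2 * (k - \<kappa>)))) (at k)"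
    by (rule DERIV_chain2[OF DERIV_max_0_power]) (auto intro!: derivative_eq_intros)
  then have *: "((\<lambda>k. max 0 (r\<^sup>2 - (k - \<kappa>)\<^sup>2) ^ 2) has_real_derivative
      2 * max 0 (r\<^sup>2 - (k - \<kappa>)\<^sup>2) * (- (2 * (k - \<kappa>)))) (at k)"
    by (simp add: numeral_2_eq_2)
  show ?thesis
    unfolding bump'_def[abs_def] bump''_def
    by (rule derivative_eq_intros * | simp)+ (simp add: algebra_simps power2_eq_square)
qed

lemma bump_support:
  assumes "0 \<le> r" "r \<le> \<bar>k - \<kappa>\<bar>"
  shows "bump \<kappa> r k = 0" "bump' \<kappa> r k = 0" "bump'' \<kappa> r k = 0"
proof -
  have "r\<^sup>2 \<le> (k - \<kappa>)\<^sup>2" using assms by (metis abs_le_square_iff abs_of_nonneg)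
  then show "bump \<kappa> r k = 0" "bump' \<kappa> r k = 0" "bump'' \<kappa> r k = 0"
    by (auto simp: bump_def bump'_def bump''_def)
qed

lemma bump_nonneg: "0 \<le> bump \<kappa> r k"
  by (simp add: bump_def)

lemma bump_pos: "\<bar>k - \<kappa>\<bar> < r \<Longrightarrow> 0 < bump \<kappa> r k"
proof -
  assume "\<bar>k - \<kappa>\<bar> < r"
  then have "\<bar>k - \<kappa>\<bar>\<^sup>2 < r\<^sup>2" by (intro power_strict_mono) auto
  then show ?thesis by (simp add: bump_def)
qed

lemma continuous_bump: "continuous_on A (bump \<kappa> r)" "continuous_on A (bump' \<kappa> r)" "continuous_on A (bump'' \<kappa> r)"
  unfolding bump_def[abs_def] bump'_def[abs_def] bump''_def[abs_def] by (intro continuous_intros)+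

lemma measurable_bump [measurable]:
  "bump \<kappa> r \<in> borel_measurable borel" "bump' \<kappa> r \<in> borel_measurable borel" "bump'' \<kappa> r \<in> borel_measurable borel"
  by (intro borel_measurable_continuous_onI continuous_bump)+

lemma bump_bounded:
  assumes "0 \<le> r"
  obtains B where "B > 0" "\<And>k. \<bar>bump \<kappa> r k\<bar> \<le> B" "\<And>k. \<bar>bump' \<kappa> r k\<bar> \<le> B" "\<And>k. \<bar>bump'' \<kappa> r k\<bar> \<le> B"
proof -
  have "\<exists>B. \<forall>k. \<bar>f k\<bar> \<le> B" if "continuous_on UNIV f" "\<And>k. r \<le> \<bar>k - \<kappa>\<bar> \<Longrightarrow> f k = 0" for f :: "real \<Rightarrow> real"
  proof -
    have "compact (f ` {\<kappa> - r..\<kappa> + r})"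
      by (intro compact_continuous_image continuous_on_subset[OF that(1)]) auto
    then obtain B where B: "\<And>k. k \<in> {\<kappa> - r..\<kappa> + r} \<Longrightarrow> norm (f k) \<le> B"
      by (meson bounded_iff compact_imp_bounded imageI)
    have "\<bar>f k\<bar> \<le> max 0 B" for k
      using B[of k] that(2)[of k] by (cases "r \<le> \<bar>k - \<kappa>\<bar>") (auto simp: abs_if split: if_splits)
    then show ?thesis by blast
  qed
  note ex = this
  obtain B0 B1 B2 where B: "\<And>k. \<bar>bump \<kappa> r k\<bar> \<le> B0" "\<And>k. \<bar>bump' \<kappa> r k\<bar> \<le> B1" "\<And>k. \<bar>bump'' \<kappa> r k\<bar> \<le> B2"
    using ex[OF continuous_bump(1) bump_support(1)[OF assms]] ex[OF continuous_bump(2) bump_support(2)[OF assms]]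
      ex[OF continuous_bump(3) bump_support(3)[OF assms]] by metis
  have nn: "0 \<le> B0" "0 \<le> B1" "0 \<le> B2"
    using B(1)[of 0] B(2)[of 0] B(3)[of 0] by linarith+
  show thesis
  proof (rule that[of "B0 + B1 + B2 + 1"])
    show "\<bar>bump \<kappa> r k\<bar> \<le> B0 + B1 + B2 + 1" for k using B(1)[of k] nn by linarith
    show "\<bar>bump' \<kappa> r k\<bar> \<le> B0 + B1 + B2 + 1" for k using B(2)[of k] nn by linarith
    show "\<bar>bump'' \<kappa> r k\<bar> \<le> B0 + B1 + B2 + 1" for k using B(3)[of k] nn by linarith
  qed (use nn in auto)
qed

lemma integral_circ_support:
  fixes f :: "real \<Rightarrow> complex"
  assumes "f \<in> borel_measurable borel" "- pi \<le> \<kappa> - r" "\<kappa> + r \<le> pi" "\<And>k. r \<le> \<bar>k - \<kappa>\<bar> \<Longrightarrow> f k = 0"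
  shows "(\<integral>k. f k \<partial>circ) = (1 / (2 * pi)) *\<^sub>R (LBINT k:{\<kappa> - r..\<kappa> + r}. f k)"
proof -
  have "indicator {- pi..pi} k *\<^sub>R f k = indicator {\<kappa> - r..\<kappa> + r} k *\<^sub>R f k" for k
    using assms(2,3) assms(4)[of k] by (cases "r \<le> \<bar>k - \<kappa>\<bar>") (auto simp: indicator_def abs_le_iff abs_if split: if_splits)
  then show ?thesis
    unfolding integral_circ[OF assms(1)] set_lebesgue_integral_def by (simp only:)
qed

text \<open>Non-stationary phase. With phase derivative \<open>p\<close>, two integrations by parts turn the amplitude \<open>u\<close>
  into \<open>(u' / p\<^sup>2 - u p' / p\<^sup>3)'\<close>, up to sign; \<open>F\<close> in the proof is the antiderivative that performs both at once. The
  condition \<open>|t| \<le> K m\<close> makes \<open>p'\<close> and \<open>p''\<close> comparable to \<open>m\<close>, and each of the four terms is then of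
  order \<open>m\<^bsup>-2\<^esup>\<close>.\<close>

lemma packet1_nonstationary:
  assumes r: "0 < r" "- pi < \<kappa> - r" "\<kappa> + r < pi" and K: "0 \<le> K"
  obtains C where "C \<ge> 0" "\<And>n t m. 0 < m \<Longrightarrow> (\<And>k. \<bar>k - \<kappa>\<bar> \<le> r \<Longrightarrow> m \<le> \<bar>real_of_int n + 2 * t * sin k\<bar>) \<Longrightarrow>
    \<bar>t\<bar> \<le> K * m \<Longrightarrow> norm (packet1 \<kappa> r n t) \<le> C / m\<^sup>2"
proof -
  obtain B where B: "B > 0" "\<And>k. \<bar>bump \<kappa> r k\<bar> \<le> B" "\<And>k. \<bar>bump' \<kappa> r k\<bar> \<le> B" "\<And>k. \<bar>bump'' \<kappa> r k\<bar> \<le> B"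
    using bump_bounded[of r \<kappa>] r by auto
  define C where "C = B * (1 + 6 * K + 2 * K + 12 * K\<^sup>2) * (2 * r)"
  have "norm (packet1 \<kappa> r n t) \<le> C / m\<^sup>2"
    if m: "0 < m" and p0: "\<And>k. \<bar>k - \<kappa>\<bar> \<le> r \<Longrightarrow> m \<le> \<bar>real_of_int n + 2 * t * sin k\<bar>" and t: "\<bar>t\<bar> \<le> K * m" for n t m
  proof -
    let ?I = "{\<kappa> - r..\<kappa> + r}"
    let ?u = "bump \<kappa> r" and ?u' = "bump' \<kappa> r" and ?u'' = "bump'' \<kappa> r"
    define p where "p k = real_of_int n + 2 * t * sin k" for k
    define p' where "p' k = 2 * t * cos k" for k
    define p'' where "p'' k = - 2 * t * sin k" for k
    define E where "E k = cis (real_of_int n * k - 2 * t * cos k)" for k :: real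
    define v where "v k = ?u' k / (p k)\<^sup>2 - ?u k * p' k / (p k) ^ 3" for k
    define v' where "v' k = ?u'' k / (p k)\<^sup>2 - 3 * ?u' k * p' k / (p k) ^ 3 - ?u k * p'' k / (p k) ^ 3 + 3 * ?u k * (p' k)\<^sup>2 / (p k) ^ 4" for k
    define F where "F k = E k * (complex_of_real (v k) - \<i> * complex_of_real (?u k / p k))" for k
    have pm: "m \<le> \<bar>p k\<bar>" if "k \<in> ?I" for k
      using p0[of k] that by (auto simp: p_def abs_le_iff)
    have pne: "p k \<noteq> 0" if "k \<in> ?I" for k using pm[OF that] m by auto
    have dp: "(p has_real_derivative p' k) (at k)" "(p' has_real_derivative p'' k) (at k)" for k
      unfolding p_def[abs_def] p'_def[abs_def] p''_def by (auto intro!: derivative_eq_intros)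
    have dv: "(v has_real_derivative v' k) (at k)" if "k \<in> ?I" for k
    proof -
      define q where "q k = inverse (p k)" for k
      have dq: "(q has_real_derivative - (p' k * (q k)\<^sup>2)) (at k)"
        unfolding q_def[abs_def] using DERIV_inverse'[OF dp(1) pne[OF that]]
        by (simp add: power2_eq_square ac_simps)
      have "((\<lambda>k. ?u' k * (q k)\<^sup>2 - ?u k * p' k * (q k) ^ 3) has_real_derivative
          ?u'' k * (q k)\<^sup>2 - 3 * ?u' k * p' k * (q k) ^ 3 - ?u k * p'' k * (q k) ^ 3 + 3 * ?u k * (p' k)\<^sup>2 * (q k) ^ 4) (at k)"
        by (rule derivative_eq_intros bump_deriv bump'_deriv dp dq refl)+
           (simp add: algebra_simps power2_eq_square power3_eq_cube power4_eq_xxxx)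
      then show ?thesis
        by (simp add: v_def[abs_def] v'_def q_def divide_inverse power_inverse)
    qed
    have dq: "((\<lambda>k. ?u k / p k) has_real_derivative ?u' k / p k - ?u k * p' k / (p k)\<^sup>2) (at k)" if "k \<in> ?I" for k
      using pne[OF that] by (auto intro!: derivative_eq_intros bump_deriv dp simp: field_simps power2_eq_square)
    have dE: "(E has_vector_derivative \<i> * p k * E k) (at k)" for k
      unfolding E_def[abs_def] p_def has_vector_derivative_def
      by (auto intro!: derivative_eq_intros ext simp: scaleR_conv_of_real algebra_simps)
    have dF: "(F has_vector_derivative E k * ?u k + E k * v' k) (at k within ?I)" if "k \<in> ?I" for k
    proof -
      have "(F has_vector_derivative E k * (complex_of_real (v' k) - \<i> * complex_of_real (?u' k / p k - ?u k * p' k / (p k)\<^sup>2))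
          + \<i> * p k * E k * (complex_of_real (v k) - \<i> * complex_of_real (?u k / p k))) (at k)"
        unfolding F_def
        by (intro has_vector_derivative_mult dE has_vector_derivative_diff has_vector_derivative_mult_right
            has_vector_derivative_of_real dv dq that)
      moreover have "E k * (complex_of_real (v' k) - \<i> * complex_of_real (?u' k / p k - ?u k * p' k / (p k)\<^sup>2))
          + \<i> * p k * E k * (complex_of_real (v k) - \<i> * complex_of_real (?u k / p k)) = E k * ?u k + E k * v' k"
      proof -
        have "p k * v k = ?u' k / p k - ?u k * p' k / (p k)\<^sup>2"
          using pne[OF that] by (simp add: v_def field_simps power2_eq_square power3_eq_cube)
        then have 1: "complex_of_real (?u' k / p k - ?u k * p' k / (p k)\<^sup>2) = complex_of_real (p k) * complex_of_real (v k)"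
          by (metis of_real_mult)
        have 2: "complex_of_real (p k) * complex_of_real (?u k / p k) = ?u k"
          using pne[OF that] by simp
        have alg: "e * (a - \<i> * (P * V)) + \<i> * P * e * (V - \<i> * X) = e * (P * X) + e * a"
          for e a P V X :: complex
          by (simp add: algebra_simps)
        show ?thesis unfolding 1 alg 2 ..
      qed
      ultimately show ?thesis by (simp add: has_vector_derivative_at_within)
    qed
    have cont: "continuous_on ?I E" "continuous_on ?I ?u" "continuous_on ?I v'"
    proof -
      show "continuous_on ?I E" unfolding E_def by (intro continuous_intros)
      show "continuous_on ?I ?u" by (rule continuous_bump)
      show "continuous_on ?I v'"
        unfolding v'_def p'_def p''_def using pne
        by (intro continuous_on_add continuous_on_diff continuous_on_divide continuous_on_mult continuous_bump
            continuous_on_power continuous_intros ballI power_not_zero) (auto simp: p_def intro!: continuous_intros)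
    qed
    have int: "set_integrable lborel ?I (\<lambda>k. E k * ?u k)" "set_integrable lborel ?I (\<lambda>k. E k * v' k)"
      unfolding set_integrable_def
      by (intro borel_integrable_compact continuous_on_mult cont continuous_on_of_real; simp)+
    have "(LBINT k:?I. E k * ?u k + E k * v' k) = F (\<kappa> + r) - F (\<kappa> - r)"
      unfolding set_lebesgue_integral_def using r
      by (intro integral_FTC_Icc dF continuous_on_add continuous_on_mult cont continuous_on_of_real) auto
    also have "\<dots> = 0"
      using bump_support[of r "\<kappa> + r" \<kappa>] bump_support[of r "\<kappa> - r" \<kappa>] r by (simp add: F_def v_def)
    finally have "(LBINT k:?I. E k * ?u k) = - (LBINT k:?I. E k * v' k)"
      using int by (simp add: set_integral_add eq_neg_iff_add_eq_0)
    moreover have "packet1 \<kappa> r n t = (1 / (2 * pi)) *\<^sub>R (LBINT k:?I. E k * ?u k)"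
      unfolding packet1_def
    proof (subst integral_circ_support)
      show "(\<lambda>k. complex_of_real (?u k) * cis (real_of_int n * k - 2 * t * cos k)) \<in> borel_measurable borel" by measurable
    qed (use r bump_support[of r _ \<kappa>] in \<open>auto simp: E_def mult.commute\<close>)
    ultimately have "norm (packet1 \<kappa> r n t) = 1 / (2 * pi) * norm (LBINT k:?I. E k * v' k)" by simp
    also have "\<dots> \<le> 1 * (B * (1 + 6 * K + 2 * K + 12 * K\<^sup>2) / m\<^sup>2 * (2 * r))"
    proof (rule mult_mono)
      show "1 / (2 * pi) \<le> 1" using pi_ge_two by simp
      have "norm (LBINT k:?I. E k * v' k) \<le> (LBINT k:?I. norm (E k * v' k))"
        by (rule set_integral_norm_bound[OF int(2)])
      also have "\<dots> \<le> (LBINT k:?I. B * (1 + 6 * K + 2 * K + 12 * K\<^sup>2) / m\<^sup>2)"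
      proof (rule set_integral_mono)
        show "set_integrable lborel ?I (\<lambda>k. norm (E k * v' k))"
          using int(2) by (rule set_integrable_norm)
        show "set_integrable lborel ?I (\<lambda>k. B * (1 + 6 * K + 2 * K + 12 * K\<^sup>2) / m\<^sup>2)"
          unfolding set_integrable_def by (intro borel_integrable_compact continuous_intros) simp
        fix k assume k: "k \<in> ?I"
        have pk: "m \<le> \<bar>p k\<bar>" by (rule pm[OF k])
        have p'k: "\<bar>p' k\<bar> \<le> 2 * K * m" "\<bar>p'' k\<bar> \<le> 2 * K * m"
        proof -
          have "\<bar>t\<bar> * \<bar>cos k\<bar> \<le> (K * m) * 1" "\<bar>t\<bar> * \<bar>sin k\<bar> \<le> (K * m) * 1"
            using t by (intro mult_mono; auto)+
          then show "\<bar>p' k\<bar> \<le> 2 * K * m" "\<bar>p'' k\<bar> \<le> 2 * K * m" by (simp_all add: p'_def p''_def abs_mult)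
        qed
        have e1: "\<bar>?u'' k / (p k)\<^sup>2\<bar> \<le> B / m\<^sup>2"
          unfolding abs_divide using B m pk by (intro frac_le) (auto simp: power2_le_iff_abs_le abs_le_square_iff[symmetric])
        have cube: "m ^ 3 \<le> \<bar>(p k) ^ 3\<bar>" unfolding power_abs using m pk by (intro power_mono) auto
        have four: "m ^ 4 \<le> \<bar>(p k) ^ 4\<bar>" unfolding power_abs using m pk by (intro power_mono) auto
        have e2: "\<bar>3 * ?u' k * p' k / (p k) ^ 3\<bar> \<le> 6 * K * B / m\<^sup>2"
        proof -
          have "\<bar>?u' k\<bar> * \<bar>p' k\<bar> \<le> B * (2 * K * m)"
            using B(1) B(3)[of k] p'k by (intro mult_mono) auto
          then have "\<bar>3 * ?u' k * p' k\<bar> \<le> 3 * B * (2 * K * m)" by (simp add: abs_mult ac_simps)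
          then have "\<bar>3 * ?u' k * p' k / (p k) ^ 3\<bar> \<le> (3 * B * (2 * K * m)) / m ^ 3"
            unfolding abs_divide using B(1) m K cube by (intro frac_le) auto
          also have "\<dots> = 6 * K * B / m\<^sup>2" using m by (simp add: power2_eq_square power3_eq_cube)
          finally show ?thesis .
        qed
        have e3: "\<bar>?u k * p'' k / (p k) ^ 3\<bar> \<le> 2 * K * B / m\<^sup>2"
        proof -
          have "\<bar>?u k * p'' k\<bar> \<le> B * (2 * K * m)"
            unfolding abs_mult using B(1) B(2)[of k] p'k by (intro mult_mono) auto
          then have "\<bar>?u k * p'' k / (p k) ^ 3\<bar> \<le> (B * (2 * K * m)) / m ^ 3"
            unfolding abs_divide using B(1) m K cube by (intro frac_le) auto
          also have "\<dots> = 2 * K * B / m\<^sup>2" using m by (simp add: power2_eq_square power3_eq_cube)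
          finally show ?thesis .
        qed
        have e4: "\<bar>3 * ?u k * (p' k)\<^sup>2 / (p k) ^ 4\<bar> \<le> 12 * K\<^sup>2 * B / m\<^sup>2"
        proof -
          have "(p' k)\<^sup>2 \<le> (2 * K * m)\<^sup>2" using p'k K m by (subst power2_le_iff_abs_le) auto
          then have "\<bar>?u k\<bar> * (p' k)\<^sup>2 \<le> B * (2 * K * m)\<^sup>2"
            using B(1) B(2)[of k] by (intro mult_mono) auto
          then have "\<bar>3 * ?u k * (p' k)\<^sup>2\<bar> \<le> 3 * B * (2 * K * m)\<^sup>2" by (simp add: abs_mult)
          then have "\<bar>3 * ?u k * (p' k)\<^sup>2 / (p k) ^ 4\<bar> \<le> (3 * B * (2 * K * m)\<^sup>2) / m ^ 4"
            unfolding abs_divide using B(1) m K four by (intro frac_le) auto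
          also have "\<dots> = 12 * K\<^sup>2 * B / m\<^sup>2" using m by (simp add: power2_eq_square power4_eq_xxxx)
          finally show ?thesis .
        qed
        have "norm (E k * v' k) = \<bar>v' k\<bar>" by (simp add: E_def norm_mult)
        also have "\<dots> \<le> B / m\<^sup>2 + 6 * K * B / m\<^sup>2 + 2 * K * B / m\<^sup>2 + 12 * K\<^sup>2 * B / m\<^sup>2"
        proof -
          have tri: "\<bar>a - b - c + d\<bar> \<le> a' + b' + c' + d'"
            if "\<bar>a\<bar> \<le> a'" "\<bar>b\<bar> \<le> b'" "\<bar>c\<bar> \<le> c'" "\<bar>d\<bar> \<le> d'" for a b c d a' b' c' d' :: real
            using that by linarith
          show ?thesis unfolding v'_def by (rule tri[OF e1 e2 e3 e4])
        qed
        also have "\<dots> = B * (1 + 6 * K + 2 * K + 12 * K\<^sup>2) / m\<^sup>2"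
          by (simp add: algebra_simps add_divide_distrib)
        finally show "norm (E k * v' k) \<le> B * (1 + 6 * K + 2 * K + 12 * K\<^sup>2) / m\<^sup>2" .
      qed
      also have "\<dots> = B * (1 + 6 * K + 2 * K + 12 * K\<^sup>2) / m\<^sup>2 * (2 * r)"
        using r by (simp add: set_lebesgue_integral_def)
      finally show "norm (LBINT k:?I. E k * v' k) \<le> B * (1 + 6 * K + 2 * K + 12 * K\<^sup>2) / m\<^sup>2 * (2 * r)" .
    qed auto
    also have "\<dots> = C / m\<^sup>2" by (simp add: C_def)
    finally show ?thesis .
  qed
  moreover have "C \<ge> 0" using B r K by (simp add: C_def)
  ultimately show thesis by (intro that[of C]) auto
qed

lemma measurable_cis_comp [measurable]: "(\<lambda>k. cis (a * k - b * cos k)) \<in> borel_measurable borel"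
  by (intro borel_measurable_continuous_onI continuous_intros)

lemma cis_phase_split: "cis (a * k - b) = cis (- b) * cis (a * k)"
  by (simp add: cis_mult)

text \<open>The evolution multiplies the Fourier transform by a unimodular factor, and multiplication by \<open>n\<close> is differentiation of
  \<open>bump \<kappa> r k * cis (- 2 t cos k)\<close>, which costs at most a factor of order \<open>t\<close>. Both parts are
  instances of Bessel's inequality.\<close>

lemma packet1_bessel:
  assumes r: "0 < r" "- pi < \<kappa> - r" "\<kappa> + r < pi"
  obtains C where "C \<ge> 1" "\<And>t n. norm (packet1 \<kappa> r n t) \<le> C"
    "\<And>t S. finite S \<Longrightarrow> (\<Sum>n\<in>S. (norm (packet1 \<kappa> r n t))\<^sup>2) \<le> C"
    "\<And>t S. finite S \<Longrightarrow> 1 \<le> t \<Longrightarrow> (\<Sum>n\<in>S. (norm (packet1 \<kappa> r n t))\<^sup>2 * (1 + \<bar>real_of_int n\<bar>)\<^sup>2) \<le> C * t\<^sup>2"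
proof -
  obtain B where B: "B > 0" "\<And>k. \<bar>bump \<kappa> r k\<bar> \<le> B" "\<And>k. \<bar>bump' \<kappa> r k\<bar> \<le> B" "\<And>k. \<bar>bump'' \<kappa> r k\<bar> \<le> B"
    using bump_bounded[of r \<kappa>] r by auto
  let ?u = "bump \<kappa> r" and ?u' = "bump' \<kappa> r"
  have s0: "(\<Sum>n\<in>S. (norm (packet1 \<kappa> r n t))\<^sup>2) \<le> B\<^sup>2" if "finite S" for S t
  proof -
    have "packet1 \<kappa> r n t = (\<integral>k. (?u k * cis (- (2 * t * cos k))) * cis (real_of_int n * k) \<partial>circ)" for n
      unfolding packet1_def cis_phase_split by (simp add: mult.assoc)
    moreover have "(\<lambda>k. ?u k * cis (- (2 * t * cos k))) \<in> borel_measurable borel"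
      by (intro borel_measurable_continuous_onI continuous_intros continuous_bump)
    ultimately show ?thesis
      using bessel_circ[of "\<lambda>k. ?u k * cis (- (2 * t * cos k))" B S] B(2) that by (simp add: norm_mult)
  qed
  have s1: "(\<Sum>n\<in>S. (norm (packet1 \<kappa> r n t))\<^sup>2 * (real_of_int n)\<^sup>2) \<le> (B + 2 * \<bar>t\<bar> * B)\<^sup>2" if "finite S" for S t
  proof -
    define h where "h k = (complex_of_real (?u' k) + \<i> * complex_of_real (2 * t * sin k * ?u k)) * cis (- (2 * t * cos k))" for k
    have hm: "h \<in> borel_measurable borel"
      unfolding h_def by (intro borel_measurable_continuous_onI continuous_intros continuous_bump)
    have hB: "norm (h k) \<le> B + 2 * \<bar>t\<bar> * B" for k
    proof -
      have "norm (h k) \<le> \<bar>?u' k\<bar> + 2 * (\<bar>t\<bar> * (\<bar>sin k\<bar> * \<bar>?u k\<bar>))"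
        unfolding h_def norm_mult norm_cis mult_1_right
        by (rule order_trans[OF norm_triangle_ineq]) (simp add: norm_mult abs_mult)
      also have "\<dots> \<le> B + 2 * (\<bar>t\<bar> * (1 * B))"
        using B by (intro add_mono mult_left_mono mult_mono) auto
      finally show ?thesis by simp
    qed
    have "\<i> * real_of_int n * packet1 \<kappa> r n t = - (\<integral>k. h k * cis (real_of_int n * k) \<partial>circ)" for n
    proof -
      let ?E = "\<lambda>k. cis (real_of_int n * k - 2 * t * cos k)"
      define F where "F k = complex_of_real (?u k) * ?E k" for k
      have dE: "(?E has_vector_derivative \<i> * (n + 2 * t * sin k) * ?E k) (at k)" for k
        unfolding has_vector_derivative_def
        by (auto intro!: derivative_eq_intros ext simp: scaleR_conv_of_real algebra_simps)
      have eq: "?E k = cis (- (2 * t * cos k)) * cis (real_of_int n * k)" for k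
        by (rule cis_phase_split)
      have dF: "(F has_vector_derivative h k * cis (real_of_int n * k) + \<i> * real_of_int n * (?u k * ?E k)) (at k within {- pi..pi})" for k
      proof -
        have "(F has_vector_derivative ?u k * (\<i> * (n + 2 * t * sin k) * ?E k) + ?u' k * ?E k) (at k)"
          unfolding F_def by (intro has_vector_derivative_mult has_vector_derivative_of_real bump_deriv dE)
        moreover have "?u k * (\<i> * (n + 2 * t * sin k) * ?E k) + ?u' k * ?E k
            = h k * cis (real_of_int n * k) + \<i> * real_of_int n * (?u k * ?E k)"
          unfolding h_def eq by (simp add: algebra_simps)
        ultimately show ?thesis by (simp only: has_vector_derivative_at_within)
      qed
      have i1: "integrable circ (\<lambda>k. h k * cis (real_of_int n * k))"
        by (rule integrable_circ_bounded[where B="B + 2 * \<bar>t\<bar> * B"])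
           (use hm hB in \<open>auto simp: norm_mult intro!: borel_measurable_times borel_measurable_continuous_onI continuous_intros\<close>)
      have i2: "integrable circ (\<lambda>k. ?u k * ?E k)"
        by (rule integrable_circ_bounded[where B=B])
           (use B(2) in \<open>auto simp: norm_mult intro!: borel_measurable_continuous_onI continuous_intros continuous_bump\<close>)
      have "(\<integral>k. h k * cis (real_of_int n * k) + \<i> * real_of_int n * (?u k * ?E k) \<partial>circ)
          = (1 / (2 * pi)) *\<^sub>R (F pi - F (- pi))"
      proof (rule integral_circ_FTC[where F=F])
        have c: "continuous_on A (\<lambda>k. h k * cis (real_of_int n * k) + \<i> * real_of_int n * (?u k * ?E k))" for A
          unfolding h_def by (intro continuous_intros continuous_bump)
        show "(\<lambda>k. h k * cis (real_of_int n * k) + \<i> * real_of_int n * (?u k * ?E k)) \<in> borel_measurable borel"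
          by (rule borel_measurable_continuous_onI[OF c])
        show "continuous_on {- pi..pi} (\<lambda>k. h k * cis (real_of_int n * k) + \<i> * real_of_int n * (?u k * ?E k))"
          by (rule c)
      qed (rule dF)
      also have "\<dots> = 0"
        using bump_support(1)[of r pi \<kappa>] bump_support(1)[of r "- pi" \<kappa>] r by (simp add: F_def)
      finally have "(\<integral>k. h k * cis (real_of_int n * k) \<partial>circ) + \<i> * real_of_int n * packet1 \<kappa> r n t = 0"
        unfolding packet1_def using i1 i2 by simp
      then show ?thesis by (simp add: eq_neg_iff_add_eq_0 add.commute)
    qed
    then have nn: "norm (\<i> * real_of_int n * packet1 \<kappa> r n t) = norm (\<integral>k. h k * cis (real_of_int n * k) \<partial>circ)" for n
      by (simp only: norm_minus_cancel)
    have "(norm (packet1 \<kappa> r n t))\<^sup>2 * (real_of_int n)\<^sup>2 = (norm (\<integral>k. h k * cis (real_of_int n * k) \<partial>circ))\<^sup>2" for n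
      unfolding nn[symmetric] by (simp add: norm_mult power_mult_distrib)
    then show ?thesis
      using bessel_circ[OF hm hB that] by simp
  qed
  define C where "C = 1 + B + 2 * B\<^sup>2 + 18 * B\<^sup>2"
  show thesis
  proof (rule that[of C])
    show "C \<ge> 1" using B by (simp add: C_def)
    show "norm (packet1 \<kappa> r n t) \<le> C" for n t
    proof -
      have "(norm (packet1 \<kappa> r n t))\<^sup>2 \<le> B\<^sup>2" using s0[of "{n}" t] by simp
      then have "norm (packet1 \<kappa> r n t) \<le> B" using B(1) by (simp add: power2_le_iff_abs_le)
      then show ?thesis using zero_le_power2[of B] unfolding C_def by linarith
    qed
    show "(\<Sum>n\<in>S. (norm (packet1 \<kappa> r n t))\<^sup>2) \<le> C" if "finite S" for S t
      using s0[OF that, of t] B(1) zero_le_power2[of B] unfolding C_def by linarith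
    show "(\<Sum>n\<in>S. (norm (packet1 \<kappa> r n t))\<^sup>2 * (1 + \<bar>real_of_int n\<bar>)\<^sup>2) \<le> C * t\<^sup>2" if "finite S" "1 \<le> t" for S t
    proof -
      have "(\<Sum>n\<in>S. (norm (packet1 \<kappa> r n t))\<^sup>2 * (1 + \<bar>real_of_int n\<bar>)\<^sup>2)
          \<le> (\<Sum>n\<in>S. 2 * (norm (packet1 \<kappa> r n t))\<^sup>2 + 2 * ((norm (packet1 \<kappa> r n t))\<^sup>2 * (real_of_int n)\<^sup>2))"
      proof (rule sum_mono)
        fix n
        have "(1 + \<bar>real_of_int n\<bar>)\<^sup>2 \<le> 2 + 2 * (real_of_int n)\<^sup>2"
          using sum_squares_bound[of 1 "\<bar>real_of_int n\<bar>"] by (simp add: power2_sum)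
        then have "(norm (packet1 \<kappa> r n t))\<^sup>2 * (1 + \<bar>real_of_int n\<bar>)\<^sup>2 \<le> (norm (packet1 \<kappa> r n t))\<^sup>2 * (2 + 2 * (real_of_int n)\<^sup>2)"
          by (intro mult_left_mono) auto
        then show "(norm (packet1 \<kappa> r n t))\<^sup>2 * (1 + \<bar>real_of_int n\<bar>)\<^sup>2
            \<le> 2 * (norm (packet1 \<kappa> r n t))\<^sup>2 + 2 * ((norm (packet1 \<kappa> r n t))\<^sup>2 * (real_of_int n)\<^sup>2)"
          by (simp add: algebra_simps)
      qed
      also have "\<dots> = 2 * (\<Sum>n\<in>S. (norm (packet1 \<kappa> r n t))\<^sup>2) + 2 * (\<Sum>n\<in>S. (norm (packet1 \<kappa> r n t))\<^sup>2 * (real_of_int n)\<^sup>2)"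
        by (simp add: sum.distrib sum_distrib_left)
      also have "\<dots> \<le> 2 * B\<^sup>2 + 2 * (B + 2 * \<bar>t\<bar> * B)\<^sup>2"
        using s0[OF that(1), of t] s1[OF that(1), of t] by linarith
      also have "\<dots> \<le> 2 * (B\<^sup>2 * t\<^sup>2) + 2 * (9 * (B\<^sup>2 * t\<^sup>2))"
      proof -
        have "1 \<le> t\<^sup>2" using that(2) by simp
        then have "B\<^sup>2 * 1 \<le> B\<^sup>2 * t\<^sup>2" by (intro mult_left_mono) auto
        moreover have "B * 1 \<le> B * t" using that(2) B(1) by (intro mult_left_mono) auto
        then have "(B + 2 * \<bar>t\<bar> * B)\<^sup>2 \<le> (3 * (B * t))\<^sup>2"
          using that(2) B(1) by (intro power_mono) (auto simp: algebra_simps)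
        ultimately show ?thesis by (simp add: power_mult_distrib)
      qed
      also have "\<dots> = 20 * B\<^sup>2 * t\<^sup>2" by simp
      also have "\<dots> \<le> C * t\<^sup>2" using B(1) by (intro mult_right_mono) (auto simp: C_def)
      finally show ?thesis .
    qed
  qed
qed

section \<open>Pointwise Fourier inversion\<close>

text \<open>The Riemann--Lebesgue lemma in the form that Bessel's inequality gives.\<close>

lemma bessel_imp_tendsto_0:
  fixes d :: "int \<Rightarrow> complex"
  assumes "\<And>S. finite S \<Longrightarrow> (\<Sum>n\<in>S. (norm (d n))\<^sup>2) \<le> C" and "inj (g :: nat \<Rightarrow> int)"
  shows "(\<lambda>N. d (g N)) \<longlonglongrightarrow> 0"
proof -
  have "summable (\<lambda>N. (norm (d (g N)))\<^sup>2)"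
  proof (rule bounded_imp_summable)
    fix n
    have "(\<Sum>k\<le>n. (norm (d (g k)))\<^sup>2) = (\<Sum>k\<in>g ` {..n}. (norm (d k))\<^sup>2)"
      using assms(2) by (subst sum.reindex) (auto intro: inj_on_subset)
    also have "\<dots> \<le> C" by (rule assms(1)) simp
    finally show "(\<Sum>k\<le>n. (norm (d (g k)))\<^sup>2) \<le> C" .
  qed auto
  then have "(\<lambda>N. (norm (d (g N)))\<^sup>2) \<longlonglongrightarrow> 0" by (rule summable_LIMSEQ_zero)
  then have "(\<lambda>N. sqrt ((norm (d (g N)))\<^sup>2)) \<longlonglongrightarrow> sqrt 0" by (rule tendsto_real_sqrt)
  then show ?thesis by (simp add: tendsto_norm_zero_iff)
qed

lemma has_vector_derivative_quotient:
  fixes f :: "real \<Rightarrow> complex"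
  assumes "(f has_vector_derivative D) (at x)"
  shows "((\<lambda>k. (f k - f x) / complex_of_real (k - x)) \<longlongrightarrow> D) (at x)"
proof -
  have "((\<lambda>y. norm (f y - f x - (y - x) *\<^sub>R D) / norm (y - x)) \<longlongrightarrow> 0) (at x)"
    using assms unfolding has_vector_derivative_def has_derivative_iff_norm by simp
  then have "((\<lambda>k. norm ((f k - f x) / complex_of_real (k - x) - D)) \<longlongrightarrow> 0) (at x)"
  proof (rule Lim_transform_eventually)
    have "norm (f k - f x - (k - x) *\<^sub>R D) / norm (k - x) = norm ((f k - f x) / complex_of_real (k - x) - D)" if "k \<noteq> x" for k
    proof -
      have "(f k - f x) / complex_of_real (k - x) - D = (f k - f x - (k - x) *\<^sub>R D) / complex_of_real (k - x)"
        using that by (simp add: diff_divide_distrib scaleR_conv_of_real)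
      then show ?thesis by (simp only: norm_divide norm_of_real real_norm_def)
    qed
    then show "eventually (\<lambda>k. norm (f k - f x - (k - x) *\<^sub>R D) / norm (k - x) = norm ((f k - f x) / complex_of_real (k - x) - D)) (at x)"
      by (auto simp: eventually_at_filter)
  qed
  then show ?thesis by (rule LIM_zero_cancel[OF tendsto_norm_zero_cancel])
qed

text \<open>Dini's criterion by telescoping. Write \<open>B k = B k\<^sub>0 + q k (cis (k - k\<^sub>0) - 1)\<close> with \<open>q\<close> continuous because
  \<open>B\<close> is differentiable at \<open>k\<^sub>0\<close>. The factor \<open>cis (k - k\<^sub>0) - 1\<close> makes each term of the Fourier series of the second
  summand, up to phases, a difference of consecutive coefficients of \<open>q\<close>, so that the symmetric partial sums reduce to two
  boundary terms, which tend to \<open>0\<close>.\<close>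

lemma fourier_inversion_circ:
  fixes B :: "real \<Rightarrow> complex"
  assumes cont: "continuous_on UNIV B" and deriv: "(B has_vector_derivative D) (at k\<^sub>0)"
    and k0: "- pi < k\<^sub>0" "k\<^sub>0 < pi"
  shows "(\<lambda>N. \<Sum>n\<in>{- int N..int N}. (\<integral>k. B k * cis (real_of_int n * k) \<partial>circ) * cis (- (real_of_int n * k\<^sub>0))) \<longlonglongrightarrow> B k\<^sub>0"
proof -
  define q where "q k = (if k = k\<^sub>0 then D / \<i> else (B k - B k\<^sub>0) / (cis (k - k\<^sub>0) - 1))" for k
  have cis1: "cis (k - k\<^sub>0) \<noteq> 1" if "k \<in> {- pi..pi}" "k \<noteq> k\<^sub>0" for k
  proof
    assume "cis (k - k\<^sub>0) = 1"
    then have "cos (k - k\<^sub>0) = 1" by (simp add: complex_eq_iff)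
    then obtain n :: int where n: "k - k\<^sub>0 = of_int n * 2 * pi" by (auto simp: cos_one_2pi_int)
    have "\<bar>k - k\<^sub>0\<bar> < 2 * pi" using that k0 by (auto simp: abs_less_iff)
    moreover have "\<bar>k - k\<^sub>0\<bar> = \<bar>real_of_int n\<bar> * (2 * pi)"
      unfolding n abs_mult by (simp only: mult.assoc abs_numeral abs_of_pos[OF pi_gt_zero])
    ultimately have "\<bar>real_of_int n\<bar> * (2 * pi) < 1 * (2 * pi)" by (simp only: mult_1_left)
    then have "\<bar>real_of_int n\<bar> < 1" by (rule mult_right_less_imp_less) simp
    then have "n = 0" by linarith
    then show False using n that by simp
  qed
  have quot: "((\<lambda>k. (B k - B k\<^sub>0) / complex_of_real (k - k\<^sub>0)) \<longlongrightarrow> D) (at k\<^sub>0)"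
    by (rule has_vector_derivative_quotient[OF deriv])
  have dcis: "((\<lambda>k. (cis (k - k\<^sub>0) - 1) / complex_of_real (k - k\<^sub>0)) \<longlongrightarrow> \<i>) (at k\<^sub>0)"
  proof -
    have "((\<lambda>k. cis (k - k\<^sub>0)) has_vector_derivative \<i>) (at k\<^sub>0)"
      unfolding has_vector_derivative_def by (auto intro!: derivative_eq_intros)
    from has_vector_derivative_quotient[OF this] show ?thesis by simp
  qed
  have qcont: "continuous_on {- pi..pi} q"
  proof (rule continuous_at_imp_continuous_on, intro ballI)
    fix k assume k: "k \<in> {- pi..pi}"
    show "isCont q k"
    proof (cases "k = k\<^sub>0")
      case False
      have "isCont B k" using cont by (simp add: continuous_on_eq_continuous_at)
      then have "isCont (\<lambda>k. (B k - B k\<^sub>0) / (cis (k - k\<^sub>0) - 1)) k"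
        using cis1[OF k False]
        by (intro isCont_divide isCont_diff continuous_const) (auto intro!: continuous_on_interior[of UNIV] continuous_intros)
      moreover have "eventually (\<lambda>x. q x = (B x - B k\<^sub>0) / (cis (x - k\<^sub>0) - 1)) (nhds k)"
        using t1_space_nhds[OF False] by eventually_elim (simp add: q_def)
      ultimately show ?thesis by (simp add: isCont_cong)
    next
      case True
      have "((\<lambda>k. ((B k - B k\<^sub>0) / complex_of_real (k - k\<^sub>0)) / ((cis (k - k\<^sub>0) - 1) / complex_of_real (k - k\<^sub>0))) \<longlongrightarrow> D / \<i>) (at k\<^sub>0)"
        by (intro tendsto_divide quot dcis) simp
      then have "(q \<longlongrightarrow> D / \<i>) (at k\<^sub>0)"
        by (rule Lim_transform_eventually) (auto simp: eventually_at_filter q_def)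
      then show ?thesis unfolding True isCont_def by (simp add: q_def)
    qed
  qed
  \<comment> \<open>Outside \<open>[-\<pi>, \<pi>]\<close> the function \<open>q\<close> may have poles, at the other points of \<open>k\<^sub>0 + 2\<pi>\<int>\<close>; cutting it off changes no integral.\<close>
  define q0 where "q0 k = indicator {- pi..pi} k *\<^sub>R q k" for k
  have q0m: "q0 \<in> borel_measurable borel"
    unfolding q0_def by (rule borel_measurable_continuous_on_indicator[OF _ qcont]) simp
  obtain A where "\<forall>x\<in>q ` {- pi..pi}. norm x \<le> A"
    using compact_imp_bounded[OF compact_continuous_image[OF qcont compact_Icc]] unfolding bounded_iff by blast
  then have A: "norm (q k) \<le> A" if "k \<in> {- pi..pi}" for k using that by blast
  have q0B: "norm (q0 k) \<le> max 0 A" for k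
    using A[of k] by (auto simp: q0_def indicator_def)
  define d where "d n = (\<integral>k. q0 k * cis (real_of_int n * k) \<partial>circ)" for n :: int
  have dB: "(\<Sum>n\<in>S. (norm (d n))\<^sup>2) \<le> (max 0 A)\<^sup>2" if "finite S" for S
    unfolding d_def using bessel_circ[OF q0m q0B that] .
  define h where "h n = cis (- (real_of_int n * k\<^sub>0)) * d n" for n
  define c where "c n = (\<integral>k. B k * cis (real_of_int n * k) \<partial>circ)" for n :: int
  have c_eq: "c n * cis (- (real_of_int n * k\<^sub>0)) = (if n = 0 then B k\<^sub>0 else 0) + (h (n + 1) - h n)" for n
  proof -
    have int: "integrable circ (\<lambda>k. q0 k * cis (real_of_int m * k))" for m :: int
      by (rule integrable_circ_bounded[where B="max 0 A"])
         (use q0m q0B in \<open>auto simp: norm_mult intro!: borel_measurable_times borel_measurable_continuous_onI continuous_intros\<close>)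
    have ic: "integrable circ (\<lambda>k. B k\<^sub>0 * cis (real_of_int n * k))"
      by (rule integrable_circ_bounded[where B="norm (B k\<^sub>0)"])
         (auto simp: norm_mult intro!: borel_measurable_continuous_onI continuous_intros)
    have "c n = (\<integral>k. B k\<^sub>0 * cis (real_of_int n * k) +
        (cis (- k\<^sub>0) * (q0 k * cis (real_of_int (n + 1) * k)) - q0 k * cis (real_of_int n * k)) \<partial>circ)"
      unfolding c_def
    proof (rule Bochner_Integration.integral_cong_AE)
      show "(\<lambda>k. B k * cis (real_of_int n * k)) \<in> borel_measurable circ"
        by (simp, intro borel_measurable_continuous_onI continuous_intros cont)
      show "(\<lambda>k. B k\<^sub>0 * cis (real_of_int n * k) +
        (cis (- k\<^sub>0) * (q0 k * cis (real_of_int (n + 1) * k)) - q0 k * cis (real_of_int n * k))) \<in> borel_measurable circ"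
        by (intro borel_measurable_integrable Bochner_Integration.integrable_add Bochner_Integration.integrable_diff
            integrable_mult_right ic int)
      show "AE k in circ. B k * cis (real_of_int n * k) = B k\<^sub>0 * cis (real_of_int n * k) +
        (cis (- k\<^sub>0) * (q0 k * cis (real_of_int (n + 1) * k)) - q0 k * cis (real_of_int n * k))"
        using AE_circ
      proof eventually_elim
        case (elim k)
        have "q k * (cis (k - k\<^sub>0) - 1) = B k - B k\<^sub>0"
          using cis1[of k] elim by (auto simp: q_def)
        then have Bk: "B k = B k\<^sub>0 + q k * (cis (k - k\<^sub>0) - 1)" by simp
        have q0k: "q0 k = q k" using elim by (simp add: q0_def)
        have phase: "cis (k - k\<^sub>0) * cis (real_of_int n * k) = cis (- k\<^sub>0) * cis (real_of_int (n + 1) * k)"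
          by (simp add: cis_mult algebra_simps)
        have alg: "(b + p * (c - 1)) * X = b * X + (e * (p * Y) - p * X)" if "c * X = e * Y" for b p c X e Y :: complex
        proof -
          have "(b + p * (c - 1)) * X = b * X + p * (c * X) - p * X" by (simp add: algebra_simps)
          then show ?thesis unfolding that by (simp add: algebra_simps)
        qed
        show ?case unfolding Bk q0k by (rule alg[OF phase])
      qed
    qed
    also have "\<dots> = B k\<^sub>0 * (if n = 0 then 1 else 0) + (cis (- k\<^sub>0) * d (n + 1) - d n)"
    proof -
      have "(\<integral>k. B k\<^sub>0 * cis (real_of_int n * k) + (cis (- k\<^sub>0) * (q0 k * cis (real_of_int (n + 1) * k)) - q0 k * cis (real_of_int n * k)) \<partial>circ)
        = (\<integral>k. B k\<^sub>0 * cis (real_of_int n * k) \<partial>circ) + ((\<integral>k. cis (- k\<^sub>0) * (q0 k * cis (real_of_int (n + 1) * k)) \<partial>circ)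
           - (\<integral>k. q0 k * cis (real_of_int n * k) \<partial>circ))"
        using Bochner_Integration.integral_add[OF ic Bochner_Integration.integrable_diff[OF integrable_mult_right[OF int[of "n + 1"]] int[of n]], of "cis (- k\<^sub>0)"]
          Bochner_Integration.integral_diff[OF integrable_mult_right[OF int[of "n + 1"]] int[of n], of "cis (- k\<^sub>0)"]
        by simp
      then show ?thesis by (simp only: integral_mult_right_zero integral_circ_cis d_def)
    qed
    finally have cn: "c n = B k\<^sub>0 * (if n = 0 then 1 else 0) + (cis (- k\<^sub>0) * d (n + 1) - d n)" .
    have "cis (- k\<^sub>0) * cis (- (real_of_int n * k\<^sub>0)) = cis (- (real_of_int (n + 1) * k\<^sub>0))"
      by (simp add: cis_mult algebra_simps)
    then show ?thesis
      unfolding cn h_def by (cases "n = 0") (simp_all add: algebra_simps)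
  qed
  have sum: "(\<Sum>n\<in>{- int N..int N}. c n * cis (- (real_of_int n * k\<^sub>0))) = B k\<^sub>0 + (h (int N + 1) - h (- int N))" for N
  proof (induction N)
    case 0
    then show ?case using c_eq[of 0] by simp
  next
    case (Suc N)
    have "{- int (Suc N)..int (Suc N)} = insert (int N + 1) (insert (- int N - 1) {- int N..int N})" by auto
    then have split: "(\<Sum>n\<in>{- int (Suc N)..int (Suc N)}. c n * cis (- (real_of_int n * k\<^sub>0))) =
       c (int N + 1) * cis (- (real_of_int (int N + 1) * k\<^sub>0)) + (c (- int N - 1) * cis (- (real_of_int (- int N - 1) * k\<^sub>0))
        + (\<Sum>n\<in>{- int N..int N}. c n * cis (- (real_of_int n * k\<^sub>0))))"
      by simp
    show ?case
      unfolding split Suc.IH c_eq[of "int N + 1"] c_eq[of "- int N - 1"]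
      by (simp add: algebra_simps) (rule arg_cong[where f=h], simp)
  qed
  have "(\<lambda>N. d (int N + 1)) \<longlonglongrightarrow> 0" "(\<lambda>N. d (- int N)) \<longlonglongrightarrow> 0"
    by (rule bessel_imp_tendsto_0[OF dB, of "\<lambda>N. int N + 1"], simp_all add: inj_def)
       (rule bessel_imp_tendsto_0[OF dB, of "\<lambda>N. - int N"], simp_all add: inj_def)
  note dlim = this
  have nh: "norm (h n) = norm (d n)" for n by (simp add: h_def norm_mult)
  have "(\<lambda>N. h (int N + 1)) \<longlonglongrightarrow> 0" "(\<lambda>N. h (- int N)) \<longlonglongrightarrow> 0"
    using dlim[THEN tendsto_norm_zero] unfolding nh[symmetric] by (simp_all only: tendsto_norm_zero_iff)
  then have "(\<lambda>N. B k\<^sub>0 + (h (int N + 1) - h (- int N))) \<longlonglongrightarrow> B k\<^sub>0 + (0 - 0)"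
    by (intro tendsto_add tendsto_diff tendsto_const)
  then show ?thesis unfolding c_def[symmetric] sum by simp
qed

section \<open>Large-time behaviour of resolvent pairings\<close>

text \<open>For a window \<open>g\<close> and \<open>H = fhat f * g\<close> this is, up to the phase \<open>cis (t * lam)\<close>, the pairing of
  \<open>(\<Delta> - (\<lambda> + \<i> \<epsilon>))\<^bsup>-1\<^esup> f\<close> with the packet at time \<open>t\<close> whose
  initial Fourier transform is \<open>g\<close>; the lemma \<open>packet_pairing_limit\<close> below makes this precise.\<close>

definition resolvent_pairing :: "(('n::finite \<Rightarrow> real) \<Rightarrow> complex) \<Rightarrow> real \<Rightarrow> real \<Rightarrow> real \<Rightarrow> complex" where
  "resolvent_pairing H lam \<epsilon> t =
    (\<integral>k. H k * cis (t * (Phi k - lam)) / (complex_of_real (Phi k - lam) - \<i> * complex_of_real \<epsilon>) \<partial>tor)"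

lemma norm_minus_imag_ge:
  "\<bar>w\<bar> \<le> norm (complex_of_real w - \<i> * complex_of_real \<epsilon>)" "\<bar>\<epsilon>\<bar> \<le> norm (complex_of_real w - \<i> * complex_of_real \<epsilon>)"
  using abs_Re_le_cmod[of "complex_of_real w - \<i> * complex_of_real \<epsilon>"]
    abs_Im_le_cmod[of "complex_of_real w - \<i> * complex_of_real \<epsilon>"] by simp_all

lemma norm_cis_minus_1: "norm (cis x - 1) \<le> \<bar>x\<bar>"
proof -
  have "norm (cis x - cis 0) \<le> 1 * norm (x - 0)"
  proof (rule differentiable_bound[where S=UNIV and f'="\<lambda>x h. h *\<^sub>R (\<i> * cis x)"])
    show "(cis has_derivative (\<lambda>h. h *\<^sub>R (\<i> * cis y))) (at y within UNIV)" for y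
      by (auto intro!: derivative_eq_intros)
    show "onorm (\<lambda>h. h *\<^sub>R (\<i> * cis y)) \<le> 1" for y
      by (simp add: onorm_scaleR_left onorm_id norm_mult)
  qed auto
  then show ?thesis by simp
qed

lemma resolvent_pairing_integrable:
  fixes H :: "('n::finite \<Rightarrow> real) \<Rightarrow> complex"
  assumes H: "H \<in> borel_measurable tor" "\<And>k. norm (H k) \<le> M" and \<epsilon>: "\<epsilon> \<noteq> 0"
  shows "integrable tor (\<lambda>k. H k * cis (t * (Phi k - lam)) / (complex_of_real (Phi k - lam) - \<i> * complex_of_real \<epsilon>))"
proof (rule integrable_tor_bounded[where B="M / \<bar>\<epsilon>\<bar>"])
  show "(\<lambda>k. H k * cis (t * (Phi k - lam)) / (complex_of_real (Phi k - lam) - \<i> * complex_of_real \<epsilon>)) \<in> borel_measurable tor"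
    using H(1) by measurable
  fix k :: "'n \<Rightarrow> real"
  show "norm (H k * cis (t * (Phi k - lam)) / (complex_of_real (Phi k - lam) - \<i> * complex_of_real \<epsilon>)) \<le> M / \<bar>\<epsilon>\<bar>"
    unfolding norm_divide norm_mult norm_cis mult_1_right
    using H(2)[of k] order_trans[OF norm_ge_zero H(2)[of k]] norm_minus_imag_ge(2)[of \<epsilon> "Phi k - lam"] \<epsilon> by (intro frac_le) auto
qed

text \<open>For \<open>\<epsilon> > 0\<close> the formula
  \<open>1 / (w - \<i> \<epsilon>) = \<i> \<integral>\<^sub>0\<^sup>\<infinity> e\<^bsup>-\<i>sw - \<epsilon>s\<^esup> ds\<close> expresses the pairing at time \<open>- \<tau>\<close> by the free evolution at
  times before \<open>- \<tau>\<close>, where it decays quadratically. The retarded pairing is thus negligible in the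
  past, and symmetrically the advanced one (\<open>\<sigma> = - 1\<close>) in the future. The proof avoids the improper
  integral: \<open>y s\<close>, the pairing at time \<open>- \<sigma> s\<close> damped by \<open>e\<^bsup>-\<epsilon>s\<^esup>\<close>, vanishes at infinity and its
  derivative is free of the resolvent.\<close>

lemma resolvent_pairing_incoming_bound:
  fixes H :: "('n::finite \<Rightarrow> real) \<Rightarrow> complex"
  assumes H: "H \<in> borel_measurable tor" "\<And>k. norm (H k) \<le> M"
    and dec: "\<And>u. u \<noteq> 0 \<Longrightarrow> norm (\<integral>k. H k * cis (u * Phi k) \<partial>tor) \<le> C / u\<^sup>2"
    and \<epsilon>: "\<epsilon> > 0" and \<sigma>: "\<sigma> = 1 \<or> \<sigma> = - 1" and \<tau>: "\<tau> > 0"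
  shows "norm (resolvent_pairing H lam (\<sigma> * \<epsilon>) (- \<sigma> * \<tau>)) \<le> C / \<tau>"
proof -
  have [measurable]: "H \<in> borel_measurable tor" by fact
  have M0: "M \<ge> 0" using order_trans[OF norm_ge_zero H(2)] .
  have C0: "C \<ge> 0" using order_trans[OF norm_ge_zero dec[of 1]] by simp
  define w where "w k = Phi k - lam" for k :: "'n \<Rightarrow> real"
  have [measurable]: "w \<in> borel_measurable tor" unfolding w_def by measurable
  define d where "d k = complex_of_real (w k) - \<i> * complex_of_real (\<sigma> * \<epsilon>)" for k
  have [measurable]: "d \<in> borel_measurable tor" unfolding d_def by measurable
  have d: "\<epsilon> \<le> norm (d k)" for k
    using norm_minus_imag_ge(2)[of "\<sigma> * \<epsilon>" "w k"] \<sigma> \<epsilon> by (auto simp: d_def)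
  have d0: "d k \<noteq> 0" for k using d[of k] \<epsilon> by auto
  define g where "g s k = H k * (exp (- \<epsilon> * s) * cis (- \<sigma> * s * w k)) / d k" for s k
  define g' where "g' s k = - \<i> * \<sigma> * (H k * (exp (- \<epsilon> * s) * cis (- \<sigma> * s * w k)))" for s k
  define y where "y s = (\<integral>k. g s k \<partial>tor)" for s
  define y' where "y' s = (\<integral>k. g' s k \<partial>tor)" for s
  have y_eq: "y s = exp (- \<epsilon> * s) * resolvent_pairing H lam (\<sigma> * \<epsilon>) (- \<sigma> * s)" for s
  proof -
    have "y s = (\<integral>k. complex_of_real (exp (- \<epsilon> * s)) * (H k * cis (- \<sigma> * s * w k) / d k) \<partial>tor)"
      unfolding y_def g_def by (simp add: algebra_simps)
    then show ?thesis by (simp only: resolvent_pairing_def w_def d_def integral_mult_right_zero)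
  qed
  have gB: "norm (g s k) \<le> M / \<epsilon>" "norm (g' s k) \<le> M" if "s \<ge> 0" for s k
  proof -
    have e: "exp (- \<epsilon> * s) \<le> 1" using that \<epsilon> by simp
    have "norm (H k) * exp (- \<epsilon> * s) \<le> M * 1" using H(2)[of k] e M0 by (intro mult_mono) auto
    then have n: "norm (H k * (exp (- \<epsilon> * s) * cis (- \<sigma> * s * w k))) \<le> M" by (simp add: norm_mult)
    show "norm (g s k) \<le> M / \<epsilon>"
      unfolding g_def norm_divide using n d[of k] \<epsilon> M0 by (intro frac_le) auto
    show "norm (g' s k) \<le> M"
      using n \<sigma> unfolding g'_def norm_mult[of "- \<i> * \<sigma>"] by (auto simp: norm_mult)
  qed
  have deriv: "(y has_vector_derivative y' s) (at s)" if "s > 0" for s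
    unfolding y_def y'_def
  proof (rule has_vector_derivative_integral[OF tor.prob_space_axioms, where a=0 and b="s + 1"])
    show "g s \<in> borel_measurable tor" for s unfolding g_def by measurable
    show "g' s \<in> borel_measurable tor" unfolding g'_def by measurable
    show "norm (g s k) \<le> M / \<epsilon>" if "0 < s" for s k using gB that by simp
    show "norm (g' s k) \<le> M" if "0 < s" for s k using gB that by simp
    show "((\<lambda>s. g s k) has_vector_derivative g' s k) (at s)" for s k
    proof -
      have "((\<lambda>s. H k * (complex_of_real (exp (- \<epsilon> * s)) * cis (- \<sigma> * s * w k)) / d k) has_vector_derivative
         H k * (complex_of_real (exp (- \<epsilon> * s)) * ((- \<sigma> * w k) *\<^sub>R (\<i> * cis (- \<sigma> * s * w k))) + complex_of_real (exp (- \<epsilon> * s) * (- \<epsilon>)) * cis (- \<sigma> * s * w k)) / d k) (at s)"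
        by (intro has_vector_derivative_divide has_vector_derivative_mult_right has_vector_derivative_mult has_vector_derivative_of_real)
           (auto simp: has_vector_derivative_def intro!: derivative_eq_intros)
      moreover have "H k * (complex_of_real (exp (- \<epsilon> * s)) * ((- \<sigma> * w k) *\<^sub>R (\<i> * cis (- \<sigma> * s * w k))) + complex_of_real (exp (- \<epsilon> * s) * (- \<epsilon>)) * cis (- \<sigma> * s * w k)) / d k
          = g' s k * (d k / d k)"
        unfolding g'_def times_divide_eq_right
        by (rule arg_cong2[where f="(/)"]) (use \<sigma> in \<open>auto simp: d_def scaleR_conv_of_real algebra_simps\<close>)
      ultimately show ?thesis using d0[of k] by (simp add: g_def)
    qed
  qed (use that in auto)
  have y'B: "norm (y' s) \<le> exp (- \<epsilon> * \<tau>) * (C / s\<^sup>2)" if "s \<ge> \<tau>" for s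
  proof -
    have "g' s k = (- \<i> * \<sigma> * exp (- \<epsilon> * s) * cis (\<sigma> * s * lam)) * (H k * cis (- \<sigma> * s * Phi k))" for k
    proof -
      have "cis (- \<sigma> * s * w k) = cis (\<sigma> * s * lam) * cis (- \<sigma> * s * Phi k)"
        by (simp add: w_def cis_mult algebra_simps)
      then show ?thesis by (simp add: g'_def algebra_simps)
    qed
    then have "y' s = (- \<i> * \<sigma> * exp (- \<epsilon> * s) * cis (\<sigma> * s * lam)) * (\<integral>k. H k * cis (- \<sigma> * s * Phi k) \<partial>tor)"
      unfolding y'_def integral_mult_right_zero[symmetric] by (intro Bochner_Integration.integral_cong refl)
    also have "norm \<dots> = exp (- \<epsilon> * s) * norm (\<integral>k. H k * cis (- \<sigma> * s * Phi k) \<partial>tor)"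
      unfolding norm_mult using \<sigma> by auto
    also have "\<dots> \<le> exp (- \<epsilon> * \<tau>) * (C / s\<^sup>2)"
    proof (rule mult_mono)
      have "norm (\<integral>k. H k * cis (- \<sigma> * s * Phi k) \<partial>tor) \<le> C / (- \<sigma> * s)\<^sup>2"
        using dec[of "- \<sigma> * s"] \<sigma> \<tau> that by auto
      then show "norm (\<integral>k. H k * cis (- \<sigma> * s * Phi k) \<partial>tor) \<le> C / s\<^sup>2" using \<sigma> by auto
    qed (use that \<epsilon> in auto)
    finally show ?thesis .
  qed
  have inc: "norm (y T - y \<tau>) \<le> exp (- \<epsilon> * \<tau>) * (C / \<tau>)" if "T > \<tau>" for T
  proof -
    let ?\<phi> = "\<lambda>s. - (exp (- \<epsilon> * \<tau>) * (C / s))"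
    have "norm (y T - y \<tau>) \<le> ?\<phi> T - ?\<phi> \<tau>"
    proof (rule differentiable_bound_general[OF that])
      show "continuous_on {\<tau>..T} y"
        by (intro continuous_at_imp_continuous_on ballI has_vector_derivative_continuous[OF deriv]) (use \<tau> in auto)
      show "continuous_on {\<tau>..T} ?\<phi>" using \<tau> by (intro continuous_intros) auto
      fix s assume s: "\<tau> < s" "s < T"
      show "(y has_vector_derivative y' s) (at s)" using s \<tau> by (intro deriv) simp
      have "(?\<phi> has_real_derivative exp (- \<epsilon> * \<tau>) * (C / s\<^sup>2)) (at s)"
        using s \<tau> by (auto intro!: derivative_eq_intros simp: power2_eq_square)
      then show "(?\<phi> has_vector_derivative exp (- \<epsilon> * \<tau>) * (C / s\<^sup>2)) (at s)"
        by (simp add: has_real_derivative_iff_has_vector_derivative)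
      show "norm (y' s) \<le> exp (- \<epsilon> * \<tau>) * (C / s\<^sup>2)" using s by (intro y'B) simp
    qed
    also have "\<dots> \<le> exp (- \<epsilon> * \<tau>) * (C / \<tau>)" using C0 \<tau> that by simp
    finally show ?thesis .
  qed
  have ylim: "(y \<longlongrightarrow> 0) at_top"
  proof (rule Lim_null_comparison)
    have "norm (y T) \<le> exp (- \<epsilon> * T) * (M / \<epsilon>)" for T
    proof -
      have "norm (resolvent_pairing H lam (\<sigma> * \<epsilon>) (- \<sigma> * T)) \<le> M / \<epsilon>"
        unfolding resolvent_pairing_def
      proof (rule norm_integral_tor_le)
        fix k :: "'n \<Rightarrow> real"
        show "norm (H k * cis (- \<sigma> * T * (Phi k - lam)) / (complex_of_real (Phi k - lam) - \<i> * complex_of_real (\<sigma> * \<epsilon>))) \<le> M / \<epsilon>"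
          unfolding norm_divide norm_mult norm_cis mult_1_right
          using H(2)[of k] d[of k] \<epsilon> M0 unfolding d_def w_def by (intro frac_le) auto
      qed measurable
      then have "exp (- \<epsilon> * T) * norm (resolvent_pairing H lam (\<sigma> * \<epsilon>) (- \<sigma> * T)) \<le> exp (- \<epsilon> * T) * (M / \<epsilon>)"
        by (rule mult_left_mono) simp
      then show ?thesis unfolding y_eq norm_mult by simp
    qed
    then show "eventually (\<lambda>T. norm (y T) \<le> exp (- \<epsilon> * T) * (M / \<epsilon>)) at_top" by simp
    have "filterlim (\<lambda>T. - \<epsilon> * T) at_bot at_top"
      using \<epsilon> by (intro filterlim_tendsto_neg_mult_at_bot[OF tendsto_const] filterlim_ident) auto
    then have "((\<lambda>T. exp (- \<epsilon> * T)) \<longlongrightarrow> 0) at_top"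
      by (rule filterlim_compose[OF exp_at_bot])
    then show "((\<lambda>T. exp (- \<epsilon> * T) * (M / \<epsilon>)) \<longlongrightarrow> 0) at_top"
      by (rule tendsto_mult_left_zero)
  qed
  have "norm (0 - y \<tau>) \<le> exp (- \<epsilon> * \<tau>) * (C / \<tau>)"
  proof (rule tendsto_upperbound)
    show "((\<lambda>T. norm (y T - y \<tau>)) \<longlongrightarrow> norm (0 - y \<tau>)) at_top" by (intro tendsto_intros ylim)
    show "eventually (\<lambda>T. norm (y T - y \<tau>) \<le> exp (- \<epsilon> * \<tau>) * (C / \<tau>)) at_top"
      using eventually_gt_at_top[of \<tau>] by eventually_elim (rule inc)
  qed simp
  then have "exp (- \<epsilon> * \<tau>) * norm (resolvent_pairing H lam (\<sigma> * \<epsilon>) (- \<sigma> * \<tau>)) \<le> exp (- \<epsilon> * \<tau>) * (C / \<tau>)"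
    unfolding y_eq by (simp add: norm_mult)
  then show ?thesis by (rule mult_left_le_imp_le) simp
qed

text \<open>Across the real axis the resolvent jumps by a multiple of the Poisson kernel.\<close>

lemma resolvent_pairing_diff_eq:
  fixes H :: "('n::finite \<Rightarrow> real) \<Rightarrow> complex"
  assumes H: "H \<in> borel_measurable tor" "\<And>k. norm (H k) \<le> M" and \<epsilon>: "\<epsilon> \<noteq> 0"
  shows "resolvent_pairing H lam \<epsilon> t - resolvent_pairing H lam (- \<epsilon>) t =
    \<i> * (\<integral>k. H k * cis (t * (Phi k - lam)) * complex_of_real (2 * \<epsilon> / ((Phi k - lam)\<^sup>2 + \<epsilon>\<^sup>2)) \<partial>tor)"
proof -
  have alg: "a / (complex_of_real w - \<i> * complex_of_real \<epsilon>) - a / (complex_of_real w - \<i> * complex_of_real (- \<epsilon>)) =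
     \<i> * (a * complex_of_real (2 * \<epsilon> / (w\<^sup>2 + \<epsilon>\<^sup>2)))" for a w
  proof -
    have "(complex_of_real w - \<i> * complex_of_real \<epsilon>) * (complex_of_real w - \<i> * complex_of_real (- \<epsilon>)) = complex_of_real (w\<^sup>2 + \<epsilon>\<^sup>2)"
      by (simp add: algebra_simps power2_eq_square)
    moreover have "complex_of_real w - \<i> * complex_of_real \<epsilon> \<noteq> 0" "complex_of_real w - \<i> * complex_of_real (- \<epsilon>) \<noteq> 0"
      using norm_minus_imag_ge(2)[of \<epsilon> w] norm_minus_imag_ge(2)[of "- \<epsilon>" w] \<epsilon> by auto
    ultimately show ?thesis
      by (simp add: diff_frac_eq) (simp add: algebra_simps)
  qed
  show ?thesis
    unfolding resolvent_pairing_def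
    using resolvent_pairing_integrable[OF H \<epsilon>, of t lam] resolvent_pairing_integrable[OF H, of "- \<epsilon>" t lam] \<epsilon>
    by (subst Bochner_Integration.integral_diff[symmetric]) (simp_all only: alg integral_mult_right_zero neg_equal_0_iff_equal not_False_eq_True)
qed

lemma resolvent_pairing_time_increment:
  fixes H :: "('n::finite \<Rightarrow> real) \<Rightarrow> complex"
  assumes H: "H \<in> borel_measurable tor" "\<And>k. norm (H k) \<le> M" and \<epsilon>: "\<epsilon> \<noteq> 0"
  shows "norm (resolvent_pairing H lam \<epsilon> t - resolvent_pairing H lam \<epsilon> 0) \<le> M * \<bar>t\<bar>"
proof -
  have [measurable]: "H \<in> borel_measurable tor" by fact
  have M0: "M \<ge> 0" using order_trans[OF norm_ge_zero H(2)] .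
  let ?d = "\<lambda>k. complex_of_real (Phi k - lam) - \<i> * complex_of_real \<epsilon>"
  have "resolvent_pairing H lam \<epsilon> t - resolvent_pairing H lam \<epsilon> 0 =
      (\<integral>k. H k * cis (t * (Phi k - lam)) / ?d k - H k * cis (0 * (Phi k - lam)) / ?d k \<partial>tor)"
    unfolding resolvent_pairing_def
    by (rule Bochner_Integration.integral_diff[OF resolvent_pairing_integrable[OF H \<epsilon>] resolvent_pairing_integrable[OF H \<epsilon>], symmetric])
  also have "norm \<dots> \<le> M * \<bar>t\<bar>"
  proof (rule norm_integral_tor_le)
    fix k :: "'n \<Rightarrow> real"
    have pos: "norm (?d k) > 0" using norm_minus_imag_ge(2)[of \<epsilon> "Phi k - lam"] \<epsilon> by linarith
    have "H k * cis (t * (Phi k - lam)) / ?d k - H k * cis (0 * (Phi k - lam)) / ?d k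
        = H k * (cis (t * (Phi k - lam)) - 1) / ?d k"
      by (simp add: diff_divide_distrib right_diff_distrib)
    also have "norm \<dots> = norm (H k) * norm (cis (t * (Phi k - lam)) - 1) / norm (?d k)"
      by (simp only: norm_divide norm_mult)
    also have "\<dots> \<le> M * (\<bar>t\<bar> * norm (?d k)) / norm (?d k)"
    proof (intro divide_right_mono mult_mono)
      have "norm (cis (t * (Phi k - lam)) - 1) \<le> \<bar>t\<bar> * \<bar>Phi k - lam\<bar>"
        using norm_cis_minus_1[of "t * (Phi k - lam)"] by (simp only: abs_mult)
      also have "\<dots> \<le> \<bar>t\<bar> * norm (?d k)"
        by (intro mult_left_mono norm_minus_imag_ge(1)) simp
      finally show "norm (cis (t * (Phi k - lam)) - 1) \<le> \<bar>t\<bar> * norm (?d k)" .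
    qed (use H M0 in auto)
    also have "\<dots> = M * \<bar>t\<bar>" using pos \<epsilon> by simp
    finally show "norm (H k * cis (t * (Phi k - lam)) / ?d k - H k * cis (0 * (Phi k - lam)) / ?d k) \<le> M * \<bar>t\<bar>" .
  qed measurable
  finally show ?thesis .
qed

text \<open>Each of the two pairings is bounded at a time of unit size in its own direction of decay, and
  changes by at most \<open>M\<close> on the way to time \<open>0\<close>. Uniformity in \<open>\<epsilon>\<close> is what dominated convergence requires
  later on.\<close>

lemma resolvent_pairing_jump_bounded:
  fixes H :: "('n::finite \<Rightarrow> real) \<Rightarrow> complex"
  assumes H: "H \<in> borel_measurable tor" "\<And>k. norm (H k) \<le> M"
    and dec: "\<And>u. u \<noteq> 0 \<Longrightarrow> norm (\<integral>k. H k * cis (u * Phi k) \<partial>tor) \<le> C / u\<^sup>2"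
    and \<epsilon>: "\<epsilon> > 0"
  shows "norm (resolvent_pairing H lam \<epsilon> 0 - resolvent_pairing H lam (- \<epsilon>) 0) \<le> 2 * (C + M)"
proof -
  have "norm (resolvent_pairing H lam \<epsilon> (- 1)) \<le> C"
    using resolvent_pairing_incoming_bound[OF H dec \<epsilon>, of 1 1 lam] by simp
  moreover have "norm (resolvent_pairing H lam (- \<epsilon>) 1) \<le> C"
    using resolvent_pairing_incoming_bound[OF H dec \<epsilon>, of "- 1" 1 lam] by simp
  moreover have "norm (resolvent_pairing H lam \<epsilon> (- 1) - resolvent_pairing H lam \<epsilon> 0) \<le> M" "norm (resolvent_pairing H lam (- \<epsilon>) 1 - resolvent_pairing H lam (- \<epsilon>) 0) \<le> M"
    using resolvent_pairing_time_increment[OF H, of \<epsilon> lam "- 1"] resolvent_pairing_time_increment[OF H, of "- \<epsilon>" lam 1] \<epsilon> by auto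
  moreover have "norm (a0 - b0) \<le> 2 * (C + M)"
    if "norm a1 \<le> C" "norm b1 \<le> C" "norm (a1 - a0) \<le> M" "norm (b1 - b0) \<le> M" for a0 a1 b0 b1 :: complex
  proof -
    have "a0 - b0 = (a1 - (a1 - a0)) - (b1 - (b1 - b0))" by simp
    also have "norm \<dots> \<le> (norm a1 + norm (a1 - a0)) + (norm b1 + norm (b1 - b0))"
      by (intro order_trans[OF norm_triangle_ineq4] add_mono norm_triangle_ineq4)
    finally show ?thesis using that by simp
  qed
  ultimately show ?thesis by blast
qed

text \<open>At a large time \<open>t\<close> both boundary values are small: the advanced one by
  \<open>resolvent_pairing_incoming_bound\<close>, the retarded one by hypothesis. The jump concentrates on the level \<open>Phi = lam\<close>, where the
  factor \<open>cis (t * (Phi k - lam))\<close> is \<open>1\<close>; going back from \<open>t\<close> to \<open>0\<close> costs only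
  \<open>36 M t \<surd>\<epsilon>\<close>, which vanishes for fixed \<open>t\<close> as \<open>\<epsilon> \<rightarrow> 0\<close>.\<close>

lemma resolvent_pairing_jump_tendsto_0:
  fixes H :: "('n::finite \<Rightarrow> real) \<Rightarrow> complex"
  assumes H: "H \<in> borel_measurable tor" "\<And>k. norm (H k) \<le> M"
    and dec: "\<And>u. u \<noteq> 0 \<Longrightarrow> norm (\<integral>k. H k * cis (u * Phi k) \<partial>tor) \<le> C / u\<^sup>2"
    and out: "\<And>t. t \<ge> T \<Longrightarrow> \<exists>K. \<forall>\<epsilon>>0. norm (resolvent_pairing H lam \<epsilon> t) \<le> \<delta> t + K * \<epsilon> powr (1 / 4)"
    and \<delta>: "(\<delta> \<longlongrightarrow> 0) at_top"
  shows "((\<lambda>\<epsilon>. resolvent_pairing H lam \<epsilon> 0 - resolvent_pairing H lam (- \<epsilon>) 0) \<longlongrightarrow> 0) (at_right 0)"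
proof -
  have [measurable]: "H \<in> borel_measurable tor" by fact
  have M0: "M \<ge> 0" using order_trans[OF norm_ge_zero H(2)] .
  define Z where "Z \<epsilon> t = resolvent_pairing H lam \<epsilon> t - resolvent_pairing H lam (- \<epsilon>) t" for \<epsilon> t
  have move: "norm (Z \<epsilon> t - Z \<epsilon> 0) \<le> 36 * M * t * sqrt \<epsilon>" if \<epsilon>: "\<epsilon> > 0" and t: "t \<ge> 1" for \<epsilon> t
  proof -
    let ?P = "\<lambda>k. complex_of_real (2 * \<epsilon> / ((Phi k - lam)\<^sup>2 + \<epsilon>\<^sup>2))"
    let ?d = "\<lambda>k :: 'n \<Rightarrow> real. complex_of_real (Phi k) - Complex lam \<epsilon>"
    have d_eq: "?d k = complex_of_real (Phi k - lam) - \<i> * complex_of_real \<epsilon>" for k :: "'n \<Rightarrow> real"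
      by (simp add: Complex_eq)
    have pos: "(Phi k - lam)\<^sup>2 + \<epsilon>\<^sup>2 > 0" for k :: "'n \<Rightarrow> real" using \<epsilon> by (simp add: add_nonneg_pos)
    have PB: "norm (H k * cis (t * (Phi k - lam)) * ?P k) \<le> M * (2 / \<epsilon>)" for k t
    proof -
      have "2 * \<epsilon> / ((Phi k - lam)\<^sup>2 + \<epsilon>\<^sup>2) \<le> 2 * \<epsilon> / \<epsilon>\<^sup>2"
        using \<epsilon> pos[of k] by (intro divide_left_mono mult_pos_pos) auto
      also have "\<dots> = 2 / \<epsilon>" using \<epsilon> by (simp add: power2_eq_square)
      moreover have "0 \<le> 2 * \<epsilon> / ((Phi k - lam)\<^sup>2 + \<epsilon>\<^sup>2)" using \<epsilon> pos[of k] by (intro divide_nonneg_pos) auto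
      ultimately have "\<bar>2 * \<epsilon> / ((Phi k - lam)\<^sup>2 + \<epsilon>\<^sup>2)\<bar> \<le> 2 / \<epsilon>" by linarith
      then show ?thesis
        unfolding norm_mult norm_cis norm_of_real mult_1_right using H(2)[of k] M0 by (intro mult_mono) auto
    qed
    have i: "integrable tor (\<lambda>k. H k * cis (t * (Phi k - lam)) * ?P k)" for t
      by (rule integrable_tor_bounded[OF _ PB]) measurable
    define I where "I = (\<integral>k. H k * cis (t * (Phi k - lam)) * ?P k - H k * cis (0 * (Phi k - lam)) * ?P k \<partial>tor)"
    have "Z \<epsilon> t - Z \<epsilon> 0 = \<i> * ((\<integral>k. H k * cis (t * (Phi k - lam)) * ?P k \<partial>tor) - (\<integral>k. H k * cis (0 * (Phi k - lam)) * ?P k \<partial>tor))"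
      unfolding Z_def using \<epsilon> by (subst (1 2) resolvent_pairing_diff_eq[OF H]) (auto simp: algebra_simps)
    then have "Z \<epsilon> t - Z \<epsilon> 0 = \<i> * I"
      unfolding I_def by (simp only: Bochner_Integration.integral_diff[OF i i])
    then have "norm (Z \<epsilon> t - Z \<epsilon> 0) = norm I"
      by (simp only: norm_mult norm_ii mult_1_left)
    also have "\<dots> \<le> (\<integral>k. norm (H k * cis (t * (Phi k - lam)) * ?P k - H k * cis (0 * (Phi k - lam)) * ?P k) \<partial>tor)"
      unfolding I_def by (rule integral_norm_bound)
    also have "\<dots> \<le> (\<integral>k. (2 * M * t * \<epsilon>) * (1 / norm (?d k)) \<partial>tor)"
    proof (rule integral_mono)
      show "integrable tor (\<lambda>k. norm (H k * cis (t * (Phi k - lam)) * ?P k - H k * cis (0 * (Phi k - lam)) * ?P k))"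
        by (intro integrable_norm Bochner_Integration.integrable_diff i)
      show "integrable tor (\<lambda>k. (2 * M * t * \<epsilon>) * (1 / norm (?d k)))"
        using \<epsilon> by (intro integrable_mult_right integrable_inverse_resolvent) simp
      fix k :: "'n \<Rightarrow> real"
      define w where "w = Phi k - lam"
      define N where "N = norm (?d k)"
      have N: "\<bar>w\<bar> \<le> N" "\<epsilon> \<le> N" "N\<^sup>2 = w\<^sup>2 + \<epsilon>\<^sup>2"
        using norm_minus_imag_ge[of w \<epsilon>] norm_minus_imag_ge(2)[of \<epsilon> w] \<epsilon>
        unfolding N_def d_eq w_def[symmetric] by (auto simp: cmod_power2)
      have N0: "N > 0" using N \<epsilon> by linarith
      have "H k * cis (t * w) * ?P k - H k * cis (0 * w) * ?P k = H k * (cis (t * w) - 1) * ?P k"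
        by (simp only: mult_zero_left cis_zero right_diff_distrib left_diff_distrib mult_1_right)
      also have "norm \<dots> = norm (H k) * norm (cis (t * w) - 1) * (2 * \<epsilon> / N\<^sup>2)"
        unfolding norm_mult norm_of_real w_def[symmetric] N(3)[symmetric] using \<epsilon> N0 by (simp add: abs_mult)
      also have "\<dots> \<le> M * (t * N) * (2 * \<epsilon> / N\<^sup>2)"
      proof (intro mult_right_mono mult_mono)
        show "norm (cis (t * w) - 1) \<le> t * N"
          using norm_cis_minus_1[of "t * w"] N(1) t by (simp add: abs_mult) (meson mult_left_mono order_trans zero_le_one)
      qed (use H M0 t \<epsilon> N0 in auto)
      also have "\<dots> = (2 * M * t * \<epsilon>) * (1 / N)" using N0 by (simp add: power2_eq_square)
      finally show "norm (H k * cis (t * (Phi k - lam)) * ?P k - H k * cis (0 * (Phi k - lam)) * ?P k) \<le> (2 * M * t * \<epsilon>) * (1 / norm (?d k))"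
        by (simp only: w_def N_def)
    qed
    also have "\<dots> = (2 * M * t * \<epsilon>) * (\<integral>k. 1 / norm (?d k) \<partial>tor)" by (simp only: integral_mult_right_zero)
    also have "\<dots> \<le> (2 * M * t * \<epsilon>) * (18 / sqrt \<epsilon>)"
      using tor_resolvent_bound[where 'n='n, of "Complex lam \<epsilon>"] \<epsilon> M0 t by (intro mult_left_mono) auto
    also have "\<dots> = 36 * M * t * sqrt \<epsilon>"
    proof -
      have "\<epsilon> / sqrt \<epsilon> = sqrt \<epsilon>" using \<epsilon> by (simp add: real_div_sqrt)
      moreover have "(2 * M * t * \<epsilon>) * (18 / sqrt \<epsilon>) = 36 * M * t * (\<epsilon> / sqrt \<epsilon>)" by simp
      ultimately show ?thesis by (simp only:)
    qed
    finally show ?thesis .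
  qed
  have C0: "C \<ge> 0" using order_trans[OF norm_ge_zero dec[of 1]] by simp
  have "((\<lambda>\<epsilon>. Z \<epsilon> 0) \<longlongrightarrow> 0) (at_right 0)"
  proof (rule tendstoI)
    fix e :: real assume e: "e > 0"
    have "((\<lambda>t. \<delta> t + C / t) \<longlongrightarrow> 0 + 0) at_top"
      by (intro tendsto_add \<delta> real_tendsto_divide_at_top[OF tendsto_const filterlim_ident])
    then have "eventually (\<lambda>t. \<delta> t + C / t < e / 2) at_top"
      using e by (intro order_tendstoD(2)) auto
    then have "eventually (\<lambda>t. \<delta> t + C / t < e / 2 \<and> t \<ge> 1 \<and> t \<ge> T) at_top"
      using eventually_ge_at_top[of 1] eventually_ge_at_top[of T] by eventually_elim auto
    then obtain t where t: "\<delta> t + C / t < e / 2" "t \<ge> 1" "t \<ge> T"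
      by (auto simp: eventually_at_top_linorder)
    obtain K where K: "\<And>\<epsilon>. \<epsilon> > 0 \<Longrightarrow> norm (resolvent_pairing H lam \<epsilon> t) \<le> \<delta> t + K * \<epsilon> powr (1 / 4)"
      using out[OF t(3)] by blast
    have "((\<lambda>\<epsilon>::real. K * \<epsilon> powr (1 / 4) + 36 * M * t * sqrt \<epsilon>) \<longlongrightarrow> K * 0 powr (1 / 4) + 36 * M * t * sqrt 0) (at_right 0)"
      by (intro tendsto_intros tendsto_powr') (auto simp: eventually_at_filter)
    then have "eventually (\<lambda>\<epsilon>::real. K * \<epsilon> powr (1 / 4) + 36 * M * t * sqrt \<epsilon> < e / 2) (at_right 0)"
      using e by (intro order_tendstoD(2)) auto
    moreover have "eventually (\<lambda>\<epsilon>::real. \<epsilon> > 0) (at_right 0)" by (rule eventually_at_right_less)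
    ultimately show "eventually (\<lambda>\<epsilon>. dist (Z \<epsilon> 0) 0 < e) (at_right 0)"
    proof eventually_elim
      case (elim \<epsilon>)
      have inc: "norm (resolvent_pairing H lam (- \<epsilon>) t) \<le> C / t"
        using resolvent_pairing_incoming_bound[OF H dec elim(2), of "- 1" t lam] t by simp
      have "norm (Z \<epsilon> t) \<le> norm (resolvent_pairing H lam \<epsilon> t) + norm (resolvent_pairing H lam (- \<epsilon>) t)"
        unfolding Z_def by (rule norm_triangle_ineq4)
      moreover have "norm (Z \<epsilon> 0) \<le> norm (Z \<epsilon> t) + norm (Z \<epsilon> t - Z \<epsilon> 0)"
        using norm_triangle_ineq4[of "Z \<epsilon> t" "Z \<epsilon> t - Z \<epsilon> 0"] by simp
      moreover have "z0 < e" if "zt \<le> s1 + s2" "z0 \<le> zt + d" "s2 \<le> ct" "s1 \<le> dt + k" "d \<le> m" "dt + ct < e / 2" "k + m < e / 2"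
        for z0 zt s1 s2 d ct dt k m :: real
        using that by linarith
      ultimately have "norm (Z \<epsilon> 0) < e"
        using inc K[OF elim(2)] move[OF elim(2) t(2)] t(1) elim(1) by blast
      then show ?case by simp
    qed
  qed
  then show ?thesis by (simp add: Z_def)
qed

lemma integral_uniform_FTC:
  fixes F f :: "real \<Rightarrow> real"
  assumes ab: "a < b" and f[measurable]: "f \<in> borel_measurable borel"
    and F: "\<And>x. a \<le> x \<Longrightarrow> x \<le> b \<Longrightarrow> (F has_real_derivative f x) (at x)"
    and cont: "continuous_on {a..b} f"
  shows "(\<integral>x. f x \<partial>uniform_measure lborel {a..b}) = (F b - F a) / (b - a)"
proof -
  have eq: "uniform_measure lborel {a..b} = density lborel (\<lambda>x. ennreal (indicator {a..b} x / (b - a)))"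
    unfolding uniform_measure_def using ab
    by (intro density_cong) (auto simp: indicator_def divide_ennreal[symmetric] simp flip: ennreal_1 split: if_splits)
  have "(\<integral>x. f x \<partial>uniform_measure lborel {a..b}) = (\<integral>x. (indicator {a..b} x / (b - a)) *\<^sub>R f x \<partial>lborel)"
    unfolding eq by (rule integral_density) (use ab in auto)
  also have "\<dots> = (\<integral>x. (1 / (b - a)) *\<^sub>R (indicator {a..b} x *\<^sub>R f x) \<partial>lborel)"
    by (rule Bochner_Integration.integral_cong) auto
  also have "\<dots> = (1 / (b - a)) *\<^sub>R (F b - F a)"
    unfolding integral_scaleR_right
    by (subst integral_FTC_Icc[where F=F])
       (use ab F cont in \<open>auto simp: has_real_derivative_iff_has_vector_derivative intro: has_vector_derivative_at_within\<close>)
  finally show ?thesis by simp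
qed

text \<open>Stone's formula: integrating the Poisson kernel over \<open>\<lambda> \<in> [a, b]\<close> gives an arctangent difference that tends to
  \<open>2 \<pi>\<close> at every \<open>k\<close> in the support of \<open>H\<close>. On the other side, the jumps tend to \<open>0\<close> boundedly.\<close>

lemma spectral_uniqueness:
  fixes H :: "('n::finite \<Rightarrow> real) \<Rightarrow> complex"
  assumes H: "H \<in> borel_measurable tor" "\<And>k. norm (H k) \<le> M"
    and dec: "\<And>u. u \<noteq> 0 \<Longrightarrow> norm (\<integral>k. H k * cis (u * Phi k) \<partial>tor) \<le> C / u\<^sup>2"
    and ab: "a < b" and supp: "\<And>k. H k \<noteq> 0 \<Longrightarrow> a < Phi k \<and> Phi k < b"
    and jump: "\<And>lam. a \<le> lam \<Longrightarrow> lam \<le> b \<Longrightarrow>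
      ((\<lambda>\<epsilon>. resolvent_pairing H lam \<epsilon> 0 - resolvent_pairing H lam (- \<epsilon>) 0) \<longlongrightarrow> 0) (at_right 0)"
  shows "(\<integral>k. H k \<partial>tor) = 0"
proof -
  have [measurable]: "H \<in> borel_measurable tor" by fact
  have M0: "M \<ge> 0" using order_trans[OF norm_ge_zero H(2)] .
  \<comment> \<open>The normalised measure on \<open>[a, b]\<close> turns all the integrals in \<open>lam\<close> into integrals over a probability space.\<close>
  define U where "U = uniform_measure lborel {a..b}"
  interpret U: prob_space U unfolding U_def using ab by (intro prob_space_uniform_measure) auto
  have setsU [measurable_cong, simp]: "sets U = sets borel" by (simp add: U_def)
  have spaceU [simp]: "space U = UNIV" by (simp add: U_def)
  interpret P: pair_prob_space U "tor :: ('n \<Rightarrow> real) measure" ..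
  define e where "e n = inverse (real (Suc n))" for n
  have e: "e n > 0" for n by (simp add: e_def)
  have e0: "e \<longlonglongrightarrow> 0" unfolding e_def by (rule LIMSEQ_inverse_real_of_nat)
  have e_right: "filterlim e (at_right 0) sequentially"
    using e by (intro tendsto_imp_filterlim_at_right[OF e0]) simp
  define p where "p n lam x = 2 * e n / ((x - lam)\<^sup>2 + (e n)\<^sup>2)" for n lam x
  have den: "(x - lam)\<^sup>2 + (e n)\<^sup>2 > 0" for x lam n using e[of n] by (simp add: add_nonneg_pos)
  define Q where "Q n lam = (\<integral>k. H k * complex_of_real (p n lam (Phi k)) \<partial>tor)" for n lam
  have Q_eq: "resolvent_pairing H lam (e n) 0 - resolvent_pairing H lam (- e n) 0 = \<i> * Q n lam" for n lam
    using resolvent_pairing_diff_eq[OF H, of "e n" lam 0] e[of n] by (simp add: Q_def p_def)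
  have QB: "norm (Q n lam) \<le> 2 * (C + M)" for n lam
    using resolvent_pairing_jump_bounded[OF H dec e, of lam n] unfolding Q_eq by (simp add: norm_mult)
  have Qlim: "(\<lambda>n. Q n lam) \<longlonglongrightarrow> 0" if "a \<le> lam" "lam \<le> b" for lam
  proof -
    have "(\<lambda>n. resolvent_pairing H lam (e n) 0 - resolvent_pairing H lam (- e n) 0) \<longlonglongrightarrow> 0"
      by (rule filterlim_compose[OF jump[OF that] e_right])
    then have "(\<lambda>n. - \<i> * (\<i> * Q n lam)) \<longlonglongrightarrow> - \<i> * 0"
      unfolding Q_eq by (intro tendsto_mult tendsto_const)
    then show ?thesis by simp
  qed
  have [measurable]: "(\<lambda>(lam, k). H k * complex_of_real (p n lam (Phi k))) \<in> borel_measurable (U \<Otimes>\<^sub>M tor)" for n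
    unfolding p_def by measurable
  have [measurable]: "Q n \<in> borel_measurable U" for n
    unfolding Q_def by measurable
  have "(\<lambda>n. \<integral>lam. Q n lam \<partial>U) \<longlonglongrightarrow> (\<integral>lam. 0 \<partial>U)"
  proof (rule integral_dominated_convergence)
    show "AE lam in U. (\<lambda>n. Q n lam) \<longlonglongrightarrow> 0"
      unfolding U_def by (rule AE_uniform_measureI) (use Qlim in auto)
    show "integrable U (\<lambda>_. 2 * (C + M))" by simp
    show "AE lam in U. norm (Q n lam) \<le> 2 * (C + M)" for n using QB by simp
  qed auto
  then have lim1: "(\<lambda>n. \<integral>lam. Q n lam \<partial>U) \<longlonglongrightarrow> 0" by simp
  define A where "A n x = 2 * (arctan ((b - x) / e n) - arctan ((a - x) / e n)) / (b - a)" for n x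
  have inner: "(\<integral>lam. p n lam x \<partial>U) = A n x" for n x
  proof -
    have "(\<integral>lam. p n lam x \<partial>U) = (2 * arctan ((b - x) / e n) - 2 * arctan ((a - x) / e n)) / (b - a)"
      unfolding U_def
    proof (rule integral_uniform_FTC[OF ab])
      have c: "continuous_on S (\<lambda>lam. p n lam x)" for S
      proof -
        have nz: "(x - lam)\<^sup>2 + (e n)\<^sup>2 \<noteq> 0" for lam using den[of x lam n] by linarith
        show ?thesis unfolding p_def by (intro continuous_intros ballI nz)
      qed
      show "(\<lambda>lam. p n lam x) \<in> borel_measurable borel" by (rule borel_measurable_continuous_onI[OF c])
      show "continuous_on {a..b} (\<lambda>lam. p n lam x)" by (rule c)
      fix lam
      have "((\<lambda>lam. 2 * arctan ((lam - x) / e n)) has_real_derivative 2 * (inverse (1 + ((lam - x) / e n)\<^sup>2) * (1 / e n))) (at lam)"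
        using e[of n] by (auto intro!: derivative_eq_intros)
      moreover have "2 * (inverse (1 + ((lam - x) / e n)\<^sup>2) * (1 / e n)) = p n lam x"
      proof -
        have "1 + ((lam - x) / e n)\<^sup>2 = ((x - lam)\<^sup>2 + (e n)\<^sup>2) / (e n)\<^sup>2"
          using e[of n] by (simp add: power_divide add_divide_distrib power2_commute)
        then show ?thesis using e[of n] by (simp add: p_def power2_eq_square)
      qed
      ultimately show "((\<lambda>lam. 2 * arctan ((lam - x) / e n)) has_real_derivative p n lam x) (at lam)" by simp
    qed
    then show ?thesis by (simp add: A_def)
  qed
  have swap: "(\<integral>lam. Q n lam \<partial>U) = (\<integral>k. H k * complex_of_real (A n (Phi k)) \<partial>tor)" for n
  proof -
    have "integrable (U \<Otimes>\<^sub>M tor) (\<lambda>(lam, k). H k * complex_of_real (p n lam (Phi k)))"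
    proof (rule P.integrable_const_bound[where B="M * (2 / e n)"])
      show "AE x in U \<Otimes>\<^sub>M tor. norm (case x of (lam, k) \<Rightarrow> H k * complex_of_real (p n lam (Phi k))) \<le> M * (2 / e n)"
      proof (rule AE_I2, clarsimp simp del: of_real_divide)
        fix lam and k :: "'n \<Rightarrow> real"
        have "p n lam (Phi k) \<le> 2 * e n / (e n)\<^sup>2"
          unfolding p_def using e[of n] den[of "Phi k" lam n] by (intro divide_left_mono mult_pos_pos) auto
        also have "\<dots> = 2 / e n" using e[of n] by (simp add: power2_eq_square)
        finally have "\<bar>p n lam (Phi k)\<bar> \<le> 2 / e n"
          using e[of n] den[of "Phi k" lam n] by (simp add: p_def)
        then have "norm (H k * complex_of_real (p n lam (Phi k))) \<le> M * (2 / e n)"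
          unfolding norm_mult norm_of_real using H(2)[of k] M0 by (intro mult_mono) auto
        then show "norm (H k * complex_of_real (p n lam (Phi k))) \<le> M * 2 / e n" by simp
      qed
    qed measurable
    from P.Fubini_integral[OF this]
    have "(\<integral>lam. Q n lam \<partial>U) = (\<integral>k. (\<integral>lam. H k * complex_of_real (p n lam (Phi k)) \<partial>U) \<partial>tor)"
      unfolding Q_def by simp
    then show ?thesis
      by (simp only: integral_mult_right_zero integral_complex_of_real inner)
  qed
  have "(\<lambda>n. \<integral>k. H k * complex_of_real (A n (Phi k)) \<partial>tor) \<longlonglongrightarrow> (\<integral>k. H k * complex_of_real (2 * pi / (b - a)) \<partial>tor)"
  proof (rule integral_dominated_convergence)
    have Am: "(\<lambda>x. A n x) \<in> borel_measurable borel" for n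
      unfolding A_def using e[of n] ab by (intro borel_measurable_continuous_onI continuous_intros) auto
    show "(\<lambda>k. H k * complex_of_real (A n (Phi k))) \<in> borel_measurable tor" for n
      using measurable_compose[OF measurable_Phi Am] by measurable
    show "integrable tor (\<lambda>_. M * (2 * pi / (b - a)))" by simp
    show "AE k in tor. norm (H k * complex_of_real (A n (Phi k))) \<le> M * (2 * pi / (b - a))" for n
    proof (rule AE_I2)
      fix k :: "'n \<Rightarrow> real"
      have "\<bar>arctan x\<bar> \<le> pi / 2" for x using arctan_bounded[of x] by auto
      moreover have "\<bar>2 * (p - q)\<bar> \<le> 4 * h" if "\<bar>p\<bar> \<le> h" "\<bar>q\<bar> \<le> h" for p q h :: real
        using that by (simp add: abs_le_iff)
      ultimately have "\<bar>2 * (arctan ((b - Phi k) / e n) - arctan ((a - Phi k) / e n))\<bar> \<le> 4 * (pi / 2)" by blast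
      then have "\<bar>2 * (arctan ((b - Phi k) / e n) - arctan ((a - Phi k) / e n))\<bar> \<le> 2 * pi" by simp
      then have "\<bar>A n (Phi k)\<bar> \<le> 2 * pi / (b - a)"
        unfolding A_def abs_divide using ab by (intro frac_le) auto
      then show "norm (H k * complex_of_real (A n (Phi k))) \<le> M * (2 * pi / (b - a))"
        unfolding norm_mult norm_of_real using H(2)[of k] M0 by (intro mult_mono) auto
    qed
    show "AE k in tor. (\<lambda>n. H k * complex_of_real (A n (Phi k))) \<longlonglongrightarrow> H k * complex_of_real (2 * pi / (b - a))"
    proof (rule AE_I2)
      fix k :: "'n \<Rightarrow> real"
      show "(\<lambda>n. H k * complex_of_real (A n (Phi k))) \<longlonglongrightarrow> H k * complex_of_real (2 * pi / (b - a))"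
      proof (cases "H k = 0")
        case False
        then have k: "a < Phi k" "Phi k < b" using supp by auto
        have inv: "y / e n = y * real (Suc n)" for y n by (simp only: e_def divide_inverse inverse_inverse_eq)
        have big: "filterlim (\<lambda>n. real (Suc n)) at_top sequentially"
          by (rule filterlim_compose[OF filterlim_real_sequentially filterlim_Suc])
        have "filterlim (\<lambda>n. (b - Phi k) * real (Suc n)) at_top sequentially"
          using k by (intro filterlim_tendsto_pos_mult_at_top[OF tendsto_const _ big]) simp
        then have 1: "(\<lambda>n. arctan ((b - Phi k) / e n)) \<longlonglongrightarrow> pi / 2"
          unfolding inv by (rule filterlim_compose[OF tendsto_arctan_at_top])
        have "filterlim (\<lambda>n. (a - Phi k) * real (Suc n)) at_bot sequentially"
          using k by (intro filterlim_tendsto_neg_mult_at_bot[OF tendsto_const _ big]) simp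
        then have 2: "(\<lambda>n. arctan ((a - Phi k) / e n)) \<longlonglongrightarrow> - (pi / 2)"
          unfolding inv by (rule filterlim_compose[OF tendsto_arctan_at_bot])
        have "(\<lambda>n. A n (Phi k)) \<longlonglongrightarrow> 2 * (pi / 2 - (- (pi / 2))) / (b - a)"
          unfolding A_def using ab by (intro tendsto_intros 1 2) auto
        then show ?thesis by (intro tendsto_mult tendsto_const tendsto_of_real) simp
      qed simp
    qed
  qed measurable
  then have "(\<integral>k. H k * complex_of_real (2 * pi / (b - a)) \<partial>tor) = 0"
    using lim1 unfolding swap by (rule LIMSEQ_unique)
  then show ?thesis using ab by (simp only: integral_mult_left_zero) simp
qed

section \<open>Wave packets on the lattice\<close>

text \<open>Pairings over \<open>\<int>\<^sup>d\<close> are taken as limits over these boxes, on which products of functions of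
  single coordinates sum to products.\<close>

definition lbox :: "nat \<Rightarrow> (int ^ 'n::finite) set" where
  "lbox N = {x. \<forall>j. \<bar>x $ j\<bar> \<le> int N}"

lemma sum_lbox_prod:
  fixes h :: "'n::finite \<Rightarrow> int \<Rightarrow> 'b::comm_semiring_1"
  shows "(\<Sum>x\<in>lbox N. \<Prod>j\<in>UNIV. h j (x $ j)) = (\<Prod>j\<in>UNIV. \<Sum>m\<in>{- int N..int N}. h j m)"
proof -
  have "(\<Sum>x\<in>lbox N. \<Prod>j\<in>UNIV. h j (x $ j)) = (\<Sum>g\<in>PiE UNIV (\<lambda>_. {- int N..int N}). \<Prod>j\<in>UNIV. h j (g j))"
    by (rule sum.reindex_bij_witness[where i="\<lambda>g. (\<chi> j. g j)" and j="\<lambda>x j. x $ j"])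
       (auto simp: lbox_def PiE_iff abs_le_iff minus_le_iff)
  also have "\<dots> = (\<Prod>j\<in>UNIV. \<Sum>m\<in>{- int N..int N}. h j m)"
    by (rule prod_sum_PiE[symmetric]) auto
  finally show ?thesis .
qed

lemma finite_lbox [simp]: "finite (lbox N :: (int ^ 'n::finite) set)"
proof -
  have "(\<lambda>x j. x $ j) ` (lbox N :: (int ^ 'n) set) \<subseteq> PiE UNIV (\<lambda>_. {- int N..int N})"
    by (auto simp: lbox_def PiE_iff abs_le_iff minus_le_iff)
  then have "finite ((\<lambda>x j. x $ j) ` (lbox N :: (int ^ 'n) set))"
    by (rule finite_subset) (intro finite_PiE, auto)
  then show ?thesis
    by (rule finite_imageD) (auto simp: inj_on_def vec_eq_iff fun_eq_iff)
qed

lemma card_lbox: "card (lbox N :: (int ^ 'n::finite) set) = (2 * N + 1) ^ CARD('n)"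
  using sum_lbox_prod[of "\<lambda>(_::'n) _. 1 :: nat" N] by (simp add: nat_add_distrib nat_mult_distrib)

lemma int_sum_le_suminf:
  fixes h :: "nat \<Rightarrow> real"
  assumes h: "summable h" "\<And>n. h n \<ge> 0" and "finite S"
  shows "(\<Sum>m\<in>S. h (nat \<bar>m\<bar>)) \<le> 2 * suminf h"
proof -
  let ?P = "{m\<in>S. m \<ge> 0}" and ?N = "{m\<in>S. m < 0}"
  have part: "(\<Sum>m\<in>A. h (nat \<bar>m\<bar>)) \<le> suminf h" if "finite A" "inj_on (\<lambda>m. nat \<bar>m\<bar>) A" for A :: "int set"
  proof -
    have "(\<Sum>m\<in>A. h (nat \<bar>m\<bar>)) = (\<Sum>n\<in>(\<lambda>m. nat \<bar>m\<bar>) ` A. h n)"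
      using that by (simp add: sum.reindex)
    also have "\<dots> \<le> suminf h" using h that by (intro sum_le_suminf) auto
    finally show ?thesis .
  qed
  have "S = ?P \<union> ?N" by auto
  then have "(\<Sum>m\<in>S. h (nat \<bar>m\<bar>)) = (\<Sum>m\<in>?P. h (nat \<bar>m\<bar>)) + (\<Sum>m\<in>?N. h (nat \<bar>m\<bar>))"
    using \<open>finite S\<close> by (subst sum.union_disjoint[symmetric]) auto
  also have "\<dots> \<le> suminf h + suminf h"
    using \<open>finite S\<close> by (intro add_mono part) (auto simp: inj_on_def)
  finally show ?thesis by simp
qed

lemma int_powr_sum_bound:
  assumes "a < - 1"
  obtains C where "C > 0" "\<And>S. finite S \<Longrightarrow> (\<Sum>m\<in>S. (1 + \<bar>real_of_int m\<bar>) powr a) \<le> C"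
proof -
  let ?h = "\<lambda>n. real (Suc n) powr a"
  have s: "summable ?h"
    using assms summable_Suc_iff[of "\<lambda>n. real n powr a"] by (simp add: summable_real_powr_iff)
  have "(\<Sum>m\<in>S. (1 + \<bar>real_of_int m\<bar>) powr a) \<le> 2 * suminf ?h" if "finite S" for S
  proof -
    have "1 + \<bar>real_of_int m\<bar> = real (Suc (nat \<bar>m\<bar>))" for m by simp
    then have "(\<Sum>m\<in>S. (1 + \<bar>real_of_int m\<bar>) powr a) = (\<Sum>m\<in>S. ?h (nat \<bar>m\<bar>))" by (simp only:)
    also have "\<dots> \<le> 2 * suminf ?h" by (rule int_sum_le_suminf[OF s _ that]) simp
    finally show ?thesis .
  qed
  moreover have "suminf ?h > 0" by (rule suminf_pos[OF s]) simp
  ultimately show thesis by (intro that[of "2 * suminf ?h"]) auto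
qed

text \<open>As \<open>Phi\<close> is a sum over the coordinates, the free evolution of a product window is a product.\<close>

definition packet :: "('n::finite \<Rightarrow> real) \<Rightarrow> real \<Rightarrow> real \<Rightarrow> int ^ 'n \<Rightarrow> complex" where
  "packet \<kappa> r t x = (\<Prod>j\<in>UNIV. packet1 (\<kappa> j) r (x $ j) t)"

definition window :: "('n::finite \<Rightarrow> real) \<Rightarrow> real \<Rightarrow> ('n \<Rightarrow> real) \<Rightarrow> complex" where
  "window \<kappa> r k = complex_of_real (\<Prod>j\<in>UNIV. bump (\<kappa> j) r (k j))"

lemma measurable_window [measurable]: "window \<kappa> r \<in> borel_measurable tor"
proof -
  have "(\<lambda>k. bump (\<kappa> j) r (k j)) \<in> borel_measurable tor" for j
    by (rule measurable_compose[OF measurable_coord measurable_bump(1)])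
  then show ?thesis unfolding window_def[abs_def] by measurable
qed

lemma prod_cis_cos: "(\<Prod>j\<in>UNIV. cis (2 * t * cos (k j))) = cis (t * Phi k)"
proof -
  have "(\<Prod>j\<in>UNIV. cis (2 * t * cos (k j))) = cis (\<Sum>j\<in>UNIV. 2 * t * cos (k j))" by (rule prod_cis)
  also have "(\<Sum>j\<in>UNIV. 2 * t * cos (k j)) = t * Phi k" by (simp add: Phi_def sum_distrib_left ac_simps)
  finally show ?thesis .
qed

lemma packet_inversion:
  fixes \<kappa> :: "'n::finite \<Rightarrow> real"
  assumes k: "\<And>j. - pi < k j" "\<And>j. k j < pi"
  shows "(\<lambda>N. \<Sum>x\<in>lbox N. cnj (packet \<kappa> r t x) * chi x k) \<longlonglongrightarrow> window \<kappa> r k * cis (t * Phi k)"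
proof -
  have one: "(\<lambda>N. \<Sum>n\<in>{- int N..int N}. cnj (packet1 (\<kappa> j) r n t) * cis (real_of_int n * k j))
     \<longlonglongrightarrow> bump (\<kappa> j) r (k j) * cis (2 * t * cos (k j))" for j
  proof -
    define B where "B k = complex_of_real (bump (\<kappa> j) r k) * cis (- (2 * t * cos k))" for k
    have "\<exists>D. (B has_vector_derivative D) (at (k j))"
    proof -
      have "((\<lambda>k. cis (- (2 * t * cos k))) has_vector_derivative (2 * t * sin (k j)) *\<^sub>R (\<i> * cis (- (2 * t * cos (k j))))) (at (k j))"
        unfolding has_vector_derivative_def by (auto intro!: derivative_eq_intros)
      from has_vector_derivative_mult[OF has_vector_derivative_of_real[OF bump_deriv] this]
      show ?thesis unfolding B_def by blast
    qed
    then obtain D where D: "(B has_vector_derivative D) (at (k j))" ..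
    have c: "continuous_on UNIV B" unfolding B_def by (intro continuous_intros continuous_bump)
    have o: "(\<integral>k. B k * cis (real_of_int n * k) \<partial>circ) = packet1 (\<kappa> j) r n t" for n
      unfolding B_def packet1_def cis_phase_split by (simp add: mult.assoc)
    have "(\<lambda>N. \<Sum>n\<in>{- int N..int N}. packet1 (\<kappa> j) r n t * cis (- (real_of_int n * k j))) \<longlonglongrightarrow> B (k j)"
      using fourier_inversion_circ[OF c D] k unfolding o by simp
    from tendsto_cnj[OF this] show ?thesis by (simp add: B_def cis_cnj)
  qed
  have "(\<lambda>N. \<Prod>j\<in>UNIV. \<Sum>n\<in>{- int N..int N}. cnj (packet1 (\<kappa> j) r n t) * cis (real_of_int n * k j))
     \<longlonglongrightarrow> (\<Prod>j\<in>UNIV. bump (\<kappa> j) r (k j) * cis (2 * t * cos (k j)))"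
    by (intro tendsto_prod one)
  moreover have "(\<Prod>j\<in>UNIV. bump (\<kappa> j) r (k j) * cis (2 * t * cos (k j))) = window \<kappa> r k * cis (t * Phi k)"
    using prod_cis_cos[of t k] by (simp add: window_def prod.distrib)
  moreover have "(\<Sum>x\<in>lbox N. cnj (packet \<kappa> r t x) * chi x k) =
      (\<Prod>j\<in>UNIV. \<Sum>n\<in>{- int N..int N}. cnj (packet1 (\<kappa> j) r n t) * cis (real_of_int n * k j))" for N
    unfolding sum_lbox_prod[symmetric] by (simp add: packet_def chi_def prod.distrib)
  ultimately show ?thesis by (simp only:)
qed

lemma window_overlap:
  fixes f :: "int ^ 'n::finite \<Rightarrow> complex"
  shows "(\<integral>k. fhat f k * window \<kappa> r k * cis (u * Phi k) \<partial>tor) =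
    (\<Sum>y | f y \<noteq> 0. f y * cnj (packet \<kappa> r u y))"
proof -
  have ph: "(\<Prod>j\<in>UNIV. cis (2 * u * cos (k j))) = cis (u * Phi k)" for k :: "'n \<Rightarrow> real"
    by (rule prod_cis_cos)
  define h where "h y j k = cnj (cis (real_of_int (y $ j) * k)) * (complex_of_real (bump (\<kappa> j) r k) * cis (2 * u * cos k))" for y :: "int ^ 'n" and j k
  have cont: "continuous_on UNIV (h y j)" for y j
    unfolding h_def by (intro continuous_intros continuous_bump)
  have hi: "integrable circ (h y j)" for y j
  proof -
    have c: "compact (h y j ` {- pi..pi})"
      by (intro compact_continuous_image continuous_on_subset[OF cont]) auto
    then obtain B where B: "\<forall>x\<in>h y j ` {- pi..pi}. norm x \<le> B"
      using compact_imp_bounded[OF c] unfolding bounded_iff by blast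
    have "AE k in circ. norm (h y j k) \<le> B" using AE_circ by eventually_elim (use B in auto)
    then show ?thesis
      by (intro circ.integrable_const_bound[where B=B]) (auto intro: borel_measurable_continuous_onI cont)
  qed
  have hint: "(\<integral>k. h y j k \<partial>circ) = cnj (packet1 (\<kappa> j) r (y $ j) u)" for y j
    unfolding packet1_def integral_cnj_bochner[symmetric]
    by (rule Bochner_Integration.integral_cong) (simp_all add: h_def cis_cnj cis_mult algebra_simps)
  have prod_eq: "cnj (chi y k) * window \<kappa> r k * cis (u * Phi k) = (\<Prod>j\<in>UNIV. h y j (k j))" for y k
    unfolding ph[symmetric] by (simp add: h_def chi_def window_def prod.distrib mult.assoc)
  have pi: "integrable tor (\<lambda>k. cnj (chi y k) * window \<kappa> r k * cis (u * Phi k))" for y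
    unfolding prod_eq tor_def by (intro circs.product_integrable_prod hi) simp
  have pk: "(\<integral>k. cnj (chi y k) * window \<kappa> r k * cis (u * Phi k) \<partial>tor) = cnj (packet \<kappa> r u y)" for y
    unfolding prod_eq by (simp add: integral_tor_prod[OF hi] hint packet_def)
  have "(\<integral>k. fhat f k * window \<kappa> r k * cis (u * Phi k) \<partial>tor) =
      (\<integral>k. (\<Sum>y | f y \<noteq> 0. f y * (cnj (chi y k) * window \<kappa> r k * cis (u * Phi k))) \<partial>tor)"
    by (simp add: fhat_def sum_distrib_right mult.assoc)
  also have "\<dots> = (\<Sum>y | f y \<noteq> 0. f y * (\<integral>k. cnj (chi y k) * window \<kappa> r k * cis (u * Phi k) \<partial>tor))"
    by (simp only: Bochner_Integration.integral_sum integrable_mult_right pi integral_mult_right_zero)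
  finally show ?thesis
    by (simp only: pk)
qed

lemma norm_cis_diff_le: "norm (cis a - cis b) \<le> \<bar>a - b\<bar>"
proof -
  have "cis a - cis b = cis b * (cis (a - b) - 1)" by (simp add: cis_mult algebra_simps)
  then have "norm (cis a - cis b) = norm (cis (a - b) - 1)" by (simp only: norm_mult norm_cis mult_1_left)
  then show ?thesis using norm_cis_minus_1[of "a - b"] by simp
qed

lemma abs_sin_cos_diff_le:
  fixes a b :: real
  shows "\<bar>sin a - sin b\<bar> \<le> \<bar>a - b\<bar>" "\<bar>cos a - cos b\<bar> \<le> \<bar>a - b\<bar>"
proof -
  show "\<bar>sin a - sin b\<bar> \<le> \<bar>a - b\<bar>" "\<bar>cos a - cos b\<bar> \<le> \<bar>a - b\<bar>"
    using norm_cis_diff_le[of a b] abs_Im_le_cmod[of "cis a - cis b"] abs_Re_le_cmod[of "cis a - cis b"] by simp_all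
qed

text \<open>Over the support of the window the velocities \<open>- 2 sin k\<close> vary by at most \<open>\<eta> / 2\<close>, as \<open>r \<le> \<eta> / 4\<close>. Hence a site
  further than \<open>\<eta> t\<close> from the centre \<open>- 2 t sin \<kappa>\<close> is non-stationary, with phase derivative comparable to its
  distance from the centre and therefore to \<open>|n| + t\<close>.\<close>

lemma packet1_outside_cone:
  assumes r: "0 < r" "- pi < \<kappa> - r" "\<kappa> + r < pi" and \<eta>: "0 < \<eta>" "r \<le> \<eta> / 4"
  obtains C where "C \<ge> 0" "\<And>n t. 1 \<le> t \<Longrightarrow> \<eta> * t < \<bar>real_of_int n + 2 * t * sin \<kappa>\<bar> \<Longrightarrow>
    norm (packet1 \<kappa> r n t) \<le> C / (\<bar>real_of_int n\<bar> + t)\<^sup>2"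
proof -
  \<comment> \<open>Outside the cone, \<open>|n| + t \<le> D + 3 t \<le> (1 + 3 / \<eta>) D\<close> for the distance \<open>D\<close> to the centre; the additional \<open>2\<close> pays
  for the spread of velocities.\<close>
  define a where "a = 2 * (1 + 3 / \<eta>)"
  have a: "a > 0" using \<eta> by (simp add: a_def add_pos_pos)
  obtain C where C: "C \<ge> 0" "\<And>n t m. 0 < m \<Longrightarrow> (\<And>k. \<bar>k - \<kappa>\<bar> \<le> r \<Longrightarrow> m \<le> \<bar>real_of_int n + 2 * t * sin k\<bar>) \<Longrightarrow>
    \<bar>t\<bar> \<le> a * m \<Longrightarrow> norm (packet1 \<kappa> r n t) \<le> C / m\<^sup>2"
    using packet1_nonstationary[OF r, of a] a by auto
  have "norm (packet1 \<kappa> r n t) \<le> (C * a\<^sup>2) / (\<bar>real_of_int n\<bar> + t)\<^sup>2"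
    if t: "1 \<le> t" and out: "\<eta> * t < \<bar>real_of_int n + 2 * t * sin \<kappa>\<bar>" for n t
  proof -
    define m where "m = (\<bar>real_of_int n\<bar> + t) / a"
    define D where "D = \<bar>real_of_int n + 2 * t * sin \<kappa>\<bar>"
    have "\<bar>t * sin \<kappa>\<bar> \<le> t * 1" unfolding abs_mult using t by (intro mult_mono) auto
    then have "\<bar>real_of_int n\<bar> \<le> D + 2 * t" unfolding D_def by linarith
    moreover have "t \<le> D / \<eta>" using out \<eta> by (simp add: D_def pos_le_divide_eq mult.commute less_imp_le)
    ultimately have "\<bar>real_of_int n\<bar> + t \<le> D + 3 * (D / \<eta>)" by linarith
    also have "\<dots> = D * a / 2" by (simp add: a_def algebra_simps)
    finally have mD: "m \<le> D / 2" using a by (simp add: m_def field_simps)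
    have "norm (packet1 \<kappa> r n t) \<le> C / m\<^sup>2"
    proof (rule C(2))
      show "0 < m" using t a by (simp add: m_def add_nonneg_pos)
      show "\<bar>t\<bar> \<le> a * m" using t a by (simp add: m_def)
      fix k assume k: "\<bar>k - \<kappa>\<bar> \<le> r"
      have "\<bar>sin k - sin \<kappa>\<bar> \<le> \<bar>k - \<kappa>\<bar>"
        by (rule abs_sin_cos_diff_le(1))
      then have "\<bar>t * (sin k - sin \<kappa>)\<bar> \<le> t * (\<eta> / 4)"
        unfolding abs_mult using k \<eta> t by (intro mult_mono) auto
      moreover have "\<bar>2 * t * sin k - 2 * t * sin \<kappa>\<bar> = 2 * \<bar>t * (sin k - sin \<kappa>)\<bar>"
        by (simp add: abs_if right_diff_distrib)
      ultimately have "\<bar>2 * t * sin k - 2 * t * sin \<kappa>\<bar> \<le> \<eta> * t / 2" by (simp add: mult.commute)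
      also have "\<dots> \<le> D / 2" using out by (simp add: D_def)
      finally show "m \<le> \<bar>real_of_int n + 2 * t * sin k\<bar>"
      proof -
        assume near: "\<bar>2 * t * sin k - 2 * t * sin \<kappa>\<bar> \<le> D / 2"
        have "D - \<bar>real_of_int n + 2 * t * sin k\<bar>
            \<le> \<bar>(real_of_int n + 2 * t * sin \<kappa>) - (real_of_int n + 2 * t * sin k)\<bar>"
          unfolding D_def by (rule abs_triangle_ineq2)
        also have "\<dots> = \<bar>2 * t * sin k - 2 * t * sin \<kappa>\<bar>" by (simp add: abs_minus_commute)
        finally show ?thesis using mD near by linarith
      qed
    qed
    then show ?thesis using a by (simp add: m_def power_divide)
  qed
  then show thesis using C(1) by (intro that[of "C * a\<^sup>2"]) auto
qed

text \<open>For fixed \<open>t\<close> the packet decays like \<open>n\<^bsup>-2\<^esup>\<close>, and \<open>3/4 - 2 < -1\<close>. For the weight \<open>|n|\<close> in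
  place of \<open>|n|\<^bsup>3/4\<^esup>\<close> this bound would not be summable.\<close>

lemma packet1_weighted_summable:
  assumes r: "0 < r" "- pi < \<kappa> - r" "\<kappa> + r < pi" and t: "1 \<le> t"
  obtains A where "A \<ge> 0" "\<And>S. finite S \<Longrightarrow>
    (\<Sum>n\<in>S. (1 + \<bar>real_of_int n\<bar>) powr (3 / 4) * norm (packet1 \<kappa> r n t)) \<le> A"
proof -
  obtain C where C: "C \<ge> 0" "\<And>n t m. 0 < m \<Longrightarrow> (\<And>k. \<bar>k - \<kappa>\<bar> \<le> r \<Longrightarrow> m \<le> \<bar>real_of_int n + 2 * t * sin k\<bar>) \<Longrightarrow>
    \<bar>t\<bar> \<le> 1 * m \<Longrightarrow> norm (packet1 \<kappa> r n t) \<le> C / m\<^sup>2"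
    using packet1_nonstationary[OF r, of 1] by auto
  obtain C1 where C1: "C1 \<ge> 1" "\<And>t n. norm (packet1 \<kappa> r n t) \<le> C1"
    using packet1_bessel[OF r] by metis
  obtain C2 where C2: "C2 > 0" "\<And>S. finite S \<Longrightarrow> (\<Sum>m\<in>S. (1 + \<bar>real_of_int m\<bar>) powr (- (5 / 4))) \<le> C2"
    using int_powr_sum_bound[of "- (5 / 4)"] by auto
  define D where "D = 16 * C + C1 * (1 + 4 * t)\<^sup>2"
  have D0: "D \<ge> 0" using C C1 by (simp add: D_def)
  have "norm (packet1 \<kappa> r n t) * (1 + \<bar>real_of_int n\<bar>)\<^sup>2 \<le> D" for n
  proof (cases "4 * t \<le> \<bar>real_of_int n\<bar>")
    case True
    have "norm (packet1 \<kappa> r n t) \<le> C / (\<bar>real_of_int n\<bar> / 2)\<^sup>2"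
    proof (rule C(2))
      fix k
      have "\<bar>t * sin k\<bar> \<le> t * 1" unfolding abs_mult using t by (intro mult_mono) auto
      then show "\<bar>real_of_int n\<bar> / 2 \<le> \<bar>real_of_int n + 2 * t * sin k\<bar>" using True by linarith
    qed (use True t in auto)
    then have "norm (packet1 \<kappa> r n t) * (1 + \<bar>real_of_int n\<bar>)\<^sup>2 \<le> C / (\<bar>real_of_int n\<bar> / 2)\<^sup>2 * (2 * \<bar>real_of_int n\<bar>)\<^sup>2"
      using True t C by (intro mult_mono power_mono) auto
    also have "\<dots> = 16 * C" using True t by (simp add: power_divide power_mult_distrib)
    also have "\<dots> \<le> D" using C1 by (simp add: D_def)
    finally show ?thesis .
  next
    case False
    then have "norm (packet1 \<kappa> r n t) * (1 + \<bar>real_of_int n\<bar>)\<^sup>2 \<le> C1 * (1 + 4 * t)\<^sup>2"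
      using C1(1) C1(2)[of n t] by (intro mult_mono power_mono) auto
    also have "\<dots> \<le> D" using C by (simp add: D_def)
    finally show ?thesis .
  qed
  then have le: "(1 + \<bar>real_of_int n\<bar>) powr (3 / 4) * norm (packet1 \<kappa> r n t) \<le> D * (1 + \<bar>real_of_int n\<bar>) powr (- (5 / 4))" for n
  proof -
    let ?b = "1 + \<bar>real_of_int n\<bar>"
    have b: "?b > 0" by simp
    have "norm (packet1 \<kappa> r n t) * ?b powr 2 \<le> D"
      using \<open>\<And>n. norm (packet1 \<kappa> r n t) * (1 + \<bar>real_of_int n\<bar>)\<^sup>2 \<le> D\<close>[of n] b by (simp add: powr_numeral)
    then have "?b powr (- (5 / 4)) * (norm (packet1 \<kappa> r n t) * ?b powr 2) \<le> ?b powr (- (5 / 4)) * D"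
      by (intro mult_left_mono) auto
    moreover have "?b powr (- (5 / 4)) * (norm (packet1 \<kappa> r n t) * ?b powr 2) = ?b powr (3 / 4) * norm (packet1 \<kappa> r n t)"
    proof -
      have "?b powr (- (5 / 4)) * ?b powr 2 = ?b powr (3 / 4)" unfolding powr_add[symmetric] by simp
      then show ?thesis by (metis mult.assoc mult.commute)
    qed
    ultimately show ?thesis by (simp only: mult.commute[of D])
  qed
  have "(\<Sum>n\<in>S. (1 + \<bar>real_of_int n\<bar>) powr (3 / 4) * norm (packet1 \<kappa> r n t)) \<le> D * C2" if "finite S" for S
  proof -
    have "(\<Sum>n\<in>S. (1 + \<bar>real_of_int n\<bar>) powr (3 / 4) * norm (packet1 \<kappa> r n t)) \<le> (\<Sum>n\<in>S. D * (1 + \<bar>real_of_int n\<bar>) powr (- (5 / 4)))"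
      by (intro sum_mono le)
    also have "\<dots> \<le> D * C2" unfolding sum_distrib_left[symmetric] using C2(2)[OF that] D0 by (intro mult_left_mono)
    finally show ?thesis .
  qed
  then show thesis using D0 C2 by (intro that[of "D * C2"]) auto
qed

lemma packet_weighted_summable:
  fixes \<kappa> :: "'n::finite \<Rightarrow> real"
  assumes r: "0 < r" "\<And>j. - pi < \<kappa> j - r" "\<And>j. \<kappa> j + r < pi" and t: "1 \<le> t"
  obtains A where "\<And>N. (\<Sum>x\<in>lbox N. rho x * norm (packet \<kappa> r t x)) \<le> A"
proof -
  have "\<exists>A. A \<ge> 0 \<and> (\<forall>S. finite S \<longrightarrow> (\<Sum>n\<in>S. (1 + \<bar>real_of_int n\<bar>) powr (3 / 4) * norm (packet1 (\<kappa> j) r n t)) \<le> A)" for j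
    using packet1_weighted_summable[OF r(1) r(2)[of j] r(3)[of j] t] by metis
  then obtain A where A: "\<And>j. A j \<ge> 0" "\<And>j S. finite S \<Longrightarrow> (\<Sum>n\<in>S. (1 + \<bar>real_of_int n\<bar>) powr (3 / 4) * norm (packet1 (\<kappa> j) r n t)) \<le> A j"
    by metis
  have "(\<Sum>x\<in>lbox N. rho x * norm (packet \<kappa> r t x)) \<le> (\<Prod>j\<in>UNIV. A j)" for N
  proof -
    have "(\<Sum>x\<in>lbox N. rho x * norm (packet \<kappa> r t x))
        = (\<Sum>x\<in>lbox N. \<Prod>j\<in>UNIV. (1 + \<bar>real_of_int (x $ j)\<bar>) powr (3 / 4) * norm (packet1 (\<kappa> j) r (x $ j) t))"
      by (simp add: rho_def packet_def prod_norm[symmetric] prod.distrib)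
    also have "\<dots> = (\<Prod>j\<in>UNIV. \<Sum>m\<in>{- int N..int N}. (1 + \<bar>real_of_int m\<bar>) powr (3 / 4) * norm (packet1 (\<kappa> j) r m t))"
      by (rule sum_lbox_prod)
    also have "\<dots> \<le> (\<Prod>j\<in>UNIV. A j)"
      using A by (intro prod_mono) (auto intro!: sum_nonneg)
    finally show ?thesis .
  qed
  then show thesis by (rule that)
qed

lemma norm_lat_bounds:
  fixes x :: "int ^ 'n::finite"
  shows "\<bar>real_of_int (x $ j)\<bar> \<le> norm (lat x)"
    "(1 + norm (lat x))\<^sup>2 \<le> 2 * (\<Sum>j\<in>UNIV. (1 + \<bar>real_of_int (x $ j)\<bar>)\<^sup>2)"
proof -
  show "\<bar>real_of_int (x $ j)\<bar> \<le> norm (lat x)"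
    using component_le_norm_cart[of "lat x" j] by (simp add: lat_def)
  have "(norm (lat x))\<^sup>2 = (\<Sum>j\<in>UNIV. (real_of_int (x $ j))\<^sup>2)"
    unfolding norm_lat_eq by (simp add: sum_nonneg)
  then have "(1 + norm (lat x))\<^sup>2 \<le> 2 * (1 + (\<Sum>j\<in>UNIV. (real_of_int (x $ j))\<^sup>2))"
    using sum_squares_bound[of 1 "norm (lat x)"] by (simp add: power2_sum)
  also have "1 + (\<Sum>j\<in>UNIV. (real_of_int (x $ j))\<^sup>2) \<le> (\<Sum>j\<in>(UNIV::'n set). 1) + (\<Sum>j\<in>UNIV. (real_of_int (x $ j))\<^sup>2)"
    by (simp add: Suc_leI)
  also have "\<dots> = (\<Sum>j\<in>UNIV. 1 + (real_of_int (x $ j))\<^sup>2)" by (simp only: sum.distrib)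
  also have "\<dots> \<le> (\<Sum>j\<in>UNIV. (1 + \<bar>real_of_int (x $ j)\<bar>)\<^sup>2)"
    by (rule sum_mono) (simp add: power2_sum)
  finally show "(1 + norm (lat x))\<^sup>2 \<le> 2 * (\<Sum>j\<in>UNIV. (1 + \<bar>real_of_int (x $ j)\<bar>)\<^sup>2)" by simp
qed

text \<open>\<open>1 + |x|\<close> dominates each \<open>1 + |x\<^sub>j|\<close>; distributing the exponent \<open>d + 1\<close> evenly leaves \<open>1 + 1/d > 1\<close> for each
  coordinate.\<close>

lemma weighted_lattice_sum:
  obtains C where "C > 0"
    "\<And>N. (\<Sum>x\<in>(lbox N :: (int ^ 'n::finite) set). (1 + norm (lat x)) powr (- (real CARD('n) + 1))) \<le> C"
proof -
  let ?d = "real CARD('n)"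
  have d: "?d > 0" by simp
  obtain C where C: "C > 0" "\<And>S. finite S \<Longrightarrow> (\<Sum>m\<in>S. (1 + \<bar>real_of_int m\<bar>) powr (- (1 + 1 / ?d))) \<le> C"
    using int_powr_sum_bound[of "- (1 + 1 / ?d)"] d by auto
  have "(1 + norm (lat x)) powr (- (?d + 1)) \<le> (\<Prod>j\<in>UNIV. (1 + \<bar>real_of_int (x $ j)\<bar>) powr (- (1 + 1 / ?d)))" for x :: "int ^ 'n"
  proof -
    have "(1 + norm (lat x)) powr (- (?d + 1)) = (1 + norm (lat x)) powr (- (1 + 1 / ?d) * ?d)"
    proof -
      have "- (1 + 1 / ?d) * ?d = - (?d + 1)" by (simp add: field_simps)
      then show ?thesis by (simp only:)
    qed
    also have "\<dots> = ((1 + norm (lat x)) powr (- (1 + 1 / ?d))) powr ?d" by (simp only: powr_powr)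
    also have "\<dots> = (\<Prod>j\<in>(UNIV::'n set). (1 + norm (lat x)) powr (- (1 + 1 / ?d)))"
      by (subst powr_realpow) (auto simp: add_nonneg_eq_0_iff intro!: less_le_trans[OF zero_less_one])
    also have "\<dots> \<le> (\<Prod>j\<in>UNIV. (1 + \<bar>real_of_int (x $ j)\<bar>) powr (- (1 + 1 / ?d)))"
    proof (intro prod_mono conjI powr_mono2')
      have "0 \<le> 1 / ?d" by simp
      then show "- (1 + 1 / ?d) \<le> 0" by linarith
    qed (use norm_lat_bounds(1)[of x] in auto)
    finally show ?thesis .
  qed
  note pw = this
  have "(\<Sum>x\<in>(lbox N :: (int ^ 'n) set). (1 + norm (lat x)) powr (- (?d + 1))) \<le> C ^ CARD('n)" for N
  proof -
    have "(\<Sum>x\<in>(lbox N :: (int ^ 'n) set). (1 + norm (lat x)) powr (- (?d + 1))) \<le>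
       (\<Sum>x\<in>(lbox N :: (int ^ 'n) set). \<Prod>j\<in>UNIV. (1 + \<bar>real_of_int (x $ j)\<bar>) powr (- (1 + 1 / ?d)))"
      by (rule sum_mono) (rule pw)
    also have "\<dots> = (\<Prod>j\<in>(UNIV::'n set). \<Sum>m\<in>{- int N..int N}. (1 + \<bar>real_of_int m\<bar>) powr (- (1 + 1 / ?d)))"
      by (rule sum_lbox_prod)
    also have "\<dots> \<le> (\<Prod>j\<in>(UNIV::'n set). C)"
      by (intro prod_mono conjI sum_nonneg C(2)) auto
    finally show ?thesis by simp
  qed
  then show thesis using C(1) by (intro that[of "C ^ CARD('n)"]) auto
qed

lemma cauchy_schwarz_sum:
  fixes f g :: "'a \<Rightarrow> real"
  assumes "(\<Sum>x\<in>S. (f x)\<^sup>2) \<le> a" "(\<Sum>x\<in>S. (g x)\<^sup>2) \<le> b"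
  shows "(\<Sum>x\<in>S. \<bar>f x\<bar> * \<bar>g x\<bar>) \<le> sqrt a * sqrt b"
proof -
  have "(\<Sum>x\<in>S. \<bar>f x\<bar> * \<bar>g x\<bar>) \<le> L2_set f S * L2_set g S" by (rule L2_set_mult_ineq)
  also have "\<dots> \<le> sqrt a * sqrt b"
    unfolding L2_set_def using assms by (intro mult_mono real_sqrt_le_mono) (auto intro!: sum_nonneg order_trans[OF _ assms(1)])
  finally show ?thesis .
qed

text \<open>The second estimate says that the packet is concentrated in the cone
  \<open>|x\<^sub>j + 2 t sin (\<kappa> j)| \<le> \<eta> t\<close>. For the part outside, bound \<open>(1 + |x|)\<^sup>2\<close> by a sum over the
  coordinates \<open>i\<close>, sum over the coordinates \<open>j\<close> that may violate the cone condition, and factor. The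
  coordinate \<open>j\<close> contributes at most \<open>t\<^bsup>-5/2\<^esup>\<close>, while the weight in the coordinate \<open>i\<close> costs \<open>t\<^sup>2\<close>; all other
  factors are bounded.\<close>

lemma packet_l2_bound:
  fixes \<kappa> :: "'n::finite \<Rightarrow> real"
  assumes r: "0 < r" "\<And>j. - pi < \<kappa> j - r" "\<And>j. \<kappa> j + r < pi" and \<eta>: "0 < \<eta>" "r \<le> \<eta> / 4"
  obtains C where "C \<ge> 1" "\<And>t N. (\<Sum>x\<in>lbox N. (norm (packet \<kappa> r t x))\<^sup>2) \<le> C"
    "\<And>t N. 1 \<le> t \<Longrightarrow>
      (\<Sum>x\<in>{x\<in>lbox N. \<exists>j. \<eta> * t < \<bar>real_of_int (x $ j) + 2 * t * sin (\<kappa> j)\<bar>}.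
        ((1 + norm (lat x)) * norm (packet \<kappa> r t x))\<^sup>2) \<le> C * t powr (- (1 / 2))"
proof -
  define bess where "bess j C \<longleftrightarrow> C \<ge> 1 \<and> (\<forall>t S. finite S \<longrightarrow> (\<Sum>n\<in>S. (norm (packet1 (\<kappa> j) r n t))\<^sup>2) \<le> C) \<and>
    (\<forall>t S. finite S \<longrightarrow> 1 \<le> t \<longrightarrow> (\<Sum>n\<in>S. (norm (packet1 (\<kappa> j) r n t))\<^sup>2 * (1 + \<bar>real_of_int n\<bar>)\<^sup>2) \<le> C * t\<^sup>2)" for j C
  have "\<exists>C. bess j C" for j
    by (rule packet1_bessel[OF r(1) r(2)[of j] r(3)[of j]]) (auto simp: bess_def)
  then obtain C0 where C0b: "\<And>j. bess j (C0 j)" by metis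
  have C0: "\<And>j. C0 j \<ge> 1"
    "\<And>j t S. finite S \<Longrightarrow> (\<Sum>n\<in>S. (norm (packet1 (\<kappa> j) r n t))\<^sup>2) \<le> C0 j"
    "\<And>j t S. finite S \<Longrightarrow> 1 \<le> t \<Longrightarrow> (\<Sum>n\<in>S. (norm (packet1 (\<kappa> j) r n t))\<^sup>2 * (1 + \<bar>real_of_int n\<bar>)\<^sup>2) \<le> C0 j * t\<^sup>2"
    using C0b unfolding bess_def by blast+
  define outb where "outb j C \<longleftrightarrow> C \<ge> 0 \<and> (\<forall>n t. 1 \<le> t \<longrightarrow> \<eta> * t < \<bar>real_of_int n + 2 * t * sin (\<kappa> j)\<bar> \<longrightarrow>
    norm (packet1 (\<kappa> j) r n t) \<le> C / (\<bar>real_of_int n\<bar> + t)\<^sup>2)" for j C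
  have "\<exists>C. outb j C" for j
    by (rule packet1_outside_cone[OF r(1) r(2)[of j] r(3)[of j] \<eta>]) (auto simp: outb_def)
  then obtain C1 where C1b: "\<And>j. outb j (C1 j)" by metis
  have C1: "\<And>j. C1 j \<ge> 0" "\<And>j n t. 1 \<le> t \<Longrightarrow> \<eta> * t < \<bar>real_of_int n + 2 * t * sin (\<kappa> j)\<bar> \<Longrightarrow>
    norm (packet1 (\<kappa> j) r n t) \<le> C1 j / (\<bar>real_of_int n\<bar> + t)\<^sup>2"
    using C1b unfolding outb_def by blast+
  obtain C2 where C2: "C2 > 0" "\<And>S. finite S \<Longrightarrow> (\<Sum>m\<in>S. (1 + \<bar>real_of_int m\<bar>) powr (- (3 / 2))) \<le> C2"
    using int_powr_sum_bound[of "- (3 / 2)"] by auto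
  define B where "B l = C0 l + (C1 l)\<^sup>2 * C2" for l
  have B: "B l \<ge> 1" "C0 l \<le> B l" "(C1 l)\<^sup>2 * C2 \<le> B l" for l
  proof -
    have "(C1 l)\<^sup>2 * C2 \<ge> 0" using C2 by simp
    then show "B l \<ge> 1" "C0 l \<le> B l" "(C1 l)\<^sup>2 * C2 \<le> B l" using C0(1)[of l] unfolding B_def by linarith+
  qed
  let ?out = "\<lambda>t j n. \<eta> * t < \<bar>real_of_int n + 2 * t * sin (\<kappa> j)\<bar>"
  \<comment> \<open>The factor for the coordinate \<open>l\<close> when the weight sits on \<open>i\<close> and the cone condition fails on \<open>j\<close>.\<close>
  define wt where "wt t i j l m = (norm (packet1 (\<kappa> l) r m t))\<^sup>2 * (if l = i then (1 + \<bar>real_of_int m\<bar>)\<^sup>2 else 1)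
     * (if l = j then (if ?out t j m then 1 else 0) else 1)" for t i j l m
  have wt0: "wt t i j l m \<ge> 0" for t i j l m by (simp add: wt_def)
  have one: "(\<Sum>m\<in>{- int N..int N}. wt t i j l m) \<le> B l * (if l = i then t powr 2 else 1) * (if l = j then t powr (- (5 / 2)) else 1)"
    if t: "1 \<le> t" for t N i j l
  proof (cases "l = j")
    case False
    show ?thesis
    proof (cases "l = i")
      case True
      then have "(\<Sum>m\<in>{- int N..int N}. wt t i j l m) = (\<Sum>m\<in>{- int N..int N}. (norm (packet1 (\<kappa> l) r m t))\<^sup>2 * (1 + \<bar>real_of_int m\<bar>)\<^sup>2)"
        using False by (simp add: wt_def)
      also have "\<dots> \<le> C0 l * t\<^sup>2" by (rule C0(3)[OF _ t]) simp
      also have "\<dots> \<le> B l * t\<^sup>2" using B by (intro mult_right_mono) auto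
      finally show ?thesis using True False t by (simp add: powr_numeral)
    next
      case F: False
      have "(\<Sum>m\<in>{- int N..int N}. wt t i j l m) = (\<Sum>m\<in>{- int N..int N}. (norm (packet1 (\<kappa> l) r m t))\<^sup>2)"
        using False F by (simp add: wt_def)
      also have "\<dots> \<le> C0 l" by (rule C0(2)) simp
      also have "\<dots> \<le> B l" by (rule B)
      finally show ?thesis using F False by simp
    qed
  next
    case True
    have pt: "(\<bar>real_of_int m\<bar> + t) powr (- c) \<le> t powr (- (c - 3 / 2)) * (1 + \<bar>real_of_int m\<bar>) powr (- (3 / 2))" if "c \<ge> 3 / 2" for m :: int and c
    proof -
      have "(\<bar>real_of_int m\<bar> + t) powr (- c) = (\<bar>real_of_int m\<bar> + t) powr (- (c - 3 / 2)) * (\<bar>real_of_int m\<bar> + t) powr (- (3 / 2))"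
        unfolding powr_add[symmetric] by simp
      also have "\<dots> \<le> t powr (- (c - 3 / 2)) * (1 + \<bar>real_of_int m\<bar>) powr (- (3 / 2))"
        using t that by (intro mult_mono powr_mono2') auto
      finally show ?thesis .
    qed
    have sq: "(norm (packet1 (\<kappa> l) r m t))\<^sup>2 \<le> (C1 l)\<^sup>2 * (\<bar>real_of_int m\<bar> + t) powr (- 4)" if "?out t l m" for m
    proof -
      have "(norm (packet1 (\<kappa> l) r m t))\<^sup>2 \<le> (C1 l / (\<bar>real_of_int m\<bar> + t)\<^sup>2)\<^sup>2"
        by (intro power_mono C1(2)[OF t that]) simp
      also have "\<dots> = (C1 l)\<^sup>2 / (\<bar>real_of_int m\<bar> + t) ^ 4" by (simp add: power_divide power_mult[symmetric])
      also have "\<dots> = (C1 l)\<^sup>2 * (\<bar>real_of_int m\<bar> + t) powr (- 4)"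
        using t by (simp add: powr_minus powr_numeral divide_inverse add_nonneg_pos)
      finally show ?thesis .
    qed
    have fin: "(\<Sum>m\<in>{- int N..int N}. wt t i j l m) \<le> B l * t powr (- a)"
      if "\<And>m. wt t i j l m \<le> (C1 l)\<^sup>2 * (t powr (- a) * (1 + \<bar>real_of_int m\<bar>) powr (- (3 / 2)))" for a
    proof -
      have "(\<Sum>m\<in>{- int N..int N}. wt t i j l m) \<le> (\<Sum>m\<in>{- int N..int N}. (C1 l)\<^sup>2 * (t powr (- a) * (1 + \<bar>real_of_int m\<bar>) powr (- (3 / 2))))"
        by (intro sum_mono that)
      also have "\<dots> = ((C1 l)\<^sup>2 * t powr (- a)) * (\<Sum>m\<in>{- int N..int N}. (1 + \<bar>real_of_int m\<bar>) powr (- (3 / 2)))"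
        by (simp add: sum_distrib_left mult.assoc)
      also have "\<dots> \<le> ((C1 l)\<^sup>2 * t powr (- a)) * C2" by (intro mult_left_mono C2) auto
      also have "\<dots> = ((C1 l)\<^sup>2 * C2) * t powr (- a)" by simp
      also have "\<dots> \<le> B l * t powr (- a)" by (intro mult_right_mono B) auto
      finally show ?thesis .
    qed
    show ?thesis
    proof (cases "l = i")
      case li: False
      have "wt t i j l m \<le> (C1 l)\<^sup>2 * (t powr (- (5 / 2)) * (1 + \<bar>real_of_int m\<bar>) powr (- (3 / 2)))" for m
      proof (cases "?out t l m")
        case o: True
        have "wt t i j l m \<le> (C1 l)\<^sup>2 * (\<bar>real_of_int m\<bar> + t) powr (- 4)"
          using True li o sq[OF o] by (simp add: wt_def)
        also have "\<dots> \<le> (C1 l)\<^sup>2 * (t powr (- (5 / 2)) * (1 + \<bar>real_of_int m\<bar>) powr (- (3 / 2)))"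
          using pt[of 4 m] by (intro mult_left_mono) auto
        finally show ?thesis .
      qed (use True in \<open>simp add: wt_def\<close>)
      from fin[OF this] show ?thesis using True li by simp
    next
      case li: True
      have "wt t i j l m \<le> (C1 l)\<^sup>2 * (t powr (- (1 / 2)) * (1 + \<bar>real_of_int m\<bar>) powr (- (3 / 2)))" for m
      proof (cases "?out t l m")
        case o: True
        have b: "\<bar>real_of_int m\<bar> + t > 0" using t by (simp add: add_nonneg_pos)
        have "wt t i j l m = (norm (packet1 (\<kappa> l) r m t))\<^sup>2 * (1 + \<bar>real_of_int m\<bar>)\<^sup>2"
          using True li o by (simp add: wt_def)
        also have "\<dots> \<le> ((C1 l)\<^sup>2 * (\<bar>real_of_int m\<bar> + t) powr (- 4)) * (\<bar>real_of_int m\<bar> + t)\<^sup>2"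
          using t by (intro mult_mono sq o power_mono) auto
        also have "\<dots> = (C1 l)\<^sup>2 * ((\<bar>real_of_int m\<bar> + t) powr (- 4) * (\<bar>real_of_int m\<bar> + t) powr 2)"
          using b by (simp add: powr_numeral)
        also have "(\<bar>real_of_int m\<bar> + t) powr (- 4) * (\<bar>real_of_int m\<bar> + t) powr 2 = (\<bar>real_of_int m\<bar> + t) powr (- 2)"
          unfolding powr_add[symmetric] by simp
        also have "(C1 l)\<^sup>2 * (\<bar>real_of_int m\<bar> + t) powr (- 2) \<le> (C1 l)\<^sup>2 * (t powr (- (1 / 2)) * (1 + \<bar>real_of_int m\<bar>) powr (- (3 / 2)))"
          using pt[of 2 m] by (intro mult_left_mono) auto
        finally show ?thesis .
      qed (use True in \<open>simp add: wt_def\<close>)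
      from fin[OF this] have "(\<Sum>m\<in>{- int N..int N}. wt t i j l m) \<le> B l * t powr (- (1 / 2))" .
      also have "t powr (- (1 / 2)) = t powr 2 * t powr (- (5 / 2))" unfolding powr_add[symmetric] by simp
      finally show ?thesis using True li by simp
    qed
  qed
  define P where "P = (\<Prod>l\<in>UNIV. B l)"
  have P: "P \<ge> 1" unfolding P_def by (intro prod_ge_1 B)
  define n where "n = real CARD('n)"
  have boxsum: "(\<Sum>x\<in>lbox N. \<Prod>l\<in>UNIV. wt t i j l (x $ l)) \<le> P * t powr (- (1 / 2))" if t: "1 \<le> t" for t N i j
  proof -
    have "(\<Sum>x\<in>lbox N. \<Prod>l\<in>UNIV. wt t i j l (x $ l)) = (\<Prod>l\<in>UNIV. \<Sum>m\<in>{- int N..int N}. wt t i j l m)"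
      by (rule sum_lbox_prod)
    also have "\<dots> \<le> (\<Prod>l\<in>UNIV. B l * (if l = i then t powr 2 else 1) * (if l = j then t powr (- (5 / 2)) else 1))"
      using wt0 by (intro prod_mono conjI one t sum_nonneg) auto
    also have "\<dots> = P * (t powr 2 * t powr (- (5 / 2)))" by (simp add: prod.distrib P_def prod.delta)
    also have "t powr 2 * t powr (- (5 / 2)) = t powr (- (1 / 2))" unfolding powr_add[symmetric] by simp
    finally show ?thesis .
  qed
  show thesis
  proof (rule that[of "P + 2 * n * n * P"])
    have n0: "2 * n * n * P \<ge> 0" using P by (simp add: n_def)
    show "1 \<le> P + 2 * n * n * P" using P n0 by linarith
    fix t N
    have "(\<Sum>x\<in>lbox N. (norm (packet \<kappa> r t x))\<^sup>2) = (\<Sum>x\<in>lbox N. \<Prod>j\<in>UNIV. (norm (packet1 (\<kappa> j) r (x $ j) t))\<^sup>2)"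
      by (simp add: packet_def prod_norm[symmetric] prod_power_distrib)
    also have "\<dots> = (\<Prod>j\<in>UNIV. \<Sum>m\<in>{- int N..int N}. (norm (packet1 (\<kappa> j) r m t))\<^sup>2)"
      by (rule sum_lbox_prod)
    also have "\<dots> \<le> P"
      unfolding P_def by (intro prod_mono conjI order_trans[OF C0(2) B(2)] sum_nonneg) auto
    finally show "(\<Sum>x\<in>lbox N. (norm (packet \<kappa> r t x))\<^sup>2) \<le> P + 2 * n * n * P" using n0 by linarith
  next
    fix t :: real and N assume t: "1 \<le> t"
    let ?S = "{x\<in>lbox N. \<exists>j. ?out t j (x $ j)}"
    have "((1 + norm (lat x)) * norm (packet \<kappa> r t x))\<^sup>2 \<le> 2 * (\<Sum>i\<in>UNIV. \<Sum>j\<in>UNIV. \<Prod>l\<in>UNIV. wt t i j l (x $ l))"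
      if x: "x \<in> ?S" for x
    proof -
      obtain j where j: "?out t j (x $ j)" using x by auto
      have trm: "(\<Prod>l\<in>UNIV. wt t i j l (x $ l)) = (norm (packet \<kappa> r t x))\<^sup>2 * (1 + \<bar>real_of_int (x $ i)\<bar>)\<^sup>2" for i
      proof -
        have "wt t i j l (x $ l) = (norm (packet1 (\<kappa> l) r (x $ l) t))\<^sup>2 * (if l = i then (1 + \<bar>real_of_int (x $ i)\<bar>)\<^sup>2 else 1)" for l
          using j by (simp add: wt_def)
        then show ?thesis by (simp add: prod.distrib prod.delta packet_def prod_norm[symmetric] prod_power_distrib)
      qed
      have "((1 + norm (lat x)) * norm (packet \<kappa> r t x))\<^sup>2 = (norm (packet \<kappa> r t x))\<^sup>2 * (1 + norm (lat x))\<^sup>2"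
        by (simp add: power_mult_distrib)
      also have "\<dots> \<le> (norm (packet \<kappa> r t x))\<^sup>2 * (2 * (\<Sum>i\<in>UNIV. (1 + \<bar>real_of_int (x $ i)\<bar>)\<^sup>2))"
        by (intro mult_left_mono norm_lat_bounds) simp
      also have "\<dots> = 2 * (\<Sum>i\<in>UNIV. \<Prod>l\<in>UNIV. wt t i j l (x $ l))"
        unfolding trm by (simp add: sum_distrib_left mult.left_commute)
      also have "\<dots> \<le> 2 * (\<Sum>i\<in>UNIV. \<Sum>j\<in>UNIV. \<Prod>l\<in>UNIV. wt t i j l (x $ l))"
        by (intro mult_left_mono sum_mono member_le_sum prod_nonneg wt0) (auto intro!: prod_nonneg wt0)
      finally show ?thesis .
    qed
    then have "(\<Sum>x\<in>?S. ((1 + norm (lat x)) * norm (packet \<kappa> r t x))\<^sup>2)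
        \<le> (\<Sum>x\<in>?S. 2 * (\<Sum>i\<in>UNIV. \<Sum>j\<in>UNIV. \<Prod>l\<in>UNIV. wt t i j l (x $ l)))"
      by (rule sum_mono)
    also have "\<dots> \<le> (\<Sum>x\<in>lbox N. 2 * (\<Sum>i\<in>UNIV. \<Sum>j\<in>UNIV. \<Prod>l\<in>UNIV. wt t i j l (x $ l)))"
      by (intro sum_mono2) (auto intro!: sum_nonneg prod_nonneg wt0)
    also have "\<dots> = 2 * (\<Sum>i\<in>UNIV. \<Sum>j\<in>UNIV. \<Sum>x\<in>lbox N. \<Prod>l\<in>UNIV. wt t i j l (x $ l))"
      by (simp only: sum_distrib_left[symmetric] sum.swap[of _ _ "lbox N"])
    also have "\<dots> \<le> 2 * (\<Sum>i\<in>(UNIV::'n set). \<Sum>j\<in>(UNIV::'n set). P * t powr (- (1 / 2)))"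
      by (intro mult_left_mono sum_mono boxsum t) simp
    also have "\<dots> = 2 * n * n * P * t powr (- (1 / 2))" by (simp add: n_def)
    also have "\<dots> \<le> (P + 2 * n * n * P) * t powr (- (1 / 2))" using P by (intro mult_right_mono) auto
    finally show "(\<Sum>x\<in>?S. ((1 + norm (lat x)) * norm (packet \<kappa> r t x))\<^sup>2) \<le> (P + 2 * n * n * P) * t powr (- (1 / 2))" .
  qed
qed

section \<open>Pairing boundary values of the resolvent with packets\<close>

lemma resolvent_superset:
  fixes f :: "int ^ 'n::finite \<Rightarrow> complex"
  assumes "Im z \<noteq> 0" "finite S" "{y. f y \<noteq> 0} \<subseteq> S"
  shows "resolvent z f x = (\<Sum>y\<in>S. f y * green z (x - y))"
  unfolding resolvent_eq_green[OF assms(1) finite_subset[OF assms(3,2)]]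
  by (rule sum.mono_neutral_left) (use assms in auto)

text \<open>\<open>rho\<close> is submultiplicative, so the rate for the kernel passes to its convolution with \<open>f\<close>.\<close>

lemma resolvent_cauchy:
  fixes f :: "int ^ 'n::finite \<Rightarrow> complex"
  assumes lam: "lam \<in> Lambda TYPE('n)" and fin: "finite {y. f y \<noteq> 0}"
  obtains K where "K \<ge> 0" "\<And>x \<epsilon>. 0 < \<epsilon> \<Longrightarrow>
    norm (resolvent (Complex lam \<epsilon>) f x - limit_solution 1 lam f x) \<le> K * rho x * \<epsilon> powr (1 / 4)"
    "\<And>x. ((\<lambda>\<epsilon>. resolvent (Complex lam \<epsilon>) f x) \<longlongrightarrow> limit_solution 1 lam f x) (at_right 0)"
proof -
  obtain K0 G where K0: "K0 \<ge> 0" "\<And>(x :: int ^ 'n) \<epsilon>. 0 < \<epsilon> \<Longrightarrow>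
    norm (green (Complex lam \<epsilon>) x - G x) \<le> K0 * rho x * \<epsilon> powr (1 / 4)"
    using limiting_absorption[OF lam] by metis
  define \<psi> where "\<psi> x = (\<Sum>y | f y \<noteq> 0. f y * G (x - y))" for x
  define K where "K = (\<Sum>y | f y \<noteq> 0. norm (f y) * (K0 * rho y))"
  have rho0: "rho x \<ge> 0" for x :: "int ^ 'n" using rho_ge_1[of x] by linarith
  have K: "K \<ge> 0" unfolding K_def by (intro sum_nonneg mult_nonneg_nonneg K0 rho0) auto
  have bound: "norm (resolvent (Complex lam \<epsilon>) f x - \<psi> x) \<le> K * rho x * \<epsilon> powr (1 / 4)" if \<epsilon>: "0 < \<epsilon>" for x \<epsilon>
  proof -
    have "resolvent (Complex lam \<epsilon>) f x - \<psi> x = (\<Sum>y | f y \<noteq> 0. f y * (green (Complex lam \<epsilon>) (x - y) - G (x - y)))"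
      using \<epsilon> by (subst resolvent_eq_green[OF _ fin]) (auto simp: \<psi>_def sum_subtractf right_diff_distrib)
    also have "norm \<dots> \<le> (\<Sum>y | f y \<noteq> 0. norm (f y) * (K0 * (rho x * rho y) * \<epsilon> powr (1 / 4)))"
    proof (rule order_trans[OF norm_sum sum_mono])
      fix y
      have "norm (green (Complex lam \<epsilon>) (x - y) - G (x - y)) \<le> K0 * rho (x - y) * \<epsilon> powr (1 / 4)"
        by (rule K0(2)[OF \<epsilon>])
      also have "\<dots> \<le> K0 * (rho x * rho y) * \<epsilon> powr (1 / 4)"
        by (intro mult_right_mono mult_left_mono rho_diff K0) simp
      finally show "norm (f y * (green (Complex lam \<epsilon>) (x - y) - G (x - y))) \<le> norm (f y) * (K0 * (rho x * rho y) * \<epsilon> powr (1 / 4))"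
        unfolding norm_mult by (intro mult_left_mono) auto
    qed
    also have "\<dots> = K * rho x * \<epsilon> powr (1 / 4)"
      unfolding K_def sum_distrib_right by (rule sum.cong) (auto simp: ac_simps)
    finally show ?thesis .
  qed
  have lim: "((\<lambda>\<epsilon>. resolvent (Complex lam \<epsilon>) f x) \<longlongrightarrow> \<psi> x) (at_right 0)" for x
  proof (rule Lim_null[THEN iffD2], rule Lim_null_comparison)
    show "eventually (\<lambda>\<epsilon>. norm (resolvent (Complex lam \<epsilon>) f x - \<psi> x) \<le> K * rho x * \<epsilon> powr (1 / 4)) (at_right 0)"
      using eventually_at_right_less[of "0::real"] by eventually_elim (rule bound)
    have "((\<lambda>\<epsilon>::real. K * rho x * \<epsilon> powr (1 / 4)) \<longlongrightarrow> K * rho x * 0 powr (1 / 4)) (at_right 0)"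
      by (intro tendsto_intros tendsto_powr') (auto simp: eventually_at_filter)
    then show "((\<lambda>\<epsilon>::real. K * rho x * \<epsilon> powr (1 / 4)) \<longlongrightarrow> 0) (at_right 0)" by simp
  qed
  have eq: "limit_solution 1 lam f x = \<psi> x" for x
    unfolding limit_solution_def mult_1_left by (rule tendsto_Lim[OF _ lim]) simp
  show thesis by (rule that[OF K]) (use bound lim in \<open>auto simp: eq\<close>)
qed

lemma limit_solution_diff:
  fixes f g :: "int ^ 'n::finite \<Rightarrow> complex"
  assumes lam: "lam \<in> Lambda TYPE('n)" and fin: "finite {y. f y \<noteq> 0}" "finite {y. g y \<noteq> 0}"
  shows "limit_solution 1 lam (\<lambda>y. f y - g y) x = limit_solution 1 lam f x - limit_solution 1 lam g x"
proof -
  let ?S = "{y. f y \<noteq> 0} \<union> {y. g y \<noteq> 0}"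
  have fin': "finite {y. f y - g y \<noteq> 0}" by (rule finite_subset[of _ ?S]) (use fin in auto)
  have lim: "((\<lambda>\<epsilon>. resolvent (Complex lam \<epsilon>) h x) \<longlongrightarrow> limit_solution 1 lam h x) (at_right 0)"
    if "finite {y. h y \<noteq> 0}" for h :: "int ^ 'n \<Rightarrow> complex"
    by (rule resolvent_cauchy[OF lam that])
  have "((\<lambda>\<epsilon>. resolvent (Complex lam \<epsilon>) f x - resolvent (Complex lam \<epsilon>) g x)
      \<longlongrightarrow> limit_solution 1 lam f x - limit_solution 1 lam g x) (at_right 0)"
    by (intro tendsto_diff lim fin)
  moreover have "eventually (\<lambda>\<epsilon>. resolvent (Complex lam \<epsilon>) f x - resolvent (Complex lam \<epsilon>) g x
      = resolvent (Complex lam \<epsilon>) (\<lambda>y. f y - g y) x) (at_right 0)"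
    using eventually_at_right_less[of "0::real"]
  proof eventually_elim
    case (elim \<epsilon>)
    then have "Im (Complex lam \<epsilon>) \<noteq> 0" by simp
    from resolvent_superset[OF this, of ?S] show ?case
      using fin by (subst (1 2 3) resolvent_superset[of _ ?S]) (use elim in \<open>auto simp: sum_subtractf left_diff_distrib\<close>)
  qed
  ultimately have "((\<lambda>\<epsilon>. resolvent (Complex lam \<epsilon>) (\<lambda>y. f y - g y) x)
      \<longlongrightarrow> limit_solution 1 lam f x - limit_solution 1 lam g x) (at_right 0)"
    by (rule Lim_transform_eventually)
  from tendsto_unique[OF _ this lim[OF fin']] show ?thesis by simp
qed

text \<open>Parseval's identity for the resolvent and a packet. The partial sums over boxes converge pointwise by
  Fourier inversion and are bounded because the packet is absolutely summable.\<close>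

lemma packet_pairing_limit:
  fixes f :: "int ^ 'n::finite \<Rightarrow> complex" and \<kappa> :: "'n \<Rightarrow> real"
  assumes fin: "finite {y. f y \<noteq> 0}" and \<epsilon>: "0 < \<epsilon>"
    and A: "\<And>N. (\<Sum>x\<in>lbox N. rho x * norm (packet \<kappa> r t x)) \<le> A"
  shows "(\<lambda>N. \<Sum>x\<in>lbox N. resolvent (Complex lam \<epsilon>) f x * cnj (packet \<kappa> r t x))
    \<longlonglongrightarrow> cis (t * lam) * resolvent_pairing (\<lambda>k. fhat f k * window \<kappa> r k) lam \<epsilon> t"
proof -
  let ?z = "Complex lam \<epsilon>"
  let ?d = "\<lambda>k. complex_of_real (Phi k) - ?z"
  have z: "Im ?z \<noteq> 0" using \<epsilon> by simp
  define M where "M = (\<Sum>y | f y \<noteq> 0. norm (f y))"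
  have fB: "norm (fhat f k) \<le> M" for k
    unfolding M_def by (rule norm_fhat_le)
  have M0: "M \<ge> 0" by (simp add: M_def sum_nonneg)
  have dB: "norm (1 / ?d k) \<le> 1 / \<epsilon>" for k :: "'n \<Rightarrow> real"
    using inverse_resolvent_bound[OF z, of "Phi k"] \<epsilon> by (simp add: norm_divide)
  have qB: "norm (fhat f k / ?d k) \<le> M / \<epsilon>" for k
    using mult_mono[OF fB[of k] dB[of k] M0] by (simp add: norm_divide)
  have res: "resolvent ?z f x = (\<integral>k. fhat f k / ?d k * chi x k \<partial>tor)" for x
  proof -
    have i: "integrable tor (\<lambda>k. chi (x - y) k / ?d k)" for y
      by (rule integrable_tor_bounded[where B="1 / \<epsilon>"]) (use dB in \<open>auto simp: norm_divide\<close>)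
    have "resolvent ?z f x = (\<integral>k. (\<Sum>y | f y \<noteq> 0. f y * (chi (x - y) k / ?d k)) \<partial>tor)"
      unfolding resolvent_eq_green[OF z fin] green_def
      by (simp only: Bochner_Integration.integral_sum integrable_mult_right i integral_mult_right_zero)
    also have "(\<lambda>k. \<Sum>y | f y \<noteq> 0. f y * (chi (x - y) k / ?d k)) = (\<lambda>k. fhat f k / ?d k * chi x k)"
      by (rule ext) (simp add: fhat_def chi_diff sum_distrib_left sum_distrib_right sum_divide_distrib ac_simps)
    finally show ?thesis .
  qed
  define s where "s N k = (\<Sum>x\<in>lbox N. cnj (packet \<kappa> r t x) * chi x k)" for N k
  have sB: "norm (s N k) \<le> A" for N k
  proof -
    have "norm (s N k) \<le> (\<Sum>x\<in>lbox N. 1 * norm (packet \<kappa> r t x))"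
      unfolding s_def by (rule order_trans[OF norm_sum]) (simp add: norm_mult)
    also have "\<dots> \<le> (\<Sum>x\<in>lbox N. rho x * norm (packet \<kappa> r t x))"
      by (intro sum_mono mult_right_mono rho_ge_1) simp
    finally show ?thesis using A[of N] by linarith
  qed
  have [measurable]: "s N \<in> borel_measurable tor" for N unfolding s_def by measurable
  have sum_eq: "(\<Sum>x\<in>lbox N. resolvent ?z f x * cnj (packet \<kappa> r t x)) = (\<integral>k. fhat f k / ?d k * s N k \<partial>tor)" for N
  proof -
    have i: "integrable tor (\<lambda>k. fhat f k / ?d k * chi x k)" for x
      by (rule integrable_tor_bounded[where B="M / \<epsilon>"]) (measurable, simp only: norm_mult norm_chi mult_1_right qB)
    have "(\<Sum>x\<in>lbox N. resolvent ?z f x * cnj (packet \<kappa> r t x)) =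
        (\<integral>k. (\<Sum>x\<in>lbox N. cnj (packet \<kappa> r t x) * (fhat f k / ?d k * chi x k)) \<partial>tor)"
      by (simp only: Bochner_Integration.integral_sum integrable_mult_right i integral_mult_right_zero res mult.commute[of _ "cnj _"])
    also have "(\<lambda>k. \<Sum>x\<in>lbox N. cnj (packet \<kappa> r t x) * (fhat f k / ?d k * chi x k)) = (\<lambda>k. fhat f k / ?d k * s N k)"
      by (rule ext) (simp add: s_def sum_distrib_left ac_simps)
    finally show ?thesis .
  qed
  have "(\<lambda>N. \<integral>k. fhat f k / ?d k * s N k \<partial>tor) \<longlonglongrightarrow> (\<integral>k. fhat f k / ?d k * (window \<kappa> r k * cis (t * Phi k)) \<partial>tor)"
  proof (rule integral_dominated_convergence)
    show "AE k in tor. (\<lambda>N. fhat f k / ?d k * s N k) \<longlonglongrightarrow> fhat f k / ?d k * (window \<kappa> r k * cis (t * Phi k))"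
      using AE_tor
    proof eventually_elim
      case (elim k)
      then show ?case unfolding s_def by (intro tendsto_mult tendsto_const packet_inversion) auto
    qed
    show "AE k in tor. norm (fhat f k / ?d k * s N k) \<le> M / \<epsilon> * A" for N
      unfolding norm_mult using order_trans[OF norm_ge_zero qB] by (intro AE_I2 mult_mono qB sB) auto
  qed auto
  also have "(\<integral>k. fhat f k / ?d k * (window \<kappa> r k * cis (t * Phi k)) \<partial>tor)
      = cis (t * lam) * resolvent_pairing (\<lambda>k. fhat f k * window \<kappa> r k) lam \<epsilon> t"
  proof -
    have d: "complex_of_real (Phi k - lam) - \<i> * complex_of_real \<epsilon> = ?d k" for k :: "'n \<Rightarrow> real"
      by (simp add: Complex_eq)
    have c: "cis (t * Phi k) = cis (t * lam) * cis (t * (Phi k - lam))" for k :: "'n \<Rightarrow> real"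
      by (simp add: cis_mult algebra_simps)
    show ?thesis
      unfolding resolvent_pairing_def d c integral_mult_right_zero[symmetric] by (simp add: ac_simps)
  qed
  finally show ?thesis unfolding sum_eq .
qed

text \<open>Where the velocity component \<open>- 2 sin (\<kappa> j0)\<close> does not vanish, the packet leaves every fixed site:
  for \<open>|u|\<close> large compared with \<open>|n|\<close> the phase is non-stationary. The remaining times are bounded in terms of
  \<open>n\<close>, and only the finitely many \<open>n\<close> from the support of \<open>f\<close> occur.\<close>

lemma packet_time_decay:
  fixes f :: "int ^ 'n::finite \<Rightarrow> complex" and \<kappa> :: "'n \<Rightarrow> real"
  assumes r: "0 < r" "\<And>j. - pi < \<kappa> j - r" "\<And>j. \<kappa> j + r < pi" and j0: "r < \<bar>sin (\<kappa> j0)\<bar>"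
  obtains C where "\<And>u. u \<noteq> 0 \<Longrightarrow> norm (\<integral>k. fhat f k * window \<kappa> r k * cis (u * Phi k) \<partial>tor) \<le> C / u\<^sup>2"
proof -
  define \<sigma> where "\<sigma> = \<bar>sin (\<kappa> j0)\<bar> - r"
  have \<sigma>: "\<sigma> > 0" using j0 by (simp add: \<sigma>_def)
  obtain C where C: "C \<ge> 0" "\<And>n t m. 0 < m \<Longrightarrow> (\<And>k. \<bar>k - \<kappa> j0\<bar> \<le> r \<Longrightarrow> m \<le> \<bar>real_of_int n + 2 * t * sin k\<bar>) \<Longrightarrow>
    \<bar>t\<bar> \<le> (1 / \<sigma>) * m \<Longrightarrow> norm (packet1 (\<kappa> j0) r n t) \<le> C / m\<^sup>2"
    using packet1_nonstationary[OF r(1) r(2)[of j0] r(3)[of j0], of "1 / \<sigma>"] \<sigma> by auto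
  define bd where "bd j c \<longleftrightarrow> c \<ge> 1 \<and> (\<forall>t n. norm (packet1 (\<kappa> j) r n t) \<le> c)" for j c
  have "\<exists>c. bd j c" for j
    by (rule packet1_bessel[OF r(1) r(2)[of j] r(3)[of j]]) (auto simp: bd_def)
  then obtain c where cb: "\<And>j. bd j (c j)" by metis
  have c: "c j \<ge> 1" "norm (packet1 (\<kappa> j) r n t) \<le> c j" for j n t using cb by (auto simp: bd_def)
  \<comment> \<open>The two summands cover the times with \<open>|n| \<le> \<sigma> |u|\<close> and those with \<open>|n| > \<sigma> |u|\<close>.\<close>
  define D where "D n = (C + c j0 * (real_of_int n)\<^sup>2) / \<sigma>\<^sup>2" for n
  have o: "norm (packet1 (\<kappa> j0) r n u) \<le> D n / u\<^sup>2" if u: "u \<noteq> 0" for n u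
  proof (cases "\<bar>real_of_int n\<bar> \<le> \<sigma> * \<bar>u\<bar>")
    case True
    have "norm (packet1 (\<kappa> j0) r n u) \<le> C / (\<sigma> * \<bar>u\<bar>)\<^sup>2"
    proof (rule C(2))
      show "0 < \<sigma> * \<bar>u\<bar>" using \<sigma> u by simp
      show "\<bar>u\<bar> \<le> 1 / \<sigma> * (\<sigma> * \<bar>u\<bar>)" using \<sigma> by simp
      fix k assume "\<bar>k - \<kappa> j0\<bar> \<le> r"
      then have "\<bar>sin (\<kappa> j0)\<bar> - \<bar>sin k\<bar> \<le> r"
        using abs_sin_cos_diff_le(1)[of "\<kappa> j0" k] abs_triangle_ineq2[of "sin (\<kappa> j0)" "sin k"] by linarith
      then have "\<bar>u\<bar> * \<sigma> \<le> \<bar>u\<bar> * \<bar>sin k\<bar>" by (intro mult_left_mono) (auto simp: \<sigma>_def)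
      moreover have "\<bar>2 * u * sin k\<bar> - \<bar>- real_of_int n\<bar> \<le> \<bar>2 * u * sin k - (- real_of_int n)\<bar>"
        by (rule abs_triangle_ineq2)
      ultimately show "\<sigma> * \<bar>u\<bar> \<le> \<bar>real_of_int n + 2 * u * sin k\<bar>"
        using True by (simp add: abs_mult ac_simps)
    qed
    also have "\<dots> = C / \<sigma>\<^sup>2 / u\<^sup>2" by (simp add: power_mult_distrib)
    also have "\<dots> \<le> D n / u\<^sup>2"
      unfolding D_def using order_trans[OF zero_le_one c(1)[of j0]] by (intro divide_right_mono) auto
    finally show ?thesis .
  next
    case False
    have "norm (packet1 (\<kappa> j0) r n u) * u\<^sup>2 \<le> c j0 * ((real_of_int n)\<^sup>2 / \<sigma>\<^sup>2)"
    proof (rule mult_mono)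
      have "\<bar>u\<bar> \<le> \<bar>real_of_int n\<bar> / \<sigma>" using False \<sigma> by (simp add: field_simps)
      then have "\<bar>u\<bar>\<^sup>2 \<le> (\<bar>real_of_int n\<bar> / \<sigma>)\<^sup>2" by (intro power_mono) auto
      then show "u\<^sup>2 \<le> (real_of_int n)\<^sup>2 / \<sigma>\<^sup>2" by (simp add: power_divide)
    qed (use c order_trans[OF zero_le_one c(1)[of j0]] in auto)
    also have "\<dots> \<le> D n" unfolding D_def using C(1) by (simp add: add_divide_distrib)
    finally show ?thesis using u by (simp add: pos_le_divide_eq)
  qed
  define E where "E = (\<Sum>y | f y \<noteq> 0. norm (f y) * (D (y $ j0) * (\<Prod>j\<in>UNIV - {j0}. c j)))"
  have pk: "norm (packet \<kappa> r u y) \<le> D (y $ j0) * (\<Prod>j\<in>UNIV - {j0}. c j) / u\<^sup>2" if u: "u \<noteq> 0" for u and y :: "int ^ 'n"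
  proof -
    have "norm (packet \<kappa> r u y) = norm (packet1 (\<kappa> j0) r (y $ j0) u) * (\<Prod>j\<in>UNIV - {j0}. norm (packet1 (\<kappa> j) r (y $ j) u))"
      unfolding packet_def prod_norm[symmetric] by (rule prod.remove) auto
    also have "\<dots> \<le> (D (y $ j0) / u\<^sup>2) * (\<Prod>j\<in>UNIV - {j0}. c j)"
      using o[OF u, of "y $ j0"] c order_trans[OF norm_ge_zero o[OF u, of "y $ j0"]]
      by (intro mult_mono prod_mono prod_nonneg) auto
    finally show ?thesis by simp
  qed
  have "norm (\<integral>k. fhat f k * window \<kappa> r k * cis (u * Phi k) \<partial>tor) \<le> E / u\<^sup>2" if u: "u \<noteq> 0" for u
  proof -
    have "norm (\<integral>k. fhat f k * window \<kappa> r k * cis (u * Phi k) \<partial>tor) \<le> (\<Sum>y | f y \<noteq> 0. norm (f y) * norm (packet \<kappa> r u y))"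
      unfolding window_overlap by (rule order_trans[OF norm_sum]) (simp add: norm_mult)
    also have "\<dots> \<le> (\<Sum>y | f y \<noteq> 0. norm (f y) * (D (y $ j0) * (\<Prod>j\<in>UNIV - {j0}. c j) / u\<^sup>2))"
      by (intro sum_mono mult_left_mono pk u) simp
    also have "\<dots> = E / u\<^sup>2" by (simp add: E_def sum_divide_distrib)
    finally show ?thesis .
  qed
  then show thesis by (rule that)
qed

text \<open>Inside the cone there are at most \<open>O(t\<^sup>d)\<close> sites, all at distance of order
  \<open>t\<close>, and there \<open>|\<psi>|\<^sup>2 = O(t\<^bsup>-d-1\<^esup>)\<close>: the extra decay beyond the generic \<open>O(t\<^bsup>-d+1\<^esup>)\<close> makes
  \<open>\<Sum> |\<psi>|\<^sup>2\<close> over the cone of order \<open>1/t\<close>, while the packet is bounded in \<open>\<ell>\<^sup>2\<close>. Outside the cone \<open>\<psi>\<close> has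
  only the generic decay, but \<open>\<psi> / (1 + |x|)\<close> is square summable and the packet is small even with the weight
  \<open>1 + |x|\<close>. The Cauchy--Schwarz inequality handles both parts.\<close>

lemma outgoing_pairing_bound:
  fixes \<psi> :: "int ^ 'n::finite \<Rightarrow> complex" and \<kappa> :: "'n \<Rightarrow> real"
  assumes r: "0 < r" "\<And>j. - pi < \<kappa> j - r" "\<And>j. \<kappa> j + r < pi" and \<eta>: "0 < \<eta>" "r \<le> \<eta> / 4"
    and j0: "\<eta> < 2 * \<bar>sin (\<kappa> j0)\<bar>"
    and all: "\<And>x. norm (\<psi> x) \<le> C0 * (1 + norm (lat x)) powr (- ((real CARD('n) - 1) / 2))"
    and cone: "\<And>x t. R \<le> norm (lat x) \<Longrightarrow> 0 < t \<Longrightarrow> (\<And>j. \<bar>real_of_int (x $ j) + 2 * t * sin (\<kappa> j)\<bar> \<le> \<eta> * t) \<Longrightarrow>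
      norm (\<psi> x) \<le> C1 * norm (lat x) powr (- ((real CARD('n) + 1) / 2))"
  obtains A T where "T \<ge> 1" "\<And>t N. T \<le> t \<Longrightarrow>
    norm (\<Sum>x\<in>lbox N. \<psi> x * cnj (packet \<kappa> r t x)) \<le> A * t powr (- (1 / 4))"
proof -
  let ?d = "real CARD('n)"
  \<comment> \<open>Sites in the cone satisfy \<open>|x| \<ge> |x $ j0| \<ge> c t\<close>.\<close>
  define c where "c = 2 * \<bar>sin (\<kappa> j0)\<bar> - \<eta>"
  have c: "c > 0" using j0 by (simp add: c_def)
  obtain C where C: "C \<ge> 1" "\<And>t N. (\<Sum>x\<in>lbox N. (norm (packet \<kappa> r t x))\<^sup>2) \<le> C"
    "\<And>t N. 1 \<le> t \<Longrightarrow>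
      (\<Sum>x\<in>{x\<in>lbox N. \<exists>j. \<eta> * t < \<bar>real_of_int (x $ j) + 2 * t * sin (\<kappa> j)\<bar>}.
        ((1 + norm (lat x)) * norm (packet \<kappa> r t x))\<^sup>2) \<le> C * t powr (- (1 / 2))"
    by (rule packet_l2_bound[where \<kappa>=\<kappa>, OF r \<eta>]) blast
  obtain W where W: "W > 0" "\<And>N. (\<Sum>x\<in>(lbox N :: (int ^ 'n) set). (1 + norm (lat x)) powr (- (?d + 1))) \<le> W"
    using weighted_lattice_sum by blast
  \<comment> \<open>For \<open>t \<ge> 1\<close> the cone at time \<open>t\<close> lies in a box of side at most \<open>L t\<close>.\<close>
  define L where "L = 2 * (2 + \<eta>) + 3"
  define A1 where "A1 = L ^ CARD('n) * (C1\<^sup>2 * c powr (- (?d + 1)))"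
  define A where "A = sqrt (C0\<^sup>2 * W) * sqrt C + sqrt A1 * sqrt C"
  show thesis
  proof (rule that[of "max 1 (R / c)" A])
    show "1 \<le> max 1 (R / c)" by simp
    fix t N assume "max 1 (R / c) \<le> t"
    then have t: "1 \<le> t" and Rc: "R \<le> c * t" using c by (auto simp: pos_divide_le_eq mult.commute)
    let ?Out = "{x\<in>lbox N :: (int ^ 'n) set. \<exists>j. \<eta> * t < \<bar>real_of_int (x $ j) + 2 * t * sin (\<kappa> j)\<bar>}"
    let ?In = "{x\<in>lbox N :: (int ^ 'n) set. \<forall>j. \<bar>real_of_int (x $ j) + 2 * t * sin (\<kappa> j)\<bar> \<le> \<eta> * t}"
    have split: "lbox N = ?Out \<union> ?In" "?Out \<inter> ?In = {}" unfolding linorder_not_le[symmetric] by blast+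
    have "norm (\<Sum>x\<in>lbox N. \<psi> x * cnj (packet \<kappa> r t x)) \<le> (\<Sum>x\<in>lbox N. norm (\<psi> x) * norm (packet \<kappa> r t x))"
      by (rule order_trans[OF norm_sum]) (simp add: norm_mult)
    also have "\<dots> = (\<Sum>x\<in>?Out. norm (\<psi> x) * norm (packet \<kappa> r t x)) + (\<Sum>x\<in>?In. norm (\<psi> x) * norm (packet \<kappa> r t x))"
      by (subst split(1), rule sum.union_disjoint) (use split in auto)
    also have "(\<Sum>x\<in>?Out. norm (\<psi> x) * norm (packet \<kappa> r t x)) \<le> sqrt (C0\<^sup>2 * W) * sqrt (C * t powr (- (1 / 2)))"
    proof -
      have "(\<Sum>x\<in>?Out. norm (\<psi> x) * norm (packet \<kappa> r t x)) =
          (\<Sum>x\<in>?Out. \<bar>norm (\<psi> x) / (1 + norm (lat x))\<bar> * \<bar>(1 + norm (lat x)) * norm (packet \<kappa> r t x)\<bar>)"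
      proof (rule sum.cong[OF refl])
        fix x :: "int ^ 'n"
        have "1 + norm (lat x) > 0" by (simp add: add_pos_nonneg)
        then show "norm (\<psi> x) * norm (packet \<kappa> r t x) =
          \<bar>norm (\<psi> x) / (1 + norm (lat x))\<bar> * \<bar>(1 + norm (lat x)) * norm (packet \<kappa> r t x)\<bar>"
          by (simp add: abs_mult abs_divide)
      qed
      also have "\<dots> \<le> sqrt (C0\<^sup>2 * W) * sqrt (C * t powr (- (1 / 2)))"
      proof (rule cauchy_schwarz_sum[OF _ C(3)[OF t]])
        have "(norm (\<psi> x) / (1 + norm (lat x)))\<^sup>2 \<le> C0\<^sup>2 * (1 + norm (lat x)) powr (- (?d + 1))" for x
        proof -
          let ?b = "1 + norm (lat x)"
          have b: "?b > 0" by (simp add: add_pos_nonneg)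
          have "norm (\<psi> x) / ?b \<le> C0 * ?b powr (- ((?d - 1) / 2)) / ?b"
            using b by (intro divide_right_mono all) simp
          also have "\<dots> = C0 * (?b powr (- ((?d - 1) / 2)) * ?b powr (- 1))"
            using b by (simp add: powr_minus_divide)
          also have "?b powr (- ((?d - 1) / 2)) * ?b powr (- 1) = ?b powr (- ((?d + 1) / 2))"
            unfolding powr_add[symmetric] by (rule arg_cong[where f="\<lambda>e. ?b powr e"]) (simp add: field_simps)
          finally have "(norm (\<psi> x) / ?b)\<^sup>2 \<le> (C0 * ?b powr (- ((?d + 1) / 2)))\<^sup>2"
            using b by (intro power_mono) auto
          also have "\<dots> = C0\<^sup>2 * (?b powr (- ((?d + 1) / 2)) * ?b powr (- ((?d + 1) / 2)))"
            by (simp add: power2_eq_square)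
          also have "?b powr (- ((?d + 1) / 2)) * ?b powr (- ((?d + 1) / 2)) = ?b powr (- (?d + 1))"
            unfolding powr_add[symmetric] by (rule arg_cong[where f="\<lambda>e. ?b powr e"]) (simp add: field_simps)
          finally show ?thesis .
        qed
        then have "(\<Sum>x\<in>?Out. (norm (\<psi> x) / (1 + norm (lat x)))\<^sup>2) \<le> (\<Sum>x\<in>?Out. C0\<^sup>2 * (1 + norm (lat x)) powr (- (?d + 1)))"
          by (rule sum_mono)
        also have "\<dots> \<le> (\<Sum>x\<in>(lbox N :: (int ^ 'n) set). C0\<^sup>2 * (1 + norm (lat x)) powr (- (?d + 1)))"
          by (intro sum_mono2) auto
        also have "\<dots> \<le> C0\<^sup>2 * W" unfolding sum_distrib_left[symmetric] by (intro mult_left_mono W) simp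
        finally show "(\<Sum>x\<in>?Out. (norm (\<psi> x) / (1 + norm (lat x)))\<^sup>2) \<le> C0\<^sup>2 * W" .
      qed
      finally show ?thesis .
    qed
    also have "sqrt (C * t powr (- (1 / 2))) = sqrt C * t powr (- (1 / 4))"
    proof -
      have "sqrt (t powr (- (1 / 2))) = (t powr (- (1 / 2))) powr (1 / 2)" by (rule powr_half_sqrt[symmetric]) simp
      also have "\<dots> = t powr (- (1 / 4))" by (simp add: powr_powr)
      finally show ?thesis by (simp add: real_sqrt_mult)
    qed
    also have "(\<Sum>x\<in>?In. norm (\<psi> x) * norm (packet \<kappa> r t x)) \<le> sqrt (A1 * t powr (- 1)) * sqrt C"
    proof -
      have "(\<Sum>x\<in>?In. norm (\<psi> x) * norm (packet \<kappa> r t x)) = (\<Sum>x\<in>?In. \<bar>norm (\<psi> x)\<bar> * \<bar>norm (packet \<kappa> r t x)\<bar>)" by simp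
      also have "\<dots> \<le> sqrt (A1 * t powr (- 1)) * sqrt C"
      proof (rule cauchy_schwarz_sum)
        have "(\<Sum>x\<in>?In. (norm (packet \<kappa> r t x))\<^sup>2) \<le> (\<Sum>x\<in>lbox N. (norm (packet \<kappa> r t x))\<^sup>2)"
          by (intro sum_mono2) auto
        then show "(\<Sum>x\<in>?In. (norm (packet \<kappa> r t x))\<^sup>2) \<le> C" using C(2)[of t N] by linarith
        have sq: "(norm (\<psi> x))\<^sup>2 \<le> C1\<^sup>2 * (c * t) powr (- (?d + 1))" if x: "x \<in> ?In" for x
        proof -
          have ct: "c * t > 0" using c t by simp
          have "2 * t * \<bar>sin (\<kappa> j0)\<bar> - \<bar>real_of_int (x $ j0)\<bar> \<le> \<bar>real_of_int (x $ j0) + 2 * t * sin (\<kappa> j0)\<bar>"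
            using abs_triangle_ineq2[of "2 * t * sin (\<kappa> j0)" "- real_of_int (x $ j0)"] t by (simp add: abs_mult add.commute)
          moreover have "\<bar>real_of_int (x $ j0) + 2 * t * sin (\<kappa> j0)\<bar> \<le> \<eta> * t" using x by blast
          ultimately have "c * t \<le> \<bar>real_of_int (x $ j0)\<bar>" by (simp add: c_def algebra_simps)
          then have xl: "c * t \<le> norm (lat x)" using norm_lat_bounds(1)[of x j0] by linarith
          have "norm (\<psi> x) \<le> C1 * norm (lat x) powr (- ((?d + 1) / 2))"
            by (rule cone[of x t]) (use x xl Rc t in auto)
          also have "\<dots> \<le> \<bar>C1\<bar> * (c * t) powr (- ((?d + 1) / 2))"
            using xl ct by (intro mult_mono powr_mono2') auto
          finally have "(norm (\<psi> x))\<^sup>2 \<le> (\<bar>C1\<bar> * (c * t) powr (- ((?d + 1) / 2)))\<^sup>2"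
            by (intro power_mono) auto
          also have "\<dots> = C1\<^sup>2 * ((c * t) powr (- ((?d + 1) / 2)) * (c * t) powr (- ((?d + 1) / 2)))"
            by (simp add: power2_eq_square)
          also have "(c * t) powr (- ((?d + 1) / 2)) * (c * t) powr (- ((?d + 1) / 2)) = (c * t) powr (- (?d + 1))"
            unfolding powr_add[symmetric] by (rule arg_cong[where f="\<lambda>e. (c * t) powr e"]) (simp add: field_simps)
          finally show ?thesis .
        qed
        define M where "M = nat \<lceil>(2 + \<eta>) * t\<rceil>"
        have "?In \<subseteq> lbox M"
        proof
          fix x assume x: "x \<in> ?In"
          have "\<bar>x $ j\<bar> \<le> int M" for j
          proof -
            have "\<bar>real_of_int (x $ j)\<bar> - \<bar>- (2 * t * sin (\<kappa> j))\<bar> \<le> \<bar>real_of_int (x $ j) - (- (2 * t * sin (\<kappa> j)))\<bar>"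
              by (rule abs_triangle_ineq2)
            moreover have "\<bar>2 * t * sin (\<kappa> j)\<bar> \<le> 2 * t * 1"
              unfolding abs_mult using t by (intro mult_mono) auto
            moreover have "\<bar>real_of_int (x $ j) + 2 * t * sin (\<kappa> j)\<bar> \<le> \<eta> * t" using x by blast
            ultimately have "\<bar>real_of_int (x $ j)\<bar> \<le> (2 + \<eta>) * t" by (simp add: algebra_simps)
            then show ?thesis unfolding M_def using \<eta> t by (simp add: le_ceiling_iff le_nat_iff) linarith
          qed
          then show "x \<in> lbox M" by (simp add: lbox_def)
        qed
        then have "real (card ?In) \<le> real (2 * M + 1) ^ CARD('n)"
          using card_mono[of "lbox M" ?In] by (simp add: card_lbox of_nat_power[symmetric] del: of_nat_power of_nat_Suc)
        also have "\<dots> \<le> (L * t) ^ CARD('n)"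
        proof (rule power_mono)
          have "real M \<le> (2 + \<eta>) * t + 1" unfolding M_def using \<eta> t by (simp add: of_nat_nat)
          then show "real (2 * M + 1) \<le> L * t" using t by (simp add: L_def algebra_simps)
        qed simp
        finally have card: "real (card ?In) \<le> (L * t) ^ CARD('n)" .
        have "(\<Sum>x\<in>?In. (norm (\<psi> x))\<^sup>2) \<le> real (card ?In) * (C1\<^sup>2 * (c * t) powr (- (?d + 1)))"
          using sum_bounded_above[of ?In "\<lambda>x. (norm (\<psi> x))\<^sup>2", OF sq] by simp
        also have "\<dots> \<le> (L * t) ^ CARD('n) * (C1\<^sup>2 * (c * t) powr (- (?d + 1)))"
          by (intro mult_right_mono card) auto
        also have "\<dots> = A1 * (t powr ?d * t powr (- (?d + 1)))"
          using t by (simp add: A1_def power_mult_distrib powr_mult powr_realpow)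
        also have "t powr ?d * t powr (- (?d + 1)) = t powr (- 1)" unfolding powr_add[symmetric] by simp
        finally show "(\<Sum>x\<in>?In. (norm (\<psi> x))\<^sup>2) \<le> A1 * t powr (- 1)" .
      qed
      finally show ?thesis .
    qed
    also have "sqrt (A1 * t powr (- 1)) \<le> sqrt A1 * t powr (- (1 / 4))"
    proof -
      have "sqrt (t powr (- 1)) = (t powr (- 1)) powr (1 / 2)" by (rule powr_half_sqrt[symmetric]) simp
      also have "\<dots> = t powr (- (1 / 2))" unfolding powr_powr by simp
      also have "\<dots> \<le> t powr (- (1 / 4))" using t by (intro powr_mono) auto
      finally show ?thesis
        unfolding real_sqrt_mult using \<eta> by (intro mult_left_mono) (auto simp: A1_def L_def)
    qed
    finally show "norm (\<Sum>x\<in>lbox N. \<psi> x * cnj (packet \<kappa> r t x)) \<le> A * t powr (- (1 / 4))"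
      using C(1) by (simp add: A_def algebra_simps)
  qed
qed

section \<open>Vanishing of the Fourier transform\<close>

lemma chi_diff_le:
  fixes y :: "int ^ 'n::finite"
  assumes "\<And>j. \<bar>k j - \<kappa> j\<bar> \<le> r"
  shows "norm (chi y k - chi y \<kappa>) \<le> r * (\<Sum>j\<in>UNIV. \<bar>real_of_int (y $ j)\<bar>)"
proof -
  have "norm (chi y k - chi y \<kappa>) \<le> (\<Sum>j\<in>UNIV. norm (cis (real_of_int (y $ j) * k j) - cis (real_of_int (y $ j) * \<kappa> j)))"
    unfolding chi_def by (rule norm_prod_diff) auto
  also have "\<dots> \<le> (\<Sum>j\<in>UNIV. \<bar>real_of_int (y $ j)\<bar> * r)"
  proof (rule sum_mono)
    fix j
    have "norm (cis (real_of_int (y $ j) * k j) - cis (real_of_int (y $ j) * \<kappa> j)) \<le> \<bar>real_of_int (y $ j) * (k j - \<kappa> j)\<bar>"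
      using norm_cis_diff_le by (simp add: right_diff_distrib)
    also have "\<dots> \<le> \<bar>real_of_int (y $ j)\<bar> * r" unfolding abs_mult by (intro mult_left_mono assms) simp
    finally show "norm (cis (real_of_int (y $ j) * k j) - cis (real_of_int (y $ j) * \<kappa> j)) \<le> \<bar>real_of_int (y $ j)\<bar> * r" .
  qed
  finally show ?thesis by (simp add: sum_distrib_left mult.commute)
qed

lemma Phi_diff_le:
  fixes k \<kappa> :: "'n::finite \<Rightarrow> real"
  assumes "\<And>j. \<bar>k j - \<kappa> j\<bar> \<le> r"
  shows "\<bar>Phi k - Phi \<kappa>\<bar> \<le> 2 * real CARD('n) * r"
proof -
  have "Phi k - Phi \<kappa> = 2 * (\<Sum>j\<in>UNIV. cos (k j) - cos (\<kappa> j))"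
    by (simp add: Phi_def sum_subtractf)
  then have "\<bar>Phi k - Phi \<kappa>\<bar> = 2 * \<bar>\<Sum>j\<in>UNIV. cos (k j) - cos (\<kappa> j)\<bar>"
    by (simp only: abs_mult abs_numeral)
  also have "\<dots> \<le> 2 * (\<Sum>j\<in>(UNIV :: 'n set). r)"
    by (intro mult_left_mono order_trans[OF sum_abs] sum_mono order_trans[OF abs_sin_cos_diff_le(2)] assms) simp
  finally show ?thesis by simp
qed

text \<open>Let \<open>\<psi>\<close> be the boundary value of the resolvent at \<open>\<lambda> + \<i>0\<close>, applied to \<open>f\<close>. Its pairing with a packet centred
  at \<open>\<kappa>\<close> tends to \<open>0\<close> as \<open>t \<rightarrow> \<infinity>\<close>, since the packet moves into the cone where \<open>\<psi>\<close> decays fast. By the previous sections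
  the jump of the resolvent pairing vanishes for all \<open>\<lambda>\<close> near \<open>Phi \<kappa>\<close>, and so \<open>\<integral> fhat f * window \<kappa> r = 0\<close>. As
  the window is nonnegative, this is impossible for small \<open>r\<close> if \<open>fhat f \<kappa> \<noteq> 0\<close>.\<close>

lemma fhat_vanishes:
  fixes f :: "int ^ 'n::finite \<Rightarrow> complex" and \<kappa> :: "'n \<Rightarrow> real"
  assumes fin: "finite {y. f y \<noteq> 0}"
    and cube: "\<And>j. - pi < \<kappa> j \<and> \<kappa> j < pi" and j0: "\<eta> < 2 * \<bar>sin (\<kappa> j0)\<bar>" and \<eta>: "0 < \<eta>"
    and lam: "\<And>lam. \<bar>lam - Phi \<kappa>\<bar> \<le> \<eta> \<Longrightarrow> lam \<in> Lambda TYPE('n)"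
    and all: "\<And>lam. \<bar>lam - Phi \<kappa>\<bar> \<le> \<eta> \<Longrightarrow> \<exists>C. \<forall>x.
      norm (limit_solution 1 lam f x) \<le> C * (1 + norm (lat x)) powr (- ((real CARD('n) - 1) / 2))"
    and cone: "\<And>lam. \<bar>lam - Phi \<kappa>\<bar> \<le> \<eta> \<Longrightarrow> \<exists>C R. \<forall>x t. R \<le> norm (lat x) \<longrightarrow> 0 < t \<longrightarrow>
      (\<forall>j. \<bar>real_of_int (x $ j) + 2 * t * sin (\<kappa> j)\<bar> \<le> \<eta> * t) \<longrightarrow>
      norm (limit_solution 1 lam f x) \<le> C * norm (lat x) powr (- ((real CARD('n) + 1) / 2))"
  shows "fhat f \<kappa> = 0"
proof (rule ccontr)
  assume nz: "fhat f \<kappa> \<noteq> 0"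
  define c where "c = fhat f \<kappa>"
  define Lf where "Lf = (\<Sum>y | f y \<noteq> 0. norm (f y) * (\<Sum>j\<in>UNIV. \<bar>real_of_int (y $ j)\<bar>)) + 1"
  have Lf: "Lf > 0" unfolding Lf_def by (intro add_nonneg_pos sum_nonneg mult_nonneg_nonneg) auto
  define n where "n = real CARD('n)"
  have n: "n \<ge> 1" by (simp add: n_def Suc_leI)
  define gap where "gap = Min (range (\<lambda>j. pi - \<bar>\<kappa> j\<bar>))"
  have gap: "gap > 0" "\<And>j. gap \<le> pi - \<bar>\<kappa> j\<bar>"
    unfolding gap_def using cube by (auto simp: abs_less_iff minus_less_iff)
  \<comment> \<open>In this order: the velocities stay within the cone, the window stays within the open cube, the component
  \<open>j0\<close> of the velocity does not vanish on the window, \<open>Phi\<close> stays within \<open>\<eta>\<close> of \<open>Phi \<kappa>\<close>, and \<open>fhat f\<close> varies by at most half of its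
  value at \<open>\<kappa>\<close>.\<close>
  define r where "r = Min {\<eta> / 4, gap / 2, \<bar>sin (\<kappa> j0)\<bar> / 2, \<eta> / (4 * n), norm c / (2 * Lf)}"
  have r: "r > 0" "r \<le> \<eta> / 4" "r \<le> gap / 2" "r \<le> \<bar>sin (\<kappa> j0)\<bar> / 2" "r \<le> \<eta> / (4 * n)" "r \<le> norm c / (2 * Lf)"
    unfolding r_def using \<eta> gap(1) j0 n nz Lf by (auto simp: c_def)
  have rj: "r < \<bar>sin (\<kappa> j0)\<bar>" using r(1,4) by linarith
  have box: "- pi < \<kappa> j - r" "\<kappa> j + r < pi" for j
    using gap(2)[of j] r(3) gap(1) by (auto simp: abs_if split: if_splits)
  define H where "H k = fhat f k * window \<kappa> r k" for k
  have Hm: "H \<in> borel_measurable tor" unfolding H_def by measurable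
  define M0 where "M0 = (\<Sum>y | f y \<noteq> 0. norm (f y))"
  have fB: "norm (fhat f k) \<le> M0" for k
    unfolding M0_def by (rule norm_fhat_le)
  obtain Bw where Bw: "\<And>j k. \<bar>bump (\<kappa> j) r k\<bar> \<le> Bw j"
  proof -
    have "\<exists>B. \<forall>k. \<bar>bump (\<kappa> j) r k\<bar> \<le> B" for j
      by (rule bump_bounded[of r "\<kappa> j"]) (use r(1) in auto)
    then show thesis using that by metis
  qed
  have wB: "norm (window \<kappa> r k) \<le> (\<Prod>j\<in>UNIV. Bw j)" for k
  proof -
    have "norm (window \<kappa> r k) = (\<Prod>j\<in>UNIV. \<bar>bump (\<kappa> j) r (k j)\<bar>)"
      unfolding window_def norm_of_real abs_prod ..
    also have "\<dots> \<le> (\<Prod>j\<in>UNIV. Bw j)" by (intro prod_mono conjI Bw) auto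
    finally show ?thesis .
  qed
  define M where "M = M0 * (\<Prod>j\<in>UNIV. Bw j)"
  have HB: "norm (H k) \<le> M" for k
    unfolding H_def M_def norm_mult by (intro mult_mono fB wB order_trans[OF norm_ge_zero fB]) auto
  have supp: "\<bar>k j - \<kappa> j\<bar> < r" if "window \<kappa> r k \<noteq> 0" for k j
  proof (rule ccontr)
    assume "\<not> \<bar>k j - \<kappa> j\<bar> < r"
    then have "bump (\<kappa> j) r (k j) = 0" using r(1) by (intro bump_support(1)) auto
    then have "(\<Prod>j\<in>UNIV. bump (\<kappa> j) r (k j)) = 0" by (intro prod_zero) auto
    then show False using that by (simp add: window_def)
  qed
  obtain C where dec: "\<And>u. u \<noteq> 0 \<Longrightarrow> norm (\<integral>k. H k * cis (u * Phi k) \<partial>tor) \<le> C / u\<^sup>2"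
    unfolding H_def using packet_time_decay[where \<kappa>=\<kappa>, OF r(1) box rj, of f] by blast
  have jump: "((\<lambda>\<epsilon>. resolvent_pairing H lam \<epsilon> 0 - resolvent_pairing H lam (- \<epsilon>) 0) \<longlongrightarrow> 0) (at_right 0)" if l: "\<bar>lam - Phi \<kappa>\<bar> \<le> \<eta>" for lam
  proof -
    let ?\<psi> = "limit_solution 1 lam f"
    obtain C0 where C0: "\<And>x. norm (?\<psi> x) \<le> C0 * (1 + norm (lat x)) powr (- ((real CARD('n) - 1) / 2))"
      using all[OF l] by blast
    obtain C1 R where C1: "\<And>x t. R \<le> norm (lat x) \<Longrightarrow> 0 < t \<Longrightarrow>
      (\<And>j. \<bar>real_of_int (x $ j) + 2 * t * sin (\<kappa> j)\<bar> \<le> \<eta> * t) \<Longrightarrow>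
      norm (?\<psi> x) \<le> C1 * norm (lat x) powr (- ((real CARD('n) + 1) / 2))"
      using cone[OF l] by blast
    obtain A T where AT: "T \<ge> 1" "\<And>t N. T \<le> t \<Longrightarrow>
        norm (\<Sum>x\<in>lbox N. ?\<psi> x * cnj (packet \<kappa> r t x)) \<le> A * t powr (- (1 / 4))"
    proof (rule outgoing_pairing_bound[where \<kappa>=\<kappa>, OF r(1) box \<eta> r(2) j0 C0])
      show "norm (?\<psi> x) \<le> C1 * norm (lat x) powr (- ((real CARD('n) + 1) / 2))"
        if "R \<le> norm (lat x)" "0 < t" "\<And>j. \<bar>real_of_int (x $ j) + 2 * t * sin (\<kappa> j)\<bar> \<le> \<eta> * t" for x t
        by (rule C1[OF that])
    qed (rule that)
    obtain K where K: "K \<ge> 0" "\<And>x \<epsilon>. 0 < \<epsilon> \<Longrightarrow>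
        norm (resolvent (Complex lam \<epsilon>) f x - ?\<psi> x) \<le> K * rho x * \<epsilon> powr (1 / 4)"
      using resolvent_cauchy[OF lam[OF l] fin] by metis
    show ?thesis
    proof (rule resolvent_pairing_jump_tendsto_0[OF Hm HB dec])
      show "((\<lambda>t. A * t powr (- (1 / 4))) \<longlongrightarrow> 0) at_top"
        by (intro tendsto_mult_right_zero tendsto_neg_powr filterlim_ident) simp
      fix t assume t: "T \<le> t"
      then have t1: "1 \<le> t" using AT(1) by simp
      obtain B where B: "\<And>N. (\<Sum>x\<in>lbox N. rho x * norm (packet \<kappa> r t x)) \<le> B"
        by (rule packet_weighted_summable[where \<kappa>=\<kappa>, OF r(1) box t1]) blast
      have "norm (resolvent_pairing H lam \<epsilon> t) \<le> A * t powr (- (1 / 4)) + (K * B) * \<epsilon> powr (1 / 4)" if \<epsilon>: "0 < \<epsilon>" for \<epsilon>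
      proof -
        have "norm (cis (t * lam) * resolvent_pairing H lam \<epsilon> t) \<le> A * t powr (- (1 / 4)) + (K * B) * \<epsilon> powr (1 / 4)"
        proof (rule tendsto_upperbound)
          show "(\<lambda>N. norm (\<Sum>x\<in>lbox N. resolvent (Complex lam \<epsilon>) f x * cnj (packet \<kappa> r t x)))
              \<longlonglongrightarrow> norm (cis (t * lam) * resolvent_pairing H lam \<epsilon> t)"
            unfolding H_def by (intro tendsto_norm packet_pairing_limit[OF fin \<epsilon> B])
          show "eventually (\<lambda>N. norm (\<Sum>x\<in>lbox N. resolvent (Complex lam \<epsilon>) f x * cnj (packet \<kappa> r t x))
              \<le> A * t powr (- (1 / 4)) + (K * B) * \<epsilon> powr (1 / 4)) sequentially"
          proof (rule always_eventually, rule allI)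
            fix N
            have "(\<Sum>x\<in>lbox N. resolvent (Complex lam \<epsilon>) f x * cnj (packet \<kappa> r t x)) =
                (\<Sum>x\<in>lbox N. ?\<psi> x * cnj (packet \<kappa> r t x))
                + (\<Sum>x\<in>lbox N. (resolvent (Complex lam \<epsilon>) f x - ?\<psi> x) * cnj (packet \<kappa> r t x))"
              by (simp add: sum.distrib[symmetric] algebra_simps)
            also have "norm \<dots> \<le> A * t powr (- (1 / 4)) + (K * \<epsilon> powr (1 / 4)) * B"
            proof (rule order_trans[OF norm_triangle_ineq add_mono])
              show "norm (\<Sum>x\<in>lbox N. ?\<psi> x * cnj (packet \<kappa> r t x)) \<le> A * t powr (- (1 / 4))" by (rule AT(2)[OF t])
              have "norm (\<Sum>x\<in>lbox N. (resolvent (Complex lam \<epsilon>) f x - ?\<psi> x) * cnj (packet \<kappa> r t x))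
                  \<le> (\<Sum>x\<in>lbox N. (K * rho x * \<epsilon> powr (1 / 4)) * norm (packet \<kappa> r t x))"
                by (rule order_trans[OF norm_sum sum_mono]) (auto simp: norm_mult intro!: mult_right_mono K(2)[OF \<epsilon>])
              also have "\<dots> = (K * \<epsilon> powr (1 / 4)) * (\<Sum>x\<in>lbox N. rho x * norm (packet \<kappa> r t x))"
                by (simp add: sum_distrib_left ac_simps)
              also have "\<dots> \<le> (K * \<epsilon> powr (1 / 4)) * B" using K(1) by (intro mult_left_mono B) auto
              finally show "norm (\<Sum>x\<in>lbox N. (resolvent (Complex lam \<epsilon>) f x - ?\<psi> x) * cnj (packet \<kappa> r t x))
                  \<le> (K * \<epsilon> powr (1 / 4)) * B" .
            qed
            also have "\<dots> = A * t powr (- (1 / 4)) + (K * B) * \<epsilon> powr (1 / 4)" by simp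
            finally show "norm (\<Sum>x\<in>lbox N. resolvent (Complex lam \<epsilon>) f x * cnj (packet \<kappa> r t x))
              \<le> A * t powr (- (1 / 4)) + (K * B) * \<epsilon> powr (1 / 4)" .
          qed
        qed simp
        then show ?thesis by (simp add: norm_mult)
      qed
      then show "\<exists>K. \<forall>\<epsilon>>0. norm (resolvent_pairing H lam \<epsilon> t) \<le> A * t powr (- (1 / 4)) + K * \<epsilon> powr (1 / 4)" by blast
    qed
  qed
  have zero: "(\<integral>k. H k \<partial>tor) = 0"
  proof (rule spectral_uniqueness[OF Hm HB dec])
    show "Phi \<kappa> - \<eta> < Phi \<kappa> + \<eta>" using \<eta> by simp
    fix k :: "'n \<Rightarrow> real" assume "H k \<noteq> 0"
    then have k: "\<bar>k j - \<kappa> j\<bar> < r" for j using supp by (auto simp: H_def)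
    have "\<bar>Phi k - Phi \<kappa>\<bar> \<le> 2 * n * r"
      using Phi_diff_le[of k \<kappa> r] k by (simp add: n_def less_imp_le)
    also have "\<dots> \<le> 2 * n * (\<eta> / (4 * n))" using n r by (intro mult_left_mono) auto
    also have "\<dots> < \<eta>" using n \<eta> by (simp add: field_simps)
    finally show "Phi \<kappa> - \<eta> < Phi k \<and> Phi k < Phi \<kappa> + \<eta>" by (auto simp: abs_less_iff)
  next
    fix lam assume "Phi \<kappa> - \<eta> \<le> lam" "lam \<le> Phi \<kappa> + \<eta>"
    then show "((\<lambda>\<epsilon>. resolvent_pairing H lam \<epsilon> 0 - resolvent_pairing H lam (- \<epsilon>) 0) \<longlongrightarrow> 0) (at_right 0)"
      by (intro jump) (simp add: abs_le_iff)
  qed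
  have wint: "integrable tor (window \<kappa> r)"
    by (rule integrable_tor_bounded[OF _ wB]) measurable
  define Iw where "Iw = (\<Prod>j\<in>UNIV. (\<integral>k. bump (\<kappa> j) r k \<partial>circ))"
  have Iw: "(\<integral>k. window \<kappa> r k \<partial>tor) = complex_of_real Iw"
  proof -
    have ic: "integrable circ (\<lambda>k. complex_of_real (bump (\<kappa> j) r k))" for j
      by (rule integrable_circ_bounded[where B="Bw j"]) (use Bw in auto)
    have "window \<kappa> r k = (\<Prod>j\<in>UNIV. complex_of_real (bump (\<kappa> j) r (k j)))" for k by (simp add: window_def)
    then have "(\<integral>k. window \<kappa> r k \<partial>tor) = (\<Prod>j\<in>UNIV. \<integral>k. complex_of_real (bump (\<kappa> j) r k) \<partial>circ)"
      using integral_tor_prod[of "\<lambda>j k. complex_of_real (bump (\<kappa> j) r k)", OF ic] by simp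
    then show ?thesis by (simp add: Iw_def)
  qed
  have Iw_pos: "Iw > 0"
    unfolding Iw_def
  proof (rule prod_pos)
    fix j
    have i: "integrable circ (bump (\<kappa> j) r)"
      by (rule integrable_circ_bounded[where B="Bw j"]) (use Bw in auto)
    show "0 < (\<integral>k. bump (\<kappa> j) r k \<partial>circ)"
    proof (rule ccontr)
      assume "\<not> 0 < (\<integral>k. bump (\<kappa> j) r k \<partial>circ)"
      moreover have "0 \<le> (\<integral>k. bump (\<kappa> j) r k \<partial>circ)" by (intro integral_nonneg_AE) (simp add: bump_nonneg)
      ultimately have "(\<integral>k. bump (\<kappa> j) r k \<partial>circ) = 0" by simp
      then have ae: "AE k in circ. bump (\<kappa> j) r k = 0"
        using integral_nonneg_eq_0_iff_AE[OF i] by (simp add: bump_nonneg)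
      have "AE k in lborel. k \<in> {- pi..pi} \<longrightarrow> bump (\<kappa> j) r k = 0"
        using ae unfolding circ_def by (subst (asm) AE_uniform_measure) auto
      then have "AE k in lborel. k \<notin> {\<kappa> j - r<..<\<kappa> j + r}"
      proof eventually_elim
        case (elim k)
        then show ?case using bump_pos[of k "\<kappa> j" r] box[of j] by (auto simp: abs_less_iff)
      qed
      then have "emeasure lborel {\<kappa> j - r<..<\<kappa> j + r} = 0"
        by (subst (asm) AE_iff_measurable[of "{\<kappa> j - r<..<\<kappa> j + r}"]) auto
      then show False using r(1) by simp
    qed
  qed
  have "norm (H k - c * window \<kappa> r k) \<le> norm c / 2 * Re (window \<kappa> r k)" for k
  proof (cases "window \<kappa> r k = 0")
    case False
    have w: "window \<kappa> r k = complex_of_real (Re (window \<kappa> r k))" "Re (window \<kappa> r k) \<ge> 0"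
      by (auto simp: window_def intro!: prod_nonneg bump_nonneg simp del: of_real_prod)
    have k: "\<bar>k j - \<kappa> j\<bar> \<le> r" for j using supp[OF False, of j] by simp
    have "fhat f k - c = (\<Sum>y | f y \<noteq> 0. f y * cnj (chi y k - chi y \<kappa>))"
      by (simp add: c_def fhat_def sum_subtractf right_diff_distrib)
    also have "norm \<dots> \<le> (\<Sum>y | f y \<noteq> 0. norm (f y) * (r * (\<Sum>j\<in>UNIV. \<bar>real_of_int (y $ j)\<bar>)))"
      by (rule order_trans[OF norm_sum sum_mono]) (simp only: norm_mult complex_mod_cnj, rule mult_left_mono[OF chi_diff_le[OF k]], simp)
    also have "\<dots> = r * (Lf - 1)" by (simp add: Lf_def sum_distrib_left ac_simps)
    also have "\<dots> \<le> r * Lf" using r(1) by (intro mult_left_mono) auto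
    also have "\<dots> \<le> norm c / (2 * Lf) * Lf" using r(6) Lf by (intro mult_right_mono) auto
    also have "\<dots> = norm c / 2" using Lf by simp
    finally have "norm (fhat f k - c) \<le> norm c / 2" .
    moreover have "norm (window \<kappa> r k) = Re (window \<kappa> r k)"
      by (subst w(1)) (use w(2) in \<open>simp only: norm_of_real abs_of_nonneg\<close>)
    moreover have "H k - c * window \<kappa> r k = (fhat f k - c) * window \<kappa> r k" by (simp add: H_def algebra_simps)
    ultimately show ?thesis using w(2) by (simp only: norm_mult) (rule mult_right_mono)
  qed (simp add: H_def)
  note close = this
  have Hint: "integrable tor H" by (rule integrable_tor_bounded[OF Hm HB])
  have "norm (\<integral>k. H k - c * window \<kappa> r k \<partial>tor) \<le> (\<integral>k. norm (H k - c * window \<kappa> r k) \<partial>tor)" by simp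
  also have "\<dots> \<le> (\<integral>k. norm c / 2 * Re (window \<kappa> r k) \<partial>tor)"
    by (intro integral_mono integrable_norm Bochner_Integration.integrable_diff Hint integrable_mult_right wint integrable_Re close)
  also have "\<dots> = norm c / 2 * Iw"
    using wint by (simp only: integral_mult_right_zero integral_Re Iw) simp
  finally have "norm (\<integral>k. H k - c * window \<kappa> r k \<partial>tor) \<le> norm c / 2 * Iw" .
  moreover have "(\<integral>k. H k - c * window \<kappa> r k \<partial>tor) = - (c * Iw)"
    using Hint wint by (simp add: zero Iw)
  ultimately have "norm c * Iw \<le> norm c / 2 * Iw" using Iw_pos by (simp add: norm_mult)
  then have "norm c * Iw \<le> 0" by linarith
  then show False using Iw_pos nz by (simp add: c_def mult_le_0_iff)
qed

section \<open>Trigonometric polynomials vanishing on an open set\<close>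

text \<open>Differentiating the sum, divided by one of the exponentials, removes that exponential and multiplies
  the other coefficients by nonzero numbers.\<close>

lemma exponentials_independent:
  fixes a :: "'i \<Rightarrow> real" and c :: "'i \<Rightarrow> complex"
  assumes "finite S" "inj_on a S" "\<And>s. \<bar>s\<bar> < 1 \<Longrightarrow> (\<Sum>y\<in>S. c y * cis (s * a y)) = 0"
  shows "\<forall>y\<in>S. c y = 0"
  using assms
proof (induction S arbitrary: c rule: finite_induct)
  case (insert z S)
  have key: "(\<Sum>y\<in>S. (c y * complex_of_real (a y - a z)) * cis (s * a y)) = 0" if s: "\<bar>s\<bar> < 1" for s
  proof -
    define h where "h s = (\<Sum>y\<in>S. c y * cis (s * (a y - a z)))" for s
    have h: "h s = - c z" if "\<bar>s\<bar> < 1" for s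
    proof -
      have "(\<Sum>y\<in>S. c y * cis (s * a y)) = - (c z * cis (s * a z))"
        using insert.prems(2)[OF that] insert.hyps by (simp add: add_eq_0_iff)
      then have "cis (- (s * a z)) * (\<Sum>y\<in>S. c y * cis (s * a y)) = - c z * (cis (- (s * a z)) * cis (s * a z))"
        by simp
      moreover have "cis (- (s * a z)) * (\<Sum>y\<in>S. c y * cis (s * a y)) = h s"
        unfolding h_def sum_distrib_left
        by (rule sum.cong) (auto simp: cis_mult algebra_simps)
      ultimately show ?thesis by (simp add: cis_mult)
    qed
    have d: "(h has_vector_derivative (\<Sum>y\<in>S. c y * ((a y - a z) *\<^sub>R (\<i> * cis (s * (a y - a z)))))) (at s)"
      unfolding h_def[abs_def]
      by (intro has_vector_derivative_sum has_vector_derivative_mult_right)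
         (auto simp: has_vector_derivative_def intro!: derivative_eq_intros)
    have "((\<lambda>_. - c z) has_vector_derivative 0) (at s)" by simp
    then have "(h has_vector_derivative 0) (at s)"
      by (rule has_vector_derivative_transform_within_open[of _ _ _ "{-1<..<1}"]) (use s h in auto)
    then have "(\<Sum>y\<in>S. c y * ((a y - a z) *\<^sub>R (\<i> * cis (s * (a y - a z))))) = 0"
      using d vector_derivative_unique_at by blast
    then have "(- \<i> * cis (s * a z)) * (\<Sum>y\<in>S. c y * ((a y - a z) *\<^sub>R (\<i> * cis (s * (a y - a z))))) = 0" by simp
    also have "(- \<i> * cis (s * a z)) * (\<Sum>y\<in>S. c y * ((a y - a z) *\<^sub>R (\<i> * cis (s * (a y - a z)))))
        = (\<Sum>y\<in>S. (c y * complex_of_real (a y - a z)) * cis (s * a y))"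
      unfolding sum_distrib_left
    proof (rule sum.cong[OF refl])
      fix y
      have "cis (s * a y) = cis (s * a z) * cis (s * (a y - a z))" by (simp add: cis_mult algebra_simps)
      moreover have "- \<i> * E * (C * (D * (\<i> * F))) = C * D * (E * F)" for C D E F :: complex
        by (simp add: algebra_simps)
      ultimately show "- \<i> * cis (s * a z) * (c y * ((a y - a z) *\<^sub>R (\<i> * cis (s * (a y - a z)))))
          = c y * complex_of_real (a y - a z) * cis (s * a y)"
        by (simp only: scaleR_conv_of_real)
    qed
    finally show ?thesis .
  qed
  have "\<forall>y\<in>S. c y * complex_of_real (a y - a z) = 0"
    by (rule insert.IH) (use insert.prems(1) key in auto)
  moreover have "a y \<noteq> a z" if "y \<in> S" for y
    using insert.prems(1) insert.hyps that by (auto simp: inj_on_def)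
  ultimately have "\<forall>y\<in>S. c y = 0" by auto
  moreover from this have "c z = 0" using insert.prems(2)[of 0] insert.hyps by simp
  ultimately show ?case by simp
qed simp

text \<open>On a line through \<open>\<kappa>\<close> in a direction \<open>v\<close> that separates the finitely many points of the support,
  \<open>fhat f\<close> is an exponential sum in one variable with distinct frequencies. Such \<open>v\<close> exist arbitrarily
  close to \<open>0\<close>, because finitely many hyperplanes cannot cover a ball.\<close>

lemma fhat_injective:
  fixes f :: "int ^ 'n::finite \<Rightarrow> complex"
  assumes fin: "finite {y. f y \<noteq> 0}" and \<delta>: "0 < \<delta>"
    and zero: "\<And>k. (\<And>j. \<bar>k j - \<kappa> j\<bar> < \<delta>) \<Longrightarrow> fhat f k = 0"
  shows "f = (\<lambda>_. 0)"
proof -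
  let ?S = "{y. f y \<noteq> 0}"
  let ?bad = "\<Union>(y, y')\<in>{(y, y'). y \<in> ?S \<and> y' \<in> ?S \<and> y \<noteq> y'}. {v :: real ^ 'n. (lat y - lat y') \<bullet> v = 0}"
  have "negligible ?bad"
  proof (rule negligible_Union[OF _ ], goal_cases)
    case 1
    have "finite (?S \<times> ?S)" using fin by simp
    then have "finite {(y, y'). y \<in> ?S \<and> y' \<in> ?S \<and> y \<noteq> y'}" by (rule finite_subset[rotated]) auto
    then show ?case by simp
  next
    case (2 T)
    then obtain y y' where T: "T = {v :: real ^ 'n. (lat y - lat y') \<bullet> v = 0}" "y \<noteq> y'" by auto
    then have "lat y - lat y' \<noteq> 0" by (auto simp: lat_def vec_eq_iff)
    then show ?case unfolding T(1) by (intro negligible_hyperplane) simp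
  qed
  moreover have "\<not> negligible (ball (0 :: real ^ 'n) \<delta>)"
    using \<delta> by (intro open_not_negligible) auto
  ultimately obtain v where v: "v \<in> ball 0 \<delta>" "v \<notin> ?bad"
    using negligible_subset by blast
  define a where "a y = - (lat y \<bullet> v)" for y :: "int ^ 'n"
  have inj: "inj_on a ?S"
  proof (rule inj_onI, rule ccontr)
    fix y y' assume "y \<in> ?S" "y' \<in> ?S" "a y = a y'" "y \<noteq> y'"
    then have "v \<in> ?bad" by (auto simp: a_def inner_diff_left)
    then show False using v(2) by blast
  qed
  have "(\<Sum>y\<in>?S. (f y * cnj (chi y \<kappa>)) * cis (s * a y)) = 0" if s: "\<bar>s\<bar> < 1" for s
  proof -
    define k where "k j = \<kappa> j + s * v $ j" for j
    have "\<bar>k j - \<kappa> j\<bar> < \<delta>" for j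
    proof -
      have "\<bar>v $ j\<bar> < \<delta>" using component_le_norm_cart[of v j] v(1) by simp
      moreover have "\<bar>s\<bar> * \<bar>v $ j\<bar> \<le> 1 * \<bar>v $ j\<bar>" using s by (intro mult_right_mono) auto
      ultimately show ?thesis by (simp add: k_def abs_mult)
    qed
    then have "fhat f k = 0" by (rule zero)
    moreover have "cnj (chi y k) = cnj (chi y \<kappa>) * cis (s * a y)" for y
    proof -
      have 1: "chi y k = cis (\<Sum>j\<in>UNIV. real_of_int (y $ j) * k j)" for k unfolding chi_def by (rule prod_cis)
      have e: "(\<Sum>j\<in>UNIV. real_of_int (y $ j) * k j) = (\<Sum>j\<in>UNIV. real_of_int (y $ j) * \<kappa> j) - s * a y"
        by (simp add: k_def a_def inner_vec_def lat_def sum.distrib distrib_left sum_distrib_left ac_simps)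
      show ?thesis unfolding 1 e by (simp add: cis_cnj cis_mult)
    qed
    ultimately show ?thesis by (simp add: fhat_def mult.assoc)
  qed
  from exponentials_independent[OF fin inj this] have "\<forall>y\<in>?S. f y * cnj (chi y \<kappa>) = 0" by blast
  moreover have "chi y \<kappa> \<noteq> 0" for y using norm_chi[of y \<kappa>] by (metis norm_zero zero_neq_one)
  ultimately show ?thesis by (auto simp: fun_eq_iff)
qed

section \<open>Directions of propagation and far-field decay\<close>

text \<open>Every direction \<open>\<omega>\<close> is the direction of \<open>\<nabla>Phi k = (- 2 sin (k j))\<^sub>j\<close> at some point of the level
  surface. For \<open>\<lambda> \<ge> 0\<close>, let \<open>m\<close> maximise \<open>|\<omega>\<^sub>m|\<close>. Let \<open>k\<^sub>m = \<mp>\<theta>\<close> move through \<open>0 \<le> \<theta> \<le> \<pi>\<close>, and let the other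
  coordinates follow in \<open>[-\<pi>/2, \<pi>/2]\<close> as the direction prescribes. Then \<open>Phi\<close> moves continuously from \<open>2d\<close> to
  \<open>2d - 4\<close>. Negative \<open>\<lambda>\<close> are reduced to positive ones by \<open>k \<mapsto> \<plusminus>\<pi> - k\<close>, which changes the sign of the
  cosines and keeps the sines.\<close>

lemma velocity_surjective:
  fixes \<omega> :: "real ^ 'n::finite"
  assumes "norm \<omega> = 1" "lam \<in> Lambda TYPE('n)"
  obtains k :: "'n \<Rightarrow> real" and c where "\<And>j. \<bar>k j\<bar> \<le> pi" "Phi k = lam" "c > 0" "\<And>j. - 2 * sin (k j) = c * \<omega> $ j"
proof -
  let ?d = "real CARD('n)"
  have pos: "\<exists>k c. (\<forall>j. \<bar>k j\<bar> \<le> pi) \<and> Phi k = l \<and> c > 0 \<and> (\<forall>j. - 2 * sin (k j) = c * \<omega> $ j)"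
    if l: "2 * ?d - 4 < l" "l < 2 * ?d" for l
  proof -
    have "\<exists>m. \<forall>j. \<bar>\<omega> $ j\<bar> \<le> \<bar>\<omega> $ m\<bar>"
    proof -
      have "Max (range (\<lambda>j. \<bar>\<omega> $ j\<bar>)) \<in> range (\<lambda>j. \<bar>\<omega> $ j\<bar>)" by (rule Max_in) auto
      then obtain m where max: "Max (range (\<lambda>j. \<bar>\<omega> $ j\<bar>)) = \<bar>\<omega> $ m\<bar>" by (rule imageE)
      have "\<forall>j. \<bar>\<omega> $ j\<bar> \<le> \<bar>\<omega> $ m\<bar>" unfolding max[symmetric] by (auto intro: Max_ge)
      then show ?thesis by blast
    qed
    then obtain m where m: "\<And>j. \<bar>\<omega> $ j\<bar> \<le> \<bar>\<omega> $ m\<bar>" by blast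
    have "\<omega> \<noteq> 0" using assms(1) by auto
    then obtain i where "\<omega> $ i \<noteq> 0" by (auto simp: vec_eq_iff)
    then have m0: "\<bar>\<omega> $ m\<bar> > 0" using m[of i] by linarith
    define q where "q j = \<omega> $ j / \<bar>\<omega> $ m\<bar>" for j
    have q: "\<bar>q j\<bar> \<le> 1" for j using m[of j] m0 by (simp add: q_def abs_divide)
    define k where "k \<theta> j = (if j = m then - sgn (\<omega> $ m) * \<theta> else - arcsin (sin \<theta> * q j))" for \<theta> j
    have sq: "\<bar>sin \<theta> * q j\<bar> \<le> 1" for \<theta> j
      unfolding abs_mult using q[of j] mult_mono[of "\<bar>sin \<theta>\<bar>" 1 "\<bar>q j\<bar>" 1] by simp
    have sink: "sin (k \<theta> j) = - sin \<theta> * q j" for \<theta> j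
    proof (cases "j = m")
      case True
      then show ?thesis using m0 by (auto simp: k_def q_def sgn_if)
    next
      case False
      then show ?thesis using sq[of \<theta> j] by (simp add: k_def abs_le_iff)
    qed
    have cosm: "cos (k \<theta> m) = cos \<theta>" for \<theta> using m0 by (auto simp: k_def sgn_if)
    define g where "g \<theta> = Phi (k \<theta>)" for \<theta>
    have g_eq: "g \<theta> = 2 * cos \<theta> + 2 * (\<Sum>j\<in>UNIV - {m}. cos (arcsin (sin \<theta> * q j)))" for \<theta>
    proof -
      have "(\<Sum>j\<in>UNIV. cos (k \<theta> j)) = cos (k \<theta> m) + (\<Sum>j\<in>UNIV - {m}. cos (k \<theta> j))" by (simp add: sum.remove)
      also have "(\<Sum>j\<in>UNIV - {m}. cos (k \<theta> j)) = (\<Sum>j\<in>UNIV - {m}. cos (arcsin (sin \<theta> * q j)))"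
        by (rule sum.cong) (auto simp: k_def)
      finally show ?thesis by (simp add: g_def Phi_def cosm)
    qed
    have cont: "continuous_on {0..pi} g"
      unfolding g_eq using sq by (intro continuous_intros) (auto simp: abs_le_iff minus_le_iff)
    have card: "real (card (UNIV - {m} :: 'n set)) = ?d - 1" by (simp add: card_Diff_singleton of_nat_diff Suc_leI)
    have g0: "g 0 = 2 * ?d" "g pi = 2 * ?d - 4" using card by (simp_all add: g_eq algebra_simps)
    obtain \<theta> where th: "0 \<le> \<theta>" "\<theta> \<le> pi" "g \<theta> = l"
      using IVT2'[of g pi l 0] l g0 cont by auto
    have "\<theta> \<noteq> 0" "\<theta> \<noteq> pi" using th(3) g0 l by auto
    then have s: "sin \<theta> > 0" using th by (intro sin_gt_zero) auto
    have "\<bar>k \<theta> j\<bar> \<le> pi" for j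
    proof (cases "j = m")
      case True
      then show ?thesis using th m0 by (auto simp: k_def sgn_if abs_mult)
    next
      case False
      then show ?thesis using arcsin_bounded[of "sin \<theta> * q j"] sq[of \<theta> j] pi_ge_zero
        by (auto simp: k_def abs_le_iff minus_le_iff)
    qed
    moreover have "- 2 * sin (k \<theta> j) = (2 * sin \<theta> / \<bar>\<omega> $ m\<bar>) * \<omega> $ j" for j
      unfolding sink by (simp add: q_def)
    ultimately show ?thesis
      using th(3) s m0 by (intro exI[of _ "k \<theta>"] exI[of _ "2 * sin \<theta> / \<bar>\<omega> $ m\<bar>"]) (auto simp: g_def)
  qed
  have lam: "2 * ?d - 4 < \<bar>lam\<bar>" "\<bar>lam\<bar> < 2 * ?d" using assms(2) by (auto simp: Lambda_def)
  then obtain k c where k: "\<And>j. \<bar>k j\<bar> \<le> pi" "Phi k = \<bar>lam\<bar>" "c > 0" "\<And>j. - 2 * sin (k j) = c * \<omega> $ j"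
    using pos[of "\<bar>lam\<bar>"] by blast
  show thesis
  proof (cases "lam \<ge> 0")
    case True
    then show ?thesis using k by (intro that[of k c]) auto
  next
    case False
    define k' where "k' j = (if k j \<ge> 0 then pi - k j else - pi - k j)" for j
    have "sin (k' j) = sin (k j)" for j
      by (auto simp: k'_def sin_diff)
    moreover have "cos (k' j) = - cos (k j)" for j
      by (auto simp: k'_def cos_diff)
    then have "Phi k' = - Phi k" by (simp add: Phi_def sum_negf)
    moreover have "\<bar>k' j\<bar> \<le> pi" for j using k(1)[of j] by (auto simp: k'_def abs_if split: if_splits)
    ultimately show ?thesis using k False by (intro that[of k' c]) auto
  qed
qed

lemma direction_open:
  fixes N :: "((real ^ 'n::finite) \<times> real) set" and v\<^sub>0 :: "real ^ 'n"
  assumes N: "openin (top_of_set (sphere 0 1 \<times> Lambda TYPE('n))) N"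
    and v0: "v\<^sub>0 \<noteq> 0" "(v\<^sub>0 /\<^sub>R norm v\<^sub>0, lam\<^sub>0) \<in> N"
  obtains \<eta> where "\<eta> > 0" "\<And>v lam. (\<And>j. \<bar>v $ j - v\<^sub>0 $ j\<bar> \<le> \<eta>) \<Longrightarrow> \<bar>lam - lam\<^sub>0\<bar> \<le> \<eta> \<Longrightarrow>
    v \<noteq> 0 \<and> (v /\<^sub>R norm v, lam) \<in> N"
proof -
  obtain T where T: "open T" "N = (sphere 0 1 \<times> Lambda TYPE('n)) \<inter> T"
    using N by (auto simp: openin_open)
  let ?g = "\<lambda>p :: (real ^ 'n) \<times> real. (fst p /\<^sub>R norm (fst p), snd p)"
  have cont: "isCont ?g (v\<^sub>0, lam\<^sub>0)"
    using v0(1) by (intro continuous_intros) auto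
  have "open {l. 2 * real CARD('n) - 4 < \<bar>l\<bar> \<and> \<bar>l\<bar> < 2 * real CARD('n)}"
    by (intro open_Collect_conj open_Collect_less continuous_intros)
  then have Lo: "open (Lambda TYPE('n))" by (simp add: Lambda_def)
  have "open (T \<inter> (UNIV \<times> Lambda TYPE('n)))" by (intro open_Int T open_Times open_UNIV Lo)
  moreover have "?g (v\<^sub>0, lam\<^sub>0) \<in> T \<inter> (UNIV \<times> Lambda TYPE('n))" using v0(2) T(2) by auto
  ultimately have "eventually (\<lambda>p. ?g p \<in> T \<inter> (UNIV \<times> Lambda TYPE('n))) (nhds (v\<^sub>0, lam\<^sub>0))"
    by (rule topological_tendstoD[OF tendsto_at_iff_tendsto_nhds[THEN iffD1, OF cont[unfolded isCont_def]]])
  moreover have "eventually (\<lambda>p. fst p \<noteq> 0) (nhds (v\<^sub>0, lam\<^sub>0))"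
  proof -
    have "open {p :: (real ^ 'n) \<times> real. fst p \<noteq> 0}" by (intro open_Collect_neq continuous_intros)
    then show ?thesis using v0(1) by (auto simp: eventually_nhds)
  qed
  ultimately have "eventually (\<lambda>p. fst p \<noteq> 0 \<and> ?g p \<in> N) (nhds (v\<^sub>0, lam\<^sub>0))"
  proof eventually_elim
    case (elim p)
    then show ?case by (auto simp: T(2))
  qed
  then obtain \<delta> where \<delta>: "\<delta> > 0" "\<And>p. dist p (v\<^sub>0, lam\<^sub>0) < \<delta> \<Longrightarrow> fst p \<noteq> 0 \<and> ?g p \<in> N"
    unfolding eventually_nhds_metric by blast
  define n where "n = real CARD('n)"
  have n: "n \<ge> 0" by (simp add: n_def)
  define \<eta> where "\<eta> = \<delta> / (n + 2)"
  have \<eta>: "\<eta> > 0" using \<delta> n by (simp add: \<eta>_def)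
  show thesis
  proof (rule that[OF \<eta>])
    fix v :: "real ^ 'n" and lam assume *: "\<And>j. \<bar>v $ j - v\<^sub>0 $ j\<bar> \<le> \<eta>" "\<bar>lam - lam\<^sub>0\<bar> \<le> \<eta>"
    have "dist v v\<^sub>0 \<le> (\<Sum>j\<in>UNIV. \<bar>(v - v\<^sub>0) $ j\<bar>)" unfolding dist_norm by (rule norm_le_l1_cart)
    also have "\<dots> \<le> (\<Sum>j\<in>(UNIV :: 'n set). \<eta>)" using * by (intro sum_mono) simp
    finally have "dist v v\<^sub>0 \<le> n * \<eta>" by (simp add: n_def)
    have "dist (v, lam) (v\<^sub>0, lam\<^sub>0) \<le> dist v v\<^sub>0 + dist lam lam\<^sub>0"
      unfolding dist_Pair_Pair using sqrt_sum_squares_le_sum by auto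
    also have "\<dots> \<le> n * \<eta> + \<eta>" using \<open>dist v v\<^sub>0 \<le> n * \<eta>\<close> *(2) by (simp add: dist_real_def)
    also have "\<dots> < (n + 2) * \<eta>" using \<eta> by (simp add: algebra_simps)
    also have "\<dots> = \<delta>" using n by (simp add: \<eta>_def)
    finally show "v \<noteq> 0 \<and> (v /\<^sub>R norm v, lam) \<in> N" using \<delta>(2)[of "(v, lam)"] by simp
  qed
qed

text \<open>A bounded amplitude, here by continuity on the compact sphere, turns the asymptotic formula into decay of order
  \<open>|x|\<^bsup>-(d-1)/2\<^esup>\<close> in all directions; the finitely many small \<open>x\<close> only affect the constant.\<close>

lemma far_field_bounds:
  fixes f :: "int ^ 'n::finite \<Rightarrow> complex"
  assumes far: "far_field_amplitude s f a" and lam: "lam \<in> Lambda TYPE('n)"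
  obtains C R where "C \<ge> 0" "R \<ge> 1"
    "\<And>x. R \<le> norm (lat x) \<Longrightarrow> norm (limit_solution s lam f x -
        exp (\<i> * complex_of_real (s * mu (lat x /\<^sub>R norm (lat x)) lam * norm (lat x))) /
        complex_of_real (norm (lat x) powr ((real CARD('n) - 1) / 2)) * a (lat x /\<^sub>R norm (lat x)) lam)
      \<le> C * norm (lat x) powr (- ((real CARD('n) + 1) / 2))"
    "\<And>x. norm (limit_solution s lam f x) \<le> C * (1 + norm (lat x)) powr (- ((real CARD('n) - 1) / 2))"
proof -
  let ?d = "real CARD('n)"
  let ?p = "\<lambda>x. exp (\<i> * complex_of_real (s * mu (lat x /\<^sub>R norm (lat x)) lam * norm (lat x))) /
        complex_of_real (norm (lat x) powr ((?d - 1) / 2)) * a (lat x /\<^sub>R norm (lat x)) lam"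
  let ?\<psi> = "limit_solution s lam f"
  have "continuous_on (sphere 0 1) (\<lambda>\<omega>. a \<omega> lam)"
    and O: "(\<lambda>x. norm (?\<psi> x - ?p x)) \<in> O[filtercomap lat at_infinity](\<lambda>x. norm (lat x) powr (- (?d + 1) / 2))"
    using far lam by (auto simp: far_field_amplitude_def Let_def)
  then have "bounded ((\<lambda>\<omega>. a \<omega> lam) ` sphere 0 1)"
    by (intro compact_imp_bounded compact_continuous_image) auto
  then obtain A where "\<forall>z\<in>(\<lambda>\<omega>. a \<omega> lam) ` sphere 0 1. norm z \<le> A" unfolding bounded_iff by blast
  then have A: "norm (a \<omega> lam) \<le> A" if "norm \<omega> = 1" for \<omega> using that by simp
  obtain c where c: "c > 0" "eventually (\<lambda>x. norm (norm (?\<psi> x - ?p x)) \<le> c * norm (norm (lat x) powr (- (?d + 1) / 2))) (filtercomap lat at_infinity)"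
    using O by (rule landau_o.bigE)
  then obtain R0 where R0: "\<And>x. R0 \<le> norm (lat x) \<Longrightarrow> norm (?\<psi> x - ?p x) \<le> c * norm (lat x) powr (- (?d + 1) / 2)"
    by (auto simp: eventually_filtercomap eventually_at_infinity)
  define R where "R = max 1 R0"
  have R: "R \<ge> 1" by (simp add: R_def)
  have e: "- (?d + 1) / 2 = - ((?d + 1) / 2)" by (rule minus_divide_left[symmetric])
  have near: "norm (?\<psi> x - ?p x) \<le> c * norm (lat x) powr (- ((?d + 1) / 2))" if "R \<le> norm (lat x)" for x
    using R0[of x] that unfolding e by (simp add: R_def)
  have d1: "(?d - 1) / 2 \<ge> 0" by (simp add: Suc_leI)
  have far1: "norm (?\<psi> x) \<le> (c + A) * 2 powr ((?d - 1) / 2) * (1 + norm (lat x)) powr (- ((?d - 1) / 2))"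
    if x: "R \<le> norm (lat x)" for x
  proof -
    let ?r = "norm (lat x)"
    have r: "1 \<le> ?r" using x R by linarith
    then have "lat x \<noteq> 0" by auto
    then have "norm (lat x /\<^sub>R ?r) = 1" by simp
    then have Ax: "norm (a (lat x /\<^sub>R ?r) lam) \<le> A" by (rule A)
    then have A0: "A \<ge> 0" using norm_ge_zero order_trans by blast
    have "norm (?p x) = ?r powr (- ((?d - 1) / 2)) * norm (a (lat x /\<^sub>R ?r) lam)"
    proof -
      have "norm (exp (\<i> * complex_of_real u) / complex_of_real (r powr q) * z) = r powr (- q) * norm z" for u r q z
        unfolding norm_mult norm_divide norm_exp_i_times norm_of_real powr_minus by (simp add: inverse_eq_divide)
      then show ?thesis .
    qed
    also have "\<dots> \<le> ?r powr (- ((?d - 1) / 2)) * A" by (intro mult_left_mono Ax) simp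
    finally have p: "norm (?p x) \<le> A * ?r powr (- ((?d - 1) / 2))" by (simp add: mult.commute)
    have "norm (?\<psi> x) \<le> norm (?\<psi> x - ?p x) + norm (?p x)"
      using norm_triangle_ineq[of "?\<psi> x - ?p x" "?p x"] by simp
    also have "\<dots> \<le> c * ?r powr (- ((?d + 1) / 2)) + A * ?r powr (- ((?d - 1) / 2))" by (intro add_mono near x p)
    also have "\<dots> \<le> c * ?r powr (- ((?d - 1) / 2)) + A * ?r powr (- ((?d - 1) / 2))"
      using c(1) r by (intro add_mono mult_left_mono powr_mono order_refl) auto
    also have "\<dots> = (c + A) * ?r powr (- ((?d - 1) / 2))" by (simp add: algebra_simps)
    also have "\<dots> \<le> (c + A) * ((1 + ?r) / 2) powr (- ((?d - 1) / 2))"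
      using c(1) A0 r d1 by (intro mult_left_mono powr_mono2') auto
    also have "((1 + ?r) / 2) powr (- ((?d - 1) / 2)) = 2 powr ((?d - 1) / 2) * (1 + ?r) powr (- ((?d - 1) / 2))"
    proof -
      have "((1 + ?r) * inverse 2) powr (- ((?d - 1) / 2)) = (1 + ?r) powr (- ((?d - 1) / 2)) * (inverse 2) powr (- ((?d - 1) / 2))"
        by (rule powr_mult)
      moreover have "(inverse 2 :: real) powr (- ((?d - 1) / 2)) = 2 powr ((?d - 1) / 2)"
        by (simp only: powr_minus inverse_powr inverse_inverse_eq)
      ultimately show ?thesis by (simp only: divide_inverse mult.commute)
    qed
    finally show ?thesis by (simp only: mult.assoc)
  qed
  have "finite {x :: int ^ 'n. norm (lat x) < R}"
  proof (rule finite_subset)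
    show "{x :: int ^ 'n. norm (lat x) < R} \<subseteq> lbox (nat \<lceil>R\<rceil>)"
    proof
      fix x :: "int ^ 'n" assume "x \<in> {x. norm (lat x) < R}"
      then have "\<bar>real_of_int (x $ j)\<bar> - 1 < R" for j using norm_lat_bounds(1)[of x j] by simp
      then have "\<bar>x $ j\<bar> \<le> \<lceil>R\<rceil>" for j by (simp add: le_ceiling_iff)
      then show "x \<in> lbox (nat \<lceil>R\<rceil>)" using R by (simp add: lbox_def)
    qed
  qed simp
  then have "finite ((\<lambda>x. norm (?\<psi> x)) ` {x. norm (lat x) < R})" by simp
  then obtain D where D: "\<And>x. norm (lat x) < R \<Longrightarrow> norm (?\<psi> x) \<le> D"
    using finite_imp_bounded[of "(\<lambda>x. norm (?\<psi> x)) ` {x. norm (lat x) < R}"] unfolding bounded_iff by auto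
  have D': "norm (?\<psi> x) \<le> \<bar>D\<bar> * (1 + R) powr ((?d - 1) / 2) * (1 + norm (lat x)) powr (- ((?d - 1) / 2))"
    if x: "norm (lat x) < R" for x
  proof -
    have "1 = (1 + R) powr ((?d - 1) / 2) * (1 + R) powr (- ((?d - 1) / 2))"
      using R by (simp add: powr_add[symmetric])
    also have "\<dots> \<le> (1 + R) powr ((?d - 1) / 2) * (1 + norm (lat x)) powr (- ((?d - 1) / 2))"
      using x d1 by (intro mult_left_mono powr_mono2') (auto simp: add_pos_nonneg)
    finally have "\<bar>D\<bar> * 1 \<le> \<bar>D\<bar> * ((1 + R) powr ((?d - 1) / 2) * (1 + norm (lat x)) powr (- ((?d - 1) / 2)))"
      by (intro mult_left_mono) auto
    then show ?thesis using D[OF x] by (simp add: mult.assoc)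
  qed
  define B1 where "B1 = \<bar>(c + A) * 2 powr ((?d - 1) / 2)\<bar>"
  define B2 where "B2 = \<bar>D\<bar> * (1 + R) powr ((?d - 1) / 2)"
  have B: "B1 \<ge> 0" "B2 \<ge> 0" by (simp_all add: B1_def B2_def)
  show thesis
  proof (rule that[of "c + B1 + B2" R])
    show "0 \<le> c + B1 + B2" using c(1) B by simp
    show "1 \<le> R" by (rule R)
    fix x
    show "norm (?\<psi> x - ?p x) \<le> (c + B1 + B2) * norm (lat x) powr (- ((?d + 1) / 2))" if "R \<le> norm (lat x)"
      by (rule order_trans[OF near[OF that] mult_right_mono]) (use B in auto)
    show "norm (?\<psi> x) \<le> (c + B1 + B2) * (1 + norm (lat x)) powr (- ((?d - 1) / 2))"
    proof (cases "R \<le> norm (lat x)")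
      case True
      have "(c + A) * 2 powr ((?d - 1) / 2) \<le> c + B1 + B2" using c(1) B(2) unfolding B1_def by linarith
      then show ?thesis by (rule order_trans[OF far1[OF True] mult_right_mono]) simp
    next
      case False
      have "\<bar>D\<bar> * (1 + R) powr ((?d - 1) / 2) \<le> c + B1 + B2" using c(1) B(1) unfolding B2_def by linarith
      then show ?thesis using False by (intro order_trans[OF D' mult_right_mono]) auto
    qed
  qed
qed

section \<open>Uniqueness\<close>

lemma limit_solution_cnj:
  fixes f :: "int ^ 'n::finite \<Rightarrow> complex"
  assumes lam: "lam \<in> Lambda TYPE('n)" and fin: "finite {y. f y \<noteq> 0}"
  shows "limit_solution (- 1) lam f x = cnj (limit_solution 1 lam (\<lambda>y. cnj (f y)) x)"
proof -
  have fin': "finite {y. cnj (f y) \<noteq> 0}" using fin by simp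
  have "((\<lambda>\<epsilon>. resolvent (Complex lam \<epsilon>) (\<lambda>y. cnj (f y)) x)
      \<longlongrightarrow> limit_solution 1 lam (\<lambda>y. cnj (f y)) x) (at_right 0)"
    by (rule resolvent_cauchy[OF lam fin'])
  then have "((\<lambda>\<epsilon>. cnj (resolvent (Complex lam \<epsilon>) (\<lambda>y. cnj (f y)) x))
      \<longlongrightarrow> cnj (limit_solution 1 lam (\<lambda>y. cnj (f y)) x)) (at_right 0)"
    by (rule tendsto_cnj)
  moreover have "eventually (\<lambda>\<epsilon>. cnj (resolvent (Complex lam \<epsilon>) (\<lambda>y. cnj (f y)) x)
      = resolvent (Complex lam (- 1 * \<epsilon>)) f x) (at_right 0)"
    unfolding eventually_at_right_field
  proof (intro exI[of _ 1] conjI allI impI)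
    fix \<epsilon> :: real assume "0 < \<epsilon>" "\<epsilon> < 1"
    then have "Im (Complex lam (- \<epsilon>)) \<noteq> 0" by simp
    from resolvent_cnj[OF this fin, of x]
    show "cnj (resolvent (Complex lam \<epsilon>) (\<lambda>y. cnj (f y)) x) = resolvent (Complex lam (- 1 * \<epsilon>)) f x"
      by (simp add: complex_cnj)
  qed simp
  ultimately have "((\<lambda>\<epsilon>. resolvent (Complex lam (- 1 * \<epsilon>)) f x)
      \<longlongrightarrow> cnj (limit_solution 1 lam (\<lambda>y. cnj (f y)) x)) (at_right 0)"
    by (rule Lim_transform_eventually)
  then show ?thesis unfolding limit_solution_def[of "- 1"] by (intro tendsto_Lim) simp_all
qed

text \<open>Conjugation exchanges the boundary values from above and from below the real axis, and with them the
  outgoing and incoming waves.\<close>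

lemma far_field_amplitude_cnj:
  fixes f :: "int ^ 'n::finite \<Rightarrow> complex"
  assumes fin: "finite {y. f y \<noteq> 0}" and far: "far_field_amplitude (- 1) f a"
  shows "far_field_amplitude 1 (\<lambda>y. cnj (f y)) (\<lambda>\<omega> lam. cnj (a \<omega> lam))"
  unfolding far_field_amplitude_def
proof (intro ballI conjI)
  fix lam assume lam: "lam \<in> Lambda TYPE('n)"
  then have "continuous_on (sphere 0 1) (\<lambda>\<omega>. a \<omega> lam)"
    and O: "(\<lambda>x. norm (limit_solution (- 1) lam f x -
        (let r = norm (lat x); \<omega> = lat x /\<^sub>R r in
          exp (\<i> * complex_of_real (- 1 * mu \<omega> lam * r)) /
            complex_of_real (r powr ((real CARD('n) - 1) / 2)) * a \<omega> lam)))
      \<in> O[filtercomap lat at_infinity](\<lambda>x. norm (lat x) powr (- (real CARD('n) + 1) / 2))"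
    using far by (auto simp: far_field_amplitude_def)
  then show "continuous_on (sphere 0 1) (\<lambda>\<omega>. cnj (a \<omega> lam))"
    by (intro continuous_on_cnj)
  have "norm (limit_solution 1 lam (\<lambda>y. cnj (f y)) x -
        (let r = norm (lat x); \<omega> = lat x /\<^sub>R r in
          exp (\<i> * complex_of_real (1 * mu \<omega> lam * r)) /
            complex_of_real (r powr ((real CARD('n) - 1) / 2)) * cnj (a \<omega> lam)))
      = norm (limit_solution (- 1) lam f x -
        (let r = norm (lat x); \<omega> = lat x /\<^sub>R r in
          exp (\<i> * complex_of_real (- 1 * mu \<omega> lam * r)) /
            complex_of_real (r powr ((real CARD('n) - 1) / 2)) * a \<omega> lam))" for x
    by (subst complex_mod_cnj[symmetric])
       (simp add: Let_def limit_solution_cnj[OF lam fin] exp_cnj mult.assoc)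
  then show "(\<lambda>x. norm (limit_solution 1 lam (\<lambda>y. cnj (f y)) x -
        (let r = norm (lat x); \<omega> = lat x /\<^sub>R r in
          exp (\<i> * complex_of_real (1 * mu \<omega> lam * r)) /
            complex_of_real (r powr ((real CARD('n) - 1) / 2)) * cnj (a \<omega> lam))))
      \<in> O[filtercomap lat at_infinity](\<lambda>x. norm (lat x) powr (- (real CARD('n) + 1) / 2))"
    using O by (simp only:)
qed

text \<open>For the difference \<open>f\<close> of the two sources the leading terms of the solutions cancel in the directions
  covered by \<open>N\<close>. A point \<open>k\<^sub>0\<close> of the level surface with direction \<open>\<omega>\<^sub>0\<close> has a neighbourhood that consists of
  points with direction and level in \<open>N\<close>, and there \<open>fhat_vanishes\<close> applies.\<close>

lemma outgoing_amplitude_injective: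
  fixes N :: "((real ^ 'n::finite) \<times> real) set"
  assumes N: "openin (top_of_set (sphere 0 1 \<times> Lambda TYPE('n))) N" and N0: "(\<omega>\<^sub>0, lam\<^sub>0) \<in> N"
    and fin: "finite {x. f\<^sub>1 x \<noteq> 0}" "finite {x. f\<^sub>2 x \<noteq> 0}"
    and far: "far_field_amplitude 1 f\<^sub>1 a\<^sub>1" "far_field_amplitude 1 f\<^sub>2 a\<^sub>2"
    and eq: "\<And>\<omega> lam. (\<omega>, lam) \<in> N \<Longrightarrow> a\<^sub>1 \<omega> lam = a\<^sub>2 \<omega> lam"
  shows "f\<^sub>1 = f\<^sub>2"
proof -
  let ?d = "real CARD('n)"
  define f where "f y = f\<^sub>1 y - f\<^sub>2 y" for y
  have finf: "finite {y. f y \<noteq> 0}"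
    by (rule finite_subset[of _ "{x. f\<^sub>1 x \<noteq> 0} \<union> {x. f\<^sub>2 x \<noteq> 0}"]) (use fin in \<open>auto simp: f_def\<close>)
  have NL: "norm \<omega> = 1 \<and> lam \<in> Lambda TYPE('n)" if "(\<omega>, lam) \<in> N" for \<omega> lam
    using openin_imp_subset[OF N] that by auto
  have bounds: "\<exists>C R. R \<ge> 1 \<and> (\<forall>x. norm (limit_solution 1 lam f x) \<le> C * (1 + norm (lat x)) powr (- ((?d - 1) / 2)))
      \<and> (\<forall>x. R \<le> norm (lat x) \<longrightarrow> (lat x /\<^sub>R norm (lat x), lam) \<in> N \<longrightarrow>
          norm (limit_solution 1 lam f x) \<le> C * norm (lat x) powr (- ((?d + 1) / 2)))"
    if lam: "lam \<in> Lambda TYPE('n)" for lam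
  proof -
    let ?p = "\<lambda>x. exp (\<i> * complex_of_real (1 * mu (lat x /\<^sub>R norm (lat x)) lam * norm (lat x))) /
        complex_of_real (norm (lat x) powr ((?d - 1) / 2))"
    let ?\<psi>1 = "limit_solution 1 lam f\<^sub>1" and ?\<psi>2 = "limit_solution 1 lam f\<^sub>2"
    obtain C1 R1 where 1: "C1 \<ge> 0" "R1 \<ge> 1"
        "\<And>x. R1 \<le> norm (lat x) \<Longrightarrow> norm (?\<psi>1 x - ?p x * a\<^sub>1 (lat x /\<^sub>R norm (lat x)) lam) \<le> C1 * norm (lat x) powr (- ((?d + 1) / 2))"
        "\<And>x. norm (?\<psi>1 x) \<le> C1 * (1 + norm (lat x)) powr (- ((?d - 1) / 2))"
      by (rule far_field_bounds[OF far(1) lam]) blast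
    obtain C2 R2 where 2: "C2 \<ge> 0" "R2 \<ge> 1"
        "\<And>x. R2 \<le> norm (lat x) \<Longrightarrow> norm (?\<psi>2 x - ?p x * a\<^sub>2 (lat x /\<^sub>R norm (lat x)) lam) \<le> C2 * norm (lat x) powr (- ((?d + 1) / 2))"
        "\<And>x. norm (?\<psi>2 x) \<le> C2 * (1 + norm (lat x)) powr (- ((?d - 1) / 2))"
      by (rule far_field_bounds[OF far(2) lam]) blast
    have diff: "limit_solution 1 lam f x = ?\<psi>1 x - ?\<psi>2 x" for x
      unfolding f_def[abs_def] by (rule limit_solution_diff[OF lam fin])
    show ?thesis
    proof (rule exI[of _ "C1 + C2"], rule exI[of _ "max R1 R2"], intro conjI allI impI)
      show "1 \<le> max R1 R2" using 1(2) by simp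
      fix x
      show "norm (limit_solution 1 lam f x) \<le> (C1 + C2) * (1 + norm (lat x)) powr (- ((?d - 1) / 2))"
        unfolding diff distrib_right by (rule order_trans[OF norm_triangle_ineq4 add_mono[OF 1(4) 2(4)]])
      assume x: "max R1 R2 \<le> norm (lat x)" "(lat x /\<^sub>R norm (lat x), lam) \<in> N"
      have split: "limit_solution 1 lam f x = (?\<psi>1 x - ?p x * a\<^sub>1 (lat x /\<^sub>R norm (lat x)) lam)
          - (?\<psi>2 x - ?p x * a\<^sub>2 (lat x /\<^sub>R norm (lat x)) lam)"
        unfolding diff eq[OF x(2)] by (simp only: diff_diff_eq2 diff_add_cancel)
      show "norm (limit_solution 1 lam f x) \<le> (C1 + C2) * norm (lat x) powr (- ((?d + 1) / 2))"
        unfolding split distrib_right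
        by (rule order_trans[OF norm_triangle_ineq4 add_mono[OF 1(3) 2(3)]]) (use x(1) in auto)
    qed
  qed
  obtain k\<^sub>0 :: "'n \<Rightarrow> real" and c where k0: "\<And>j. \<bar>k\<^sub>0 j\<bar> \<le> pi" "Phi k\<^sub>0 = lam\<^sub>0" "c > 0"
      "\<And>j. - 2 * sin (k\<^sub>0 j) = c * \<omega>\<^sub>0 $ j"
    by (rule velocity_surjective[of \<omega>\<^sub>0 lam\<^sub>0]) (use NL[OF N0] in auto)
  define v :: "('n \<Rightarrow> real) \<Rightarrow> real ^ 'n" where "v k = (\<chi> j. - 2 * sin (k j))" for k
  have "v k\<^sub>0 = c *\<^sub>R \<omega>\<^sub>0" using k0(4) by (simp add: v_def vec_eq_iff)
  then have vk0: "v k\<^sub>0 \<noteq> 0" "v k\<^sub>0 /\<^sub>R norm (v k\<^sub>0) = \<omega>\<^sub>0" using NL[OF N0] k0(3) by auto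
  have vk0N: "(v k\<^sub>0 /\<^sub>R norm (v k\<^sub>0), lam\<^sub>0) \<in> N" using vk0(2) N0 by simp
  obtain \<eta> where \<eta>: "\<eta> > 0" "\<And>w lam. (\<And>j. \<bar>w $ j - v k\<^sub>0 $ j\<bar> \<le> \<eta>) \<Longrightarrow> \<bar>lam - lam\<^sub>0\<bar> \<le> \<eta> \<Longrightarrow>
      w \<noteq> 0 \<and> (w /\<^sub>R norm w, lam) \<in> N"
    by (rule direction_open[OF N vk0(1) vk0N]) blast
  have d: "?d \<ge> 1" by (simp add: Suc_leI)
  define \<delta> where "\<delta> = \<eta> / (2 * ?d)"
  have \<delta>: "\<delta> > 0" using \<eta>(1) d by (simp add: \<delta>_def)
  have \<delta>d: "2 * ?d * \<delta> = \<eta>" using d by (simp add: \<delta>_def)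
  have \<delta>2: "2 * \<delta> \<le> \<eta>" unfolding \<delta>d[symmetric] using d \<delta> by simp
  have near: "v k \<noteq> 0 \<and> (v k /\<^sub>R norm (v k), Phi k) \<in> N" if k: "\<And>j. \<bar>k j - k\<^sub>0 j\<bar> \<le> \<delta>" for k
  proof (rule \<eta>(2))
    show "\<bar>v k $ j - v k\<^sub>0 $ j\<bar> \<le> \<eta>" for j
    proof -
      have "\<bar>sin (k j) - sin (k\<^sub>0 j)\<bar> \<le> \<delta>" using abs_sin_cos_diff_le(1)[of "k j" "k\<^sub>0 j"] k[of j] by linarith
      then have "\<bar>v k $ j - v k\<^sub>0 $ j\<bar> \<le> 2 * \<delta>" by (simp add: v_def abs_le_iff)
      then show ?thesis using \<delta>2 by linarith
    qed
    show "\<bar>Phi k - lam\<^sub>0\<bar> \<le> \<eta>" using Phi_diff_le[of k k\<^sub>0 \<delta>] k k0(2) \<delta>d by simp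
  qed
  \<comment> \<open>\<open>k\<^sub>0\<close> may lie on the boundary of the cube \<open>[-\<pi>, \<pi>]\<^sup>d\<close>, where the windows do not fit; shrinking it by the factor
  \<open>1 - s\<close> moves it into the interior.\<close>
  define s where "s = min (1 / 2) (\<delta> / (2 * pi))"
  have s: "0 < s" "s \<le> 1 / 2" "s * pi \<le> \<delta> / 2"
  proof -
    show "0 < s" "s \<le> 1 / 2" using \<delta> by (auto simp: s_def)
    have "s * pi \<le> \<delta> / (2 * pi) * pi" by (intro mult_right_mono) (auto simp: s_def)
    then show "s * pi \<le> \<delta> / 2" by simp
  qed
  define \<kappa>\<^sub>1 where "\<kappa>\<^sub>1 j = (1 - s) * k\<^sub>0 j" for j
  define \<delta>' where "\<delta>' = min (\<delta> / 2) (s * pi)"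
  have \<delta>': "\<delta>' > 0" "\<delta>' \<le> \<delta> / 2" "\<delta>' \<le> s * pi" using \<delta> s(1) by (auto simp: \<delta>'_def)
  have "f = (\<lambda>_. 0)"
  proof (rule fhat_injective[OF finf \<delta>'(1)])
    fix \<kappa> assume \<kappa>: "\<bar>\<kappa> j - \<kappa>\<^sub>1 j\<bar> < \<delta>'" for j
    have 1: "\<bar>\<kappa>\<^sub>1 j\<bar> \<le> (1 - s) * pi" "\<bar>\<kappa>\<^sub>1 j - k\<^sub>0 j\<bar> \<le> s * pi" for j
    proof -
      show "\<bar>\<kappa>\<^sub>1 j\<bar> \<le> (1 - s) * pi"
        unfolding \<kappa>\<^sub>1_def abs_mult using s k0(1)[of j] by (intro mult_mono) auto
      have "\<kappa>\<^sub>1 j - k\<^sub>0 j = - (s * k\<^sub>0 j)" by (simp add: \<kappa>\<^sub>1_def algebra_simps)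
      then have "\<bar>\<kappa>\<^sub>1 j - k\<^sub>0 j\<bar> = s * \<bar>k\<^sub>0 j\<bar>" using s(1) by (simp add: abs_mult)
      then show "\<bar>\<kappa>\<^sub>1 j - k\<^sub>0 j\<bar> \<le> s * pi" using s(1) k0(1)[of j] by simp
    qed
    have cube: "- pi < \<kappa> j \<and> \<kappa> j < pi" for j
    proof -
      have "(1 - s) * pi + s * pi = pi" by (simp add: algebra_simps)
      then have "\<bar>\<kappa> j\<bar> < pi" using 1(1)[of j] \<kappa>[of j] \<delta>'(3) by linarith
      then show ?thesis by (auto simp: abs_less_iff)
    qed
    have "\<bar>\<kappa> j - k\<^sub>0 j\<bar> \<le> \<delta>" for j using 1(2)[of j] \<kappa>[of j] \<delta>'(2) s(3) by linarith
    from near[OF this] have v\<kappa>: "v \<kappa> \<noteq> 0" "(v \<kappa> /\<^sub>R norm (v \<kappa>), Phi \<kappa>) \<in> N" by auto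
    obtain \<eta>' where \<eta>': "\<eta>' > 0" "\<And>w lam. (\<And>j. \<bar>w $ j - v \<kappa> $ j\<bar> \<le> \<eta>') \<Longrightarrow> \<bar>lam - Phi \<kappa>\<bar> \<le> \<eta>' \<Longrightarrow>
        w \<noteq> 0 \<and> (w /\<^sub>R norm w, lam) \<in> N"
      by (rule direction_open[OF N v\<kappa>]) blast
    obtain j\<^sub>0 where j0: "sin (\<kappa> j\<^sub>0) \<noteq> 0" using v\<kappa>(1) by (auto simp: v_def vec_eq_iff)
    define \<theta> where "\<theta> = min \<eta>' \<bar>sin (\<kappa> j\<^sub>0)\<bar>"
    have \<theta>: "0 < \<theta>" "\<theta> < 2 * \<bar>sin (\<kappa> j\<^sub>0)\<bar>" "\<theta> \<le> \<eta>'" using \<eta>'(1) j0 by (auto simp: \<theta>_def min_def)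
    have L: "lam \<in> Lambda TYPE('n)" if "\<bar>lam - Phi \<kappa>\<bar> \<le> \<theta>" for lam
      using \<eta>'(2)[of "v \<kappa>" lam] that \<theta>(3) \<eta>'(1) NL by (simp, blast)
    show "fhat f \<kappa> = 0"
    proof (rule fhat_vanishes[where \<kappa>=\<kappa>, OF finf cube \<theta>(2) \<theta>(1) L])
      fix lam assume lam: "\<bar>lam - Phi \<kappa>\<bar> \<le> \<theta>"
      obtain C R where CR: "R \<ge> 1"
          "\<And>x. norm (limit_solution 1 lam f x) \<le> C * (1 + norm (lat x)) powr (- ((?d - 1) / 2))"
          "\<And>x. R \<le> norm (lat x) \<Longrightarrow> (lat x /\<^sub>R norm (lat x), lam) \<in> N \<Longrightarrow>
            norm (limit_solution 1 lam f x) \<le> C * norm (lat x) powr (- ((?d + 1) / 2))"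
        using bounds[OF L[OF lam]] by blast
      show "\<exists>C. \<forall>x. norm (limit_solution 1 lam f x) \<le> C * (1 + norm (lat x)) powr (- ((?d - 1) / 2))"
        using CR(2) by blast
      show "\<exists>C R. \<forall>x t. R \<le> norm (lat x) \<longrightarrow> 0 < t \<longrightarrow>
          (\<forall>j. \<bar>real_of_int (x $ j) + 2 * t * sin (\<kappa> j)\<bar> \<le> \<theta> * t) \<longrightarrow>
          norm (limit_solution 1 lam f x) \<le> C * norm (lat x) powr (- ((?d + 1) / 2))"
      proof (rule exI[of _ C], rule exI[of _ R], intro allI impI)
        fix x :: "int ^ 'n" and t :: real
        assume x: "R \<le> norm (lat x)" "0 < t" "\<forall>j. \<bar>real_of_int (x $ j) + 2 * t * sin (\<kappa> j)\<bar> \<le> \<theta> * t"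
        define w where "w = lat x /\<^sub>R t"
        have "\<bar>w $ j - v \<kappa> $ j\<bar> \<le> \<eta>'" for j
        proof -
          have "w $ j - v \<kappa> $ j = (real_of_int (x $ j) + 2 * t * sin (\<kappa> j)) / t"
            using x(2) by (simp add: w_def v_def lat_def field_simps)
          then have "\<bar>w $ j - v \<kappa> $ j\<bar> = \<bar>real_of_int (x $ j) + 2 * t * sin (\<kappa> j)\<bar> / t"
            using x(2) by simp
          also have "\<dots> \<le> \<theta>" using x(2,3) by (simp add: pos_divide_le_eq)
          finally show ?thesis using \<theta>(3) by simp
        qed
        then have "(w /\<^sub>R norm w, lam) \<in> N" using \<eta>'(2)[of w lam] lam \<theta>(3) by simp
        moreover have "w /\<^sub>R norm w = lat x /\<^sub>R norm (lat x)" using x(2) by (simp add: w_def)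
        ultimately show "norm (limit_solution 1 lam f x) \<le> C * norm (lat x) powr (- ((?d + 1) / 2))"
          using CR(3)[OF x(1)] by simp
      qed
    qed
  qed
  then show ?thesis by (simp add: f_def fun_eq_iff)
qed

theorem theorem2p1:
  fixes s :: real
    and N :: "((real ^ 'n) \<times> real) set"
    and \<omega>\<^sub>0 :: "real ^ 'n" and lam\<^sub>0 :: real
    and f\<^sub>1 f\<^sub>2 :: "int ^ 'n \<Rightarrow> complex"
    and a\<^sub>1 a\<^sub>2 :: "real ^ 'n \<Rightarrow> real \<Rightarrow> complex"
  assumes "s = 1 \<or> s = -1"
    and "openin (top_of_set (sphere 0 1 \<times> Lambda TYPE('n))) N"
    and "(\<omega>\<^sub>0, lam\<^sub>0) \<in> N"
    and "finite {x. f\<^sub>1 x \<noteq> 0}" and "finite {x. f\<^sub>2 x \<noteq> 0}"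
    and "far_field_amplitude s f\<^sub>1 a\<^sub>1" and "far_field_amplitude s f\<^sub>2 a\<^sub>2"
    and "\<And>\<omega> lam. (\<omega>, lam) \<in> N \<Longrightarrow> a\<^sub>1 \<omega> lam = a\<^sub>2 \<omega> lam"
  shows "f\<^sub>1 = f\<^sub>2"
  using assms(1)
proof
  assume "s = 1"
  then show ?thesis using outgoing_amplitude_injective[OF assms(2-5) _ _ assms(8)] assms(6,7) by simp
next
  assume s: "s = - 1"
  have "(\<lambda>y. cnj (f\<^sub>1 y)) = (\<lambda>y. cnj (f\<^sub>2 y))"
  proof (rule outgoing_amplitude_injective[OF assms(2,3)])
    show "far_field_amplitude 1 (\<lambda>y. cnj (f\<^sub>1 y)) (\<lambda>\<omega> lam. cnj (a\<^sub>1 \<omega> lam))"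
      "far_field_amplitude 1 (\<lambda>y. cnj (f\<^sub>2 y)) (\<lambda>\<omega> lam. cnj (a\<^sub>2 \<omega> lam))"
      using assms(6,7) unfolding s by (auto intro: far_field_amplitude_cnj assms(4,5))
  qed (use assms(4,5,8) in simp_all)
  then show ?thesis by (simp add: fun_eq_iff)
qed

end
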